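(* Let $u,v\in C^0_2(\Theta)$ be respectively a $\mathbb P_\sigma$-viscosity subsolution and a $\mathbb P_\sigma$-viscosity supersolution of the path-dependent heat equation $-\mathcal Lu(t,\omega)=0$, $t<T$, $\omega\in\Omega$. If $u_T\le v_T$ on $\Omega$, then $u\le v$ on $\Theta$.
   Context: Setting. Fix $T>0$, $d\ge 1$. $\Omega=\{\omega\in C([0,T];\mathbb R^d):\omega_0=0\}$, $\Theta=[0,T]\times\Omega$, $B$ is the canonical process on $\Omega$, $\mathbb F=(\mathcal F_t)_{0\le t\le T}$ its canonical filtration. $\mathcal T$ is the set of $\mathbb F$-stopping times with values in $[0,T]$; for $\mathrm h\in\mathcal T$, $\mathcal T_{\mathrm h}$ (resp. $\mathcal T^+_{\mathrm h}$) is the set of $\tau\in\mathcal T$ with values in $[0,\mathrm h]$ (resp. $(0,\mathrm h]$). $\|\omega\|_t=\sup_{s\le t}|\omega_s|$, and $C^0(\Theta,E)$ is the set of $E$-valued processes continuous for the pseudo-distance $|t-t'|+\|\omega_{t\wedge\cdot}-\omega'_{t'\wedge\cdot}\|_T$ on $\Theta$ ($E=\mathbb R$ is omitted). $\mathbb L^0(\mathbb F)$: real-valued $\mathbb F$-progressively measurable processes. Shifts. $(\omega\otimes_t\omega')_s=\omega_s\mathbf 1_{[0,t]}(s)+(\omega_t+\omega'_{s-t})\mathbf 1_{(t,T]}(s)$; $X^{t,\omega}_s(\omega')=X_{t+s}(\omega\otimes_t\omega')$, $0\le s\le T-t$. Standing assumption on $\sigma$. $\sigma:\Theta\to\mathbb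 R^{d\times d}$ is continuous in $t$ and $|\sigma_t(\omega)-\sigma_t(\omega')|\le C\|\omega-\omega'\|_t$ for all $t,\omega,\omega'$, for some $C\ge0$. Measures. $\mathbb P_\sigma$ is the law on $\Omega$ of the unique strong solution $X$ of $dX_t=\sigma_t(X)dW_t$, $X_0=0$, $W$ a Brownian motion; $\mathbb P_{\sigma^{t,\omega}}$ is defined in the same way with the shifted coefficient $\sigma^{t,\omega}$ on the time interval $[0,T-t]$. Space $C^0_2(\Theta)$: all $u\in C^0(\Theta)$ such that for all $(t,\omega)\in\Theta$, $u^{t,\omega}\in\mathbb L^0(\mathbb F)$ is continuous in time $\mathbb P_{\sigma^{t,\omega}}$-a.s. and $\mathbb E^{\mathbb P_{\sigma^{t,\omega}}}[\sup_{0\le s\le T-t}|u^{t,\omega}_s|^2]<\infty$. Smooth processes. $u\in C^{1,2}(\Theta)$ if $u\in C^0(\Theta)$ and there are $\Lambda\in C^0(\Theta,\mathbb R)$, $Z\in C^0(\Theta,\mathbb R^d)$ such that for each $(t,\omega)$, $u^{t,\omega}_s-u_t(\omega)=\int_0^s\Lambda^{t,\omega}_rdr+\int_0^sZ^{t,\omega}_r\cdot dB_r$ for all $s\in[0,T-t]$, $\mathbb P_{\sigma^{t,\omega}}$-a.s.; then $\mathcal Lu:=\Lambda$, $\partial_\omega u:=Z$. $\mathbb P_\sigma$-viscosity solutions (the case $L=0$ of $\mathcal P_L$-viscosity solutions). $\underline{\mathcal A}_0u_t(\omega)$ (resp. $\overline{\mathcal A}_0u_t(\omega)$) is the set of $\varphi\in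 C^{1,2}(\Theta)$ such that, for some $\mathrm h\in\mathcal T^+_{T-t}$, $(\varphi-u)_t(\omega)$ equals $\min_{\tau\in\mathcal T_{\mathrm h}}\mathbb E^{\mathbb P_{\sigma^{t,\omega}}}[(\varphi-u)^{t,\omega}_\tau]$ (resp. $\max_{\tau\in\mathcal T_{\mathrm h}}\mathbb E^{\mathbb P_{\sigma^{t,\omega}}}[(\varphi-u)^{t,\omega}_\tau]$). $u\in C^0(\Theta)$ is a $\mathbb P_\sigma$-viscosity subsolution (resp. supersolution) of the heat equation if for every $(t,\omega)\in[0,T)\times\Omega$, $-\mathcal L\varphi_t(\omega)\le0$ for all $\varphi\in\underline{\mathcal A}_0u_t(\omega)$ (resp. $\ge0$ for all $\varphi\in\overline{\mathcal A}_0u_t(\omega)$). *)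

theory Defs
  imports "HOL-Probability.Probability"
begin

section \<open>Path space, canonical filtration, shifts\<close>

text \<open>
  A path on \<open>[0,T]\<close> is encoded as a function on all of \<open>\<real>\<close> that is frozen at its end values outside
  \<open>[0,T]\<close>.  Such functions correspond one-to-one to elements of \<open>C([0,T])\<close>, and the path space with
  horizon \<open>T' \<le> T\<close> becomes the set of those paths of horizon \<open>T\<close> that are stopped at \<open>T'\<close>.
\<close>

type_synonym 'd path = "real \<Rightarrow> real ^ 'd"

definition path_space :: "real \<Rightarrow> ('d::finite) path set" where
  "path_space T = {\<omega>. \<omega> 0 = 0 \<and> continuous_on {0..T} \<omega> \<and> (\<forall>s. \<omega> s = \<omega> (max 0 (min s T)))}"

definition path_norm :: "real \<Rightarrow> ('d::finite) path \<Rightarrow> real" where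
  "path_norm t \<omega> = (SUP s\<in>{0..t}. norm (\<omega> s))"

definition path_dist :: "real \<Rightarrow> real \<Rightarrow> ('d::finite) path \<Rightarrow> real \<Rightarrow> 'd path \<Rightarrow> real" where
  "path_dist T t \<omega> t' \<omega>' = \<bar>t - t'\<bar> + path_norm T (\<lambda>s. \<omega> (min t s) - \<omega>' (min t' s))"

text \<open>For \<open>t < 0\<close> the filtration is trivial, and for \<open>t \<ge> T\<close> it is constant since paths are frozen
  after \<open>T\<close>.\<close>

definition canonical_filtration :: "real \<Rightarrow> real \<Rightarrow> ('d::finite) path measure" where
  "canonical_filtration T t =
     sigma (path_space T) {{\<omega> \<in> path_space T. \<omega> s \<in> A} | s A. s \<in> {0..t} \<and> A \<in> sets borel}"

definition stopping_times :: "real \<Rightarrow> (('d::finite) path \<Rightarrow> real) set" where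
  "stopping_times T =
     {\<tau>. stopping_time (canonical_filtration T) \<tau> \<and> (\<forall>\<omega>\<in>path_space T. \<tau> \<omega> \<in> {0..T})}"

definition stopping_times_le :: "real \<Rightarrow> (('d::finite) path \<Rightarrow> real) \<Rightarrow> ('d path \<Rightarrow> real) set" where
  "stopping_times_le T h = {\<tau> \<in> stopping_times T. \<forall>\<omega>\<in>path_space T. \<tau> \<omega> \<in> {0..h \<omega>}}"

definition pos_stopping_times_le :: "real \<Rightarrow> (('d::finite) path \<Rightarrow> real) \<Rightarrow> ('d path \<Rightarrow> real) set" where
  "pos_stopping_times_le T h = {\<tau> \<in> stopping_times T. \<forall>\<omega>\<in>path_space T. \<tau> \<omega> \<in> {0<..h \<omega>}}"

definition path_concat :: "real \<Rightarrow> real \<Rightarrow> ('d::finite) path \<Rightarrow> 'd path \<Rightarrow> 'd path" where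
  "path_concat T t \<omega> \<omega>' =
     (\<lambda>s. let r = max 0 (min s T) in if r \<le> t then \<omega> r else \<omega> t + \<omega>' (r - t))"

definition shift :: "real \<Rightarrow> real \<Rightarrow> ('d::finite) path \<Rightarrow> (real \<Rightarrow> 'd path \<Rightarrow> 'e) \<Rightarrow>
    real \<Rightarrow> 'd path \<Rightarrow> 'e" where
  "shift T t \<omega> X = (\<lambda>s \<omega>'. X (t + s) (path_concat T t \<omega> \<omega>'))"

definition C0 :: "real \<Rightarrow> (real \<Rightarrow> ('d::finite) path \<Rightarrow> 'e::metric_space) set" where
  "C0 T = {u. \<forall>t\<in>{0..T}. \<forall>\<omega>\<in>path_space T. \<forall>e>0. \<exists>\<delta>>0. \<forall>t'\<in>{0..T}. \<forall>\<omega>'\<in>path_space T.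
      path_dist T t \<omega> t' \<omega>' < \<delta> \<longrightarrow> dist (u t \<omega>) (u t' \<omega>') < e}"

text \<open>Progressive measurability of a process with time set \<open>[0,S]\<close> on the path space of horizon \<open>T\<close>.\<close>

definition prog_measurable :: "real \<Rightarrow> real \<Rightarrow> (real \<Rightarrow> ('d::finite) path \<Rightarrow> real) \<Rightarrow> bool" where
  "prog_measurable T S X \<longleftrightarrow>
     (\<forall>s\<in>{0..S}. (\<lambda>(r, \<omega>). X r \<omega>)
        \<in> borel_measurable (restrict_space borel {0..s} \<Otimes>\<^sub>M canonical_filtration T s))"


section \<open>Brownian motion and stochastic integrals\<close>

definition brownian_motion :: "real \<Rightarrow> 'm measure \<Rightarrow> (real \<Rightarrow> 'm \<Rightarrow> real ^ ('d::finite)) \<Rightarrow> bool" where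
  "brownian_motion T M W \<longleftrightarrow>
     prob_space M \<and>
     (\<forall>t\<in>{0..T}. W t \<in> borel_measurable M) \<and>
     (AE x in M. W 0 x = 0) \<and>
     (AE x in M. continuous_on {0..T} (\<lambda>t. W t x)) \<and>
     (\<forall>s\<in>{0..T}. \<forall>t\<in>{0..T}. s < t \<longrightarrow>
        prob_space.indep_vars M (\<lambda>_. borel) (\<lambda>i x. (W t x - W s x) $ i) UNIV \<and>
        (\<forall>i. distributed M lborel (\<lambda>x. (W t x - W s x) $ i) (normal_density 0 (sqrt (t - s))))) \<and>
     (\<forall>n. \<forall>r :: nat \<Rightarrow> real. (\<forall>k\<le>n. r k \<in> {0..T}) \<and> mono_on {..n} r \<longrightarrow>
        prob_space.indep_vars M (\<lambda>_. borel) (\<lambda>k x. W (r (Suc k)) x - W (r k) x) {..<n})"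

definition brownian_filtration :: "'m measure \<Rightarrow> (real \<Rightarrow> 'm \<Rightarrow> real ^ ('d::finite)) \<Rightarrow> real \<Rightarrow> 'm measure"
  where
  "brownian_filtration M W t =
     sigma (space M) ({W s -` A \<inter> space M | s A. s \<in> {0..t} \<and> A \<in> sets borel} \<union> null_sets M)"

text \<open>Convergence uniformly in time, in probability.  The measurable sets \<open>A n\<close> express convergence of
  outer probabilities, so that no measurability of suprema has to be assumed.\<close>

definition ucp_tendsto :: "'m measure \<Rightarrow> real set \<Rightarrow> (nat \<Rightarrow> real \<Rightarrow> 'm \<Rightarrow> 'e::metric_space) \<Rightarrow>
    (real \<Rightarrow> 'm \<Rightarrow> 'e) \<Rightarrow> bool" where
  "ucp_tendsto M I Y Z \<longleftrightarrow>
     (\<forall>e>0. \<exists>A. (\<forall>n. A n \<in> sets M \<and>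
                 {x \<in> space M. \<exists>t\<in>I. dist (Y n t x) (Z t x) > e} \<subseteq> A n) \<and>
            (\<lambda>n. measure M (A n)) \<longlonglongrightarrow> 0)"

text \<open>The elementary process \<open>\<Sum>k<n. \<xi> k * indicator {r k <.. r (k+1)}\<close>, and its stochastic integral.
  The parameter \<open>p\<close> is the product used in the integral: \<open>( *v )\<close> for matrix-valued integrands
  and the inner product for vector-valued ones.\<close>

definition elementary :: "(real \<Rightarrow> 'm measure) \<Rightarrow> real \<Rightarrow> nat \<Rightarrow> (nat \<Rightarrow> real) \<Rightarrow>
    (nat \<Rightarrow> 'm \<Rightarrow> 'h::real_normed_vector) \<Rightarrow> bool" where
  "elementary F T n r \<xi> \<longleftrightarrow>
     (\<forall>k\<le>n. r k \<in> {0..T}) \<and> mono_on {..n} r \<and> (\<forall>k<n. \<xi> k \<in> borel_measurable (F (r k)))"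

definition elementary_process :: "nat \<Rightarrow> (nat \<Rightarrow> real) \<Rightarrow> (nat \<Rightarrow> 'm \<Rightarrow> 'h::real_normed_vector) \<Rightarrow>
    real \<Rightarrow> 'm \<Rightarrow> 'h" where
  "elementary_process n r \<xi> t x = (\<Sum>k<n. if r k < t \<and> t \<le> r (Suc k) then \<xi> k x else 0)"

definition elementary_integral :: "('h \<Rightarrow> 'b \<Rightarrow> 'c) \<Rightarrow> nat \<Rightarrow> (nat \<Rightarrow> real) \<Rightarrow> (nat \<Rightarrow> 'm \<Rightarrow> 'h) \<Rightarrow>
    (real \<Rightarrow> 'm \<Rightarrow> 'b::real_normed_vector) \<Rightarrow> real \<Rightarrow> 'm \<Rightarrow> 'c::real_normed_vector" where
  "elementary_integral p n r \<xi> X t x =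
     (\<Sum>k<n. p (\<xi> k x) (X (min (r (Suc k)) t) x - X (min (r k) t) x))"

text \<open>The stochastic integral as the ucp-continuous extension of the elementary integral (as in
  Protter, Stochastic Integration and Differential Equations, Ch. II), for continuous adapted
  integrands \<open>H\<close> and semimartingale integrators \<open>X\<close>: \<open>I t\<close> is the integral of \<open>H\<close> against \<open>X\<close> over
  \<open>[0,t]\<close>.  It determines \<open>I\<close> up to indistinguishability.\<close>

definition has_stoch_integral :: "'m measure \<Rightarrow> (real \<Rightarrow> 'm measure) \<Rightarrow> real \<Rightarrow> ('h \<Rightarrow> 'b \<Rightarrow> 'c) \<Rightarrow>
    (real \<Rightarrow> 'm \<Rightarrow> 'h::real_normed_vector) \<Rightarrow> (real \<Rightarrow> 'm \<Rightarrow> 'b::real_normed_vector) \<Rightarrow>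
    (real \<Rightarrow> 'm \<Rightarrow> 'c::real_normed_vector) \<Rightarrow> bool" where
  "has_stoch_integral M F T p H X I \<longleftrightarrow>
     (\<exists>n r \<xi>. (\<forall>j. elementary F T (n j) (r j) (\<xi> j)) \<and>
        ucp_tendsto M {0<..T} (\<lambda>j. elementary_process (n j) (r j) (\<xi> j)) H \<and>
        ucp_tendsto M {0..T} (\<lambda>j. elementary_integral p (n j) (r j) (\<xi> j) X) I)"


section \<open>The laws \<open>P\<^sub>\<sigma>\<close>\<close>

text \<open>\<open>dX = \<sigma>(X) dW\<close> on \<open>[0,S]\<close> with \<open>X 0 = 0\<close>, where \<open>X\<close> is adapted to the completed filtration of
  \<open>W\<close>.\<close>

definition strong_solution :: "'m measure \<Rightarrow> (real \<Rightarrow> 'm \<Rightarrow> real ^ ('d::finite)) \<Rightarrow> real \<Rightarrow>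
    (real \<Rightarrow> 'd path \<Rightarrow> real ^ 'd ^ 'd) \<Rightarrow> ('m \<Rightarrow> 'd path) \<Rightarrow> bool" where
  "strong_solution M W S \<sigma> X \<longleftrightarrow>
     X \<in> space M \<rightarrow> path_space S \<and>
     (\<forall>t\<in>{0..S}. (\<lambda>x. X x t) \<in> borel_measurable (brownian_filtration M W t)) \<and>
     has_stoch_integral M (brownian_filtration M W) S (*v) (\<lambda>t x. \<sigma> t (X x)) W (\<lambda>t x. X x t)"

text \<open>\<open>solution_law M W T \<sigma> t \<omega>\<close> is the law for the shifted coefficient on the horizon \<open>T - t\<close>, regarded
  as a measure on the path space of horizon \<open>T\<close> that is carried by the paths stopped at \<open>T - t\<close>.  The
  strong solution is unique up to indistinguishability, so the law does not depend on the choice.\<close>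

definition solution_law :: "'m measure \<Rightarrow> (real \<Rightarrow> 'm \<Rightarrow> real ^ ('d::finite)) \<Rightarrow> real \<Rightarrow>
    (real \<Rightarrow> 'd path \<Rightarrow> real ^ 'd ^ 'd) \<Rightarrow> real \<Rightarrow> 'd path \<Rightarrow> 'd path measure" where
  "solution_law M W T \<sigma> t \<omega> =
     distr M (canonical_filtration T T) (SOME X. strong_solution M W (T - t) (shift T t \<omega> \<sigma>) X)"

definition admissible_coefficient :: "real \<Rightarrow> (real \<Rightarrow> ('d::finite) path \<Rightarrow> real ^ 'd ^ 'd) \<Rightarrow> bool" where
  "admissible_coefficient T \<sigma> \<longleftrightarrow>
     (\<forall>\<omega>\<in>path_space T. continuous_on {0..T} (\<lambda>t. \<sigma> t \<omega>)) \<and>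
     (\<exists>C\<ge>0. \<forall>t\<in>{0..T}. \<forall>\<omega>\<in>path_space T. \<forall>\<omega>'\<in>path_space T.
        norm (\<sigma> t \<omega> - \<sigma> t \<omega>') \<le> C * path_norm t (\<lambda>s. \<omega> s - \<omega>' s))"


section \<open>Function spaces and viscosity solutions\<close>

text \<open>In this section \<open>P t \<omega>\<close> stands for the law associated with the coefficient shifted by
  \<open>(t, \<omega>)\<close>.\<close>

definition C0_2 :: "real \<Rightarrow> (real \<Rightarrow> ('d::finite) path \<Rightarrow> 'd path measure) \<Rightarrow>
    (real \<Rightarrow> 'd path \<Rightarrow> real) set" where
  "C0_2 T P = {u \<in> C0 T. \<forall>t\<in>{0..T}. \<forall>\<omega>\<in>path_space T.
      prog_measurable T (T - t) (shift T t \<omega> u) \<and>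
      (AE \<omega>' in P t \<omega>. continuous_on {0..T - t} (\<lambda>s. shift T t \<omega> u s \<omega>')) \<and>
      (\<integral>\<^sup>+ \<omega>'. (SUP s\<in>{0..T - t}. ennreal (\<bar>shift T t \<omega> u s \<omega>'\<bar>\<^sup>2)) \<partial>P t \<omega>) < \<infinity>}"

text \<open>\<open>has_path_derivs T P u \<Lambda> Z\<close>: \<open>u\<close> belongs to \<open>C\<^sup>1\<^sup>,\<^sup>2\<close> with \<open>\<L>u = \<Lambda>\<close> and \<open>\<partial>\<^sub>\<omega>u = Z\<close>.  As with
  \<open>has_derivative\<close>, the derivatives enter as a relation; \<open>\<Lambda>\<close> is determined by \<open>u\<close>.\<close>

definition has_path_derivs :: "real \<Rightarrow> (real \<Rightarrow> ('d::finite) path \<Rightarrow> 'd path measure) \<Rightarrow>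
    (real \<Rightarrow> 'd path \<Rightarrow> real) \<Rightarrow> (real \<Rightarrow> 'd path \<Rightarrow> real) \<Rightarrow> (real \<Rightarrow> 'd path \<Rightarrow> real ^ 'd) \<Rightarrow> bool" where
  "has_path_derivs T P u \<Lambda> Z \<longleftrightarrow>
     u \<in> C0 T \<and> \<Lambda> \<in> C0 T \<and> Z \<in> C0 T \<and>
     (\<forall>t\<in>{0..T}. \<forall>\<omega>\<in>path_space T. \<exists>I.
        has_stoch_integral (P t \<omega>) (canonical_filtration T) (T - t) (\<bullet>)
          (shift T t \<omega> Z) (\<lambda>s \<omega>'. \<omega>' s) I \<and>
        (AE \<omega>' in P t \<omega>. \<forall>s\<in>{0..T - t}.
           shift T t \<omega> u s \<omega>' - u t \<omega> = (LINT r:{0..s}|lborel. shift T t \<omega> \<Lambda> r \<omega>') + I s \<omega>'))"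

definition C1_2 :: "real \<Rightarrow> (real \<Rightarrow> ('d::finite) path \<Rightarrow> 'd path measure) \<Rightarrow>
    (real \<Rightarrow> 'd path \<Rightarrow> real) set" where
  "C1_2 T P = {u. \<exists>\<Lambda> Z. has_path_derivs T P u \<Lambda> Z}"

definition stopped_values :: "real \<Rightarrow> (real \<Rightarrow> ('d::finite) path \<Rightarrow> 'd path measure) \<Rightarrow>
    real \<Rightarrow> 'd path \<Rightarrow> ('d path \<Rightarrow> real) \<Rightarrow> (real \<Rightarrow> 'd path \<Rightarrow> real) \<Rightarrow> real set" where
  "stopped_values T P t \<omega> h X =
     {\<integral>\<omega>'. shift T t \<omega> X (\<tau> \<omega>') \<omega>' \<partial>P t \<omega> | \<tau>. \<tau> \<in> stopping_times_le T h}"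

text \<open>The Bochner integral is \<open>0\<close> for non-integrable functions, so the existence of the expectations
  in the optimal stopping problem has to be required explicitly.\<close>

definition stopped_integrable :: "real \<Rightarrow> (real \<Rightarrow> ('d::finite) path \<Rightarrow> 'd path measure) \<Rightarrow>
    real \<Rightarrow> 'd path \<Rightarrow> ('d path \<Rightarrow> real) \<Rightarrow> (real \<Rightarrow> 'd path \<Rightarrow> real) \<Rightarrow> bool" where
  "stopped_integrable T P t \<omega> h X \<longleftrightarrow>
     (\<forall>\<tau>\<in>stopping_times_le T h. integrable (P t \<omega>) (\<lambda>\<omega>'. shift T t \<omega> X (\<tau> \<omega>') \<omega>'))"

definition lower_tests :: "real \<Rightarrow> (real \<Rightarrow> ('d::finite) path \<Rightarrow> 'd path measure) \<Rightarrow>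
    (real \<Rightarrow> 'd path \<Rightarrow> real) \<Rightarrow> real \<Rightarrow> 'd path \<Rightarrow> (real \<Rightarrow> 'd path \<Rightarrow> real) set" where
  "lower_tests T P u t \<omega> = {\<phi> \<in> C1_2 T P. \<exists>h\<in>pos_stopping_times_le T (\<lambda>_. T - t).
      let X = (\<lambda>s \<omega>'. \<phi> s \<omega>' - u s \<omega>') in
        stopped_integrable T P t \<omega> h X \<and>
        X t \<omega> \<in> stopped_values T P t \<omega> h X \<and> (\<forall>y\<in>stopped_values T P t \<omega> h X. X t \<omega> \<le> y)}"

definition upper_tests :: "real \<Rightarrow> (real \<Rightarrow> ('d::finite) path \<Rightarrow> 'd path measure) \<Rightarrow>
    (real \<Rightarrow> 'd path \<Rightarrow> real) \<Rightarrow> real \<Rightarrow> 'd path \<Rightarrow> (real \<Rightarrow> 'd path \<Rightarrow> real) set" where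
  "upper_tests T P u t \<omega> = {\<phi> \<in> C1_2 T P. \<exists>h\<in>pos_stopping_times_le T (\<lambda>_. T - t).
      let X = (\<lambda>s \<omega>'. \<phi> s \<omega>' - u s \<omega>') in
        stopped_integrable T P t \<omega> h X \<and>
        X t \<omega> \<in> stopped_values T P t \<omega> h X \<and> (\<forall>y\<in>stopped_values T P t \<omega> h X. y \<le> X t \<omega>)}"

definition heat_viscosity_subsolution :: "real \<Rightarrow> (real \<Rightarrow> ('d::finite) path \<Rightarrow> 'd path measure) \<Rightarrow>
    (real \<Rightarrow> 'd path \<Rightarrow> real) \<Rightarrow> bool" where
  "heat_viscosity_subsolution T P u \<longleftrightarrow> u \<in> C0 T \<and>
     (\<forall>t\<in>{0..<T}. \<forall>\<omega>\<in>path_space T. \<forall>\<phi>\<in>lower_tests T P u t \<omega>.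
        \<forall>\<Lambda> Z. has_path_derivs T P \<phi> \<Lambda> Z \<longrightarrow> - \<Lambda> t \<omega> \<le> 0)"

definition heat_viscosity_supersolution :: "real \<Rightarrow> (real \<Rightarrow> ('d::finite) path \<Rightarrow> 'd path measure) \<Rightarrow>
    (real \<Rightarrow> 'd path \<Rightarrow> real) \<Rightarrow> bool" where
  "heat_viscosity_supersolution T P u \<longleftrightarrow> u \<in> C0 T \<and>
     (\<forall>t\<in>{0..<T}. \<forall>\<omega>\<in>path_space T. \<forall>\<phi>\<in>upper_tests T P u t \<omega>.
        \<forall>\<Lambda> Z. has_path_derivs T P \<phi> \<Lambda> Z \<longrightarrow> - \<Lambda> t \<omega> \<ge> 0)"

end

theory Submission
 imports Defs
begin

text \<open>The linear function \<open>s \<mapsto> c s\<close> with \<open>c < 0\<close> is smooth with negative drift, so it is never a test function of the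
subsolution \<open>u\<close>.  Hence at every \<open>(t, \<omega>)\<close> with \<open>t < T\<close> some stopping time improves the expectation of \<open>u + \<epsilon> s\<close>,
and stopping is never optimal before the horizon.  To paste such improvements along a stopping time one needs a
measurable choice, made among countably many stopping times, and the flow property of the laws.  The latter is
read off from the Euler scheme: it restarts explicitly, and its convergence also makes the laws right-continuous
in the starting point.  Following Brezis and Browder, one repeatedly passes to a larger stopping time that does
not decrease the expectation of \<open>u + \<epsilon> s\<close> and is almost maximal in mean; the limit must be the horizon, giving
\<open>u t \<omega> \<le> \<E> u T + \<epsilon> (T - t)\<close>; symmetrically for \<open>v\<close>, and \<open>\<epsilon> \<rightarrow> 0\<close>.\<close>

section \<open>Paths\<close>

text \<open>The obstacle is that \<open>solution_law\<close> is the law of a solution picked by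
  \<open>SOME\<close>: nothing is known about it before existence is proved, and afterwards only
  that it is a ucp limit of elementary integrals. A solution is therefore built by a Picard
  iteration whose integrands are frozen on dyadic grids, so that every iterate is an elementary
  integral, and an arbitrary solution is compared with the Euler scheme in probability. Both
  arguments rest on the discrete Gronwall estimate \<open>step_gronwall\<close>. The shifted
  equations for different (t, \<omega>) are all driven by W from time 0, the shift being absorbed in
  the coefficient; schemes for converging starting points thus share one probability space and one
  noise. Starting times converge only from the right, which is enough because stopping times are
  discretised from above. Sub- and supersolution never meet in one test function: each is compared
  with the expectation of its own terminal value, so neither a doubling of variables nor a Snell
  envelope is involved.\<close>

lemma norm_diff_halves:
 fixes a b :: "'a::real_normed_vector"
 assumes "norm a < e/2" "norm b < e/2" shows "norm (a - b) < e"
 using norm_triangle_ineq4[of a b] assms by linarith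

lemma norm_add_thirds:
 fixes a b c :: "'a::real_normed_vector"
 assumes "norm a < e/3" "norm b < e/3" "norm c < e/3" shows "norm (a + b + c) < e"
 using norm_triangle_ineq[of "a + b" c] norm_triangle_ineq[of a b] assms by linarith

section \<open>Stopping, tails and concatenation of paths\<close>

definition stopped :: "real => ('d::finite) path => 'd path" where
 "stopped t w = (\<lambda>s. w (min t s))"

text \<open>The \<open>max 0 s\<close> makes the tail vanish at negative times, as the encoding of
  \<open>path_space\<close> demands.\<close>

definition path_tail :: "real => ('d::finite) path => 'd path" where
 "path_tail t w = (\<lambda>s. w (t + max 0 s) - w t)"

lemma path_space_0: "w \<in> path_space T ==> w 0 = 0"
 by (simp add: path_space_def)

lemma path_space_neg: "w \<in> path_space T ==> 0 \<le> T ==> s \<le> 0 ==> w s = 0"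
proof -
 assume a: "w \<in> path_space T" "0 \<le> T" "s \<le> 0"
 have "w s = w (max 0 (min s T))" using a(1) unfolding path_space_def by blast
 also have "max 0 (min s T) = 0" using a by auto
 finally show ?thesis using a(1) by (simp add: path_space_def)
qed

lemma path_space_ge: "w \<in> path_space T ==> 0 \<le> T ==> T \<le> s ==> w s = w T"
proof -
 assume a: "w \<in> path_space T" "0 \<le> T" "T \<le> s"
 have "w s = w (max 0 (min s T))" using a(1) unfolding path_space_def by blast
 also have "max 0 (min s T) = T" using a by auto
 finally show ?thesis .
qed

lemma path_space_min: "w \<in> path_space T ==> 0 \<le> T ==> w (min s T) = w s"
 using path_space_ge[of w T s] by (auto simp: min_def)

lemma path_spaceI:
 fixes w :: "('d::finite) path"
 assumes "0 \<le> T" "continuous_on {0..T} w" "\<And>s. s \<le> 0 ==> w s = 0" "\<And>s. T \<le> s ==> w s = w T"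
 shows "w \<in> path_space T"
proof -
 have "w s = w (max 0 (min s T))" for s
  using assms(1) assms(3)[of s] assms(3)[of 0] assms(4)[of s]
  by (cases "s \<le> 0"; cases "T \<le> s") (auto simp: min_def max_def)
 then show ?thesis using assms by (auto simp: path_space_def)
qed

lemma path_space_clamp: "w \<in> path_space T ==> w s = w (max 0 (min s T))"
 unfolding path_space_def by blast

lemma path_space_uniformly_continuous:
 fixes w :: "('d::finite) path"
 assumes "w \<in> path_space T" "0 \<le> T"
 shows "uniformly_continuous_on UNIV w"
proof -
 have c: "uniformly_continuous_on {0..T} w"
  using assms(1) by (intro compact_uniformly_continuous) (auto simp: path_space_def)
 show ?thesis unfolding uniformly_continuous_on_def
 proof (intro allI impI)
  fix e :: real assume "e > 0"
  then obtain d where d: "d > 0" "\<And>s s'. s \<in> {0..T} ==> s' \<in> {0..T} ==> dist s' s < d ==> dist (w s') (w s) < e"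
   using uniformly_continuous_onE[OF c] by metis
  show "\<exists>d>0. \<forall>x\<in>UNIV. \<forall>x'\<in>UNIV. dist x' x < d \<longrightarrow> dist (w x') (w x) < e"
  proof (intro exI[of _ d] conjI ballI impI d(1))
   fix s s' :: real assume "dist s' s < d"
   then have "dist (w (max 0 (min s' T))) (w (max 0 (min s T))) < e"
    using assms(2) by (intro d(2)) (auto simp: dist_real_def)
   then show "dist (w s') (w s) < e"
    using path_space_clamp[OF assms(1), of s] path_space_clamp[OF assms(1), of s'] by simp
  qed
 qed
qed

lemma path_space_continuous:
 "(w :: ('d::finite) path) \<in> path_space T ==> 0 \<le> T ==> continuous_on A w"
 using continuous_on_subset[OF uniformly_continuous_imp_continuous[OF path_space_uniformly_continuous] subset_UNIV] .

lemma path_space_modulus: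
 fixes w :: "('d::finite) path"
 assumes "w \<in> path_space T" "0 \<le> T" "e > 0"
 obtains d where "d > 0" "\<And>s s'. \<bar>s - s'\<bar> < d ==> norm (w s - w s') < e"
proof -
 obtain d where "d > 0" "\<And>s s'. dist s' s < d ==> dist (w s') (w s) < e"
  using uniformly_continuous_onE[OF path_space_uniformly_continuous[OF assms(1,2)] assms(3)] by (metis UNIV_I)
 then show ?thesis using that[of d] by (auto simp: dist_norm)
qed

lemma path_space_mono:
 fixes w :: "('d::finite) path"
 assumes "w \<in> path_space S" "0 \<le> S" "S \<le> T"
 shows "w \<in> path_space T"
proof (rule path_spaceI)
 show "w s = w T" if "T \<le> s" for s
  using path_space_ge[OF assms(1,2), of s] path_space_ge[OF assms(1,2), of T] that assms by simp
qed (use assms path_space_neg[OF assms(1,2)] path_space_continuous[OF assms(1,2)] in auto)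

lemma path_space_zero: "(\<lambda>_. 0) \<in> path_space T"
 by (auto simp: path_space_def)

lemma stopped_path_space:
 fixes w :: "('d::finite) path"
 assumes "w \<in> path_space T" "0 \<le> T" "0 \<le> t"
 shows "stopped t w \<in> path_space T"
proof (rule path_spaceI)
 show "continuous_on {0..T} (stopped t w)" unfolding stopped_def
  by (intro continuous_on_compose2[OF path_space_continuous[OF assms(1,2), of UNIV]] continuous_intros) auto
 show "stopped t w s = stopped t w T" if "T \<le> s" for s
  using that path_space_ge[OF assms(1,2), of "min t s"] path_space_ge[OF assms(1,2), of "min t T"]
  by (auto simp: stopped_def min_def)
qed (use assms path_space_neg[OF assms(1,2)] in \<open>auto simp: stopped_def min_def\<close>)

lemma stopped_stopped: "stopped s (stopped t w) = stopped (min s t) w"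
 by (auto simp: stopped_def fun_eq_iff ac_simps)

lemma stopped_id: "w \<in> path_space T ==> 0 \<le> T ==> T \<le> t ==> stopped t w = w"
proof
 fix s assume a: "w \<in> path_space T" "0 \<le> T" "T \<le> t"
 show "stopped t w s = w s"
  using path_space_ge[OF a(1,2), of s] path_space_ge[OF a(1,2), of t] a(3) by (auto simp: stopped_def min_def)
qed

lemma path_tail_path_space:
 fixes w :: "('d::finite) path"
 assumes "w \<in> path_space T" "0 \<le> T" "0 \<le> t" "t \<le> T"
 shows "path_tail t w \<in> path_space (T - t)"
proof (rule path_spaceI)
 show "continuous_on {0..T - t} (path_tail t w)" unfolding path_tail_def
  by (intro continuous_on_compose2[OF path_space_continuous[OF assms(1,2), of UNIV]] continuous_intros) auto
 show "path_tail t w s = path_tail t w (T - t)" if "T - t \<le> s" for s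
  using that assms path_space_ge[OF assms(1,2), of "t + s"] by (simp add: path_tail_def)
qed (use assms in \<open>auto simp: path_tail_def\<close>)

lemma path_tail_path_space':
 fixes w :: "('d::finite) path"
 assumes "w \<in> path_space T" "0 \<le> T" "0 \<le> t" "t \<le> T"
 shows "path_tail t w \<in> path_space T"
 by (rule path_space_mono[OF path_tail_path_space[OF assms]]) (use assms in auto)

text \<open>Paths vanish at negative times, so the second summand is 0 before t, and the first is
  frozen after t. This form without case distinction reduces continuity, convergence and
  measurability of concatenations to those of sums and compositions.\<close>

lemma path_concat_eq:
 fixes w v :: "('d::finite) path"
 assumes "w \<in> path_space T" "v \<in> path_space T" "0 \<le> t" "t \<le> T"
 shows "path_concat T t w v = (\<lambda>s. w (min t s) + v (min s T - t))"
proof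
 fix s
 have T: "0 \<le> T" using assms by simp
 note n = path_space_neg[OF assms(1) T] path_space_neg[OF assms(2) T]
 show "path_concat T t w v s = w (min t s) + v (min s T - t)"
 proof (cases "s \<le> 0")
  case True
  then show ?thesis using assms n[of s] n[of 0] n(2)[of "s - t"]
   by (simp add: path_concat_def Let_def min_absorb1 min_absorb2)
 next
  case False
  show ?thesis
  proof (cases "min s T \<le> t")
   case True
   then have "w (min s T) = w (min t s)" using assms(4) False path_space_ge[OF assms(1) T, of s]
    by (auto simp: min_def split: if_splits)
   then show ?thesis using True False assms n(2)[of "min s T - t"]
    by (simp add: path_concat_def Let_def max_def)
  next
   case F: False
   then show ?thesis using False assms by (auto simp: path_concat_def Let_def max_def min_def)
  qed
 qed
qed

lemma path_concat_path_space:
 fixes w v :: "('d::finite) path"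
 assumes "w \<in> path_space T" "v \<in> path_space T" "0 \<le> t" "t \<le> T"
 shows "path_concat T t w v \<in> path_space T"
 unfolding path_concat_eq[OF assms]
proof (rule path_spaceI)
 have T: "0 \<le> T" using assms by simp
 show "continuous_on {0..T} (\<lambda>s. w (min t s) + v (min s T - t))"
  by (intro continuous_on_add continuous_on_compose2[OF path_space_continuous[OF assms(1) T, of UNIV]]
   continuous_on_compose2[OF path_space_continuous[OF assms(2) T, of UNIV]] continuous_intros) auto
 show "w (min t s) + v (min s T - t) = 0" if "s \<le> 0" for s
  using that assms T path_space_neg[OF assms(1) T, of s] path_space_neg[OF assms(2) T, of "s - t"] by auto
qed (use assms in auto)

lemma path_concat_stopped: "path_concat T t (stopped t w) v = path_concat T t w v"
 by (simp add: path_concat_def stopped_def Let_def fun_eq_iff min_absorb2)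

lemma path_concat_0:
 fixes v :: "('d::finite) path"
 assumes "w \<in> path_space T" "v \<in> path_space T" "0 \<le> T"
 shows "path_concat T 0 w v = v"
 unfolding path_concat_eq[OF assms(1,2) order_refl assms(3)]
 using path_space_neg[OF assms(1,3)] path_space_min[OF assms(2,3)] by (auto simp: fun_eq_iff)

lemma stopped_path_concat:
 fixes w v :: "('d::finite) path"
 assumes "w \<in> path_space T" "v \<in> path_space T" "0 \<le> t" "t \<le> T"
 shows "stopped t (path_concat T t w v) = stopped t w"
 unfolding path_concat_eq[OF assms] stopped_def
 using path_space_neg[OF assms(2)] assms(3,4) by (auto simp: fun_eq_iff min_def)

text \<open>A concatenated path cut at t + s is recovered by gluing back the tail of v: the tail
  drops the increment of v up to s, which the outer path already contains. The identity lets
  functionals of the whole path be written in terms of past and future.\<close>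

lemma path_concat_path_tail:
 fixes w v :: "('d::finite) path"
 assumes "w \<in> path_space T" "v \<in> path_space T" "0 \<le> t" "0 \<le> s" "t + s \<le> T"
 shows "path_concat T (t + s) (path_concat T t w v) (path_tail s v) = path_concat T t w v"
proof -
 have T: "0 \<le> T" "t \<le> T" "s \<le> T" "0 \<le> t + s" using assms by auto
 note n = path_space_neg[OF assms(2) T(1)]
 show ?thesis
  unfolding path_concat_eq[OF path_concat_path_space[OF assms(1-3) T(2)]
    path_tail_path_space'[OF assms(2) T(1) assms(4) T(3)] T(4) assms(5)]
  unfolding path_concat_eq[OF assms(1-3) T(2)] path_tail_def
  using assms(3-) by (auto simp: fun_eq_iff min_def max_def algebra_simps)
qed

lemma path_concat_stopped_right:
 fixes w v :: "('d::finite) path"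
 assumes "w \<in> path_space T" "v \<in> path_space T" "0 \<le> t" "0 \<le> s" "t + s \<le> T"
 shows "stopped (t + s) (path_concat T t w (stopped s v)) = stopped (t + s) (path_concat T t w v)"
proof -
 have T: "0 \<le> T" "t \<le> T" using assms by auto
 show ?thesis
  unfolding path_concat_eq[OF assms(1-3) T(2)] path_concat_eq[OF assms(1) stopped_path_space[OF assms(2) T(1) assms(4)] assms(3) T(2)]
  unfolding stopped_def using assms by (auto simp: fun_eq_iff min_def)
qed

lemma path_tail_stopped:
 "0 \<le> s ==> s \<le> t ==> path_tail s (stopped t w) = stopped (t - s) (path_tail s w)"
 by (auto simp: path_tail_def stopped_def fun_eq_iff min_def max_def)

lemma path_norm_ge:
 fixes p :: "('d::finite) path"
 assumes "continuous_on {0..t} p" "s \<in> {0..t}"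
 shows "norm (p s) \<le> path_norm t p"
 unfolding path_norm_def
proof (rule cSUP_upper[OF assms(2)])
 have "compact ((\<lambda>s. norm (p s)) ` {0..t})"
  by (intro compact_continuous_image continuous_on_norm assms) auto
 then show "bdd_above ((\<lambda>s. norm (p s)) ` {0..t})"
  by (intro bounded_imp_bdd_above compact_imp_bounded)
qed

lemma path_norm_le:
 assumes "0 \<le> t" "\<And>s. s \<in> {0..t} ==> norm (p s) \<le> e"
 shows "path_norm t p \<le> e"
 unfolding path_norm_def using assms by (intro cSUP_least) auto

lemma path_norm_nonneg:
 fixes p :: "('d::finite) path"
 assumes "continuous_on {0..t} p" "0 \<le> t"
 shows "0 \<le> path_norm t p"
 using path_norm_ge[OF assms(1), of 0] assms(2) order_trans[OF norm_ge_zero[of "p 0"]] by simp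

lemma path_dist_less:
 fixes w w' :: "('d::finite) path"
 assumes "0 \<le> T" "\<And>s. norm (stopped t w s - stopped t' w' s) \<le> e" "\<bar>t - t'\<bar> < d"
 shows "path_dist T t w t' w' < d + e"
 unfolding path_dist_def using assms path_norm_le[of T "\<lambda>s. w (min t s) - w' (min t' s)" e]
 by (simp add: stopped_def)

subsection \<open>Convergence\<close>

text \<open>On stopped paths this is convergence in the pseudo-metric \<open>path_dist\<close>.\<close>

definition pconv :: "(nat => ('d::finite) path) => 'd path => bool" where
 "pconv p q \<longleftrightarrow> uniform_limit UNIV p q sequentially"

lemma pconvD: "pconv p q ==> e > 0 ==> \<forall>\<^sub>F n in sequentially. \<forall>s. norm (p n s - q s) < e"
 by (auto simp: pconv_def uniform_limit_iff dist_norm)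

lemma pconvI: "(\<And>e. e > 0 ==> \<forall>\<^sub>F n in sequentially. \<forall>s. norm (p n s - q s) < e) ==> pconv p q"
 by (auto simp: pconv_def uniform_limit_iff dist_norm)

lemma pconv_const: "pconv (\<lambda>_. p) p"
 by (intro pconvI) auto

lemma pconv_subseq: "pconv p q ==> strict_mono r ==> pconv (\<lambda>n. p (r n)) q"
 unfolding pconv_def using filterlim_compose[OF _ filterlim_subseq] by (auto simp: o_def)

text \<open>Continuity for \<open>path_dist\<close> in sequential form; the paths enter only through
  their stopped versions, so convergence is asked of those alone.\<close>

lemma C0_sequentially:
 fixes u :: "real => ('d::finite) path => 'e::metric_space"
 assumes "u \<in> C0 T" "0 \<le> T" "t \<in> {0..T}" "w \<in> path_space T"
  "\<And>n. tt n \<in> {0..T}" "\<And>n. p n \<in> path_space T" "tt \<longlonglongrightarrow> t"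
  "pconv (\<lambda>n. stopped (tt n) (p n)) (stopped t w)"
 shows "(\<lambda>n. u (tt n) (p n)) \<longlonglongrightarrow> u t w"
proof (rule metric_LIMSEQ_I)
 fix e :: real assume "e > 0"
 then obtain d where d: "d > 0" "\<And>t' w'. t' \<in> {0..T} ==> w' \<in> path_space T ==>
   path_dist T t w t' w' < d ==> dist (u t w) (u t' w') < e"
  using assms(1,3,4) unfolding C0_def by blast
 have "\<forall>\<^sub>F n in sequentially. \<bar>tt n - t\<bar> < d / 2"
  using tendstoD[OF assms(7), of "d/2"] d(1) by (simp add: dist_real_def)
 moreover have "\<forall>\<^sub>F n in sequentially. \<forall>s. norm (stopped (tt n) (p n) s - stopped t w s) < d / 2"
  using pconvD[OF assms(8), of "d/2"] d(1) by simp
 ultimately have "\<forall>\<^sub>F n in sequentially. dist (u (tt n) (p n)) (u t w) < e"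
 proof eventually_elim
  case (elim n)
  have "path_dist T t w (tt n) (p n) < d / 2 + d / 2"
   using elim assms(2) by (intro path_dist_less) (auto simp: norm_minus_commute abs_minus_commute intro: less_imp_le)
  then show ?case using d(2)[OF assms(5,6), of n] by (simp add: dist_commute)
 qed
 then show "\<exists>no. \<forall>n\<ge>no. dist (u (tt n) (p n)) (u t w) < e"
  by (simp add: eventually_sequentially)
qed

text \<open>The constant sequence w' converges to w in the pseudo-metric, which cannot separate
  paths with the same stopped version. Membership in \<open>C0\<close> thereby forces
  non-anticipativity.\<close>

lemma C0_stopped:
 fixes u :: "real => ('d::finite) path => 'e::metric_space"
 assumes "u \<in> C0 T" "0 \<le> T" "t \<in> {0..T}" "w \<in> path_space T" "w' \<in> path_space T" "stopped t w' = stopped t w"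
 shows "u t w' = u t w"
proof -
 have "(\<lambda>n::nat. u t w') \<longlonglongrightarrow> u t w"
  by (rule C0_sequentially[OF assms(1-4)]) (use assms in \<open>auto simp: pconv_const\<close>)
 then show ?thesis using LIMSEQ_unique tendsto_const by metis
qed

lemma pconv_stopped_time:
 fixes w :: "('d::finite) path"
 assumes "w \<in> path_space T" "0 \<le> T" "tt \<longlonglongrightarrow> t"
 shows "pconv (\<lambda>n. stopped (tt n) w) (stopped t w)"
proof (rule pconvI)
 fix e :: real assume e: "e > 0"
 obtain d where d: "d > 0" "\<And>s s'. \<bar>s - s'\<bar> < d ==> norm (w s - w s') < e"
  using path_space_modulus[OF assms(1,2) e] by blast
 have "\<forall>\<^sub>F n in sequentially. \<bar>tt n - t\<bar> < d"
  using tendstoD[OF assms(3), of d] d(1) by (simp add: dist_real_def)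
 then show "\<forall>\<^sub>F n in sequentially. \<forall>s. norm (stopped (tt n) w s - stopped t w s) < e"
  by eventually_elim (auto simp: stopped_def min_def e intro!: d(2))
qed

lemma pconv_stopped_time':
 fixes w :: "('d::finite) path"
 assumes "w \<in> path_space T" "0 \<le> T" "tt \<longlonglongrightarrow> t" "pconv p w"
 shows "pconv (\<lambda>n. stopped (tt n) (p n)) (stopped t w)"
proof (rule pconvI)
 fix e :: real assume e: "e > 0"
 have "\<forall>\<^sub>F n in sequentially. \<forall>s. norm (p n s - w s) < e/2" using pconvD[OF assms(4), of "e/2"] e by simp
 moreover have "\<forall>\<^sub>F n in sequentially. \<forall>s. norm (stopped (tt n) w s - stopped t w s) < e/2"
  using pconvD[OF pconv_stopped_time[OF assms(1-3)], of "e/2"] e by simp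
 ultimately show "\<forall>\<^sub>F n in sequentially. \<forall>s. norm (stopped (tt n) (p n) s - stopped t w s) < e"
 proof eventually_elim
  case (elim n)
  show ?case
  proof
   fix s
   have "norm (stopped (tt n) (p n) s - stopped (tt n) w s) < e/2" using elim(1) by (simp add: stopped_def)
   then show "norm (stopped (tt n) (p n) s - stopped t w s) < e"
    using elim(2)[rule_format, of s] norm_triangle_lt[of "stopped (tt n) (p n) s - stopped (tt n) w s" "stopped (tt n) w s - stopped t w s" e]
    by simp
  qed
 qed
qed

text \<open>The error has three parts: the pasts, the appended paths, and the shifted time argument
  of the appended path. The last one is controlled by the modulus of continuity of the limit
  v.\<close>

lemma pconv_path_concat:
 fixes w v :: "('d::finite) path"
 assumes "0 \<le> T" "t \<in> {0..T}" "w \<in> path_space T" "v \<in> path_space T"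
  "\<And>n. tt n \<in> {0..T}" "\<And>n. p n \<in> path_space T" "\<And>n. q n \<in> path_space T" "tt \<longlonglongrightarrow> t"
  "pconv (\<lambda>n. stopped (tt n) (p n)) (stopped t w)" "pconv q v"
 shows "pconv (\<lambda>n. path_concat T (tt n) (p n) (q n)) (path_concat T t w v)"
proof (rule pconvI)
 fix e :: real assume e: "e > 0"
 obtain d where d: "d > 0" "\<And>s s'. \<bar>s - s'\<bar> < d ==> norm (v s - v s') < e/3"
  using path_space_modulus[OF assms(4,1), of "e/3"] e by auto
 have "\<forall>\<^sub>F n in sequentially. \<bar>tt n - t\<bar> < d"
  using tendstoD[OF assms(8), of d] d(1) by (simp add: dist_real_def)
 moreover have "\<forall>\<^sub>F n in sequentially. \<forall>s. norm (stopped (tt n) (p n) s - stopped t w s) < e / 3"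
  using pconvD[OF assms(9), of "e/3"] e by simp
 moreover have "\<forall>\<^sub>F n in sequentially. \<forall>s. norm (q n s - v s) < e / 3"
  using pconvD[OF assms(10), of "e/3"] e by simp
 ultimately show "\<forall>\<^sub>F n in sequentially. \<forall>s. norm (path_concat T (tt n) (p n) (q n) s - path_concat T t w v s) < e"
 proof eventually_elim
  case (elim n)
  show ?case
  proof
   fix s
   have eq: "path_concat T (tt n) (p n) (q n) s - path_concat T t w v s =
    (stopped (tt n) (p n) s - stopped t w s) + (q n (min s T - tt n) - v (min s T - tt n))
    + (v (min s T - tt n) - v (min s T - t))"
    using assms by (subst (1 2) path_concat_eq) (auto simp: stopped_def)
   have "norm (v (min s T - tt n) - v (min s T - t)) < e/3" using elim(1) by (intro d(2)) auto
   then show "norm (path_concat T (tt n) (p n) (q n) s - path_concat T t w v s) < e"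
    unfolding eq using elim(2)[rule_format, of s] elim(3)[rule_format, of "min s T - tt n"]
    by (intro norm_add_thirds) auto
  qed
 qed
qed

lemma pconv_path_tail:
 assumes "pconv p q"
 shows "pconv (\<lambda>n. path_tail s (p n)) (path_tail s q)"
proof (rule pconvI)
 fix e :: real assume e: "e > 0"
 have "\<forall>\<^sub>F n in sequentially. \<forall>s. norm (p n s - q s) < e/2" using pconvD[OF assms, of "e/2"] e by simp
 then show "\<forall>\<^sub>F n in sequentially. \<forall>r. norm (path_tail s (p n) r - path_tail s q r) < e"
 proof eventually_elim
  case (elim n)
  show ?case
  proof
   fix r
   have "path_tail s (p n) r - path_tail s q r = (p n (s + max 0 r) - q (s + max 0 r)) - (p n s - q s)" by (simp add: path_tail_def)
   then show "norm (path_tail s (p n) r - path_tail s q r) < e"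
    using elim[rule_format, of "s + max 0 r"] elim[rule_format, of s]
    by (metis norm_diff_halves)
  qed
 qed
qed

lemma pconv_path_tail_time:
 fixes w :: "('d::finite) path"
 assumes "w \<in> path_space T" "0 \<le> T" "tt \<longlonglongrightarrow> t"
 shows "pconv (\<lambda>n. path_tail (tt n) w) (path_tail t w)"
proof (rule pconvI)
 fix e :: real assume e: "e > 0"
 obtain d where d: "d > 0" "\<And>s s'. \<bar>s - s'\<bar> < d ==> norm (w s - w s') < e/2"
  using path_space_modulus[OF assms(1,2), of "e/2"] e by auto
 have "\<forall>\<^sub>F n in sequentially. \<bar>tt n - t\<bar> < d"
  using tendstoD[OF assms(3), of d] d(1) by (simp add: dist_real_def)
 then show "\<forall>\<^sub>F n in sequentially. \<forall>s. norm (path_tail (tt n) w s - path_tail t w s) < e"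
 proof eventually_elim
  case (elim n)
  show ?case
  proof
   fix s
   have "path_tail (tt n) w s - path_tail t w s = (w (tt n + max 0 s) - w (t + max 0 s)) - (w (tt n) - w t)" by (simp add: path_tail_def)
   then show "norm (path_tail (tt n) w s - path_tail t w s) < e"
    using d(2)[of "tt n + max 0 s" "t + max 0 s"] d(2)[of "tt n" t] elim
    unfolding add_diff_cancel_right
    by (metis norm_diff_halves)
  qed
 qed
qed

section \<open>Measurability on path space\<close>

lemma space_cf [simp]: "space (canonical_filtration T t) = path_space T"
 unfolding canonical_filtration_def by (intro space_measure_of) auto

lemma sets_cf: "sets (canonical_filtration T t) =
  sigma_sets (path_space T) {{w \<in> path_space T. w s \<in> A} | s A. s \<in> {0..t} \<and> A \<in> sets borel}"
 unfolding canonical_filtration_def by (intro sets_measure_of) auto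

lemma measurable_cfI:
 fixes f :: "'a => ('d::finite) path"
 assumes "\<And>x. x \<in> space N ==> f x \<in> path_space T"
  "\<And>s. 0 \<le> s ==> s \<le> t ==> (\<lambda>x. f x s) \<in> borel_measurable N"
 shows "f \<in> measurable N (canonical_filtration T t)"
 unfolding canonical_filtration_def
proof (rule measurable_measure_of)
 fix y assume "y \<in> {{w \<in> path_space T. w s \<in> A} |s A. s \<in> {0..t} \<and> (A :: (real ^ 'd) set) \<in> sets borel}"
 then obtain s A where y: "y = {w \<in> path_space T. w s \<in> A}" "s \<in> {0..t}" "A \<in> sets borel" by blast
 have "f -` y \<inter> space N = (\<lambda>x. f x s) -` A \<inter> space N" using y assms(1) by auto
 also have "... \<in> sets N" by (rule measurable_sets[OF assms(2) y(3)]) (use y in auto)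
 finally show "f -` y \<inter> space N \<in> sets N" .
qed (use assms(1) in auto)

lemma coord_measurable_le:
 fixes s :: real
 assumes "0 \<le> T" "s \<le> t"
 shows "(\<lambda>w :: ('d::finite) path. w s) \<in> borel_measurable (canonical_filtration T t)"
proof (cases "s \<le> 0")
 case True
 then show ?thesis using path_space_neg[OF _ assms(1) True]
  by (subst measurable_cong[of _ _ "\<lambda>_. 0"]) auto
next
 case False
 show ?thesis
 proof (rule measurableI)
  fix A :: "(real ^ 'd) set" assume "A \<in> sets borel"
  then show "(\<lambda>w. w s) -` A \<inter> space (canonical_filtration T t) \<in> sets (canonical_filtration T t)"
   unfolding sets_cf using False assms(2)
   by (intro sigma_sets.Basic CollectI exI[of _ s] exI[of _ A]) auto
 qed simp
qed

lemma coord_measurable: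
 fixes s :: real
 assumes "0 \<le> T"
 shows "(\<lambda>w :: ('d::finite) path. w s) \<in> borel_measurable (canonical_filtration T T)"
proof (cases "s \<le> T")
 case True then show ?thesis using assms coord_measurable_le by blast
next
 case False
 then have "(\<lambda>w :: 'd path. w s) \<in> borel_measurable (canonical_filtration T T) \<longleftrightarrow>
   (\<lambda>w :: 'd path. w T) \<in> borel_measurable (canonical_filtration T T)"
  using False by (intro measurable_cong path_space_ge[OF _ assms]) auto
 then show ?thesis using coord_measurable_le[OF assms, of T T] by simp
qed

lemma coord_measurable_compose:
 "f \<in> measurable N (canonical_filtration T T) ==> 0 \<le> T ==> (\<lambda>x. f x (s::real) :: real ^ ('d::finite)) \<in> borel_measurable N"
 using measurable_compose[OF _ coord_measurable] .

lemma cf_mono: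
 assumes "s \<le> t"
 shows "sets (canonical_filtration T s :: ('d::finite) path measure) \<subseteq> sets (canonical_filtration T t)"
 unfolding sets_cf using assms by (intro sigma_sets_mono') force

lemma stopped_measurable_cf:
 assumes "0 \<le> T" "0 \<le> t"
 shows "stopped t \<in> measurable (canonical_filtration T t) (canonical_filtration T T :: ('d::finite) path measure)"
 by (intro measurable_cfI)
  (auto intro!: stopped_path_space assms, auto simp: stopped_def intro!: coord_measurable_le[OF assms(1)])

text \<open>Galmarino's test\<close>

lemma cf_sets_stopped_iff:
 fixes A :: "('d::finite) path set"
 assumes "A \<in> sets (canonical_filtration T t)" "0 \<le> T" "0 \<le> t" "w \<in> path_space T"
 shows "stopped t w \<in> A \<longleftrightarrow> w \<in> A"
proof -
 note sp = stopped_path_space[OF _ assms(2,3)]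
 have "\<forall>w\<in>path_space T. stopped t w \<in> A \<longleftrightarrow> w \<in> A" using assms(1) unfolding sets_cf
 proof induction
  case (Basic a)
  then show ?case by (auto intro: sp simp: min_absorb2) (auto simp: stopped_def min_absorb2)
 next
  case (Compl a)
  then show ?case using sp by auto
 qed auto
 then show ?thesis using assms(4) by blast
qed

text \<open>The converse of Galmarino's test: a set invariant under stopping at t is its own
  preimage under \<open>stopped t\<close>, and that map is measurable from the \<sigma>-algebra at
  time t.\<close>

lemma cf_sets_stoppedI:
 fixes A :: "('d::finite) path set"
 assumes "A \<in> sets (canonical_filtration T T)" "0 \<le> T" "0 \<le> t"
  "\<And>w. w \<in> path_space T ==> stopped t w \<in> A \<longleftrightarrow> w \<in> A"
 shows "A \<in> sets (canonical_filtration T t)"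
proof -
 have "stopped t -` A \<inter> path_space T \<in> sets (canonical_filtration T t)"
  using measurable_sets[OF stopped_measurable_cf[OF assms(2,3)] assms(1)] by simp
 moreover have "stopped t -` A \<inter> path_space T = A"
  using assms(4) sets.sets_into_space[OF assms(1)] by auto
 ultimately show ?thesis by simp
qed

lemma stopping_times_set:
 "\<tau> \<in> stopping_times T ==> {w \<in> path_space T. \<tau> w \<le> s} \<in> sets (canonical_filtration T s)"
 using stopping_timeD[where F = "canonical_filtration T" and T = \<tau> and t = s]
 by (simp add: stopping_times_def Measurable.pred_def)

lemma stopping_times_le_iff:
 fixes w :: "('d::finite) path"
 assumes "\<tau> \<in> stopping_times T" "0 \<le> T" "0 \<le> s" "w \<in> path_space T"
 shows "\<tau> (stopped s w) \<le> s \<longleftrightarrow> \<tau> w \<le> s"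
 using cf_sets_stopped_iff[OF stopping_times_set[OF assms(1)] assms(2-4)] assms(4)
  stopped_path_space[OF assms(4,2,3)] by auto

lemma stopping_times_range: "\<tau> \<in> stopping_times T ==> w \<in> path_space T ==> 0 \<le> \<tau> w \<and> \<tau> w \<le> T"
 by (auto simp: stopping_times_def)

text \<open>Each of the two values is tested at its own level by
  \<open>stopping_times_le_iff\<close>; there the stopping at s disappears, because the level does
  not exceed s.\<close>

lemma stopping_times_stopped:
 fixes w :: "('d::finite) path"
 assumes "\<tau> \<in> stopping_times T" "0 \<le> T" "w \<in> path_space T" "\<tau> w \<le> s"
 shows "\<tau> (stopped s w) = \<tau> w"
proof (rule antisym)
 have s: "0 \<le> s" using stopping_times_range[OF assms(1,3)] assms(4) by simp
 note sp = stopped_path_space[OF assms(3,2) s]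
 let ?r = "\<tau> w" and ?r' = "\<tau> (stopped s w)"
 have r: "0 \<le> ?r" "0 \<le> ?r'" using stopping_times_range[OF assms(1)] assms(3) sp by auto
 have "\<tau> (stopped ?r (stopped s w)) \<le> ?r \<longleftrightarrow> \<tau> (stopped s w) \<le> ?r"
  by (rule stopping_times_le_iff[OF assms(1,2) r(1) sp])
 moreover have "\<tau> (stopped ?r w) \<le> ?r" by (subst stopping_times_le_iff[OF assms(1,2) r(1) assms(3)]) simp
 ultimately show le: "?r' \<le> ?r" using assms(4) by (simp add: stopped_stopped min_absorb1)
 have "\<tau> (stopped ?r' (stopped s w)) \<le> ?r'" by (subst stopping_times_le_iff[OF assms(1,2) r(2) sp]) simp
 then have "\<tau> (stopped ?r' w) \<le> ?r'" using le assms(4) by (simp add: stopped_stopped min_absorb1)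
 then show "?r \<le> ?r'" by (subst (asm) stopping_times_le_iff[OF assms(1,2) r(2) assms(3)])
qed

lemma stopping_times_measurable:
 assumes "\<tau> \<in> stopping_times T" "0 \<le> T"
 shows "\<tau> \<in> borel_measurable (canonical_filtration T T :: ('d::finite) path measure)"
proof (rule borel_measurableI_le)
 fix s
 show "{w \<in> space (canonical_filtration T T :: 'd path measure). \<tau> w \<le> s} \<in> sets (canonical_filtration T T)"
 proof (cases "s \<le> T")
  case True
  then show ?thesis using stopping_times_set[OF assms(1), of s] cf_mono[of s T] by auto
 next
  case False
  then have "{w \<in> space (canonical_filtration T T :: 'd path measure). \<tau> w \<le> s} = space (canonical_filtration T T)"
   using stopping_times_range[OF assms(1)] by force
  then show ?thesis by (metis sets.top)
 qed
qed

text \<open>Adaptedness is replaced by invariance under stopping. Levels s \<ge> T are left out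
  because \<open>stopped s\<close> is the identity there.\<close>

lemma stopping_timesI:
 fixes \<tau> :: "('d::finite) path => real"
 assumes "0 \<le> T" "\<tau> \<in> borel_measurable (canonical_filtration T T)"
  "\<And>w. w \<in> path_space T ==> 0 \<le> \<tau> w \<and> \<tau> w \<le> T"
  "\<And>w s. w \<in> path_space T ==> 0 \<le> s ==> s < T ==> \<tau> (stopped s w) \<le> s \<longleftrightarrow> \<tau> w \<le> s"
 shows "\<tau> \<in> stopping_times T"
proof -
 have "{w \<in> path_space T. \<tau> w \<le> s} \<in> sets (canonical_filtration T s)" for s
 proof (cases "0 \<le> s")
  case True
  have "\<tau> -` {..s} \<inter> space (canonical_filtration T T) \<in> sets (canonical_filtration T T)"
   by (rule measurable_sets[OF assms(2)]) auto
  also have "\<tau> -` {..s} \<inter> space (canonical_filtration T T) = {w \<in> path_space T. \<tau> w \<le> s}" by auto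
  finally show ?thesis
  proof (rule cf_sets_stoppedI[OF _ assms(1) True])
   fix w :: "'d path" assume wT: "w \<in> path_space T"
   show "stopped s w \<in> {w \<in> path_space T. \<tau> w \<le> s} \<longleftrightarrow> w \<in> {w \<in> path_space T. \<tau> w \<le> s}"
    using assms(4)[OF wT True] stopped_id[OF wT assms(1), of s] stopped_path_space[OF wT assms(1) True] wT
    by (cases "s < T") auto
  qed
 next
  case False
  then have "{w \<in> path_space T. \<tau> w \<le> s} = {}" using assms(3) by force
  then show ?thesis by (simp only: sets.empty_sets)
 qed
 then show ?thesis using assms(3) by (auto simp: stopping_times_def stopping_time_def Measurable.pred_def)
qed

subsection \<open>Polygons\<close>

definition ramp :: "real => nat => real => real" where
 "ramp dt k s = max 0 (min 1 (s / dt - real k))"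

text \<open>The piecewise linear path with increment y k over the k-th interval of mesh dt, constant
  after n intervals. Increments rather than values are the data, since increments are what an Euler
  step produces.\<close>

definition polygon :: "real => nat => (nat => real ^ ('d::finite)) => 'd path" where
 "polygon dt n y = (\<lambda>s. \<Sum>k<n. ramp dt k s *\<^sub>R y k)"

lemma ramp_0: "dt > 0 ==> s \<le> real k * dt ==> ramp dt k s = 0"
 by (auto simp: ramp_def field_simps)

lemma ramp_1: "dt > 0 ==> real (Suc k) * dt \<le> s ==> ramp dt k s = 1"
proof -
 assume "dt > 0" "real (Suc k) * dt \<le> s"
 then have "real (Suc k) \<le> s / dt" by (simp add: pos_le_divide_eq)
 then show ?thesis by (simp add: ramp_def)
qed

lemma ramp_range: "0 \<le> ramp dt k s" "ramp dt k s \<le> 1"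
 by (auto simp: ramp_def)

lemma polygon_continuous: "continuous_on A (polygon dt n y)"
 unfolding polygon_def ramp_def divide_inverse by (intro continuous_intros)

lemma polygon_path_space:
 assumes "dt > 0" "real n * dt \<le> T"
 shows "polygon dt n y \<in> path_space T"
proof (rule path_spaceI)
 show "0 \<le> T" using assms by (smt (verit) mult_nonneg_nonneg of_nat_0_le_iff)
 show "polygon dt n y s = 0" if "s \<le> 0" for s
  unfolding polygon_def using assms that
  by (intro sum.neutral ballI) (simp add: ramp_0 order_trans[OF that])
 show "polygon dt n y s = polygon dt n y T" if "T \<le> s" for s
  unfolding polygon_def
 proof (intro sum.cong refl)
  fix k assume "k \<in> {..<n}"
  then have "real (Suc k) * dt \<le> real n * dt" using assms(1) by (intro mult_right_mono) auto
  then have "ramp dt k s = 1" "ramp dt k T = 1" by (intro ramp_1 assms(1); use assms that in linarith)+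
  then show "ramp dt k s *\<^sub>R y k = ramp dt k T *\<^sub>R y k" by simp
 qed
qed (rule polygon_continuous)

lemma polygon_split:
 assumes "dt > 0" "j \<le> n" "real j * dt \<le> s" "s \<le> real (Suc j) * dt"
 shows "polygon dt n y s = (\<Sum>k<j. y k) + (if j < n then ramp dt j s *\<^sub>R y j else 0)"
proof -
 have "ramp dt k s *\<^sub>R y k = (if k < j then y k else if k = j then ramp dt j s *\<^sub>R y j else 0)" for k
 proof -
  consider "k < j" | "k = j" | "k > j" by linarith
  then show ?thesis
  proof cases
   case 1
   then have "real (Suc k) * dt \<le> real j * dt" using assms(1) by (intro mult_right_mono) auto
   then have "ramp dt k s = 1" by (intro ramp_1 assms(1)) (use assms in linarith)
   with 1 show ?thesis by simp
  next
   case 3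
   then have "real (Suc j) * dt \<le> real k * dt" using assms(1) by (intro mult_right_mono) auto
   then have "ramp dt k s = 0" by (intro ramp_0 assms(1)) (use assms in linarith)
   with 3 show ?thesis by simp
  qed auto
 qed
 then have "polygon dt n y s = (\<Sum>k<n. (if k < j then y k else 0) + (if k = j then ramp dt j s *\<^sub>R y j else 0))"
  unfolding polygon_def by (intro sum.cong) auto
 also have "... = (\<Sum>k\<in>{..<n} \<inter> {..<j}. y k) + (if j < n then ramp dt j s *\<^sub>R y j else 0)"
  by (simp add: sum.distrib sum.If_cases sum.delta lessThan_def)
 also have "{..<n} \<inter> {..<j} = {..<j}" using assms(2) by auto
 finally show ?thesis .
qed

lemma polygon_grid: "dt > 0 ==> j \<le> n ==> polygon dt n y (real j * dt) = (\<Sum>k<j. y k)"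
 using polygon_split[of dt j n "real j * dt" y] by (auto simp: ramp_0 mult_right_mono)

lemma polygon_end:
 assumes "dt > 0" "real n * dt \<le> s" shows "polygon dt n y s = (\<Sum>k<n. y k)"
 unfolding polygon_def
proof (intro sum.cong refl)
 fix k assume "k \<in> {..<n}"
 then have "real (Suc k) * dt \<le> real n * dt" using assms(1) by (intro mult_right_mono) auto
 then have "ramp dt k s = 1" by (intro ramp_1 assms(1)) (use assms in linarith)
 then show "ramp dt k s *\<^sub>R y k = y k" by simp
qed

lemma grid_interval:
 fixes s dt :: real
 assumes "dt > 0" "0 \<le> s"
 shows "real (nat \<lfloor>s / dt\<rfloor>) * dt \<le> s" "s < real (Suc (nat \<lfloor>s / dt\<rfloor>)) * dt"
proof -
 have "0 \<le> s / dt" using assms by simp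
 then have "real (nat \<lfloor>s / dt\<rfloor>) \<le> s / dt" "s / dt < real (Suc (nat \<lfloor>s / dt\<rfloor>))"
  by linarith+
 then show "real (nat \<lfloor>s / dt\<rfloor>) * dt \<le> s" "s < real (Suc (nat \<lfloor>s / dt\<rfloor>)) * dt"
  using assms(1) by (simp_all add: pos_le_divide_eq pos_divide_less_eq)
qed

text \<open>On a grid interval the polygon is a convex combination of its two end values, and each
  of these is within a of p at the node and hence within a + b of p s.\<close>

lemma polygon_close:
 fixes p :: "('d::finite) path"
 assumes "dt > 0" "0 \<le> s" "s \<le> real n * dt"
  "\<And>j. j \<le> n ==> norm ((\<Sum>k<j. y k) - p (real j * dt)) \<le> a"
  "\<And>s s'. \<bar>s - s'\<bar> \<le> dt ==> norm (p s - p s') \<le> b"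
 shows "norm (polygon dt n y s - p s) \<le> a + b"
proof -
 define j where "j = nat \<lfloor>s / dt\<rfloor>"
 note gi = grid_interval[OF assms(1,2), folded j_def]
 have jn: "j \<le> n"
 proof (rule ccontr)
  assume "\<not> j \<le> n"
  then have "real (Suc n) * dt \<le> real j * dt" using assms(1) by (intro mult_right_mono) auto
  then show False using gi(1) assms(1,3) by (simp add: algebra_simps)
 qed
 have near: "norm ((\<Sum>k<i. y k) - p s) \<le> a + b" if "i \<le> n" "\<bar>real i * dt - s\<bar> \<le> dt" for i
  using norm_triangle_ineq[of "(\<Sum>k<i. y k) - p (real i * dt)" "p (real i * dt) - p s"]
   assms(4)[OF that(1)] assms(5)[OF that(2)] by simp
 show ?thesis
 proof (cases "j < n")
  case True
  define c where "c = ramp dt j s"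
  have c: "0 \<le> c" "c \<le> 1" using ramp_range by (auto simp: c_def)
  have "polygon dt n y s - p s = (1 - c) *\<^sub>R ((\<Sum>k<j. y k) - p s) + c *\<^sub>R ((\<Sum>k<Suc j. y k) - p s)"
   using polygon_split[OF assms(1) jn gi(1) less_imp_le[OF gi(2)], of y] True
   by (simp add: c_def algebra_simps)
  also have "norm ... \<le> (1 - c) * norm ((\<Sum>k<j. y k) - p s) + c * norm ((\<Sum>k<Suc j. y k) - p s)"
   using c norm_triangle_ineq[of "(1 - c) *\<^sub>R ((\<Sum>k<j. y k) - p s)" "c *\<^sub>R ((\<Sum>k<Suc j. y k) - p s)"]
   by simp
  also have "... \<le> (1 - c) * (a + b) + c * (a + b)"
   using True gi c by (intro add_mono mult_left_mono near) (auto simp: algebra_simps)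
  finally show ?thesis by (simp add: algebra_simps)
 next
  case False
  then have "polygon dt n y s - p s = (\<Sum>k<j. y k) - p s"
   using polygon_split[OF assms(1) jn gi(1) less_imp_le[OF gi(2)], of y] by simp
  then show ?thesis using near[OF jn] gi by (simp add: algebra_simps)
 qed
qed

definition interpolate :: "real => nat => ('d::finite) path => 'd path" where
 "interpolate dt n p = polygon dt n (\<lambda>k. p (real (Suc k) * dt) - p (real k * dt))"

lemma sum_increments: "(\<Sum>k<j. p (real (Suc k) * dt) - p (real k * dt)) = p (real j * dt) - (p 0 :: 'a::ab_group_add)"
 using sum_lessThan_telescope[of "\<lambda>k. p (real k * dt)" j] by simp

text \<open>The grid has to exhaust [0,S] only in the limit: after its last node the interpolation
  is constant, and p moves little between that node and S, where it is frozen.\<close>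

lemma pconv_interpolate:
 fixes p :: "('d::finite) path"
 assumes "p \<in> path_space T" "0 < T" "\<And>n. dt n > 0" "dt \<longlonglongrightarrow> 0"
  "\<And>n. real (N n) * dt n \<le> S" "(\<lambda>n. real (N n) * dt n) \<longlonglongrightarrow> S" "p \<in> path_space S" "0 \<le> S"
 shows "pconv (\<lambda>n. interpolate (dt n) (N n) p) p"
proof (rule pconvI)
 fix e :: real assume e: "e > 0"
 obtain d where d: "d > 0" "\<And>s s'. \<bar>s - s'\<bar> < d ==> norm (p s - p s') < e/2"
  using path_space_modulus[of p T "e/2"] assms(1,2) e by auto
 have "\<forall>\<^sub>F n in sequentially. dt n < d"
  using order_tendstoD(2)[OF assms(4) d(1)] .
 moreover have "\<forall>\<^sub>F n in sequentially. real (N n) * dt n > S - d"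
  using order_tendstoD(1)[OF assms(6), of "S - d"] d(1) by simp
 ultimately show "\<forall>\<^sub>F n in sequentially. \<forall>s. norm (interpolate (dt n) (N n) p s - p s) < e"
 proof eventually_elim
  case (elim n)
  have dn: "dt n > 0" using assms(3) by simp
  have p0: "p 0 = 0" using assms(1) by (rule path_space_0)
  show ?case
  proof
   fix s
   consider "s \<le> 0" | "0 \<le> s" "s \<le> real (N n) * dt n" | "real (N n) * dt n \<le> s" by linarith
   then show "norm (interpolate (dt n) (N n) p s - p s) < e"
   proof cases
    case 1
    have "interpolate (dt n) (N n) p \<in> path_space S"
     unfolding interpolate_def by (rule polygon_path_space) (use assms dn in auto)
    then have "interpolate (dt n) (N n) p s = 0" by (rule path_space_neg[OF _ assms(8) 1])
    then show ?thesis using path_space_neg[OF assms(7,8) 1] e by simp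
   next
    case 2
    have "norm (interpolate (dt n) (N n) p s - p s) \<le> 0 + e/2" unfolding interpolate_def
    proof (rule polygon_close)
     show "norm (p s - p s') \<le> e/2" if "\<bar>s - s'\<bar> \<le> dt n" for s s'
      using that elim(1) by (intro less_imp_le[OF d(2)]) auto
    qed (use dn 2 p0 in \<open>auto simp: sum_increments simp del: of_nat_Suc\<close>)
    then show ?thesis using e by simp
   next
    case 3
    have *: "interpolate (dt n) (N n) p s = p (real (N n) * dt n)"
     unfolding interpolate_def polygon_end[OF dn 3] sum_increments p0 by simp
    have "p s = p (min s S)" using path_space_min[OF assms(7,8)] by simp
    moreover have "norm (p (real (N n) * dt n) - p (min s S)) < e/2"
     using 3 elim(2) assms(5)[of n] by (intro d(2)) auto
    ultimately show ?thesis using * e by simp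
   qed
  qed
 qed
qed

lemma pconv_interpolate':
 fixes p :: "('d::finite) path"
 assumes "p \<in> path_space T" "0 < T"
 shows "pconv (\<lambda>n. interpolate (T / real (Suc n)) (Suc n) p) p"
proof (rule pconv_interpolate[OF assms, where S = T])
 show "(\<lambda>n. T / real (Suc n)) \<longlonglongrightarrow> 0"
  using tendsto_mult_right_zero[OF LIMSEQ_inverse_real_of_nat, of T] by (simp add: divide_inverse)
qed (use assms in auto)

lemma norm_polygon_le: "norm (polygon dt n y s) \<le> (\<Sum>k<n. norm (y k))"
 unfolding polygon_def
proof (rule order_trans[OF norm_sum], intro sum_mono)
 fix k
 show "norm (ramp dt k s *\<^sub>R y k) \<le> norm (y k)"
  using ramp_range[of dt k s] by (simp add: mult_left_le_one_le)
qed

lemma polygon_diff: "polygon dt n y s - polygon dt n z s = polygon dt n (\<lambda>k. y k - z k) s"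
 by (simp add: polygon_def sum_subtractf scaleR_diff_right)

lemma pconv_polygon:
 assumes "\<And>k. k < n ==> (\<lambda>m. y m k) \<longlonglongrightarrow> z k"
 shows "pconv (\<lambda>m. polygon dt n (y m)) (polygon dt n z)"
proof (rule pconvI)
 fix e :: real assume e: "e > 0"
 have "(\<lambda>m. \<Sum>k<n. norm (y m k - z k)) \<longlonglongrightarrow> (\<Sum>k<n. 0)"
  using assms by (intro tendsto_sum tendsto_norm_zero LIM_zero) auto
 then have "\<forall>\<^sub>F m in sequentially. (\<Sum>k<n. norm (y m k - z k)) < e"
  using order_tendstoD(2)[of _ 0 sequentially e] e by simp
 then show "\<forall>\<^sub>F m in sequentially. \<forall>s. norm (polygon dt n (y m) s - polygon dt n z s) < e"
  by eventually_elim (auto simp: polygon_diff intro: le_less_trans[OF norm_polygon_le])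
qed

subsection \<open>Functionals of paths\<close>

text \<open>Sequential continuity for uniform convergence. Through
  \<open>path_continuous_measurable\<close> it takes the place of the Borel \<sigma>-algebra on the
  path space.\<close>

definition path_continuous :: "real => (('d::finite) path => 'e::topological_space) => bool" where
 "path_continuous T f \<longleftrightarrow> (\<forall>p q. (\<forall>n. p n \<in> path_space T) \<longrightarrow> q \<in> path_space T \<longrightarrow> pconv p q \<longrightarrow> (\<lambda>n. f (p n)) \<longlonglongrightarrow> f q)"

lemma path_continuousD:
 "path_continuous T f ==> (\<And>n. p n \<in> path_space T) ==> q \<in> path_space T ==> pconv p q ==> (\<lambda>n. f (p n)) \<longlonglongrightarrow> f q"
 by (auto simp: path_continuous_def)

text \<open>Composed with the polygon, the functional is continuous on a countable product of
  Euclidean spaces, whose Borel sets are generated by the coordinates.\<close>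

lemma path_continuous_polygon_measurable:
 fixes f :: "('d::finite) path => 'e::metric_space"
 assumes "path_continuous T f" "dt > 0" "real n * dt \<le> T" "\<And>k. (\<lambda>x. y x k) \<in> borel_measurable N"
 shows "(\<lambda>x. f (polygon dt n (y x))) \<in> borel_measurable N"
proof -
 have "continuous_on UNIV (\<lambda>y. f (polygon dt n y))"
 proof (rule continuous_on_sequentiallyI)
  fix u :: "nat => nat => real ^ 'd" and a assume u: "u \<longlonglongrightarrow> a"
  have "(\<lambda>m. u m k) \<longlonglongrightarrow> a k" for k
  proof -
   have "isCont (\<lambda>x :: nat => real ^ 'd. x k) a"
    using continuous_on_product_coordinates[of k] continuous_on_eq_continuous_at[of UNIV] by blast
   then show ?thesis using u by (rule isCont_tendsto_compose)
  qed
  then show "(\<lambda>m. f (polygon dt n (u m))) \<longlonglongrightarrow> f (polygon dt n a)"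
   by (intro path_continuousD[OF assms(1)] polygon_path_space assms pconv_polygon)
 qed
 then have 1: "(\<lambda>y. f (polygon dt n y)) \<in> borel_measurable borel"
  by (rule borel_measurable_continuous_onI)
 have "y \<in> measurable N (PiM UNIV (\<lambda>_. borel))"
  using assms(4) by (intro measurable_PiM_single') auto
 then have "y \<in> measurable N borel"
  using measurable_cong_sets[OF refl sets_PiM_equal_borel, of N] by blast
 from measurable_compose[OF this 1] show ?thesis .
qed

text \<open>Every path is the uniform limit of its interpolations, and f of an interpolation depends
  on finitely many coordinates.\<close>

lemma path_continuous_measurable:
 fixes f :: "('d::finite) path => 'e::metric_space"
 assumes "path_continuous T f" "0 < T"
 shows "f \<in> borel_measurable (canonical_filtration T T)"
proof (rule borel_measurable_LIMSEQ_metric)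
 fix n
 show "(\<lambda>w. f (interpolate (T / real (Suc n)) (Suc n) w)) \<in> borel_measurable (canonical_filtration T T)"
  unfolding interpolate_def
  by (rule path_continuous_polygon_measurable[OF assms(1)])
    (use assms(2) coord_measurable[of T] in \<open>auto intro!: borel_measurable_diff simp del: of_nat_Suc\<close>)
next
 fix w :: "'d path" assume "w \<in> space (canonical_filtration T T)"
 then have wT: "w \<in> path_space T" by simp
 show "(\<lambda>n. f (interpolate (T / real (Suc n)) (Suc n) w)) \<longlonglongrightarrow> f w"
  using assms(2) by (intro path_continuousD[OF assms(1)] wT pconv_interpolate')
   (auto simp: interpolate_def simp del: of_nat_Suc intro!: polygon_path_space)
qed

text \<open>The time g is rounded up to a grid, where it takes countably many values; the limit then
  uses continuity from the right only, which is what \<open>law_right_continuous\<close> offers for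
  the laws.\<close>

lemma right_continuous_measurable:
 fixes \<Phi> :: "real => 'x => 'e::metric_space"
 assumes "\<And>t. t \<in> {0..T} ==> \<Phi> t \<in> borel_measurable N" "g \<in> borel_measurable N"
  "\<And>x. x \<in> space N ==> g x \<in> {0..T}"
  "\<And>x tt. x \<in> space N ==> (\<And>n::nat. tt n \<in> {g x..T}) ==> tt \<longlonglongrightarrow> g x ==> (\<lambda>n. \<Phi> (tt n) x) \<longlonglongrightarrow> \<Phi> (g x) x"
 shows "(\<lambda>x. \<Phi> (g x) x) \<in> borel_measurable N"
proof (rule borel_measurable_LIMSEQ_metric)
 define q where "q n x = min T (real_of_int \<lceil>g x * real (Suc n)\<rceil> / real (Suc n))" for n x
 fix n
 \<comment> \<open>The composition ranges over all integers; \<open>max 0\<close> keeps the time in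
   [0,T] for negative ones.\<close>
 have "(\<lambda>x. \<Phi> (min T (max 0 (real_of_int (\<lceil>g x * real (Suc n)\<rceil>) / real (Suc n)))) x) \<in> borel_measurable N"
 proof (cases "0 \<le> T")
  case True
  show ?thesis
  proof (rule measurable_compose_countable[where f = "\<lambda>i x. \<Phi> (min T (max 0 (real_of_int i / real (Suc n)))) x"])
   show "(\<lambda>x. \<lceil>g x * real (Suc n)\<rceil>) \<in> measurable N (count_space UNIV)"
    using assms(2) by measurable
  qed (intro assms(1), use True in auto)
 next
  case False
  then have "space N = {}" using assms(3) by force
  then show ?thesis by (intro measurableI) auto
 qed
 also have "?this \<longleftrightarrow> (\<lambda>x. \<Phi> (q n x) x) \<in> borel_measurable N"
 proof (rule measurable_cong)
  fix x assume x: "x \<in> space N"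
  have "0 \<le> g x * real (Suc n)" using assms(3)[OF x] by simp
  then have "0 \<le> \<lceil>g x * real (Suc n)\<rceil>" by linarith
  then have "0 \<le> real_of_int \<lceil>g x * real (Suc n)\<rceil> / real (Suc n)" by simp
  then show "\<Phi> (min T (max 0 (real_of_int \<lceil>g x * real (Suc n)\<rceil> / real (Suc n)))) x = \<Phi> (q n x) x"
   by (simp add: q_def max_absorb2 del: of_nat_Suc)
 qed
 finally show "(\<lambda>x. \<Phi> (q n x) x) \<in> borel_measurable N" .
next
 define q where "q n x = min T (real_of_int \<lceil>g x * real (Suc n)\<rceil> / real (Suc n))" for n x
 fix x assume x: "x \<in> space N"
 have lo: "g x \<le> real_of_int \<lceil>g x * real (Suc n)\<rceil> / real (Suc n)" for n
  by (simp add: pos_le_divide_eq del: of_nat_Suc)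
 have hi: "real_of_int \<lceil>g x * real (Suc n)\<rceil> / real (Suc n) \<le> g x + inverse (real (Suc n))" for n
 proof -
  have "real_of_int \<lceil>g x * real (Suc n)\<rceil> \<le> g x * real (Suc n) + 1" by linarith
  then have "real_of_int \<lceil>g x * real (Suc n)\<rceil> / real (Suc n) \<le> (g x * real (Suc n) + 1) / real (Suc n)"
   by (intro divide_right_mono) auto
  also have "... = g x + inverse (real (Suc n))" by (simp add: add_divide_distrib inverse_eq_divide del: of_nat_Suc)
  finally show ?thesis .
 qed
 have "(\<lambda>n. q n x) \<longlonglongrightarrow> g x"
 proof (rule tendsto_sandwich[where f = "\<lambda>_. g x" and h = "\<lambda>n. g x + inverse (real (Suc n))"])
  show "(\<lambda>n. g x + inverse (real (Suc n))) \<longlonglongrightarrow> g x"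
   using tendsto_add[OF tendsto_const LIMSEQ_inverse_real_of_nat, of "g x"] by simp
  show "(\<lambda>n. g x) \<longlonglongrightarrow> g x" by simp
  show "\<forall>\<^sub>F n in sequentially. g x \<le> q n x"
   using assms(3)[OF x] lo by (intro always_eventually) (auto simp: q_def)
  show "\<forall>\<^sub>F n in sequentially. q n x \<le> g x + inverse (real (Suc n))"
   using hi by (intro always_eventually) (auto simp: q_def min_le_iff_disj)
 qed
 moreover have "q n x \<in> {g x..T}" for n using assms(3)[OF x] lo by (auto simp: q_def)
 ultimately show "(\<lambda>n. \<Phi> (q n x) x) \<longlonglongrightarrow> \<Phi> (g x) x" by (intro assms(4) x)
qed

lemma eval_measurable:
 fixes f :: "'x => ('d::finite) path"
 assumes "f \<in> measurable N (canonical_filtration T T)" "g \<in> borel_measurable N" "0 \<le> T"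
 shows "(\<lambda>x. f x (g x)) \<in> borel_measurable N"
proof -
 have f: "f x \<in> path_space T" if "x \<in> space N" for x using measurable_space[OF assms(1) that] by simp
 have "(\<lambda>x. f x (max 0 (min (g x) T))) \<in> borel_measurable N"
 proof (rule right_continuous_measurable[where \<Phi> = "\<lambda>t x. f x t" and T = T])
  fix x tt assume "x \<in> space N" and tt: "tt \<longlonglongrightarrow> max 0 (min (g x) T)"
  then have "isCont (f x) (max 0 (min (g x) T))"
   using path_space_continuous[OF f assms(3), of x UNIV] by (simp add: continuous_on_eq_continuous_at)
  then show "(\<lambda>n. f x (tt n)) \<longlonglongrightarrow> f x (max 0 (min (g x) T))" using tt by (rule isCont_tendsto_compose)
 qed (use assms in \<open>auto intro!: coord_measurable_compose[OF assms(1)]\<close>)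
 also have "?this \<longleftrightarrow> ?thesis"
  using path_space_clamp[OF f] by (intro measurable_cong) metis
 finally show ?thesis .
qed

lemma stopped_measurable:
 fixes f :: "'x => ('d::finite) path"
 assumes "f \<in> measurable N (canonical_filtration T T)" "g \<in> borel_measurable N" "0 \<le> T" "\<And>x. x \<in> space N ==> 0 \<le> g x"
 shows "(\<lambda>x. stopped (g x) (f x)) \<in> measurable N (canonical_filtration T T)"
proof (rule measurable_cfI)
 show "(\<lambda>x. stopped (g x) (f x) s) \<in> borel_measurable N" for s
  unfolding stopped_def using assms(2) by (intro eval_measurable[OF assms(1) _ assms(3)]) auto
next
 fix x assume x: "x \<in> space N"
 show "stopped (g x) (f x) \<in> path_space T"
  using assms(4)[OF x] assms(3) measurable_space[OF assms(1) x] by (intro stopped_path_space) auto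
qed

lemma path_tail_measurable:
 fixes f :: "'x => ('d::finite) path"
 assumes "f \<in> measurable N (canonical_filtration T T)" "g \<in> borel_measurable N" "0 \<le> T" "\<And>x. x \<in> space N ==> 0 \<le> g x \<and> g x \<le> T"
 shows "(\<lambda>x. path_tail (g x) (f x)) \<in> measurable N (canonical_filtration T T)"
proof (rule measurable_cfI)
 show "(\<lambda>x. path_tail (g x) (f x) s) \<in> borel_measurable N" for s
  unfolding path_tail_def using assms(2)
  by (intro borel_measurable_diff eval_measurable[OF assms(1) _ assms(3)]) auto
next
 fix x assume x: "x \<in> space N"
 show "path_tail (g x) (f x) \<in> path_space T"
  using assms(4)[OF x] assms(3) measurable_space[OF assms(1) x] by (intro path_tail_path_space') auto
qed

lemma path_concat_measurable:
 fixes f h :: "'x => ('d::finite) path"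
 assumes "f \<in> measurable N (canonical_filtration T T)" "h \<in> measurable N (canonical_filtration T T)"
  "g \<in> borel_measurable N" "0 \<le> T" "\<And>x. x \<in> space N ==> 0 \<le> g x \<and> g x \<le> T"
 shows "(\<lambda>x. path_concat T (g x) (f x) (h x)) \<in> measurable N (canonical_filtration T T)"
proof (rule measurable_cfI)
 have sp: "f x \<in> path_space T" "h x \<in> path_space T" if "x \<in> space N" for x
  using measurable_space[OF assms(1) that] measurable_space[OF assms(2) that] by auto
 fix s
 have "(\<lambda>x. f x (min (g x) s) + h x (min s T - g x)) \<in> borel_measurable N"
  using assms(3) by (intro borel_measurable_add eval_measurable[OF assms(1) _ assms(4)] eval_measurable[OF assms(2) _ assms(4)]) auto
 also have "?this \<longleftrightarrow> (\<lambda>x. path_concat T (g x) (f x) (h x) s) \<in> borel_measurable N"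
  using assms(5) by (intro measurable_cong) (auto simp: path_concat_eq[OF sp])
 finally show "(\<lambda>x. path_concat T (g x) (f x) (h x) s) \<in> borel_measurable N" .
next
 show "path_concat T (g x) (f x) (h x) \<in> path_space T" if "x \<in> space N" for x
  using assms(5)[OF that] measurable_space[OF assms(1) that] measurable_space[OF assms(2) that]
  by (intro path_concat_path_space) auto
qed

lemma prog_measurable_joint:
 fixes f :: "'x => ('d::finite) path"
 assumes "prog_measurable T T u" "0 \<le> T" "f \<in> measurable N (canonical_filtration T T)" "g \<in> borel_measurable N"
  "\<And>x. x \<in> space N ==> g x \<in> {0..T}"
 shows "(\<lambda>x. u (g x) (f x)) \<in> borel_measurable N"
proof -
 have 1: "(\<lambda>(r, w). u r w) \<in> borel_measurable (restrict_space borel {0..T} \<Otimes>\<^sub>M canonical_filtration T T)"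
  using assms(1,2) by (auto simp: prog_measurable_def)
 have "(\<lambda>x. (g x, f x)) \<in> measurable N (restrict_space borel {0..T} \<Otimes>\<^sub>M canonical_filtration T T)"
  using assms(3-5) by (intro measurable_Pair measurable_restrict_space2) auto
 from measurable_compose[OF this 1] show ?thesis by simp
qed

section \<open>Maximal inequality\<close>

primrec runmax :: "(nat => real) => nat => real" where
 "runmax f 0 = f 0"
| "runmax f (Suc k) = max (runmax f k) (f (Suc k))"

lemma runmax_ge: "i \<le> k ==> f i \<le> runmax f k"
 by (induction k) (auto simp: le_Suc_eq max.coboundedI1)

lemma runmax_le_iff: "runmax f k \<le> b \<longleftrightarrow> (\<forall>i\<le>k. f i \<le> b)"
 by (induction k) (auto simp: le_Suc_eq)

lemma runmax_attained: "\<exists>i\<le>k. runmax f k = f i"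
proof (induction k)
 case (Suc k)
 then obtain i where "i \<le> k" "runmax f k = f i" by blast
 then show ?case by (cases "f i \<le> f (Suc k)") (auto intro: exI[of _ i] exI[of _ "Suc k"])
qed simp

lemma runmax_ge_iff: "b \<le> runmax f k \<longleftrightarrow> (\<exists>i\<le>k. b \<le> f i)"
 using runmax_attained[of k f] runmax_ge[of _ k f] by (metis order.trans)

lemma runmax_cong: "(\<And>i. i \<le> k ==> f i = g i) ==> runmax f k = runmax g k"
 by (induction k) auto

lemma runmax_nonneg: "(\<And>i. i \<le> k ==> 0 \<le> f i) ==> 0 \<le> runmax f k"
 using runmax_ge[of 0 k f] by force

lemma runmax_measurable:
 "(\<And>i. i \<le> k ==> (\<lambda>x. f x i) \<in> borel_measurable N) ==> (\<lambda>x. runmax (f x) k) \<in> borel_measurable N"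
 by (induction k) (auto intro!: borel_measurable_max)

text \<open>Doob's inequality is a pathwise inequality plus the martingale property.\<close>

lemma doob_pathwise_aux:
 assumes "\<And>i. 0 \<le> (s i :: real)"
 shows "(runmax s n)^2 \<le> 2 * runmax s n * s n - 2 * (\<Sum>i<n. runmax s i * (s (Suc i) - s i))"
proof (induction n)
 case 0
 then show ?case by (simp add: power2_eq_square)
next
 case (Suc n)
 let ?a = "runmax s n" and ?b = "s (Suc n)"
 show ?case
 proof (cases "?b \<le> ?a")
  case True
  then have "runmax s (Suc n) = ?a" by simp
  then show ?thesis using Suc by (simp add: algebra_simps)
 next
  case False
  then have eq: "runmax s (Suc n) = ?b" by simp
  have "0 \<le> (?b - ?a)^2" by simp
  then show ?thesis using Suc unfolding eq by (simp add: algebra_simps power2_eq_square)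
 qed
qed

text \<open>Convexity replaces the increments of the absolute value by sgn (m i) times the
  increments of m. The product of maximum and end value is split by 2ab \<le> a^2/2 + 2b^2, and
  absorbing a^2/2 on the left doubles the constants, which gives the factor 4.\<close>

lemma doob_pathwise:
 fixes m :: "nat => real"
 shows "(runmax (\<lambda>i. \<bar>m i\<bar>) n)^2 \<le> 4 * (m n)^2
   - 4 * (\<Sum>i<n. runmax (\<lambda>i. \<bar>m i\<bar>) i * sgn (m i) * (m (Suc i) - m i))"
proof -
 let ?s = "\<lambda>i. \<bar>m i\<bar>"
 have "(\<Sum>i<n. runmax ?s i * sgn (m i) * (m (Suc i) - m i)) \<le> (\<Sum>i<n. runmax ?s i * (?s (Suc i) - ?s i))"
 proof (intro sum_mono)
  fix i
  have "sgn (m i) * (m (Suc i) - m i) \<le> ?s (Suc i) - ?s i" by (auto simp: sgn_if)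
  from mult_left_mono[OF this, of "runmax ?s i"]
  show "runmax ?s i * sgn (m i) * (m (Suc i) - m i) \<le> runmax ?s i * (?s (Suc i) - ?s i)"
   using runmax_nonneg[of i ?s] by (simp add: mult.assoc)
 qed
 moreover have "2 * runmax ?s n * ?s n \<le> (runmax ?s n)^2 / 2 + 2 * (m n)^2"
  using zero_le_power2[of "runmax ?s n - 2 * ?s n"] by (simp add: power2_eq_square algebra_simps)
 ultimately show ?thesis using doob_pathwise_aux[of ?s n] by simp
qed

lemma norm_vec_sq: "(norm (x :: 'a::real_normed_vector ^ ('n::finite)))^2 = (\<Sum>a\<in>UNIV. (norm (x $ a))^2)"
 by (simp add: norm_vec_def L2_set_def sum_nonneg)

lemma runmax_norm_sq_le:
 fixes y :: "nat => real ^ ('n::finite)"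
 shows "(runmax (\<lambda>k. norm (y k)) n)^2 \<le> (\<Sum>a\<in>UNIV. (runmax (\<lambda>k. \<bar>y k $ a\<bar>) n)^2)"
proof -
 obtain i where i: "i \<le> n" "runmax (\<lambda>k. norm (y k)) n = norm (y i)" using runmax_attained by blast
 have "(norm (y i))^2 = (\<Sum>a\<in>UNIV. \<bar>y i $ a\<bar>^2)" by (simp add: norm_vec_sq)
 also have "... \<le> (\<Sum>a\<in>UNIV. (runmax (\<lambda>k. \<bar>y k $ a\<bar>) n)^2)"
  by (intro sum_mono power_mono runmax_ge[OF i(1), of "\<lambda>k. \<bar>y k $ _\<bar>"]) auto
 finally show ?thesis using i(2) by simp
qed

section \<open>Independence of Brownian increments from the past\<close>

locale brownian =
 fixes T :: real and M :: "'m measure" and W :: "real => 'm => real ^ ('d::finite)"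
 assumes T_pos: "0 < T" and bm: "brownian_motion T M W"
begin

abbreviation "filt \<equiv> brownian_filtration M W"

lemma prob_M: "prob_space M"
 using bm by (simp add: brownian_motion_def)

sublocale prob_space M by (rule prob_M)

lemma W_measurable: "0 \<le> t ==> t \<le> T ==> W t \<in> borel_measurable M"
 using bm by (simp add: brownian_motion_def)

lemma W_0: "AE x in M. W 0 x = 0"
 using bm by (simp add: brownian_motion_def)

lemma W_continuous: "AE x in M. continuous_on {0..T} (\<lambda>t. W t x)"
 using bm by (simp add: brownian_motion_def)

lemma increments_indep:
 "(\<And>k. k \<le> n ==> r k \<in> {0..T}) ==> mono_on {..n} r ==>
  indep_vars (\<lambda>_. borel) (\<lambda>k x. W (r (Suc k)) x - W (r k) x) {..<n}"
 using bm by (simp add: brownian_motion_def)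

lemma increment_components:
 assumes "0 \<le> s" "s < t" "t \<le> T"
 shows "indep_vars (\<lambda>_. borel) (\<lambda>i x. (W t x - W s x) $ i) UNIV"
  "distributed M lborel (\<lambda>x. (W t x - W s x) $ i) (normal_density 0 (sqrt (t - s)))"
 using bm assms by (auto simp: brownian_motion_def)

lemma filt_gen: "t \<le> T ==> {W s -` A \<inter> space M | s A. s \<in> {0..t} \<and> A \<in> sets borel} \<union> null_sets M \<subseteq> sets M"
 by (auto intro!: measurable_sets[OF W_measurable])

lemma space_filt [simp]: "space (filt t) = space M"
 unfolding brownian_filtration_def by (intro space_measure_of) (auto dest: sets.sets_into_space)

lemma sets_filt: "sets (filt t) =
  sigma_sets (space M) ({W s -` A \<inter> space M | s A. s \<in> {0..t} \<and> A \<in> sets borel} \<union> null_sets M)"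
 unfolding brownian_filtration_def by (intro sets_measure_of) (auto dest: sets.sets_into_space)

lemma sets_filt_subset: "t \<le> T ==> sets (filt t) \<subseteq> sets M"
 unfolding sets_filt by (rule sets.sigma_sets_subset[OF filt_gen])

lemma sets_filt_mono: "s \<le> t ==> sets (filt s) \<subseteq> sets (filt t)"
 unfolding sets_filt
proof (rule sigma_sets_mono', rule Un_mono[OF _ order_refl], rule subsetI)
 fix E assume "s \<le> t" "E \<in> {W s' -` A \<inter> space M | s' A. s' \<in> {0..s} \<and> A \<in> sets borel}"
 then obtain s' A where "E = W s' -` A \<inter> space M" "s' \<in> {0..t}" "A \<in> sets borel" by auto
 then show "E \<in> {W s' -` A \<inter> space M | s' A. s' \<in> {0..t} \<and> A \<in> sets borel}" by blast
qed

lemma null_sets_filt: "N \<in> null_sets M ==> N \<in> sets (filt t)"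
 unfolding sets_filt by (intro sigma_sets.Basic) auto

lemma measurable_filt_mono: "f \<in> measurable (filt s) N ==> s \<le> t ==> f \<in> measurable (filt t) N"
 unfolding measurable_def using sets_filt_mono[of s t] by auto

lemma measurable_filt_M: "f \<in> measurable (filt t) N ==> t \<le> T ==> f \<in> measurable M N"
 unfolding measurable_def using sets_filt_subset[of t] by auto

lemma W_filt: "0 \<le> s ==> s \<le> t ==> W s \<in> borel_measurable (filt t)"
 by (rule measurableI) (auto simp: sets_filt intro!: sigma_sets.Basic)

lemma cylinder_event:
 assumes "0 \<le> j" "j \<le> T" "A \<in> sets borel"
 shows "{x\<in>space M. W j x \<in> A} \<in> events"
 using measurable_sets[OF W_measurable[OF assms(1,2)] assms(3)] by (simp add: vimage_def Int_def conj_commute)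

text \<open>The times of the cylinder are sorted together with 0 and s, and t is appended. Because W
  starts at 0 almost surely, the cylinder is a condition on partial sums of all increments but the
  last, and the last increment is W t - W s.\<close>

lemma indep_cylinder_increment:
 assumes "0 \<le> s" "s < t" "t \<le> T" "finite J" "J \<subseteq> {0..s}" "\<And>j. j \<in> J ==> A j \<in> sets borel" "B \<in> sets borel"
 shows "prob ({x\<in>space M. \<forall>j\<in>J. W j x \<in> A j} \<inter> {x\<in>space M. W t x - W s x \<in> B}) =
  prob {x\<in>space M. \<forall>j\<in>J. W j x \<in> A j} * prob {x\<in>space M. W t x - W s x \<in> B}"
proof -
 define L where "L = sorted_list_of_set (insert 0 (insert s J))"
 have L: "sorted L" "set L = insert 0 (insert s J)" "distinct L"
  unfolding L_def using assms(4)
  by (auto simp del: sorted_list_of_set_insert_remove sorted_list_of_set.fold_insort_key.insert_remove)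
 define n where "n = length L"
 have n: "0 < n" using L(2) by (auto simp: n_def)
 define r where "r k = (if k < n then L ! k else t)" for k
 have Lran: "L ! k \<in> {0..s}" if "k < n" for k
  using nth_mem[of k L] that L(2) assms(1,5) by (auto simp: n_def)
 have mono: "mono_on {..n} r"
 proof (rule mono_onI)
  fix i j assume "i \<in> {..n}" "j \<in> {..n}" "i \<le> j"
  then show "r i \<le> r j" using Lran[of i] assms(2) sorted_nth_mono[OF L(1), of i j]
   by (auto simp: r_def n_def)
 qed
 have ran: "r k \<in> {0..T}" if "k \<le> n" for k
  using Lran[of k] assms(1-3) by (auto simp: r_def)
 have r0: "r 0 = 0"
 proof -
  obtain k where "k < n" "L ! k = 0" using L(2) by (metis in_set_conv_nth insertI1 n_def)
  then show ?thesis using sorted_nth_mono[OF L(1), of 0 k] Lran[of 0] n by (auto simp: r_def n_def)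
 qed
 have rl: "r (n - 1) = s"
 proof -
  obtain k where "k < n" "L ! k = s" using L(2) by (metis in_set_conv_nth insertCI n_def)
  then show ?thesis using sorted_nth_mono[OF L(1), of k "n - 1"] Lran[of "n - 1"] n by (auto simp: r_def n_def)
 qed
 have rn: "r n = t" by (simp add: r_def)
 define Z where "Z k x = W (r (Suc k)) x - W (r k) x" for k x
 have ind: "indep_vars (\<lambda>_. borel) Z {..<n}"
  unfolding Z_def by (rule increments_indep[OF ran mono])
 \<comment> \<open>As r (n - 1) = s and r n = t, the increment with index n - 1 is the future one
   and the smaller indices describe the past.\<close>
 define I1 where "I1 = {..<n - 1}"
 let ?PI = "PiM I1 (\<lambda>_. borel)"
 let ?Zs = "\<lambda>k x. \<Sum>i<k. restrict (\<lambda>i. Z i x) I1 i"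
 have I: "I1 \<inter> {n - 1} = {}" "I1 \<subseteq> {..<n}" "{n - 1} \<subseteq> {..<n}" using n by (auto simp: I1_def)
 have iv: "indep_var ?PI (\<lambda>x. restrict (\<lambda>i. Z i x) I1)
   (PiM {n - 1} (\<lambda>_. borel)) (\<lambda>x. restrict (\<lambda>i. Z i x) {n - 1})"
  by (rule indep_var_restrict[OF ind I])
 define C where "C = {f \<in> space (PiM I1 (\<lambda>_. borel :: (real ^ 'd) measure)). \<forall>k<n. L ! k \<in> J \<longrightarrow> (\<Sum>i<k. f i) \<in> A (L ! k)}"
 have C: "C \<in> sets ?PI"
 proof -
  have "C = {f \<in> space ?PI. \<forall>k\<in>{k. k < n \<and> L ! k \<in> J}. (\<Sum>i<k. f i) \<in> A (L ! k)}"
   by (auto simp: C_def)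
  also have "... \<in> sets ?PI"
  proof (rule sets.sets_Collect_finite_All)
   fix k assume k: "k \<in> {k. k < n \<and> L ! k \<in> J}"
   have "(\<lambda>f. \<Sum>i<k. f i) \<in> borel_measurable (PiM I1 (\<lambda>_. borel :: (real ^ 'd) measure))"
    using k by (intro borel_measurable_sum measurable_component_singleton) (auto simp: I1_def)
   from measurable_sets_Collect[OF this, of "\<lambda>y. y \<in> A (L ! k)"]
   show "{f \<in> space ?PI. (\<Sum>i<k. f i) \<in> A (L ! k)} \<in> sets ?PI"
    using assms(6) k by auto
  qed auto
  finally show ?thesis .
 qed
 define D where "D = {f \<in> space (PiM {n - 1} (\<lambda>_. borel :: (real ^ 'd) measure)). f (n - 1) \<in> B}"
 have D: "D \<in> sets (PiM {n - 1} (\<lambda>_. borel))"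
  unfolding D_def using assms(7) by (intro sets_Collect_single) auto
 let ?X = "\<lambda>x. restrict (\<lambda>i. Z i x) I1" and ?Y = "\<lambda>x. restrict (\<lambda>i. Z i x) {n - 1}"
 have sp: "restrict f I1 \<in> space (PiM I1 (\<lambda>_. borel))" for f :: "nat => real ^ 'd"
  and I1 by (auto simp: space_PiM)
 have Zn: "Z (n - 1) x = W t x - W s x" for x
 proof -
  have "Suc (n - 1) = n" using n by simp
  then show ?thesis unfolding Z_def rl by (simp only: rn)
 qed
 have Y: "?Y -` D \<inter> space M = {x\<in>space M. W t x - W s x \<in> B}"
  unfolding D_def using Zn by (auto simp: space_PiM)
 have tele: "?Zs k x = W (L ! k) x - W 0 x" if "k < n" for k x
 proof -
  have "?Zs k x = (\<Sum>i<k. W (r (Suc i)) x - W (r i) x)"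
   using that by (intro sum.cong) (auto simp: I1_def Z_def)
  also have "... = W (r k) x - W (r 0) x" by (rule sum_lessThan_telescope)
  finally show ?thesis using that r0 by (simp add: r_def)
 qed
 have J: "(\<forall>j\<in>J. P j) \<longleftrightarrow> (\<forall>k<n. L ! k \<in> J \<longrightarrow> P (L ! k))" for P
  using L(2) by (metis in_set_conv_nth insertCI n_def)
 have X: "AE x in M. x \<in> ?X -` C \<inter> space M \<longleftrightarrow> x \<in> {x\<in>space M. \<forall>j\<in>J. W j x \<in> A j}"
  using W_0
 proof eventually_elim
  case (elim x)
  have "?X x \<in> C \<longleftrightarrow> (\<forall>k<n. L ! k \<in> J \<longrightarrow> W (L ! k) x \<in> A (L ! k))"
  proof -
   have "?Zs k x = W (L ! k) x" if "k < n" for k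
    using tele[OF that, of x] elim by simp
   then show ?thesis using sp[of "\<lambda>i. Z i x" I1] by (simp add: C_def del: restrict_apply cong: conj_cong)
  qed
  then show ?case using J[of "\<lambda>j. W j x \<in> A j"] by auto
 qed
 have XM: "?X \<in> measurable M ?PI" "?Y \<in> measurable M (PiM {n - 1} (\<lambda>_. borel))"
  using iv by (auto dest: indep_var_rv1 indep_var_rv2)
 have mJ: "{x\<in>space M. \<forall>j\<in>J. W j x \<in> A j} \<in> events"
  using assms by (intro sets.sets_Collect_finite_All cylinder_event) auto
 have mB: "{x\<in>space M. W t x - W s x \<in> B} \<in> events"
  unfolding Y[symmetric] by (rule measurable_sets[OF XM(2) D])
 have mC: "?X -` C \<inter> space M \<in> events" by (rule measurable_sets[OF XM(1) C])
 have "prob ({x\<in>space M. \<forall>j\<in>J. W j x \<in> A j} \<inter> {x\<in>space M. W t x - W s x \<in> B}) =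
   prob ((\<lambda>x. (?X x, ?Y x)) -` (C \<times> D) \<inter> space M)"
 proof (rule finite_measure_eq_AE)
  have e: "(\<lambda>x. (?X x, ?Y x)) -` (C \<times> D) \<inter> space M = (?X -` C \<inter> space M) \<inter> {x\<in>space M. W t x - W s x \<in> B}"
   using Y by auto
  show "AE x in M. x \<in> {x\<in>space M. \<forall>j\<in>J. W j x \<in> A j} \<inter> {x\<in>space M. W t x - W s x \<in> B} \<longleftrightarrow>
    x \<in> (\<lambda>x. (?X x, ?Y x)) -` (C \<times> D) \<inter> space M"
   unfolding e using X by eventually_elim auto
  show "(\<lambda>x. (?X x, ?Y x)) -` (C \<times> D) \<inter> space M \<in> events" unfolding e using mC mB by auto
 qed (use mJ mB in auto)
 also have "... = prob (?X -` C \<inter> space M) * prob (?Y -` D \<inter> space M)"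
  by (rule indep_varD[OF iv C D])
 also have "prob (?X -` C \<inter> space M) = prob {x\<in>space M. \<forall>j\<in>J. W j x \<in> A j}"
  by (rule finite_measure_eq_AE[OF X mC mJ])
 finally show ?thesis unfolding Y .
qed

text \<open>A Dynkin argument. Finite cylinders together with the null sets are an
  intersection-stable generator, so the completion of the filtration is handled inside the
  generator.\<close>

lemma indep_filt_increment:
 assumes "0 \<le> s" "s < t" "t \<le> T" "E \<in> sets (filt s)" "B \<in> sets borel"
 shows "prob (E \<inter> {x\<in>space M. W t x - W s x \<in> B}) = prob E * prob {x\<in>space M. W t x - W s x \<in> B}"
proof -
 define G where "G = {{x\<in>space M. \<forall>j\<in>J. W j x \<in> A j} | J A. finite J \<and> J \<subseteq> {0..s} \<and> (\<forall>j\<in>J. A j \<in> sets borel)} \<union> null_sets M"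
 let ?B = "{x\<in>space M. W t x - W s x \<in> B}"
 have mW: "(\<lambda>x. W t x - W s x) \<in> borel_measurable M"
  using assms by (intro borel_measurable_diff W_measurable) auto
 have mB: "?B \<in> events" using measurable_sets[OF mW assms(5)] by (simp add: vimage_def Int_def conj_commute)
 have Gs: "G \<subseteq> sets M"
 proof
  fix X assume "X \<in> G"
  then consider "X \<in> null_sets M" | J A where "X = {x\<in>space M. \<forall>j\<in>J. W j x \<in> A j}" "finite J" "J \<subseteq> {0..s}" "\<forall>j\<in>J. A j \<in> sets borel"
   by (auto simp: G_def)
  then show "X \<in> sets M"
  proof cases
   case 2
   then show ?thesis using assms(2,3) by (auto intro!: sets.sets_Collect_finite_All cylinder_event)
  qed auto
 qed
 have stable: "Int_stable G"
 proof (rule Int_stableI)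
  fix a b assume ab: "a \<in> G" "b \<in> G"
  show "a \<inter> b \<in> G"
  proof (cases "a \<in> null_sets M \<or> b \<in> null_sets M")
   case True
   then have "a \<inter> b \<in> null_sets M" using ab Gs by (auto intro: null_set_Int1 null_set_Int2)
   then show ?thesis by (simp add: G_def)
  next
   case False
   then obtain J A J' A' where *: "a = {x\<in>space M. \<forall>j\<in>J. W j x \<in> A j}" "finite J" "J \<subseteq> {0..s}" "\<forall>j\<in>J. A j \<in> sets borel"
    "b = {x\<in>space M. \<forall>j\<in>J'. W j x \<in> A' j}" "finite J'" "J' \<subseteq> {0..s}" "\<forall>j\<in>J'. A' j \<in> sets borel"
    using ab by (auto simp: G_def)
   \<comment> \<open>Absent constraints are filled up with UNIV, so that the intersection is one
     cylinder over J \<union> J'.\<close>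
   let ?A = "\<lambda>j. (if j \<in> J then A j else UNIV) \<inter> (if j \<in> J' then A' j else UNIV)"
   have "a \<inter> b = {x\<in>space M. \<forall>j\<in>J \<union> J'. W j x \<in> ?A j}" using * by auto
   moreover have "\<forall>j\<in>J \<union> J'. ?A j \<in> sets borel" using * by auto
   ultimately show ?thesis unfolding G_def using * by (intro UnI1 CollectI exI[of _ "J \<union> J'"] exI[of _ ?A]) auto
  qed
 qed
 have closed: "G \<subseteq> Pow (space M)" using Gs sets.sets_into_space by blast
 have E: "E \<in> sigma_sets (space M) G"
 proof -
  have "{W s' -` A \<inter> space M | s' A. s' \<in> {0..s} \<and> A \<in> sets borel} \<union> null_sets M \<subseteq> G"
  proof
   fix X assume "X \<in> {W s' -` A \<inter> space M | s' A. s' \<in> {0..s} \<and> A \<in> sets borel} \<union> null_sets M"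
   then consider "X \<in> null_sets M" | s' A where "X = W s' -` A \<inter> space M" "s' \<in> {0..s}" "A \<in> sets borel" by blast
   then show "X \<in> G"
   proof cases
    case 2
    then have "X = {x\<in>space M. \<forall>j\<in>{s'}. W j x \<in> A}" by auto
    then show ?thesis unfolding G_def using 2 by (intro UnI1 CollectI exI[of _ "{s'}"] exI[of _ "\<lambda>_. A"]) auto
   qed (simp add: G_def)
  qed
  then show ?thesis using assms(4) unfolding sets_filt using sigma_sets_mono' by blast
 qed
 \<comment> \<open>Measurability is carried along for the complement and union cases.\<close>
 from stable closed E have "prob (E \<inter> ?B) = prob E * prob ?B \<and> E \<in> events"
 proof (induction rule: sigma_sets_induct_disjoint)
  case (basic A)
  then show ?case
  proof (cases "A \<in> null_sets M")
   case True
   then have "prob A = 0" "prob (A \<inter> ?B) = 0"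
    using mB by (intro measure_eq_0_null_sets null_set_Int2; simp)+
   then show ?thesis using True by auto
  next
   case False
   then obtain J A' where "A = {x\<in>space M. \<forall>j\<in>J. W j x \<in> A' j}" "finite J" "J \<subseteq> {0..s}" "\<forall>j\<in>J. A' j \<in> sets borel"
    using basic by (auto simp: G_def)
   moreover have "A \<in> events" using basic Gs by blast
   ultimately show ?thesis using indep_cylinder_increment[OF assms(1-3) _ _ _ assms(5), of J A'] by blast
  qed
 next
  case (compl A)
  then have "A \<in> events" by simp
  have "prob ((space M - A) \<inter> ?B) = prob (?B - A \<inter> ?B)" by (intro arg_cong[where f = prob]) auto
  also have "... = prob ?B - prob (A \<inter> ?B)"
   using mB \<open>A \<in> events\<close> by (intro finite_measure_Diff) auto
  finally have "prob ((space M - A) \<inter> ?B) = (1 - prob A) * prob ?B" using compl by (simp add: algebra_simps)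
  then show ?case using prob_compl[OF \<open>A \<in> events\<close>] \<open>A \<in> events\<close> by auto
 next
  case (union A)
  then have ev: "range A \<subseteq> events" by auto
  have "(\<lambda>i. prob (A i \<inter> ?B)) sums prob (\<Union>i. A i \<inter> ?B)"
   using ev mB union(1) by (intro finite_measure_UNION) (auto simp: disjoint_family_on_def)
  moreover have "(\<lambda>i. prob (A i) * prob ?B) sums (prob (\<Union>i. A i) * prob ?B)"
   using ev union(1) by (intro sums_mult2 finite_measure_UNION) auto
  moreover have "(\<Union>i. A i \<inter> ?B) = (\<Union>i. A i) \<inter> ?B" by auto
  ultimately show ?case using union ev by (auto intro: sums_unique2)
 qed auto
 then show ?thesis by simp
qed

text \<open>The function \<phi> of the increment is built in so that single components and products
  of two components are covered at once.\<close>

lemma indep_var_filt_increment: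
 assumes "0 \<le> s" "s < t" "t \<le> T" "Y \<in> measurable (filt s) N" "\<phi> \<in> measurable borel N'"
 shows "indep_var N Y N' (\<lambda>x. \<phi> (W t x - W s x))"
proof -
 let ?Z = "\<lambda>x. \<phi> (W t x - W s x)"
 have mZ: "?Z \<in> measurable M N'"
  using assms by (intro measurable_compose[OF _ assms(5)] borel_measurable_diff W_measurable) auto
 have mY: "Y \<in> measurable M N" using measurable_filt_M[OF assms(4)] assms by simp
 have sub: "sigma_sets (space M) {Y -` A \<inter> space M | A. A \<in> sets N} \<subseteq> sets (filt s)"
 proof -
  have "{Y -` A \<inter> space M | A. A \<in> sets N} \<subseteq> sets (filt s)"
   using measurable_sets[OF assms(4)] by auto
  from sets.sigma_sets_subset[OF this] show ?thesis by simp
 qed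
 have sub2: "sigma_sets (space M) {?Z -` A \<inter> space M | A. A \<in> sets N'} = {?Z -` A \<inter> space M | A. A \<in> sets N'}"
  unfolding sets_vimage_algebra[symmetric] using measurable_space[OF mZ] by (intro sets_vimage_algebra2) auto
 show ?thesis unfolding indep_var_eq
 proof (intro conjI mZ mY indep_setI)
  fix a b assume ab: "a \<in> sigma_sets (space M) {Y -` A \<inter> space M | A. A \<in> sets N}"
   "b \<in> sigma_sets (space M) {?Z -` A \<inter> space M | A. A \<in> sets N'}"
  obtain B where B: "b = ?Z -` B \<inter> space M" "B \<in> sets N'" using ab(2) unfolding sub2 by auto
  have "b = {x\<in>space M. W t x - W s x \<in> \<phi> -` B}" using B by auto
  moreover have "\<phi> -` B \<in> sets borel" using measurable_sets[OF assms(5) B(2)] by simp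
  ultimately show "prob (a \<inter> b) = prob a * prob b"
   using indep_filt_increment[OF assms(1-3), of a "\<phi> -` B"] ab(1) sub by auto
 next
  show "sigma_sets (space M) {Y -` A \<inter> space M | A. A \<in> sets N} \<subseteq> events"
   using sub sets_filt_subset[of s] assms by auto
  show "sigma_sets (space M) {?Z -` A \<inter> space M | A. A \<in> sets N'} \<subseteq> events"
   unfolding sub2 using measurable_sets[OF mZ] by auto
 qed
qed

end

lemma borel_measurable_vec_nth: "(\<lambda>x :: 'a::{real_normed_vector,second_countable_topology} ^ ('n::finite). x $ a) \<in> borel_measurable borel"
 by (intro borel_measurable_continuous_onI continuous_intros)

section \<open>Second moments and maximal inequality for discrete stochastic integrals\<close>

context brownian
begin

lemma increment_moments:
 assumes "0 \<le> s" "s < t" "t \<le> T"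
 shows "integrable M (\<lambda>x. (W t x - W s x) $ a)" "expectation (\<lambda>x. (W t x - W s x) $ a) = 0"
  "integrable M (\<lambda>x. (W t x - W s x) $ a * (W t x - W s x) $ b)"
  "expectation (\<lambda>x. (W t x - W s x) $ a * (W t x - W s x) $ b) = (if a = b then t - s else 0)"
proof -
 let ?Z = "\<lambda>a x. (W t x - W s x) $ a"
 have pos: "0 < sqrt (t - s)" using assms by simp
 note d = increment_components(2)[OF assms]
 have i1: "integrable M (?Z a)" for a
  using distributed_integrable[OF d, of "\<lambda>x. x"] integrable_normal_moment_nz_1[OF pos, of 0] by simp
 have e1: "expectation (?Z a) = 0" for a
  using distributed_integral[OF d, of "\<lambda>x. x"] integral_normal_moment_nz_1[OF pos, of 0] by simp
 have m2: "has_bochner_integral lborel (\<lambda>x. normal_density 0 (sqrt (t - s)) x * x^2) (t - s)"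
  using normal_moment_even[OF pos, of 0 1] assms by (simp add: fact_numeral diff_divide_distrib)
 have i2: "integrable M (\<lambda>x. (?Z a x)^2)" for a
  using distributed_integrable[OF d, of "\<lambda>x. x^2"] integrable.intros[OF m2] by simp
 have e2: "expectation (\<lambda>x. (?Z a x)^2) = t - s" for a
  using distributed_integral[OF d, of "\<lambda>x. x^2"] has_bochner_integral_integral_eq[OF m2] by simp
 have ind: "indep_var borel (?Z a) borel (?Z b)" if "a \<noteq> b"
  using indep_vars_sum[of "{b}" a ?Z] that indep_vars_subset[OF increment_components(1)[OF assms], of "{a, b}"]
  by simp
 show "integrable M (?Z a)" "expectation (?Z a) = 0" by (fact i1 e1)+
 show "integrable M (\<lambda>x. ?Z a x * ?Z b x)"
  using i2[of a] indep_var_integrable[OF ind i1 i1] by (cases "a = b") (auto simp: power2_eq_square)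
 show "expectation (\<lambda>x. ?Z a x * ?Z b x) = (if a = b then t - s else 0)"
  using e2[of a] indep_var_lebesgue_integral[OF ind i1 i1] e1 by (cases "a = b") (auto simp: power2_eq_square)
qed

lemma integrable_mult_sq:
 fixes f g :: "'m => real"
 assumes "f \<in> borel_measurable M" "g \<in> borel_measurable M" "integrable M (\<lambda>x. (f x)^2)" "integrable M (\<lambda>x. (g x)^2)"
 shows "integrable M (\<lambda>x. f x * g x)"
proof (rule Bochner_Integration.integrable_bound[OF Bochner_Integration.integrable_add[OF assms(3,4)]])
 show "AE x in M. norm (f x * g x) \<le> norm ((f x)^2 + (g x)^2)"
 proof (rule AE_I2)
  fix x
  have "0 \<le> (\<bar>f x\<bar> - \<bar>g x\<bar>)^2" by simp
  moreover have "0 \<le> \<bar>f x\<bar> * \<bar>g x\<bar>" by simp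
  ultimately have "\<bar>f x\<bar> * \<bar>g x\<bar> \<le> (f x)^2 + (g x)^2" unfolding power2_diff power2_abs by linarith
  then show "norm (f x * g x) \<le> norm ((f x)^2 + (g x)^2)" by (simp add: abs_mult)
 qed
qed (use assms in auto)

lemma integrable_mult_sq_comp:
 fixes c :: "'m => real ^ ('n::finite)"
 assumes "c \<in> borel_measurable M" "integrable M (\<lambda>x. (norm (c x))^2)"
 shows "integrable M (\<lambda>x. (c x $ a)^2)"
proof (rule Bochner_Integration.integrable_bound[OF assms(2)])
 have "(c x $ a)^2 \<le> (norm (c x))^2" for x
  using component_le_norm_cart[of "c x" a] by (metis abs_le_square_iff abs_norm_cancel)
 then show "AE x in M. norm ((c x $ a)^2) \<le> norm ((norm (c x))^2)" by simp
qed (use assms(1) in \<open>auto intro!: borel_measurable_power measurable_compose[OF _ borel_measurable_vec_nth]\<close>)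

text \<open>The one-step Ito isometry and orthogonality to the past. In components every summand is
  a past factor times an increment factor, which are independent; the mixed second moments of the
  increment vanish.\<close>

lemma filt_integrals:
 fixes c :: "'m => real ^ 'd"
 assumes "0 \<le> s" "s \<le> t" "t \<le> T" "c \<in> borel_measurable (filt s)" "integrable M (\<lambda>x. (norm (c x))^2)"
  "Y \<in> borel_measurable (filt s)" "integrable M (\<lambda>x. (Y x)^2)"
 shows "integrable M (\<lambda>x. (c x \<bullet> (W t x - W s x))^2)"
  "expectation (\<lambda>x. (c x \<bullet> (W t x - W s x))^2) = (t - s) * expectation (\<lambda>x. (norm (c x))^2)"
  "integrable M (\<lambda>x. Y x * (c x \<bullet> (W t x - W s x)))"
  "expectation (\<lambda>x. Y x * (c x \<bullet> (W t x - W s x))) = 0"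
proof -
let ?z = "\<lambda>x. c x \<bullet> (W t x - W s x)"
 have "integrable M (\<lambda>x. (?z x)^2) \<and>
  expectation (\<lambda>x. (?z x)^2) = (t - s) * expectation (\<lambda>x. (norm (c x))^2) \<and>
  integrable M (\<lambda>x. Y x * (?z x)) \<and>
  expectation (\<lambda>x. Y x * (?z x)) = 0"
 proof (cases "s = t")
  case False
  then have st: "s < t" using assms(2) by simp
  let ?Z = "\<lambda>a x. (W t x - W s x) $ a"
  note mom = increment_moments[OF assms(1) st assms(3)]
  have mf: "f \<in> borel_measurable M" if "f \<in> borel_measurable (filt s)" for f :: "'m => 'x::topological_space"
   using measurable_filt_M[OF that] assms by simp
  have mc: "(\<lambda>x. c x $ a) \<in> borel_measurable (filt s)" for a
   using measurable_compose[OF assms(4) borel_measurable_vec_nth] .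
  note c2 = integrable_mult_sq_comp[OF mf[OF assms(4)] assms(5)]
  have icc: "integrable M (\<lambda>x. c x $ a * c x $ b)" for a b
   by (intro integrable_mult_sq c2 mf mc)
  have iYc: "integrable M (\<lambda>x. Y x * c x $ a)" for a
   by (intro integrable_mult_sq c2 mf mc assms)
  have ind2: "indep_var borel (\<lambda>x. c x $ a * c x $ b) borel (\<lambda>x. ?Z a x * ?Z b x)" for a b
   using mc by (intro indep_var_filt_increment[OF assms(1) st assms(3), where \<phi> = "\<lambda>z. z $ a * z $ b"]) auto
  have ind1: "indep_var borel (\<lambda>x. Y x * c x $ a) borel (\<lambda>x. ?Z a x)" for a
   using mc assms(6) by (intro indep_var_filt_increment[OF assms(1) st assms(3), where \<phi> = "\<lambda>z. z $ a"]) auto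
  have e: "(?z x)^2 = (\<Sum>a\<in>UNIV. \<Sum>b\<in>UNIV. (c x $ a * c x $ b) * (?Z a x * ?Z b x))" for x
   by (simp add: inner_vec_def power2_eq_square sum_product algebra_simps)
  have e': "Y x * (?z x) = (\<Sum>a\<in>UNIV. (Y x * c x $ a) * ?Z a x)" for x
   by (simp add: inner_vec_def sum_distrib_left algebra_simps)
  have i: "integrable M (\<lambda>x. (c x $ a * c x $ b) * (?Z a x * ?Z b x))" for a b
   by (rule indep_var_integrable[OF ind2 icc mom(3)])
  have i': "integrable M (\<lambda>x. (Y x * c x $ a) * ?Z a x)" for a
   by (rule indep_var_integrable[OF ind1 iYc mom(1)])
  have "expectation (\<lambda>x. (?z x)^2) =
    (\<Sum>a\<in>UNIV. \<Sum>b\<in>UNIV. expectation (\<lambda>x. (c x $ a * c x $ b) * (?Z a x * ?Z b x)))"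
   unfolding e
   by (subst Bochner_Integration.integral_sum, intro Bochner_Integration.integrable_sum i,
     intro sum.cong refl Bochner_Integration.integral_sum i)
  also have "... = (\<Sum>a\<in>UNIV. \<Sum>b\<in>UNIV. expectation (\<lambda>x. c x $ a * c x $ b) * (if a = b then t - s else 0))"
   by (simp add: indep_var_lebesgue_integral[OF ind2 icc mom(3)] mom(4) del: vector_minus_component)
  also have "... = (t - s) * (\<Sum>a\<in>UNIV. expectation (\<lambda>x. (norm (c x $ a))^2))"
  proof -
   have "(\<Sum>b\<in>UNIV. E b * (if a = b then h else 0)) = h * E a" for E :: "'d => real" and a h
   proof -
    have "(\<Sum>b\<in>UNIV. E b * (if a = b then h else 0)) = (\<Sum>b\<in>UNIV. if b = a then h * E b else 0)"
     by (intro sum.cong) auto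
    then show ?thesis by (simp add: sum.delta)
   qed
   then show ?thesis by (simp add: sum_distrib_left power2_eq_square)
  qed
  also have "(\<Sum>a\<in>UNIV. expectation (\<lambda>x. (norm (c x $ a))^2)) = expectation (\<lambda>x. (norm (c x))^2)"
   unfolding norm_vec_sq using c2 by (subst Bochner_Integration.integral_sum) auto
  finally have 1: "expectation (\<lambda>x. (?z x)^2) = (t - s) * expectation (\<lambda>x. (norm (c x))^2)" .
  have 2: "integrable M (\<lambda>x. (?z x)^2)"
   unfolding e by (intro Bochner_Integration.integrable_sum i)
  have 3: "integrable M (\<lambda>x. Y x * (?z x))"
   unfolding e' by (intro Bochner_Integration.integrable_sum i')
  have "expectation (\<lambda>x. Y x * (?z x)) = (\<Sum>a\<in>UNIV. expectation (\<lambda>x. (Y x * c x $ a) * ?Z a x))"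
   unfolding e' by (rule Bochner_Integration.integral_sum) (rule i')
  also have "... = 0"
   by (simp add: indep_var_lebesgue_integral[OF ind1 iYc mom(1)] mom(2) del: vector_minus_component)
  finally show ?thesis using 1 2 3 by simp
 qed simp
 then show "integrable M (\<lambda>x. (?z x)^2)"
  "expectation (\<lambda>x. (?z x)^2) = (t - s) * expectation (\<lambda>x. (norm (c x))^2)"
  "integrable M (\<lambda>x. Y x * (?z x))"
  "expectation (\<lambda>x. Y x * (?z x)) = 0" by simp_all
qed

text \<open>Expectations are taken in \<open>doob_pathwise\<close>: the sum there consists of past
  variables times martingale increments and has mean 0, while the isometry, applied step by step,
  computes the second moment of the end value.\<close>

lemma doob_scalar:
 fixes c :: "nat => 'm => real ^ 'd" and r :: "nat => real"
 defines "m \<equiv> \<lambda>k x. \<Sum>i<k. c i x \<bullet> (W (r (Suc i)) x - W (r i) x)"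
 assumes r: "\<And>k. k \<le> n ==> r k \<in> {0..T}" "\<And>i. i < n ==> r i \<le> r (Suc i)"
  and c: "\<And>i. i < n ==> c i \<in> borel_measurable (filt (r i))" "\<And>i. i < n ==> integrable M (\<lambda>x. (norm (c i x))^2)"
 shows "integrable M (\<lambda>x. (runmax (\<lambda>k. \<bar>m k x\<bar>) n)^2)"
  "expectation (\<lambda>x. (runmax (\<lambda>k. \<bar>m k x\<bar>) n)^2)
   \<le> 4 * (\<Sum>i<n. (r (Suc i) - r i) * expectation (\<lambda>x. (norm (c i x))^2))"
proof -
 let ?e = "\<lambda>i x. c i x \<bullet> (W (r (Suc i)) x - W (r i) x)"
 let ?R = "\<lambda>n x. runmax (\<lambda>k. \<bar>m k x\<bar>) n"
 have rmono: "r i \<le> r j" if "i \<le> j" "j \<le> n" for i j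
  using that
 proof (induction j rule: dec_induct)
  case (step j)
  then show ?case using r(2)[of j] by simp
 qed simp
 have mm: "m k \<in> borel_measurable (filt (r j))" if "k \<le> j" "j \<le> n" for k j
  unfolding m_def
 proof (intro borel_measurable_sum borel_measurable_inner borel_measurable_diff)
  fix i assume "i \<in> {..<k}"
  then have i: "i < n" "Suc i \<le> j" "i \<le> j" using that by auto
  show "c i \<in> borel_measurable (filt (r j))" using measurable_filt_mono[OF c(1)[OF i(1)]] rmono[OF i(3) that(2)] .
  show "W (r (Suc i)) \<in> borel_measurable (filt (r j))" "W (r i) \<in> borel_measurable (filt (r j))"
   using r(1)[of i] r(1)[of "Suc i"] i that rmono[OF i(3) that(2)] rmono[OF i(2) that(2)] by (auto intro!: W_filt)
 qed
 have mM: "m k \<in> borel_measurable M" if "k \<le> n" for k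
  using measurable_filt_M[OF mm[OF order_refl that]] r(1)[OF that] by simp
 have step: "m (Suc k) x = m k x + ?e k x" for k x by (simp add: m_def)
 have main: "integrable M (\<lambda>x. (m k x)^2) \<and>
   expectation (\<lambda>x. (m k x)^2) = (\<Sum>i<k. (r (Suc i) - r i) * expectation (\<lambda>x. (norm (c i x))^2))" if "k \<le> n" for k
  using that
 proof (induction k)
  case 0
  then show ?case by (simp add: m_def)
 next
  case (Suc k)
  then have k: "k < n" "k \<le> n" "integrable M (\<lambda>x. (m k x)^2)" by auto
  note fi = filt_integrals[OF _ r(2)[OF k(1)] _ c[OF k(1)] mm[OF order_refl k(2)] k(3)]
  have eq: "(m (Suc k) x)^2 = (m k x)^2 + 2 * (m k x * ?e k x) + (?e k x)^2" for x
   unfolding step by (simp add: power2_eq_square algebra_simps)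
  show ?case unfolding eq using fi r(1)[of k] r(1)[of "Suc k"] Suc by simp
 qed
 have irm: "integrable M (\<lambda>x. (?R k x)^2)" if "k \<le> n" for k
 proof (rule Bochner_Integration.integrable_bound)
  show "integrable M (\<lambda>x. \<Sum>i\<le>k. (m i x)^2)" using that main by (intro Bochner_Integration.integrable_sum) auto
  show "AE x in M. norm ((?R k x)^2) \<le> norm (\<Sum>i\<le>k. (m i x)^2)"
  proof (rule AE_I2)
   fix x
   obtain i where i: "i \<le> k" "runmax (\<lambda>k. \<bar>m k x\<bar>) k = \<bar>m i x\<bar>" using runmax_attained by blast
   have "(m i x)^2 \<le> (\<Sum>i\<le>k. (m i x)^2)" using i(1) by (intro member_le_sum) auto
   then show "norm ((?R k x)^2) \<le> norm (\<Sum>i\<le>k. (m i x)^2)" using i(2) by (simp add: sum_nonneg)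
  qed
  show "(\<lambda>x. (?R k x)^2) \<in> borel_measurable M"
   using that mM by (intro borel_measurable_power runmax_measurable borel_measurable_abs) auto
 qed
 show "integrable M (\<lambda>x. (?R n x)^2)" using irm by simp
 define Y where "Y i x = runmax (\<lambda>k. \<bar>m k x\<bar>) i * sgn (m i x)" for i x
 have Ym: "Y i \<in> borel_measurable (filt (r i))" if "i \<le> n" for i
  unfolding Y_def using mm that by (intro borel_measurable_times runmax_measurable borel_measurable_abs borel_measurable_sgn) auto
 have Yi: "integrable M (\<lambda>x. (Y i x)^2)" if "i \<le> n" for i
 proof (rule Bochner_Integration.integrable_bound[OF irm[OF that]])
  show "AE x in M. norm ((Y i x)^2) \<le> norm ((runmax (\<lambda>k. \<bar>m k x\<bar>) i)^2)"
   by (rule AE_I2) (auto simp: Y_def power_mult_distrib sgn_if)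
  show "(\<lambda>x. (Y i x)^2) \<in> borel_measurable M"
   using measurable_filt_M[OF Ym[OF that]] r(1)[OF that] by (intro borel_measurable_power) auto
 qed
 have Z: "integrable M (\<lambda>x. Y i x * ?e i x) \<and> expectation (\<lambda>x. Y i x * ?e i x) = 0" if "i < n" for i
  using filt_integrals(3,4)[OF _ r(2)[OF that] _ c[OF that] Ym Yi] that r(1)[of i] r(1)[of "Suc i"] by simp
 have "expectation (\<lambda>x. (?R n x)^2) \<le> expectation (\<lambda>x. 4 * (m n x)^2 - 4 * (\<Sum>i<n. Y i x * ?e i x))"
 proof (rule integral_mono[OF irm])
  show "integrable M (\<lambda>x. 4 * (m n x)^2 - 4 * (\<Sum>i<n. Y i x * ?e i x))"
   using main Z by (intro Bochner_Integration.integrable_diff integrable_mult_right Bochner_Integration.integrable_sum) auto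
  show "(?R n x)^2 \<le> 4 * (m n x)^2 - 4 * (\<Sum>i<n. Y i x * ?e i x)" for x
   using doob_pathwise[of "\<lambda>k. m k x" n] by (simp add: step Y_def)
 qed simp
 also have "... = 4 * expectation (\<lambda>x. (m n x)^2) - 4 * expectation (\<lambda>x. \<Sum>i<n. Y i x * ?e i x)"
  using main Z by (subst Bochner_Integration.integral_diff) (auto intro!: Bochner_Integration.integrable_sum)
 also have "expectation (\<lambda>x. \<Sum>i<n. Y i x * ?e i x) = (\<Sum>i<n. expectation (\<lambda>x. Y i x * ?e i x))"
  using Z by (intro Bochner_Integration.integral_sum) auto
 also have "4 * expectation (\<lambda>x. (m n x)^2) - 4 * (\<Sum>i<n. expectation (\<lambda>x. Y i x * ?e i x)) = 4 * (\<Sum>i<n. (r (Suc i) - r i) * expectation (\<lambda>x. (norm (c i x))^2))"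
  using main Z by simp
 finally show "expectation (\<lambda>x. (?R n x)^2)
   \<le> 4 * (\<Sum>i<n. (r (Suc i) - r i) * expectation (\<lambda>x. (norm (c i x))^2))" .
qed

definition step_integral :: "(nat => real) => (nat => 'm => real ^ 'd ^ 'd) => nat => 'm => real ^ 'd" where
 "step_integral r D k x = (\<Sum>i<k. D i x *v (W (r (Suc i)) x - W (r i) x))"

definition grid :: "nat => (nat => real) => bool" where
 "grid n r \<longleftrightarrow> (\<forall>k\<le>n. r k \<in> {0..T}) \<and> (\<forall>i<n. r i \<le> r (Suc i))"

lemma grid_ran: "grid n r ==> k \<le> n ==> 0 \<le> r k \<and> r k \<le> T"
 by (auto simp: grid_def)

lemma grid_mono: "grid n r ==> i \<le> j ==> j \<le> n ==> r i \<le> r j"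
proof -
 assume g: "grid n r" and "i \<le> j" "j \<le> n"
 from this(2,3) show ?thesis
 proof (induction j rule: dec_induct)
  case (step j)
  then have "r j \<le> r (Suc j)" using g by (auto simp: grid_def)
  with step show ?case by simp
 qed simp
qed

lemma grid_less: "grid n r ==> m \<le> n ==> grid m r"
 by (auto simp: grid_def)

lemma borel_measurable_vec: "(\<And>a. (\<lambda>x. f x $ a) \<in> borel_measurable N) ==> f \<in> borel_measurable N" for f :: "'x => real ^ ('n::finite)"
 by (subst borel_measurable_euclidean_space) (auto simp: Basis_vec_def inner_axis)

lemma borel_measurable_mv:
 fixes D :: "'x => real ^ 'd ^ 'd"
 assumes "D \<in> borel_measurable N" "z \<in> borel_measurable N"
 shows "(\<lambda>x. D x *v z x) \<in> borel_measurable N"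
proof (rule borel_measurable_vec)
 fix a
 have "(\<lambda>x. D x $ a \<bullet> z x) \<in> borel_measurable N"
  using assms by (intro borel_measurable_inner measurable_compose[OF assms(1) borel_measurable_vec_nth]) auto
 then show "(\<lambda>x. (D x *v z x) $ a) \<in> borel_measurable N"
  by (simp add: matrix_vector_mult_def inner_vec_def)
qed

lemma step_integral_filt:
 assumes "grid n r" "\<And>i. i < n ==> D i \<in> borel_measurable (filt (r i))" "k \<le> j" "j \<le> n"
 shows "step_integral r D k \<in> borel_measurable (filt (r j))"
 unfolding step_integral_def
proof (intro borel_measurable_sum borel_measurable_mv borel_measurable_diff)
 fix i assume "i \<in> {..<k}"
 then have i: "i < n" "Suc i \<le> j" "i \<le> j" using assms by auto
 show "D i \<in> borel_measurable (filt (r j))"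
  using measurable_filt_mono[OF assms(2)[OF i(1)]] grid_mono[OF assms(1) i(3) assms(4)] .
 show "W (r (Suc i)) \<in> borel_measurable (filt (r j))" "W (r i) \<in> borel_measurable (filt (r j))"
  using grid_ran[OF assms(1)] i assms(4) grid_mono[OF assms(1) i(3) assms(4)] grid_mono[OF assms(1) i(2) assms(4)]
  by (auto intro!: W_filt)
qed

lemma step_integral_measurable:
 assumes "grid n r" "\<And>i. i < n ==> D i \<in> borel_measurable (filt (r i))" "k \<le> n"
 shows "step_integral r D k \<in> borel_measurable M"
 using measurable_filt_M[OF step_integral_filt[OF assms(1,2) order_refl assms(3)]] grid_ran[OF assms(1,3)] by auto

text \<open>Doob's inequality row by row. It is stated with \<open>nn_integral\<close>, so that an
  infinite second moment makes the bound trivial and later arguments carry no integrability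
  conditions.\<close>

lemma step_maximal:
 assumes g: "grid n r" and D: "\<And>i. i < n ==> D i \<in> borel_measurable (filt (r i))"
 shows "(\<integral>\<^sup>+x. ennreal ((runmax (\<lambda>k. norm (step_integral r D k x)) n)^2) \<partial>M)
   \<le> 4 * (\<Sum>i<n. ennreal (r (Suc i) - r i) * (\<integral>\<^sup>+x. ennreal ((norm (D i x))^2) \<partial>M))"
proof (cases "\<forall>i<n. r i < r (Suc i) \<longrightarrow> (\<integral>\<^sup>+x. ennreal ((norm (D i x))^2) \<partial>M) < \<infinity>")
 case False
 then obtain i where i: "i < n" "r i < r (Suc i)" "(\<integral>\<^sup>+x. ennreal ((norm (D i x))^2) \<partial>M) = \<infinity>"
  by (auto simp: not_less top.extremum_uniqueI)
 have "ennreal (r (Suc i) - r i) * (\<integral>\<^sup>+x. ennreal ((norm (D i x))^2) \<partial>M) \<le> (\<Sum>i<n. ennreal (r (Suc i) - r i) * (\<integral>\<^sup>+x. ennreal ((norm (D i x))^2) \<partial>M))"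
  using i(1) by (intro member_le_sum) auto
 moreover have "ennreal (r (Suc i) - r i) * (\<integral>\<^sup>+x. ennreal ((norm (D i x))^2) \<partial>M) = \<infinity>"
  using i by (simp add: ennreal_mult_eq_top_iff ennreal_eq_0_iff)
 ultimately have "(\<Sum>i<n. ennreal (r (Suc i) - r i) * (\<integral>\<^sup>+x. ennreal ((norm (D i x))^2) \<partial>M)) = \<infinity>"
  by (simp add: top.extremum_unique)
 then show ?thesis unfolding infinity_ennreal_def by (simp only:) (simp add: ennreal_mult_top)
next
 case fin: True
 let ?D2 = "\<lambda>i. \<integral>\<^sup>+x. ennreal ((norm (D i x))^2) \<partial>M"
 \<comment> \<open>A coefficient on an interval of length 0 may have infinite second moment, which
   the factor 0 hides in the bound. It does not contribute to the integral and is set to 0.\<close>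
 define E where "E i x = (if r i < r (Suc i) then D i x else 0)" for i x
 let ?E2 = "\<lambda>i. expectation (\<lambda>x. (norm (E i x))^2)"
 let ?Ea2 = "\<lambda>i a. expectation (\<lambda>x. (norm (E i x $ a))^2)"
 let ?dr = "\<lambda>i. r (Suc i) - r i"
 have EM: "E i \<in> borel_measurable (filt (r i))" if "i < n" for i
  using D[OF that] by (auto simp: E_def cong: measurable_cong)
 have DM: "D i \<in> borel_measurable M" if "i < n" for i
  using measurable_filt_M[OF D[OF that]] grid_ran[OF g, of i] that by simp
 have EM': "E i \<in> borel_measurable M" if "i < n" for i
  using measurable_filt_M[OF EM[OF that]] grid_ran[OF g, of i] that by simp
 have Eint: "integrable M (\<lambda>x. (norm (E i x))^2)" if "i < n" for i
  unfolding integrable_iff_bounded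
 proof
  show "(\<lambda>x. (norm (E i x))^2) \<in> borel_measurable M" using EM'[OF that] by auto
  show "(\<integral>\<^sup>+x. ennreal (norm ((norm (E i x))^2)) \<partial>M) < \<infinity>"
   using fin that by (cases "r i < r (Suc i)") (auto simp: E_def)
 qed
 have rowsq: "(norm (E i x $ a))^2 \<le> (norm (E i x))^2" for i x a
  unfolding norm_vec_sq[of "E i x"] by (rule member_le_sum) auto
 have rowint: "integrable M (\<lambda>x. (norm (E i x $ a))^2)" if "i < n" for i a
 proof (rule Bochner_Integration.integrable_bound[OF Eint[OF that]])
  show "AE x in M. norm ((norm (E i x $ a))^2) \<le> norm ((norm (E i x))^2)" using rowsq by simp
  show "(\<lambda>x. (norm (E i x $ a))^2) \<in> borel_measurable M"
   using measurable_compose[OF EM'[OF that] borel_measurable_vec_nth] by auto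
 qed
 define m where "m a k x = (\<Sum>i<k. E i x $ a \<bullet> (W (r (Suc i)) x - W (r i) x))" for a k x
 let ?R = "\<lambda>a x. (runmax (\<lambda>k. \<bar>m a k x\<bar>) n)^2"
 have comp: "step_integral r D k x $ a = m a k x" if "k \<le> n" for a k x
 proof -
  have "step_integral r D k x = (\<Sum>i<k. E i x *v (W (r (Suc i)) x - W (r i) x))"
   unfolding step_integral_def
  proof (intro sum.cong refl)
   fix i assume "i \<in> {..<k}"
   then have "r i \<le> r (Suc i)" using that g by (auto simp: grid_def)
   then show "D i x *v (W (r (Suc i)) x - W (r i) x) = E i x *v (W (r (Suc i)) x - W (r i) x)"
    by (cases "r i = r (Suc i)") (auto simp: E_def)
  qed
  then show ?thesis by (simp add: m_def sum_component matrix_vector_mult_def inner_vec_def)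
 qed
 have gr: "\<And>k. k \<le> n ==> r k \<in> {0..T}" "\<And>i. i < n ==> r i \<le> r (Suc i)" using g by (auto simp: grid_def)
 note ds = doob_scalar[where c = "\<lambda>i x. E i x $ a" and r = r and n = n for a, OF gr, folded m_def]
 have ds1: "integrable M (\<lambda>x. ?R a x)" for a
  by (rule ds(1)) (use EM rowint in \<open>auto intro: measurable_compose[OF _ borel_measurable_vec_nth]\<close>)
 have ds2: "expectation (\<lambda>x. ?R a x) \<le> 4 * (\<Sum>i<n. (?dr i) * ?Ea2 i a)" for a
  by (rule ds(2)) (use EM rowint in \<open>auto intro: measurable_compose[OF _ borel_measurable_vec_nth]\<close>)
 have "(\<integral>\<^sup>+x. ennreal ((runmax (\<lambda>k. norm (step_integral r D k x)) n)^2) \<partial>M)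
   \<le> (\<integral>\<^sup>+x. ennreal (\<Sum>a\<in>UNIV. ?R a x) \<partial>M)"
 proof (intro nn_integral_mono ennreal_leI)
  fix x
  have "runmax (\<lambda>k. \<bar>step_integral r D k x $ a\<bar>) n = runmax (\<lambda>k. \<bar>m a k x\<bar>) n" for a
   by (intro runmax_cong) (simp add: comp)
  then show "(runmax (\<lambda>k. norm (step_integral r D k x)) n)^2 \<le> (\<Sum>a\<in>UNIV. ?R a x)"
   using runmax_norm_sq_le[of "\<lambda>k. step_integral r D k x" n] by simp
 qed
 also have "... = ennreal (expectation (\<lambda>x. \<Sum>a\<in>UNIV. ?R a x))"
  using ds1 by (intro nn_integral_eq_integral) (auto intro!: sum_nonneg)
 also have "... \<le> ennreal (\<Sum>a\<in>UNIV. 4 * (\<Sum>i<n. (?dr i) * ?Ea2 i a))"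
  using ds1 ds2 by (intro ennreal_leI) (simp add: sum_mono)
 also have "(\<Sum>a\<in>UNIV. 4 * (\<Sum>i<n. (?dr i) * ?Ea2 i a)) =
   4 * (\<Sum>i<n. (?dr i) * (\<Sum>a\<in>UNIV. ?Ea2 i a))"
  by (simp add: sum_distrib_left sum.swap[of _ UNIV])
 also have "... = 4 * (\<Sum>i<n. (?dr i) * ?E2 i)"
  unfolding norm_vec_sq[of "E _ _"] using rowint by (simp add: Bochner_Integration.integral_sum)
 also have "ennreal ... = 4 * (\<Sum>i<n. ennreal (?dr i) * ennreal (?E2 i))"
 proof -
  have nn: "0 \<le> r (Suc i) - r i" "0 \<le> ?E2 i" if "i < n" for i
   using gr(2)[OF that] by auto
  have "ennreal (4 * (\<Sum>i<n. (?dr i) * ?E2 i))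
    = 4 * ennreal (\<Sum>i<n. (?dr i) * ?E2 i)"
   by (subst ennreal_mult') auto
  also have "ennreal (\<Sum>i<n. (?dr i) * ?E2 i)
    = (\<Sum>i<n. ennreal ((?dr i) * ?E2 i))"
   using nn by (intro sum_ennreal[symmetric]) auto
  also have "... = (\<Sum>i<n. ennreal (?dr i) * ennreal (?E2 i))"
   using nn by (intro sum.cong refl ennreal_mult) auto
  finally show ?thesis .
 qed
 also have "... = 4 * (\<Sum>i<n. ennreal (?dr i) * (?D2 i))"
 proof (intro arg_cong[where f = "\<lambda>y. 4 * y"] sum.cong refl)
  fix i assume i: "i \<in> {..<n}"
  show "ennreal (?dr i) * ennreal (?E2 i) = ennreal (?dr i) * (?D2 i)"
  proof (cases "r i < r (Suc i)")
   case True
   have "ennreal (?E2 i) = (\<integral>\<^sup>+x. ennreal ((norm (E i x))^2) \<partial>M)"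
    using Eint i by (intro nn_integral_eq_integral[symmetric]) auto
   then show ?thesis using True by (simp add: E_def)
  next
   case False
   then have "r i = r (Suc i)" using gr(2)[of i] i by simp
   then show ?thesis by simp
  qed
 qed
 finally show ?thesis .
qed

text \<open>Gronwall for the stochastic integral whose integrand is dominated by the running maximum of the
 integral itself.  No integrability is assumed: the integrand is truncated where the domination fails.\<close>

lemma step_gronwall:
 assumes g: "grid n r" and D: "\<And>i. i < n ==> D i \<in> borel_measurable (filt (r i))" and "0 \<le> L" "0 < \<eta>" "0 < dt"
 defines "Z \<equiv> \<lambda>D i x. runmax (\<lambda>k. norm (step_integral r D k x)) i"
 shows "prob {x\<in>space M. dt \<le> Z D n x} \<le>
   prob {x\<in>space M. \<exists>i<n. r i < r (Suc i) \<and> L * Z D i x + \<eta> < norm (D i x)} + \<eta>^2 * exp (8 * (L^2 + 1) * T) / dt^2"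
proof -
 \<comment> \<open>\<open>ok i x\<close> says that the domination has held up to index i. It is
   decided at time r i, so the truncated coefficients remain adapted.\<close>
 define ok where "ok i x \<longleftrightarrow> (\<forall>j\<in>{..i}. r j < r (Suc j) \<longrightarrow> norm (D j x) \<le> L * Z D j x + \<eta>)" for i x
 define E where "E i x = (if ok i x \<and> r i < r (Suc i) then D i x else 0)" for i x
 let ?E2 = "\<lambda>i. \<integral>\<^sup>+x. ennreal ((norm (E i x))^2) \<partial>M"
 have DM: "D i \<in> borel_measurable M" if "i < n" for i
  using measurable_filt_M[OF D[OF that]] grid_ran[OF g, of i] that by simp
 have ZF: "Z D j \<in> borel_measurable (filt (r i))" if "j \<le> i" "i \<le> n" for i j
  unfolding Z_def
 proof (rule runmax_measurable)
  fix k assume "k \<le> j"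
  then have "step_integral r D k \<in> borel_measurable (filt (r i))"
   by (intro step_integral_filt[OF g D]) (use \<open>j \<le> i\<close> \<open>i \<le> n\<close> in auto)
  then show "(\<lambda>x. norm (step_integral r D k x)) \<in> borel_measurable (filt (r i))" by (rule measurable_compose[OF _ borel_measurable_norm])
 qed
 have ZM: "Z D i \<in> borel_measurable M" if "i \<le> n" for i
  using measurable_filt_M[OF ZF[OF order_refl that]] grid_ran[OF g that] by simp
 have okm: "{x\<in>space (filt (r i)). ok i x} \<in> sets (filt (r i))" if "i < n" for i
  unfolding ok_def
 proof (rule sets.sets_Collect_finite_All)
  fix j assume "j \<in> {..i}"
  then have j: "j \<le> i" "j < n" using that by auto
  have [measurable]: "D j \<in> borel_measurable (filt (r i))"
   by (rule measurable_filt_mono[OF D[OF j(2)]]) (use grid_mono[OF g j(1)] that in simp)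
  have [measurable]: "Z D j \<in> borel_measurable (filt (r i))" using ZF[OF j(1)] that by simp
  show "{x \<in> space (filt (r i)). r j < r (Suc j) \<longrightarrow> norm (D j x) \<le> L * Z D j x + \<eta>} \<in> sets (filt (r i))"
   by measurable
 qed simp
 have EF: "E i \<in> borel_measurable (filt (r i))" if "i < n" for i
 proof (cases "r i < r (Suc i)")
  case True
  then have "E i = (\<lambda>x. if ok i x then D i x else 0)" by (auto simp: E_def)
  then show ?thesis using measurable_If[OF D[OF that] _ okm[OF that], of "\<lambda>_. 0"] by simp
 next
  case False
  then have "E i = (\<lambda>_. 0)" by (auto simp: E_def)
  then show ?thesis by simp
 qed
 have Eeq: "step_integral r E k x = step_integral r D k x" if "k \<le> n" "\<And>i. i < k ==> ok i x" for k x
  unfolding step_integral_def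
 proof (intro sum.cong refl)
  fix i assume "i \<in> {..<k}"
  then have i: "i < k" "r i \<le> r (Suc i)" using g that(1) by (auto simp: grid_def)
  show "E i x *v (W (r (Suc i)) x - W (r i) x) = D i x *v (W (r (Suc i)) x - W (r i) x)"
   using that(2)[OF i(1)] i(2) by (cases "r i = r (Suc i)") (auto simp: E_def)
 qed
 have Znn: "0 \<le> Z D' i x" for D' i x unfolding Z_def by (intro runmax_nonneg) simp
 \<comment> \<open>After truncation the domination holds everywhere and in terms of the truncated
   integral itself, since the two integrals agree as long as nothing has been cut off.\<close>
 have Eb: "norm (E i x) \<le> L * Z E i x + \<eta>" if "i < n" for i x
 proof (cases "ok i x \<and> r i < r (Suc i)")
  case True
  then have "ok j x" if "j \<le> i" for j using that by (auto simp: ok_def)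
  then have "Z E i x = Z D i x" unfolding Z_def using that by (intro runmax_cong arg_cong[where f = norm] Eeq) auto
  then show ?thesis using True by (auto simp: E_def ok_def)
 next
  case False
  then show ?thesis using assms Znn[of E i x] by (auto simp: E_def)
 qed
 define f where "f i = (\<integral>\<^sup>+x. ennreal ((Z E i x)^2) \<partial>M)" for i
 have ZEM: "Z E i \<in> borel_measurable M" if "i \<le> n" for i
  unfolding Z_def using that
  by (intro runmax_measurable measurable_compose[OF step_integral_measurable[OF g EF] borel_measurable_norm]) auto
 have Ef: "(?E2 i) \<le> 2 * (ennreal (L^2) * f i + ennreal (\<eta>^2))" if "i < n" for i
 proof -
  have "(?E2 i) \<le> (\<integral>\<^sup>+x. 2 * (ennreal (L^2) * ennreal ((Z E i x)^2) + ennreal (\<eta>^2)) \<partial>M)"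
  proof (rule nn_integral_mono)
   fix x
   have "(norm (E i x))^2 \<le> (L * Z E i x + \<eta>)^2" using Eb[OF that, of x] by (intro power_mono) auto
   also have "... \<le> 2 * (L^2 * (Z E i x)^2 + \<eta>^2)"
    using zero_le_power2[of "L * Z E i x - \<eta>"] by (simp add: power2_eq_square algebra_simps)
   finally have "ennreal ((norm (E i x))^2) \<le> ennreal (2 * (L^2 * (Z E i x)^2 + \<eta>^2))" by (rule ennreal_leI)
   also have "... = 2 * (ennreal (L^2) * ennreal ((Z E i x)^2) + ennreal (\<eta>^2))"
    by (simp add: ennreal_mult ennreal_plus)
   finally show "ennreal ((norm (E i x))^2) \<le> 2 * (ennreal (L^2) * ennreal ((Z E i x)^2) + ennreal (\<eta>^2))" .
  qed
  also have "... = 2 * (ennreal (L^2) * f i + ennreal (\<eta>^2))"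
   using ZEM[of i] that unfolding f_def
   by (simp add: nn_integral_cmult nn_integral_add emeasure_space_1)
  finally show ?thesis .
 qed
 \<comment> \<open>8 = 4 * 2: the factor of the maximal inequality and the one from (a + b)^2 \<le>
   2 (a^2 + b^2). The summand 1 absorbs \<eta>^2 in the recursion.\<close>
 define c where "c = 8 * (L^2 + 1)"
 define gk where "gk k = (\<Sum>i<k. 8 * (ennreal (r (Suc i) - r i) * (ennreal (L^2) * f i + ennreal (\<eta>^2))))" for k
 have fg: "f k \<le> gk k" if "k \<le> n" for k
 proof -
  have "f k \<le> 4 * (\<Sum>i<k. ennreal (r (Suc i) - r i) * (?E2 i))"
   unfolding f_def Z_def using that by (intro step_maximal grid_less[OF g] EF) auto
  also have "... \<le> 4 * (\<Sum>i<k. ennreal (r (Suc i) - r i) * (2 * (ennreal (L^2) * f i + ennreal (\<eta>^2))))"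
   using that by (intro mult_left_mono sum_mono Ef) auto
  also have "... = gk k" unfolding gk_def sum_distrib_left
  proof (intro sum.cong refl)
   fix i
   have "(8::ennreal) = 4 * 2" by simp
   then show "4 * (ennreal (r (Suc i) - r i) * (2 * (ennreal (L^2) * f i + ennreal (\<eta>^2)))) =
    8 * (ennreal (r (Suc i) - r i) * (ennreal (L^2) * f i + ennreal (\<eta>^2)))"
    by (simp only: mult.assoc mult.left_commute[of _ 2])
  qed
  finally show ?thesis .
 qed
 \<comment> \<open>The discrete Gronwall step: gk + \<eta>^2 grows at most by the factor 1 + c
   \<Delta> \<le> exp (c \<Delta>). In particular all these moments are finite.\<close>
 have gr: "gk k + ennreal (\<eta>^2) \<le> ennreal (\<eta>^2 * exp (c * (r k - r 0)))" if "k \<le> n" for k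
  using that
 proof (induction k)
  case 0
  then show ?case by (simp add: gk_def)
 next
  case (Suc k)
  define \<Delta> where "\<Delta> = r (Suc k) - r k"
  have \<Delta>: "0 \<le> \<Delta>" using g Suc.prems by (auto simp: \<Delta>_def grid_def)
  let ?h = "gk k + ennreal (\<eta>^2)"
  have "ennreal (L^2) * f k + ennreal (\<eta>^2) \<le> ennreal (L^2 + 1) * ?h"
  proof -
   have "ennreal (L^2) * f k + ennreal (\<eta>^2) \<le> ennreal (L^2) * ?h + 1 * ?h"
    using fg[of k] Suc.prems by (intro add_mono mult_left_mono order_trans[OF fg[of k]]) auto
   also have "... = ennreal (L^2 + 1) * ?h" by (simp add: ennreal_plus distrib_right)
   finally show ?thesis .
  qed
  then have "gk (Suc k) + ennreal (\<eta>^2) \<le> ?h + 8 * (ennreal \<Delta> * (ennreal (L^2 + 1) * ?h))"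
   unfolding gk_def \<Delta>_def by (simp add: add.commute add.left_commute mult_left_mono)
  also have "... = ennreal (1 + c * \<Delta>) * ?h"
  proof -
   have "ennreal (1 + c * \<Delta>) = 1 + 8 * (ennreal \<Delta> * ennreal (L^2 + 1))"
    using \<Delta> by (simp add: c_def ennreal_plus ennreal_mult' ennreal_mult mult.commute mult.left_commute)
   then show ?thesis by (simp add: distrib_right mult.assoc)
  qed
  also have "... \<le> ennreal (exp (c * \<Delta>)) * ennreal (\<eta>^2 * exp (c * (r k - r 0)))"
   using Suc by (intro mult_mono ennreal_leI exp_ge_add_one_self) auto
  also have "... = ennreal (\<eta>^2 * exp (c * (r (Suc k) - r 0)))"
   by (simp add: \<Delta>_def ennreal_mult[symmetric] exp_add[symmetric] algebra_simps)
  finally show ?case .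
 qed
 have "f n \<le> ennreal (\<eta>^2 * exp (c * T))"
 proof -
  have "f n \<le> gk n + ennreal (\<eta>^2)" using fg[of n] by (simp add: add_increasing2)
  also have "... \<le> ennreal (\<eta>^2 * exp (c * (r n - r 0)))" by (rule gr) simp
  also have "... \<le> ennreal (\<eta>^2 * exp (c * T))"
   using grid_ran[OF g, of n] grid_ran[OF g, of 0] by (intro ennreal_leI mult_left_mono) (auto simp: c_def intro!: mult_left_mono)
  finally show ?thesis .
 qed
 have mE: "emeasure M {x\<in>space M. dt \<le> Z E n x} \<le> ennreal (\<eta>^2 * exp (c * T) / dt^2)"
 proof -
  have "emeasure M {x\<in>space M. dt \<le> Z E n x} = emeasure M {x\<in>space M. 1 \<le> ennreal (1 / dt^2) * ennreal ((Z E n x)^2)}"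
  proof (intro arg_cong[where f = "emeasure M"] Collect_cong conj_cong refl)
   fix x
   have "dt \<le> Z E n x \<longleftrightarrow> dt^2 \<le> (Z E n x)^2"
    using assms Znn[of E n x] by (intro power_mono_iff[symmetric]) auto
   also have "... \<longleftrightarrow> 1 \<le> 1 / dt^2 * (Z E n x)^2" using assms by (simp add: field_simps)
   also have "... \<longleftrightarrow> 1 \<le> ennreal (1 / dt^2 * (Z E n x)^2)" by simp
   finally show "dt \<le> Z E n x \<longleftrightarrow> 1 \<le> ennreal (1 / dt^2) * ennreal ((Z E n x)^2)" by (subst ennreal_mult[symmetric]) auto
  qed
  also have "... \<le> ennreal (1 / dt^2) * (\<integral>\<^sup>+x\<in>space M. ennreal ((Z E n x)^2) \<partial>M)"
   using nn_integral_Markov_inequality[of "\<lambda>x. ennreal ((Z E n x)^2)" "space M" M "ennreal (1 / dt^2)"] ZEM[of n]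
   by simp
  also have "(\<integral>\<^sup>+x\<in>space M. ennreal ((Z E n x)^2) \<partial>M) = f n"
   unfolding f_def by (intro nn_integral_cong) auto
  also have "ennreal (1 / dt^2) * f n \<le> ennreal (1 / dt^2) * ennreal (\<eta>^2 * exp (c * T))"
   by (intro mult_left_mono) (fact, simp)
  also have "... = ennreal (\<eta>^2 * exp (c * T) / dt^2)" by (subst ennreal_mult[symmetric]) auto
  finally show ?thesis .
 qed
 let ?bad = "{x\<in>space M. \<exists>i<n. r i < r (Suc i) \<and> L * Z D i x + \<eta> < norm (D i x)}"
 have badm: "?bad \<in> events"
 proof -
  have "{x\<in>space M. \<exists>i\<in>{..<n}. r i < r (Suc i) \<and> L * Z D i x + \<eta> < norm (D i x)} \<in> events"
  proof (rule sets.sets_Collect_finite_Ex)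
   fix i assume "i \<in> {..<n}"
   then have [measurable]: "D i \<in> borel_measurable M" "Z D i \<in> borel_measurable M" using DM ZM by auto
   show "{x \<in> space M. r i < r (Suc i) \<and> L * Z D i x + \<eta> < norm (D i x)} \<in> events" by measurable
  qed simp
  also have "{x\<in>space M. \<exists>i\<in>{..<n}. r i < r (Suc i) \<and> L * Z D i x + \<eta> < norm (D i x)} = ?bad" by blast
  finally show ?thesis .
 qed
 have mm: "{x\<in>space M. dt \<le> Z E n x} \<in> events" using ZEM[OF order_refl] by measurable
 \<comment> \<open>Off the bad event nothing is truncated, so both integrals have the same
   maximum.\<close>
 have "{x\<in>space M. dt \<le> Z D n x} \<subseteq> ?bad \<union> {x\<in>space M. dt \<le> Z E n x}"
 proof
  fix x assume x: "x \<in> {x\<in>space M. dt \<le> Z D n x}"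
  show "x \<in> ?bad \<union> {x\<in>space M. dt \<le> Z E n x}"
  proof (cases "x \<in> ?bad")
   case False
   have "ok i x" if "i < n" for i unfolding ok_def
   proof (intro ballI impI)
    fix j assume j: "j \<in> {..i}" "r j < r (Suc j)"
    then have "j < n" using that by simp
    then have "\<not> L * Z D j x + \<eta> < norm (D j x)" using False x j(2) by blast
    then show "norm (D j x) \<le> L * Z D j x + \<eta>" by simp
   qed
   then have "Z E n x = Z D n x" unfolding Z_def by (intro runmax_cong arg_cong[where f = norm] Eeq) auto
   then show ?thesis using x by simp
  qed simp
 qed
 then have "prob {x\<in>space M. dt \<le> Z D n x} \<le> prob (?bad \<union> {x\<in>space M. dt \<le> Z E n x})"
  by (rule finite_measure_mono[OF _ sets.Un[OF badm mm]])
 also have "... \<le> prob ?bad + prob {x\<in>space M. dt \<le> Z E n x}"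
  by (rule measure_Un_le[OF badm mm])
 also have "prob {x\<in>space M. dt \<le> Z E n x} \<le> \<eta>^2 * exp (c * T) / dt^2"
  using mE by (simp add: emeasure_eq_measure)
 finally show ?thesis by (simp add: c_def)
qed

end

section \<open>Refinement of elementary processes\<close>

lemma strict_grid_less_iff:
 fixes \<rho> :: "nat => real"
 assumes "\<And>i. i < N ==> \<rho> i < \<rho> (Suc i)" "a \<le> N" "b \<le> N"
 shows "\<rho> a < \<rho> b \<longleftrightarrow> a < b" "\<rho> a \<le> \<rho> b \<longleftrightarrow> a \<le> b"
proof -
 have lt: "\<rho> i < \<rho> j" if "i < j" "j \<le> N" for i j
  using that(1)[THEN Suc_leI] that(2)
 proof (induction j rule: dec_induct)
  case base then show ?case using assms(1) by simp
 next
  case (step j) then show ?case using assms(1)[of j] by simp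
 qed
 show "\<rho> a < \<rho> b \<longleftrightarrow> a < b" "\<rho> a \<le> \<rho> b \<longleftrightarrow> a \<le> b"
  using lt[of a b] lt[of b a] assms(2,3) by (cases a b rule: linorder_cases; auto)+
qed

lemma finite_set_grid:
 assumes "finite G" "G \<noteq> {}"
 obtains N and \<rho> :: "nat => real" where "\<rho> ` {..N} = G" "\<And>i. i < N ==> \<rho> i < \<rho> (Suc i)"
proof -
 define L where "L = sorted_list_of_set G"
 have L: "set L = G" "sorted_wrt (<) L" "L \<noteq> []" using assms by (auto simp: L_def)
 have "(\<lambda>i. L ! i) ` {..length L - 1} = G"
  unfolding L(1)[symmetric] set_conv_nth using L(3) by (auto simp: image_def) (metis One_nat_def Suc_pred atMost_iff length_greater_0_conv less_Suc_eq_le)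
 moreover have "L ! i < L ! Suc i" if "i < length L - 1" for i
  using sorted_wrt_nth_less[OF L(2), of i "Suc i"] that by auto
 ultimately show ?thesis using that by blast
qed

text \<open>Nodes of r beyond the end of the fine grid \<rho> are allowed, because an Euler grid may
  stop before the last node of an elementary process.\<close>

locale refinement =
 fixes N :: nat and \<rho> :: "nat => real" and n :: nat and r :: "nat => real"
 assumes strict: "\<And>i. i < N ==> \<rho> i < \<rho> (Suc i)"
  and r_mono: "\<And>k. k < n ==> r k \<le> r (Suc k)"
  and refine: "\<And>k. k \<le> n ==> r k \<le> \<rho> N ==> r k \<in> \<rho> ` {..N}"
begin

lemma less_iff: "a \<le> N ==> b \<le> N ==> \<rho> a < \<rho> b \<longleftrightarrow> a < b" "a \<le> N ==> b \<le> N ==> \<rho> a \<le> \<rho> b \<longleftrightarrow> a \<le> b"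
 using strict_grid_less_iff[of N \<rho> a b] strict by auto

text \<open>A node of r beyond the end of \<rho> gets the index N: comparisons restricted to times
  up to \<rho> N cannot tell it from a node at that end.\<close>

lemma index_of:
 assumes "k \<le> n"
 obtains a where "a \<le> N" "\<And>j. j \<le> N ==> min (r k) (\<rho> j) = \<rho> (min a j)" "\<And>i. i < N ==> r k < \<rho> (Suc i) \<longleftrightarrow> a \<le> i"
  "\<And>i s. i < N ==> \<rho> i < s ==> s \<le> \<rho> (Suc i) ==> r k < s \<longleftrightarrow> a \<le> i"
proof -
 note le = less_iff
 obtain a where a: "a \<le> N" "r k = \<rho> a \<or> (a = N \<and> \<rho> N < r k)"
  using refine[OF assms] by (cases "r k \<le> \<rho> N") auto
 have 1: "min (r k) (\<rho> j) = \<rho> (min a j)" if "j \<le> N" for j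
  using a le(2)[OF a(1) that] le(2)[OF that order_refl] that by (auto simp: min_def)
 have 3: "r k < s \<longleftrightarrow> a \<le> i" if "i < N" "\<rho> i < s" "s \<le> \<rho> (Suc i)" for i s
 proof (cases "a \<le> i")
  case True
  then have "r k = \<rho> a" "\<rho> a \<le> \<rho> i" using a that le(2)[of a i] by auto
  then show ?thesis using True that by simp
 next
  case False
  then have "\<rho> (Suc i) \<le> \<rho> a" using a that le(2)[of "Suc i" a] by auto
  then show ?thesis using False that a by auto
 qed
 have 2: "r k < \<rho> (Suc i) \<longleftrightarrow> a \<le> i" if "i < N" for i
  using 3[OF that strict[OF that] order_refl] .
 show ?thesis using that[OF a(1) 1 2 3] .
qed

lemma elementary_process_const:
 assumes "i < N" "\<rho> i < s" "s \<le> \<rho> (Suc i)"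
 shows "elementary_process n r \<xi> s x = elementary_process n r \<xi> (\<rho> (Suc i)) x"
 unfolding elementary_process_def
proof (intro sum.cong refl)
 fix k assume "k \<in> {..<n}"
 then have k: "k \<le> n" "Suc k \<le> n" by auto
 from index_of[OF k(1)] have 1: "r k < s \<longleftrightarrow> r k < \<rho> (Suc i)" using assms by metis
 from index_of[OF k(2)] have 2: "r (Suc k) < s \<longleftrightarrow> r (Suc k) < \<rho> (Suc i)" using assms by metis
 show "(if r k < s \<and> s \<le> r (Suc k) then \<xi> k x else 0) = (if r k < \<rho> (Suc i) \<and> \<rho> (Suc i) \<le> r (Suc k) then \<xi> k x else 0)"
  using 1 2 by (simp add: not_less[symmetric])
qed

end

context brownian
begin

text \<open>Elementary processes live on left-open intervals, so the value on a fine interval is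
  read off at its right end; it is nevertheless known at the left end.\<close>

lemma elementary_refine:
 fixes \<xi> :: "nat => 'm => real ^ 'd ^ 'd"
 assumes "refinement N \<rho> n r" "elementary filt S n r \<xi>" "i < N"
 shows "elementary_process n r \<xi> (\<rho> (Suc i)) \<in> borel_measurable (filt (\<rho> i))"
proof -
 interpret refinement N \<rho> n r by fact
 have "(\<lambda>x. if r k < \<rho> (Suc i) \<and> \<rho> (Suc i) \<le> r (Suc k) then \<xi> k x else 0) \<in> borel_measurable (filt (\<rho> i))" if "k < n" for k
 proof (cases "r k < \<rho> (Suc i) \<and> \<rho> (Suc i) \<le> r (Suc k)")
  case True
  have "k \<le> n" using that by simp
  then obtain a where a: "a \<le> N" "\<And>j. j \<le> N ==> min (r k) (\<rho> j) = \<rho> (min a j)" "r k < \<rho> (Suc i) \<longleftrightarrow> a \<le> i"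
   using index_of assms(3) by metis
  have "r k = \<rho> a" using a(2)[of "Suc i"] a(3) True assms(3) by simp
  moreover have "a \<le> i" using a(3) True by simp
  ultimately have "r k \<le> \<rho> i" using less_iff(2)[OF a(1), of i] assms(3) by simp
  then show ?thesis using True measurable_filt_mono[of "\<xi> k" "r k" borel "\<rho> i"] assms(2) that by (auto simp: elementary_def)
 qed auto
 then show ?thesis unfolding elementary_process_def[abs_def] by (intro borel_measurable_sum) auto
qed

text \<open>Each increment of W over an interval of r telescopes into increments over \<rho>.
  Exchanging the sums collects, for each interval of \<rho>, the value of the elementary process
  there.\<close>

lemma elementary_integral_refine:
 fixes \<xi> :: "nat => 'm => real ^ 'd ^ 'd"
 assumes "refinement N \<rho> n r" "j \<le> N"
 shows "elementary_integral (*v) n r \<xi> W (\<rho> j) x = step_integral \<rho> (\<lambda>i. elementary_process n r \<xi> (\<rho> (Suc i))) j x"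
proof -
 interpret refinement N \<rho> n r by fact
 let ?w = "\<lambda>i. W (\<rho> (Suc i)) x - W (\<rho> i) x"
 have inc: "W (min (r (Suc k)) (\<rho> j)) x - W (min (r k) (\<rho> j)) x =
   (\<Sum>i<j. if r k < \<rho> (Suc i) \<and> \<rho> (Suc i) \<le> r (Suc k) then ?w i else 0)" if "k < n" for k
 proof -
  have kn: "k \<le> n" "Suc k \<le> n" using that by auto
  obtain a where a: "a \<le> N" "min (r k) (\<rho> j) = \<rho> (min a j)" "\<And>i. i < N ==> r k < \<rho> (Suc i) \<longleftrightarrow> a \<le> i"
   using index_of[OF kn(1)] assms(2) by metis
  obtain b where b: "b \<le> N" "min (r (Suc k)) (\<rho> j) = \<rho> (min b j)" "\<And>i. i < N ==> r (Suc k) < \<rho> (Suc i) \<longleftrightarrow> b \<le> i"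
   using index_of[OF kn(2)] assms(2) by metis
  have "\<rho> (min a j) \<le> \<rho> (min b j)" unfolding a(2)[symmetric] b(2)[symmetric] using r_mono[OF that] by simp
  then have ab: "min a j \<le> min b j" using less_iff(2)[of "min a j" "min b j"] assms(2) by simp
  have "(\<Sum>i<j. if r k < \<rho> (Suc i) \<and> \<rho> (Suc i) \<le> r (Suc k) then ?w i else 0) = (\<Sum>i<j. if a \<le> i \<and> i < b then ?w i else 0)"
   using a(3) b(3) assms(2) by (intro sum.cong refl) (auto simp: not_less[symmetric])
  also have "... = (\<Sum>i\<in>{min a j..<min b j}. ?w i)"
   by (subst sum.inter_filter[symmetric]) (auto intro!: sum.cong)
  also have "... = W (\<rho> (min b j)) x - W (\<rho> (min a j)) x"
   using sum_Suc_diff'[OF ab, of "\<lambda>i. W (\<rho> i) x"] by simp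
  finally show ?thesis by (simp add: a b)
 qed
 have "elementary_integral (*v) n r \<xi> W (\<rho> j) x =
   (\<Sum>k<n. \<Sum>i<j. (if r k < \<rho> (Suc i) \<and> \<rho> (Suc i) \<le> r (Suc k) then \<xi> k x else 0) *v ?w i)"
  unfolding elementary_integral_def
 proof (intro sum.cong refl)
  fix k assume "k \<in> {..<n}"
  then show "\<xi> k x *v (W (min (r (Suc k)) (\<rho> j)) x - W (min (r k) (\<rho> j)) x) =
   (\<Sum>i<j. (if r k < \<rho> (Suc i) \<and> \<rho> (Suc i) \<le> r (Suc k) then \<xi> k x else 0) *v ?w i)"
   by (simp add: inc linear_sum[OF matrix_vector_mul_linear] if_distrib[of "\<lambda>A. A *v _"] if_distrib[of "\<lambda>w. _ *v w"] cong: if_cong)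
 qed
 also have "... = (\<Sum>i<j. \<Sum>k<n. (if r k < \<rho> (Suc i) \<and> \<rho> (Suc i) \<le> r (Suc k) then \<xi> k x else 0) *v ?w i)"
  by (rule sum.swap)
 also have "... = step_integral \<rho> (\<lambda>i. elementary_process n r \<xi> (\<rho> (Suc i))) j x"
  unfolding step_integral_def elementary_process_def
 proof (intro sum.cong refl)
  fix i
  have "(\<Sum>k<m. A k *v w) = (\<Sum>k<m. A k) *v w" for A :: "nat => real ^ 'd ^ 'd" and w :: "real ^ 'd" and m :: nat
   by (induction m) (auto simp: matrix_vector_mult_add_rdistrib)
  then show "(\<Sum>k<n. (if r k < \<rho> (Suc i) \<and> \<rho> (Suc i) \<le> r (Suc k) then \<xi> k x else 0) *v ?w i) =
    (\<Sum>k<n. if r k < \<rho> (Suc i) \<and> \<rho> (Suc i) \<le> r (Suc k) then \<xi> k x else 0) *v ?w i" .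
 qed
 finally show ?thesis .
qed

lemma step_integral_diff:
 "step_integral r (\<lambda>i x. D i x - E i x) k x = step_integral r D k x - step_integral r E k x"
 unfolding step_integral_def by (simp add: matrix_vector_mult_diff_rdistrib sum_subtractf)

text \<open>Dominated convergence for indicators. In this way moduli of continuity that depend on
  the path enter estimates in probability.\<close>

lemma prob_tendsto_0:
 assumes "\<And>n. B n \<in> events" "\<And>x. x \<in> space M ==> \<forall>\<^sub>F n in sequentially. x \<notin> B n"
 shows "(\<lambda>n. prob (B n)) \<longlonglongrightarrow> 0"
proof -
 have "(\<lambda>n. expectation (indicator (B n))) \<longlonglongrightarrow> expectation (\<lambda>_. 0 :: real)"
 proof (rule integral_dominated_convergence[where w = "\<lambda>_. 1"])
  show "AE x in M. (\<lambda>n. indicator (B n) x :: real) \<longlonglongrightarrow> 0"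
  proof (rule AE_I2)
   fix x assume "x \<in> space M"
   from assms(2)[OF this] have "\<forall>\<^sub>F n in sequentially. indicator (B n) x = (0::real)"
    by eventually_elim simp
   then show "(\<lambda>n. indicator (B n) x :: real) \<longlonglongrightarrow> 0" by (rule tendsto_eventually)
  qed
 qed (use assms(1) in \<open>auto simp: indicator_def\<close>)
 then show ?thesis using assms(1) by simp
qed

end

section \<open>Euler scheme\<close>

lemma polygon_restrict:
 assumes "dt > 0" "k \<le> n" "s \<le> real k * dt"
 shows "polygon dt n y s = polygon dt k y s"
proof -
 have "ramp dt j s *\<^sub>R y j = 0" if "k \<le> j" for j
 proof -
  have "real k * dt \<le> real j * dt" using that assms(1) by (intro mult_right_mono) auto
  then have "ramp dt j s = 0" by (intro ramp_0 assms(1)) (use assms(3) in linarith)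
  then show ?thesis by simp
 qed
 then show ?thesis unfolding polygon_def using assms(2)
  by (intro sum.mono_neutral_right) auto
qed

lemma norm_polygon_le_max:
 fixes y :: "nat => real ^ ('d::finite)"
 assumes "dt > 0" "\<And>j. j \<le> n ==> norm (\<Sum>k<j. y k) \<le> a" "k \<le> n" "s \<le> real k * dt"
 shows "norm (polygon dt n y s) \<le> a"
proof (cases "0 \<le> s")
 case True
 have "norm (polygon dt k y s - (\<lambda>_. 0) s) \<le> a + 0"
  by (rule polygon_close[OF assms(1) True assms(4)]) (use assms in auto)
 then show ?thesis using polygon_restrict[OF assms(1,3,4), of y] by simp
next
 case False
 have "polygon dt n y s = 0" unfolding polygon_def using False assms(1)
  by (intro sum.neutral ballI) (simp add: ramp_0 order_trans[of s 0])
 then show ?thesis using assms(2)[of 0] by simp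
qed

lemma elementary_integral_uniform:
 assumes "0 \<le> dt" "j \<le> l"
 shows "elementary_integral (*v) l (\<lambda>k. real k * dt) \<xi> W (real j * dt) x =
  (\<Sum>i<j. \<xi> i x *v (W (real (Suc i) * dt) x - W (real i * dt) x))"
proof -
 have m: "min (real i * dt) (real j * dt) = real (min i j) * dt" for i
  using assms(1) by (cases "i \<le> j") (auto simp: min_absorb1 min_absorb2 mult_right_mono)
 have "elementary_integral (*v) l (\<lambda>k. real k * dt) \<xi> W (real j * dt) x =
   (\<Sum>i<l. if i < j then \<xi> i x *v (W (real (Suc i) * dt) x - W (real i * dt) x) else 0)"
  unfolding elementary_integral_def m by (intro sum.cong) (auto simp: min_def le_Suc_eq)
 also have "... = (\<Sum>i<j. \<xi> i x *v (W (real (Suc i) * dt) x - W (real i * dt) x))"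
  using assms(2) by (subst sum.inter_filter[symmetric]) (auto intro!: sum.cong)
 finally show ?thesis .
qed

lemma elementary_process_uniform:
 assumes "0 < dt" "k < l" "real k * dt < s" "s \<le> real (Suc k) * dt"
 shows "elementary_process l (\<lambda>k. real k * dt) \<xi> s x = \<xi> k x"
proof -
 have "(real i * dt < s \<and> s \<le> real (Suc i) * dt) \<longleftrightarrow> i = k" for i
 proof
  assume i: "real i * dt < s \<and> s \<le> real (Suc i) * dt"
  then have "real i * dt < real (Suc k) * dt" "real k * dt < real (Suc i) * dt" using assms by linarith+
  then have "real i < real (Suc k)" "real k < real (Suc i)" using assms(1) mult_less_cancel_right_pos by blast+
  then show "i = k" by linarith
 qed (use assms in auto)
 then show ?thesis unfolding elementary_process_def using assms(2) by (simp add: sum.delta)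
qed

section \<open>The Lipschitz coefficient and the Euler scheme\<close>

locale sde = brownian T M W for T :: real and M :: "'m measure" and W :: "real => 'm => real ^ ('d::finite)" +
 fixes \<sigma> :: "real => 'd path => real ^ 'd ^ 'd"
 assumes adm: "admissible_coefficient T \<sigma>"
begin

definition "lip = (SOME C. 0 \<le> C \<and> (\<forall>t\<in>{0..T}. \<forall>w\<in>path_space T. \<forall>w'\<in>path_space T.
    norm (\<sigma> t w - \<sigma> t w') \<le> C * path_norm t (\<lambda>s. w s - w' s)))"

lemma lip: "0 \<le> lip" "t \<in> {0..T} ==> w \<in> path_space T ==> w' \<in> path_space T ==>
    norm (\<sigma> t w - \<sigma> t w') \<le> lip * path_norm t (\<lambda>s. w s - w' s)"
proof -
 have "\<exists>C. 0 \<le> C \<and> (\<forall>t\<in>{0..T}. \<forall>w\<in>path_space T. \<forall>w'\<in>path_space T.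
    norm (\<sigma> t w - \<sigma> t w') \<le> C * path_norm t (\<lambda>s. w s - w' s))"
  using adm unfolding admissible_coefficient_def by auto
 from someI_ex[OF this, folded lip_def]
 show "0 \<le> lip" "t \<in> {0..T} ==> w \<in> path_space T ==> w' \<in> path_space T ==>
    norm (\<sigma> t w - \<sigma> t w') \<le> lip * path_norm t (\<lambda>s. w s - w' s)" by auto
qed

lemma sigma_lip:
 assumes "0 \<le> t" "t \<le> T" "w \<in> path_space T" "w' \<in> path_space T" "\<And>s. 0 \<le> s ==> s \<le> t ==> norm (w s - w' s) \<le> e"
 shows "norm (\<sigma> t w - \<sigma> t w') \<le> lip * e"
proof -
 have "norm (\<sigma> t w - \<sigma> t w') \<le> lip * path_norm t (\<lambda>s. w s - w' s)" using lip(2) assms by simp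
 also have "... \<le> lip * e" using assms by (intro mult_left_mono lip(1) path_norm_le) auto
 finally show ?thesis .
qed

lemma sigma_time: "w \<in> path_space T ==> continuous_on {0..T} (\<lambda>t. \<sigma> t w)"
 using adm by (auto simp: admissible_coefficient_def)

lemma sigma_path_continuous:
 assumes "0 \<le> t" "t \<le> T" shows "path_continuous T (\<sigma> t)"
 unfolding path_continuous_def
proof (intro allI impI)
 fix p :: "nat => 'd path" and q assume p: "\<forall>n. p n \<in> path_space T" "q \<in> path_space T" "pconv p q"
 show "(\<lambda>n. \<sigma> t (p n)) \<longlonglongrightarrow> \<sigma> t q"
 proof (rule metric_LIMSEQ_I)
  fix e :: real assume e: "e > 0"
  have lp: "0 < lip + 1" using lip(1) by simp
  have "\<forall>\<^sub>F n in sequentially. \<forall>s. norm (p n s - q s) < e / (lip + 1)"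
   using pconvD[OF p(3), of "e / (lip + 1)"] e lp by simp
  then have "\<forall>\<^sub>F n in sequentially. dist (\<sigma> t (p n)) (\<sigma> t q) < e"
  proof eventually_elim
   case (elim n)
   have "norm (\<sigma> t (p n) - \<sigma> t q) \<le> lip * (e / (lip + 1))"
    using elim p assms by (intro sigma_lip) (auto intro: less_imp_le)
   also have "... < e" using e lp by (simp add: field_simps)
   finally show ?case by (simp add: dist_norm)
  qed
  then show "\<exists>no. \<forall>n\<ge>no. dist (\<sigma> t (p n)) (\<sigma> t q) < e" by (simp add: eventually_sequentially)
 qed
qed

lemma sigma_measurable:
 assumes "f \<in> measurable N (canonical_filtration T T)" "0 \<le> t" "t \<le> T"
 shows "(\<lambda>x. \<sigma> t (f x)) \<in> borel_measurable N"
 using measurable_compose[OF assms(1) path_continuous_measurable[OF sigma_path_continuous[OF assms(2,3)] T_pos]] .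

lemma path_concat_const_measurable:
 assumes "f \<in> measurable N (canonical_filtration T T)" "0 \<le> t" "t \<le> T" "w \<in> path_space T"
 shows "(\<lambda>x. path_concat T t w (f x)) \<in> measurable N (canonical_filtration T T)"
 using assms T_pos by (intro path_concat_measurable) (auto intro!: measurable_const)

lemma interpolate_measurable:
 assumes "f \<in> measurable N (canonical_filtration T T)" "0 < dt" "real l * dt \<le> T"
 shows "(\<lambda>x. interpolate dt l (f x)) \<in> measurable N (canonical_filtration T T)"
proof (rule measurable_cfI)
 show "interpolate dt l (f x) \<in> path_space T" for x
  unfolding interpolate_def using assms by (intro polygon_path_space) auto
 show "(\<lambda>x. interpolate dt l (f x) s) \<in> borel_measurable N" for s
  unfolding interpolate_def polygon_def
  using coord_measurable_compose[OF assms(1) less_imp_le[OF T_pos]]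
  by (intro borel_measurable_sum borel_measurable_scaleR borel_measurable_diff) auto
qed

definition noise :: "real => 'm => nat => real ^ 'd" where
 "noise dt x k = W (real (Suc k) * dt) x - W (real k * dt) x"

text \<open>The path is constant after its k-th node, so the coefficient taken along it at time t +
  k dt uses only increments before that node, although the linear interpolation looks ahead by one
  increment. The noise z is an argument so that blocks of it can be exchanged.\<close>

primrec euler :: "real => real => 'd path => (nat => real ^ 'd) => nat => 'd path" where
 "euler dt t w z 0 = (\<lambda>_. 0)"
| "euler dt t w z (Suc k) = (\<lambda>s. euler dt t w z k s
   + ramp dt k s *\<^sub>R (\<sigma> (t + real k * dt) (path_concat T t w (euler dt t w z k)) *v z k))"

definition euler_coef :: "real => real => 'd path => (nat => real ^ 'd) => nat => real ^ 'd ^ 'd" where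
 "euler_coef dt t w z k = \<sigma> (t + real k * dt) (path_concat T t w (euler dt t w z k))"

text \<open>Rounded down: the grid starts at 0 and in general ends before the horizon T - t.\<close>

definition steps :: "real => real => nat" where
 "steps dt t = nat \<lfloor>(T - t) / dt\<rfloor>"

lemma steps_le: "0 < dt ==> t \<le> T ==> real (steps dt t) * dt \<le> T - t"
 and steps_gt: "0 < dt ==> t \<le> T ==> T - t < real (Suc (steps dt t)) * dt"
 using grid_interval[of dt "T - t"] by (auto simp: steps_def)

lemma euler_polygon: "euler dt t w z k = polygon dt k (\<lambda>i. euler_coef dt t w z i *v z i)"
 by (induction k) (auto simp: polygon_def euler_coef_def)

lemma euler_path_space: "0 < dt ==> real k * dt \<le> T ==> euler dt t w z k \<in> path_space T"
 unfolding euler_polygon by (rule polygon_path_space)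

lemma euler_measurable:
 assumes "0 < dt" "0 \<le> t" "w \<in> path_space T" "t + real k * dt \<le> T" "\<And>i. i < k ==> (\<lambda>x. z x i) \<in> borel_measurable N"
 shows "(\<lambda>x. euler dt t w (z x) k) \<in> measurable N (canonical_filtration T T)"
 using assms(4,5)
proof (induction k)
 case 0
 then show ?case by (auto simp: path_space_zero)
next
 case (Suc k)
 have le: "t + real k * dt \<le> t + real (Suc k) * dt" using assms(1) by (simp add: algebra_simps)
 then have IH: "(\<lambda>x. euler dt t w (z x) k) \<in> measurable N (canonical_filtration T T)"
  using Suc by (intro Suc.IH) auto
 have t: "0 \<le> t + real k * dt" "t + real k * dt \<le> T" "t \<le> T"
  using le Suc.prems(1) assms(1,2) mult_nonneg_nonneg[of "real k" dt] by linarith+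
 have "(\<lambda>x. \<sigma> (t + real k * dt) (path_concat T t w (euler dt t w (z x) k))) \<in> borel_measurable N"
  by (intro sigma_measurable path_concat_const_measurable IH t assms)
 then have m: "(\<lambda>x. \<sigma> (t + real k * dt) (path_concat T t w (euler dt t w (z x) k)) *v z x k) \<in> borel_measurable N"
  using Suc.prems(2)[of k] by (intro borel_measurable_mv) auto
 show ?case
 proof (rule measurable_cfI)
  fix x
  have "real (Suc k) * dt \<le> T" using Suc.prems(1) assms(2) by linarith
  then show "euler dt t w (z x) (Suc k) \<in> path_space T"
   using assms(1) by (intro euler_path_space)
 next
  show "(\<lambda>x. euler dt t w (z x) (Suc k) s) \<in> borel_measurable N" for s
   using m coord_measurable_compose[OF IH less_imp_le[OF T_pos], of s] by simp
 qed
qed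

lemma noise_filt: "0 < dt ==> real k * dt \<le> t ==> i < k ==> (\<lambda>x. noise dt x i) \<in> borel_measurable (filt t)"
proof -
 assume a: "0 < dt" "real k * dt \<le> t" "i < k"
 then have "real (Suc i) * dt \<le> real k * dt" "real i * dt \<le> real k * dt" by (intro mult_right_mono; simp)+
 then have "real (Suc i) * dt \<le> t" "real i * dt \<le> t" "0 \<le> real (Suc i) * dt" "0 \<le> real i * dt"
  using a(1,2) by (linarith, linarith, simp_all)
 then show ?thesis unfolding noise_def by (intro borel_measurable_diff W_filt)
qed

lemma euler_coef_measurable:
 assumes "0 < dt" "0 \<le> t" "w \<in> path_space T" "t + real k * dt \<le> T"
 shows "(\<lambda>x. euler_coef dt t w (noise dt x) k) \<in> borel_measurable (filt (real k * dt))"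
proof -
 have "0 \<le> real k * dt" using assms(1) by simp
 moreover from this have "t \<le> T" using assms(4) by linarith
 ultimately show ?thesis unfolding euler_coef_def
  using assms by (intro sigma_measurable path_concat_const_measurable euler_measurable noise_filt[of _ k]) auto
qed

abbreviation solves :: "real => 'd path => ('m => 'd path) => bool" where
 "solves t w X \<equiv> strong_solution M W (T - t) (shift T t w \<sigma>) X"

lemma solves_path: "solves t w X ==> x \<in> space M ==> X x \<in> path_space (T - t)"
 by (auto simp: strong_solution_def)

lemma solves_measurable:
 assumes "solves t w X" "0 \<le> t" "t \<le> T"
 shows "X \<in> measurable M (canonical_filtration T T)"
proof (rule measurable_cfI)
 show "X x \<in> path_space T" if "x \<in> space M" for x
  using path_space_mono[OF solves_path[OF assms(1) that], of T] assms by auto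
 fix s :: real assume s: "0 \<le> s" "s \<le> T"
 have m: "(\<lambda>x. X x s) \<in> borel_measurable M" if "0 \<le> s" "s \<le> T - t" for s
  using assms that measurable_filt_M[of "\<lambda>x. X x s" s borel] by (auto simp: strong_solution_def)
 show "(\<lambda>x. X x s) \<in> borel_measurable M"
 proof (cases "s \<le> T - t")
  case False
  then have "(\<lambda>x. X x s) \<in> borel_measurable M \<longleftrightarrow> (\<lambda>x. X x (T - t)) \<in> borel_measurable M"
   using assms by (intro measurable_cong path_space_ge[OF solves_path[OF assms(1)]]) auto
  then show ?thesis using m[of "T - t"] assms by simp
 qed (use m s in auto)
qed

text \<open>Uniform continuity in time along the fixed path q handles the change of time, the
  Lipschitz bound the change from q to \<phi> n. Division by lip + 1 covers lip = 0.\<close>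

lemma coef_uniform:
 assumes "\<And>n. \<phi> n \<in> path_space T" "q \<in> path_space T" "pconv \<phi> q" "e > 0"
  "\<And>n i. i \<in> I n ==> a n i \<in> {0..T} \<and> b n i \<in> {0..T} \<and> \<bar>a n i - b n i\<bar> \<le> c n" "c \<longlonglongrightarrow> 0"
 shows "\<forall>\<^sub>F n in sequentially. \<forall>i\<in>I n. norm (\<sigma> (a n i) q - \<sigma> (b n i) (\<phi> n)) \<le> e"
proof -
 have "uniformly_continuous_on {0..T} (\<lambda>t. \<sigma> t q)"
  by (intro compact_uniformly_continuous sigma_time assms(2)) auto
 then obtain d where d: "d > 0" "\<And>s s'. s \<in> {0..T} ==> s' \<in> {0..T} ==> dist s' s < d ==> dist (\<sigma> s' q) (\<sigma> s q) < e/2"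
  using uniformly_continuous_onE[of "{0..T}" "\<lambda>t. \<sigma> t q" "e/2"] assms(4) by (metis half_gt_zero)
 have lp: "0 < lip + 1" using lip(1) by simp
 have "\<forall>\<^sub>F n in sequentially. \<forall>s. norm (\<phi> n s - q s) < e/2 / (lip + 1)"
  using pconvD[OF assms(3), of "e/2 / (lip + 1)"] assms(4) lp by simp
 moreover have "\<forall>\<^sub>F n in sequentially. c n < d" using order_tendstoD(2)[OF assms(6) d(1)] .
 ultimately show ?thesis
 proof eventually_elim
  case (elim n)
  show ?case
  proof
   fix i assume i: "i \<in> I n"
   have "dist (\<sigma> (a n i) q) (\<sigma> (b n i) q) < e/2"
    using assms(5)[OF i] elim(2) by (intro d(2)) (auto simp: dist_real_def)
   moreover have "norm (\<sigma> (b n i) q - \<sigma> (b n i) (\<phi> n)) \<le> lip * (e/2 / (lip + 1))"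
    using assms(1,2) assms(5)[OF i] elim(1) by (intro sigma_lip) (auto simp: norm_minus_commute intro: less_imp_le)
   moreover have "lip * (e/2 / (lip + 1)) \<le> e/2" using lp assms(4) lip(1) by (simp add: field_simps)
   moreover have "norm (\<sigma> (a n i) q - \<sigma> (b n i) (\<phi> n)) \<le> norm (\<sigma> (a n i) q - \<sigma> (b n i) q) + norm (\<sigma> (b n i) q - \<sigma> (b n i) (\<phi> n))"
    using norm_triangle_ineq[of "\<sigma> (a n i) q - \<sigma> (b n i) q" "\<sigma> (b n i) q - \<sigma> (b n i) (\<phi> n)"] by simp
   ultimately show "norm (\<sigma> (a n i) q - \<sigma> (b n i) (\<phi> n)) \<le> e" unfolding dist_norm by linarith
  qed
 qed
qed

end

lemma ucp_tendstoD:
 assumes "ucp_tendsto M I Y Z" "e > 0"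
 obtains A where "\<And>n. A n \<in> sets M" "(\<lambda>n. measure M (A n)) \<longlonglongrightarrow> 0"
  "\<And>n x t. x \<in> space M ==> x \<notin> A n ==> t \<in> I ==> dist (Y n t x) (Z t x) \<le> e"
proof -
 have "\<exists>A. (\<forall>n. A n \<in> sets M \<and> {x \<in> space M. \<exists>t\<in>I. dist (Y n t x) (Z t x) > e} \<subseteq> A n) \<and> (\<lambda>n. measure M (A n)) \<longlonglongrightarrow> 0"
  using assms unfolding ucp_tendsto_def by simp
 then obtain A where A0: "(\<forall>n. A n \<in> sets M \<and> {x \<in> space M. \<exists>t\<in>I. dist (Y n t x) (Z t x) > e} \<subseteq> A n) \<and> (\<lambda>n. measure M (A n)) \<longlonglongrightarrow> 0"
  by (rule exE)
 then have A: "A n \<in> sets M \<and> {x \<in> space M. \<exists>t\<in>I. dist (Y n t x) (Z t x) > e} \<subseteq> A n" for n by simp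
 have "dist (Y n t x) (Z t x) \<le> e" if "x \<in> space M" "x \<notin> A n" "t \<in> I" for n x t
 proof (rule ccontr)
  assume "\<not> dist (Y n t x) (Z t x) \<le> e"
  then have "e < dist (Y n t x) (Z t x)" by simp
  with that(1,3) have "x \<in> {x \<in> space M. \<exists>t\<in>I. dist (Y n t x) (Z t x) > e}" by blast
  then show False using A[of n] that(2) by blast
 qed
 then show ?thesis using A0 A by (intro that[of A]) auto
qed

section \<open>Convergence of the Euler scheme to an arbitrary solution\<close>

context sde
begin

definition euler_error :: "real => real => 'd path => ('m => 'd path) => 'm => real" where
 "euler_error dt t w X x = runmax (\<lambda>k. norm (X x (real k * dt)
   - euler dt t w (noise dt x) (steps dt t) (real k * dt))) (steps dt t)"

lemma euler_error_measurable:
 assumes "X \<in> measurable M (canonical_filtration T T)" "0 < dt" "0 \<le> t" "t \<le> T" "w \<in> path_space T"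
 shows "euler_error dt t w X \<in> borel_measurable M"
proof -
 have le: "real (steps dt t) * dt \<le> T - t" using steps_le assms by simp
 have "(\<lambda>x. noise dt x i) \<in> borel_measurable M" if "i < steps dt t" for i
  using measurable_filt_M[OF noise_filt[OF assms(2) order_refl that]] le assms by auto
 then have E: "(\<lambda>x. euler dt t w (noise dt x) (steps dt t)) \<in> measurable M (canonical_filtration T T)"
  using le assms by (intro euler_measurable) auto
 note m = coord_measurable_compose[OF _ less_imp_le[OF T_pos]]
 show ?thesis unfolding euler_error_def[abs_def]
  by (intro runmax_measurable measurable_compose[OF borel_measurable_diff borel_measurable_norm] m E assms)
qed

text \<open>X is replaced by an elementary integral whose integrand is close to the coefficient
  along X, as the definition of the integral permits. On a common refinement of the two grids its
  difference to the scheme is a \<open>step_integral\<close> whose integrand is bounded by lip times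
  the running maximum of that difference, up to small errors, and \<open>step_gronwall\<close>
  applies.\<close>

lemma euler_converges:
 assumes t: "0 \<le> t" "t \<le> T" and tt: "\<And>n. t \<le> tt n \<and> tt n \<le> T" "tt \<longlonglongrightarrow> t"
  and p: "w \<in> path_space T" "\<And>n. p n \<in> path_space T" "pconv (\<lambda>n. stopped (tt n) (p n)) (stopped t w)"
  and dt: "\<And>n. 0 < dt n" "dt \<longlonglongrightarrow> 0" and X: "solves t w X" and \<epsilon>: "0 < \<epsilon>"
 shows "(\<lambda>n. prob {x\<in>space M. \<epsilon> \<le> euler_error (dt n) (tt n) (p n) X x}) \<longlonglongrightarrow> 0"
proof (rule order_tendstoI)
 fix \<kappa> :: real assume \<kappa>: "0 < \<kappa>"
 define K where "K = exp (8 * (lip^2 + 1) * T)"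
 \<comment> \<open>Makes the Gronwall term equal to \<kappa>/4 at level \<epsilon>/2. With 3
   \<kappa>/8 for the approximation events, where \<open>A2 j\<close> counts twice, and \<kappa>/4
   for \<open>B n\<close> the total stays below \<kappa>.\<close>
 define \<eta> where "\<eta> = \<epsilon> / 4 * sqrt (\<kappa> / K)"
 have K: "0 < K" by (simp add: K_def)
 have \<eta>: "0 < \<eta>" using \<epsilon> \<kappa> K by (simp add: \<eta>_def)
 have \<eta>2: "\<eta>^2 * K / (\<epsilon> / 2)^2 = \<kappa> / 4"
  using \<epsilon> \<kappa> K by (simp add: \<eta>_def power_mult_distrib power_divide field_simps)
 \<comment> \<open>The first bound is for the error at the nodes; by the second, two coefficient
   errors and lip times the node error add up to at most \<eta>.\<close>
 define e where "e = min (\<epsilon> / 4) (\<eta> / (2 + lip))"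
 have e: "0 < e" "e \<le> \<epsilon> / 4" using \<epsilon> \<eta> lip(1) unfolding e_def by (simp, intro min.cobounded1)
 have e\<eta>: "e + e + lip * e \<le> \<eta>"
 proof -
  have "e * (2 + lip) \<le> \<eta>" using lip(1) by (simp add: e_def min_le_iff_disj pos_le_divide_eq[symmetric])
  then show ?thesis by (simp add: algebra_simps)
 qed
 define S where "S = T - t"
 have S: "0 \<le> S" "S \<le> T" using t by (auto simp: S_def)
 obtain nn r \<xi> where el: "\<And>j. elementary filt S (nn j) (r j) (\<xi> j)"
  and u1: "ucp_tendsto M {0<..S} (\<lambda>j. elementary_process (nn j) (r j) (\<xi> j)) (\<lambda>s x. shift T t w \<sigma> s (X x))"
  and u2: "ucp_tendsto M {0..S} (\<lambda>j. elementary_integral (*v) (nn j) (r j) (\<xi> j) W) (\<lambda>s x. X x s)"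
  using X unfolding strong_solution_def has_stoch_integral_def S_def by blast
 obtain A1 where A1: "\<And>j. A1 j \<in> events" "(\<lambda>j. prob (A1 j)) \<longlonglongrightarrow> 0" "\<And>j x s. x \<in> space M ==> x \<notin> A1 j ==> s \<in> {0<..S} ==>
   dist (elementary_process (nn j) (r j) (\<xi> j) s x) (shift T t w \<sigma> s (X x)) \<le> e"
  using ucp_tendstoD[OF u1 e(1)] by blast
 obtain A2 where A2: "\<And>j. A2 j \<in> events" "(\<lambda>j. prob (A2 j)) \<longlonglongrightarrow> 0" "\<And>j x s. x \<in> space M ==> x \<notin> A2 j ==> s \<in> {0..S} ==>
   dist (elementary_integral (*v) (nn j) (r j) (\<xi> j) W s x) (X x s) \<le> e"
  using ucp_tendstoD[OF u2 e(1)] by blast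
 have "\<forall>\<^sub>F j in sequentially. prob (A1 j) < \<kappa> / 8" "\<forall>\<^sub>F j in sequentially. prob (A2 j) < \<kappa> / 8"
  using order_tendstoD(2)[OF A1(2), of "\<kappa>/8"] order_tendstoD(2)[OF A2(2), of "\<kappa>/8"] \<kappa> by auto
 then have "\<forall>\<^sub>F j in sequentially. prob (A1 j) < \<kappa> / 8 \<and> prob (A2 j) < \<kappa> / 8" by (rule eventually_conj)
 then obtain j where j: "prob (A1 j) < \<kappa> / 8" "prob (A2 j) < \<kappa> / 8" by (auto dest: eventually_happens)
 define H where "H = elementary_process (nn j) (r j) (\<xi> j)"
 define I where "I = elementary_integral (*v) (nn j) (r j) (\<xi> j) W"
 let ?q = "\<lambda>x. path_concat T t w (X x)"
 have H: "norm (H s x - \<sigma> (t + s) (?q x)) \<le> e" if "x \<in> space M" "x \<notin> A1 j" "0 < s" "s \<le> S" for x s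
  using A1(3)[of x j s] that by (simp add: H_def dist_norm shift_def)
 have I: "norm (I s x - X x s) \<le> e" if "x \<in> space M" "x \<notin> A2 j" "0 \<le> s" "s \<le> S" for x s
  using A2(3)[of x j s] that by (simp add: I_def dist_norm)
 define l where "l n = steps (dt n) (tt n)" for n
 have l: "real (l n) * dt n \<le> T - tt n" "T - tt n < real (Suc (l n)) * dt n" for n
  using steps_le[OF dt(1)] steps_gt[OF dt(1)] tt(1) by (auto simp: l_def)
 have XM: "X \<in> measurable M (canonical_filtration T T)" by (rule solves_measurable[OF X t])
 have XS: "X x \<in> path_space S" if "x \<in> space M" for x using solves_path[OF X that] by (simp add: S_def)
 have XT: "X x \<in> path_space T" if "x \<in> space M" for x using measurable_space[OF XM that] by simp
 \<comment> \<open>The common refinement of the Euler grid and the nodes of the elementary process,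
   cut off at the last Euler node.\<close>
 have "\<exists>N \<rho>. \<rho> ` {..N} = (\<lambda>k. real k * dt n) ` {..l n} \<union> (r j ` {..nn j} \<inter> {0..real (l n) * dt n}) \<and> (\<forall>i<N. \<rho> i < \<rho> (Suc i))" for n
  by (rule finite_set_grid[of "(\<lambda>k. real k * dt n) ` {..l n} \<union> (r j ` {..nn j} \<inter> {0..real (l n) * dt n})"]) auto
 then obtain N \<rho> where \<rho>: "\<And>n. \<rho> n ` {..N n} = (\<lambda>k. real k * dt n) ` {..l n} \<union> (r j ` {..nn j} \<inter> {0..real (l n) * dt n})"
  "\<And>n i. i < N n ==> \<rho> n i < \<rho> n (Suc i)" by metis
 have le: "\<rho> n a < \<rho> n b \<longleftrightarrow> a < b" "\<rho> n a \<le> \<rho> n b \<longleftrightarrow> a \<le> b" if "a \<le> N n" "b \<le> N n" for a b n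
  using strict_grid_less_iff[of "N n" "\<rho> n" a b] \<rho>(2) that by auto
 have ran: "0 \<le> \<rho> n i \<and> \<rho> n i \<le> real (l n) * dt n" if "i \<le> N n" for n i
 proof -
  have "\<rho> n i \<in> \<rho> n ` {..N n}" using that by simp
  then show ?thesis unfolding \<rho>(1) using dt(1)[of n] by (auto intro!: mult_right_mono)
 qed
 have idx: "\<exists>i\<le>N n. \<rho> n i = real k * dt n" if "k \<le> l n" for n k
 proof -
  have "real k * dt n \<in> \<rho> n ` {..N n}" unfolding \<rho>(1) using that by auto
  then show ?thesis by force
 qed
 have \<rho>N: "\<rho> n (N n) = real (l n) * dt n" for n
  using idx[of "l n" n] ran[of "N n" n] le(2)[of _ n "N n"] by force
 \<comment> \<open>The last Euler node not after the refined node, where the scheme evaluates its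
   coefficient.\<close>
 define fl where "fl n i = real (nat \<lfloor>\<rho> n i / dt n\<rfloor>) * dt n" for n i
 have fl: "fl n i \<le> \<rho> n i" "\<rho> n i < fl n i + dt n" "0 \<le> fl n i" if "i \<le> N n" for n i
  using grid_interval[OF dt(1), of "\<rho> n i" n] ran[OF that] dt(1)[of n] by (auto simp: fl_def algebra_simps)
 \<comment> \<open>The path that the scheme would see if its nodes lay on X. It separates the
   discretisation error, measured by \<open>B n\<close>, from the accumulated error of the
   scheme.\<close>
 define \<phi> where "\<phi> n x = path_concat T (tt n) (p n) (interpolate (dt n) (l n) (X x))" for n x
 have lT: "real (l n) * dt n \<le> T" for n using l(1)[of n] tt(1)[of n] t by linarith
 define B where "B n = {x\<in>space M. \<exists>i\<in>{..<N n}. e < norm (\<sigma> (t + \<rho> n i) (?q x) - \<sigma> (tt n + fl n i) (\<phi> n x))}" for n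
 have tr: "0 \<le> t + \<rho> n i \<and> t + \<rho> n i \<le> T" "0 \<le> tt n + fl n i \<and> tt n + fl n i \<le> T" if "i \<le> N n" for n i
  using ran[OF that] fl[OF that] l(1)[of n] tt(1)[of n] t by linarith+
 have Bm: "B n \<in> events" for n
  unfolding B_def
 proof (rule sets.sets_Collect_finite_Ex)
  fix i assume "i \<in> {..<N n}"
  then have i: "i \<le> N n" by simp
  have [measurable]: "(\<lambda>x. \<sigma> (t + \<rho> n i) (?q x)) \<in> borel_measurable M" "(\<lambda>x. \<sigma> (tt n + fl n i) (\<phi> n x)) \<in> borel_measurable M"
   unfolding \<phi>_def using tr[OF i] tt(1)[of n] t p dt(1) lT
   by (intro sigma_measurable path_concat_const_measurable interpolate_measurable XM; force)+
  show "{x \<in> space M. e < norm (\<sigma> (t + \<rho> n i) (?q x) - \<sigma> (tt n + fl n i) (\<phi> n x))} \<in> events" by measurable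
 qed simp
 have ld: "(\<lambda>n. real (l n) * dt n) \<longlonglongrightarrow> S"
 proof (rule tendsto_sandwich[where f = "\<lambda>n. T - tt n - dt n" and h = "\<lambda>n. T - tt n"])
  show "\<forall>\<^sub>F n in sequentially. T - tt n - dt n \<le> real (l n) * dt n"
   using l(2) by (intro always_eventually allI) (simp add: algebra_simps less_imp_le)
  show "(\<lambda>n. T - tt n - dt n) \<longlonglongrightarrow> S" using tendsto_diff[OF tendsto_diff[OF tendsto_const[of T] tt(2)] dt(2)] by (simp add: S_def)
  show "(\<lambda>n. T - tt n) \<longlonglongrightarrow> S" using tendsto_diff[OF tendsto_const[of T] tt(2)] by (simp add: S_def)
 qed (use l(1) in auto)
 \<comment> \<open>For each sample the interpolations, the starting points and the evaluation times
   all converge, so every sample eventually leaves \<open>B n\<close>.\<close>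
 have "(\<lambda>n. prob (B n)) \<longlonglongrightarrow> 0"
 proof (rule prob_tendsto_0[OF Bm])
  fix x assume x: "x \<in> space M"
  have lS: "real (l n) * dt n \<le> S" for n using l(1)[of n] tt(1)[of n] by (simp add: S_def)
  have ip: "pconv (\<lambda>n. interpolate (dt n) (l n) (X x)) (X x)"
   by (rule pconv_interpolate[OF XT[OF x] T_pos dt lS ld XS[OF x] S(1)])
  have isp: "interpolate (dt n) (l n) (X x) \<in> path_space T" for n
   unfolding interpolate_def using lT dt(1) by (intro polygon_path_space)
  have "\<forall>\<^sub>F n in sequentially. \<forall>i\<in>{..<N n}. norm (\<sigma> (t + \<rho> n i) (?q x) - \<sigma> (tt n + fl n i) (\<phi> n x)) \<le> e"
  proof (rule coef_uniform[where c = "\<lambda>n. (tt n - t) + dt n"])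
   show "\<phi> n x \<in> path_space T" for n unfolding \<phi>_def using tt(1)[of n] t p isp by (intro path_concat_path_space) auto
   show "?q x \<in> path_space T" using p t XT[OF x] by (intro path_concat_path_space) auto
   show "pconv (\<lambda>n. \<phi> n x) (?q x)" unfolding \<phi>_def
    using t tt p isp ip XT[OF x] T_pos order_trans[OF t(1)] by (intro pconv_path_concat) auto
   show "(\<lambda>n. (tt n - t) + dt n) \<longlonglongrightarrow> 0" using tendsto_add[OF LIM_zero[OF tt(2)] dt(2)] by simp
   fix n i assume "i \<in> {..<N n}"
   then have i: "i \<le> N n" by simp
   show "t + \<rho> n i \<in> {0..T} \<and> tt n + fl n i \<in> {0..T} \<and> \<bar>t + \<rho> n i - (tt n + fl n i)\<bar> \<le> tt n - t + dt n"
    using tr[OF i] fl[OF i] tt(1)[of n] by (auto simp: abs_le_iff)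
  qed (rule e(1))
  then show "\<forall>\<^sub>F n in sequentially. x \<notin> B n"
   by eventually_elim (auto simp: B_def not_less)
 qed
 then have "\<forall>\<^sub>F n in sequentially. prob (B n) < \<kappa> / 4" using order_tendstoD(2)[of _ 0 sequentially "\<kappa>/4"] \<kappa> by simp
 then show "\<forall>\<^sub>F n in sequentially. prob {x\<in>space M. \<epsilon> \<le> euler_error (dt n) (tt n) (p n) X x} < \<kappa>"
 proof eventually_elim
  case (elim n)
  let ?\<rho> = "\<rho> n" and ?N = "N n" and ?d = "dt n" and ?l = "l n"
  let ?err = "{x\<in>space M. \<epsilon> \<le> euler_error ?d (tt n) (p n) X x}"
  let ?e = "\<lambda>x k. euler ?d (tt n) (p n) (noise ?d x) k"
  let ?r = "\<lambda>k. real k * ?d"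
  define Ec where "Ec k x = euler_coef ?d (tt n) (p n) (noise ?d x) k" for k x
  define D where "D i x = H (?\<rho> (Suc i)) x - elementary_process ?l ?r Ec (?\<rho> (Suc i)) x" for i x
  define Y where "Y x = runmax (\<lambda>k. norm (step_integral ?\<rho> D k x))" for x
  let ?Yb = "{x\<in>space M. \<epsilon> / 2 \<le> Y x ?N}"
  let ?Db = "{x\<in>space M. \<exists>i<?N. ?\<rho> i < ?\<rho> (Suc i) \<and> lip * Y x i + \<eta> < norm (D i x)}"
  have rf1: "refinement ?N ?\<rho> (nn j) (r j)"
  proof
   have mono: "mono_on {..nn j} (r j)" and nneg: "k \<le> nn j ==> 0 \<le> r j k" for k
    using el[of j] by (auto simp: elementary_def)
   show "r j k \<le> r j (Suc k)" if "k < nn j" for k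
    by (rule mono_onD[OF mono]) (use that in auto)
   show "r j k \<in> ?\<rho> ` {..?N}" if "k \<le> nn j" "r j k \<le> ?\<rho> ?N" for k
    unfolding \<rho>(1) using nneg[OF that(1)] that \<rho>N by auto
  qed (rule \<rho>(2))
  have rf2: "refinement ?N ?\<rho> ?l ?r"
  proof
   show "?r k \<le> ?r (Suc k)" for k using dt(1)[of n] by (intro mult_right_mono) auto
   show "?r k \<in> ?\<rho> ` {..?N}" if "k \<le> ?l" for k unfolding \<rho>(1) using that by auto
  qed (rule \<rho>(2))
  have elE: "elementary filt T ?l ?r Ec"
   unfolding elementary_def
  proof (intro conjI allI impI)
   fix k assume k: "k < ?l"
   have "?r k \<le> ?r ?l" using k dt(1)[of n] by (intro mult_right_mono) auto
   then have "tt n + ?r k \<le> T" using l(1)[of n] by linarith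
   then show "Ec k \<in> borel_measurable (filt (?r k))"
    unfolding Ec_def[abs_def] using tt(1)[of n] t dt(1) p by (intro euler_coef_measurable) auto
  next
   fix k assume k: "k \<le> ?l"
   have "?r k \<le> ?r ?l" using k dt(1)[of n] by (intro mult_right_mono) auto
   then have "?r k \<le> T" using lT[of n] by linarith
   then show "?r k \<in> {0..T}" using dt(1)[of n] by auto
  qed (use dt(1)[of n] in \<open>auto intro!: mono_onI mult_right_mono\<close>)
  have g: "grid ?N ?\<rho>"
   unfolding grid_def using ran lT[of n] \<rho>(2)[of _ n] by (auto intro: less_imp_le order_trans)
  have Dm: "D i \<in> borel_measurable (filt (?\<rho> i))" if "i < ?N" for i
   unfolding D_def[abs_def] H_def using elementary_refine[OF rf1 el that] elementary_refine[OF rf2 elE that] by simp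
  have stepD: "step_integral ?\<rho> D k x = I (?\<rho> k) x - elementary_integral (*v) ?l ?r Ec W (?\<rho> k) x" if "k \<le> ?N" for k x
   unfolding I_def elementary_integral_refine[OF rf1 that] elementary_integral_refine[OF rf2 that]
   unfolding D_def[abs_def] H_def by (rule step_integral_diff)
  have eu: "elementary_integral (*v) ?l ?r Ec W (?r k) x = ?e x ?l (?r k)"
   if "k \<le> ?l" for k x
   using that dt(1)[of n]
   by (subst elementary_integral_uniform) (auto simp: euler_polygon polygon_grid Ec_def noise_def)
  \<comment> \<open>At an Euler node the elementary integral differs from the scheme by a step
    integral, and from X by at most e.\<close>
  have node: "norm (X x (?r k) - ?e x ?l (?r k)) \<le> e + Y x i"
   if x: "x \<in> space M" "x \<notin> A2 j" and k: "k \<le> ?l" "?r k \<le> ?\<rho> i" "i \<le> ?N" for x k i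
  proof -
   obtain a where a: "a \<le> ?N" "?\<rho> a = ?r k" using idx[OF k(1)] by auto
   have ai: "a \<le> i" using le(2)[OF a(1) k(3)] k(2) a(2) by simp
   have "norm (I (?\<rho> a) x - X x (?\<rho> a)) \<le> e"
    using I[OF x] ran[OF a(1)] l(1)[of n] tt(1)[of n] by (simp add: S_def)
   moreover have "norm (step_integral ?\<rho> D a x) \<le> Y x i" unfolding Y_def by (rule runmax_ge[OF ai])
   moreover have "X x (?r k) - ?e x ?l (?r k) = step_integral ?\<rho> D a x - (I (?\<rho> a) x - X x (?\<rho> a))"
    unfolding stepD[OF a(1)] unfolding a(2) eu[OF k(1)] by simp
   ultimately show ?thesis
    using norm_triangle_ineq4[of "step_integral ?\<rho> D a x" "I (?\<rho> a) x - X x (?\<rho> a)"] by simp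
  qed
  have dom: "norm (D i x) \<le> lip * Y x i + \<eta>" if x: "x \<in> space M" "x \<notin> A1 j" "x \<notin> A2 j" "x \<notin> B n" and i: "i < ?N" for x i
  proof -
   have i': "i \<le> ?N" "Suc i \<le> ?N" using i by auto
   define k where "k = nat \<lfloor>?\<rho> i / ?d\<rfloor>"
   have fk: "fl n i = ?r k" by (simp add: fl_def k_def)
   have kl: "k < ?l"
   proof -
    have "?r k < ?r ?l" using fl(1)[OF i'(1)] \<rho>(2)[OF i] ran[OF i'(2)] by (simp add: fk)
    then show ?thesis using dt(1)[of n] by simp
   qed
   have kS: "?r (Suc k) = fl n i + ?d" by (simp add: fk algebra_simps)
   have "?\<rho> (Suc i) \<le> ?r (Suc k)"
   proof -
    obtain a where a: "a \<le> ?N" "?\<rho> a = ?r (Suc k)" using idx[of "Suc k" n] kl by auto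
    have "?\<rho> i < ?\<rho> a" using fl(2)[OF i'(1)] by (simp only: a(2) kS)
    then have "Suc i \<le> a" using le(1)[OF i'(1) a(1)] by simp
    then show ?thesis using le(2)[OF i'(2) a(1)] a(2) by simp
   qed
   then have E: "elementary_process ?l ?r Ec (?\<rho> (Suc i)) x = Ec k x"
    using fl(1)[OF i'(1)] \<rho>(2)[OF i] by (intro elementary_process_uniform dt(1) kl) (simp_all only: fk)
   have q: "?q x \<in> path_space T" using p t XT[OF x(1)] by (intro path_concat_path_space) auto
   let ?h = "\<lambda>m. (?\<rho> (Suc i) - ?\<rho> i) / real (Suc m)"
   let ?Hi = "H (?\<rho> (Suc i)) x"
   let ?\<sigma>1 = "\<sigma> (t + ?\<rho> i) (?q x)"
   let ?\<sigma>2 = "\<sigma> (tt n + fl n i) (\<phi> n x)"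
   let ?dX = "\<lambda>i. (X x (?r (Suc i)) - X x (?r i)) - Ec i x *v noise ?d x i"
   \<comment> \<open>H is known to be close to the coefficient on the left-open interval, where it
     is constant. The bound at the left end follows by letting the time decrease to it.\<close>
   have 1: "norm (?Hi - ?\<sigma>1) \<le> e"
   proof (rule tendsto_upperbound)
    have "continuous_on {0..T} (\<lambda>s. \<sigma> s (?q x))" by (rule sigma_time[OF q])
    moreover have "(\<lambda>m. t + ?\<rho> i + ?h m) \<longlonglongrightarrow> t + ?\<rho> i + 0"
     by (intro tendsto_add tendsto_const LIMSEQ_Suc lim_const_over_n)
    moreover have mem: "t + ?\<rho> i + ?h m \<in> {0..T} \<and> ?\<rho> i < ?\<rho> i + ?h m \<and>
      ?\<rho> i + ?h m \<le> ?\<rho> (Suc i)" for m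
    proof -
     have "?h m \<le> (?\<rho> (Suc i) - ?\<rho> i) / 1" "0 < ?h m"
      using \<rho>(2)[OF i] by (intro divide_left_mono divide_pos_pos; simp)+
     then show ?thesis using tr(1)[OF i'(1)] tr(1)[OF i'(2)] by auto
    qed
    ultimately have "(\<lambda>m. \<sigma> (t + ?\<rho> i + ?h m) (?q x)) \<longlonglongrightarrow> ?\<sigma>1"
     using tr(1)[OF i'(1)] by (intro continuous_on_tendsto_compose[of "{0..T}" "\<lambda>s. \<sigma> s (?q x)"]) auto
    then show "(\<lambda>m. norm (?Hi - \<sigma> (t + ?\<rho> i + ?h m) (?q x))) \<longlonglongrightarrow> norm (?Hi - ?\<sigma>1)"
     by (intro tendsto_norm tendsto_diff tendsto_const)
    show "\<forall>\<^sub>F m in sequentially. norm (?Hi - \<sigma> (t + ?\<rho> i + ?h m) (?q x)) \<le> e"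
    proof (intro always_eventually allI)
     fix m
     let ?s = "?\<rho> i + ?h m"
     have s: "?\<rho> i < ?s" "?s \<le> ?\<rho> (Suc i)" using mem[of m] by auto
     have "?Hi = H ?s x"
      unfolding H_def by (rule refinement.elementary_process_const[OF rf1 i s, symmetric])
     moreover have "norm (H ?s x - \<sigma> (t + ?s) (?q x)) \<le> e"
      by (rule H[OF x(1,2)]) (use s ran[OF i'(1)] ran[OF i'(2)] l(1)[of n] tt(1)[of n] in \<open>auto simp: S_def\<close>)
     ultimately show "norm (?Hi - \<sigma> (t + ?\<rho> i + ?h m) (?q x)) \<le> e"
      by (simp add: add.assoc)
    qed
   qed simp
   have 2: "norm (?\<sigma>1 - ?\<sigma>2) \<le> e"
    using x(1,4) i by (auto simp: B_def not_less)
   have kd: "?r k \<le> ?r ?l" using kl dt(1)[of n] by (intro mult_right_mono) auto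
   have ttT: "0 \<le> tt n" "tt n \<le> T" using tt(1)[of n] t by auto
   have isp: "interpolate ?d ?l (X x) \<in> path_space T" "?e x k \<in> path_space T"
    unfolding interpolate_def
    by (rule polygon_path_space[OF dt(1) lT], rule euler_path_space[OF dt(1) order_trans[OF kd lT]])
   \<comment> \<open>Both paths have the same past p n, and after it they differ by a polygon whose
     node values are bounded by \<open>node\<close>.\<close>
   have 3: "norm (?\<sigma>2 - Ec k x) \<le> lip * (e + Y x i)"
    unfolding Ec_def euler_coef_def fk[symmetric]
   proof (rule sigma_lip)
    fix s assume s: "0 \<le> s" "s \<le> tt n + fl n i"
    have s': "min s T - tt n \<le> ?r k" using s by (simp add: fk)
    have "\<phi> n x s - path_concat T (tt n) (p n) (?e x k) s =
     interpolate ?d ?l (X x) (min s T - tt n) - ?e x k (min s T - tt n)"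
     unfolding \<phi>_def path_concat_eq[OF p(2) isp(1) ttT] path_concat_eq[OF p(2) isp(2) ttT] by simp
    also have "... = polygon ?d ?l ?dX (min s T - tt n)"
     unfolding interpolate_def euler_polygon polygon_restrict[OF dt(1) less_imp_le[OF kl] s', symmetric]
     by (simp add: polygon_diff Ec_def)
    also have "norm ... = norm (polygon ?d k ?dX (min s T - tt n))"
     by (subst polygon_restrict[OF dt(1) less_imp_le[OF kl] s']) simp
    also have "... \<le> e + Y x i"
    proof (rule norm_polygon_le_max[OF dt(1) _ order_refl s'])
     fix a assume a: "a \<le> k"
     have al: "a \<le> ?l" using a kl by simp
     have "?r a \<le> ?r k" using a dt(1)[of n] by (intro mult_right_mono) auto
     then have "?r a \<le> ?\<rho> i" using fl(1)[OF i'(1)] by (simp add: fk)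
     note nd = node[OF x(1,3) al this i'(1)]
     have "(\<Sum>i<a. ?dX i) =
       X x (?r a) - (\<Sum>i<a. Ec i x *v noise ?d x i)"
      by (subst sum_subtractf, subst sum_increments) (simp add: path_space_0[OF XT[OF x(1)]])
     then show "norm (\<Sum>i<a. ?dX i) \<le> e + Y x i"
      using nd unfolding euler_polygon polygon_grid[OF dt(1) al] by (simp add: Ec_def)
    qed
    finally show "norm (\<phi> n x s - path_concat T (tt n) (p n) (?e x k) s) \<le> e + Y x i" .
   qed (use tr(2)[OF i'(1)] p isp ttT in \<open>auto simp: \<phi>_def intro!: path_concat_path_space\<close>)
   have "D i x = (?Hi - ?\<sigma>1) + (?\<sigma>1 - ?\<sigma>2) + (?\<sigma>2 - Ec k x)"
    unfolding D_def E by simp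
   then have "norm (D i x) \<le> e + e + lip * (e + Y x i)"
    using 1 2 3 by (metis norm_triangle_mono)
   then show ?thesis using e\<eta> by (simp add: algebra_simps)
  qed
  have sub1: "?err \<subseteq> A2 j \<union> ?Yb"
  proof
   fix x assume "x \<in> ?err"
   then have x: "x \<in> space M" "\<epsilon> \<le> euler_error ?d (tt n) (p n) X x" by auto
   obtain k where k: "k \<le> ?l" "\<epsilon> \<le> norm (X x (?r k) - ?e x ?l (?r k))"
    using x(2) unfolding euler_error_def runmax_ge_iff l_def[symmetric] by auto
   have "?r k \<le> ?r ?l" using k(1) dt(1)[of n] by (intro mult_right_mono) auto
   then have "x \<notin> A2 j ==> \<epsilon> \<le> e + Y x ?N"
    using node[OF x(1) _ k(1) _ order_refl] k(2) \<rho>N[of n] by force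
   then show "x \<in> A2 j \<union> ?Yb" using x(1) e(2) \<epsilon> by force
  qed
  have sub2: "?Db \<subseteq> A1 j \<union> A2 j \<union> B n"
   using dom by (force simp: not_less[symmetric])
  have Ym: "?Yb \<in> events"
  proof -
   have [measurable]: "(\<lambda>x. Y x ?N) \<in> borel_measurable M" unfolding Y_def
    by (intro runmax_measurable measurable_compose[OF step_integral_measurable[OF g Dm] borel_measurable_norm])
   show ?thesis by measurable
  qed
  have "prob ?err \<le> prob (A2 j \<union> ?Yb)"
   by (rule finite_measure_mono[OF sub1 sets.Un[OF A2(1) Ym]])
  also have "... \<le> prob (A2 j) + prob ?Yb"
   by (rule measure_Un_le[OF A2(1) Ym])
  also have "prob ?Yb \<le>
    prob ?Db + \<eta>^2 * K / (\<epsilon> / 2)^2"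
   unfolding Y_def K_def using \<epsilon> by (intro step_gronwall[OF g Dm lip(1) \<eta>]) auto
  also have "prob ?Db \<le> prob (A1 j \<union> A2 j \<union> B n)"
   by (rule finite_measure_mono[OF sub2 sets.Un[OF sets.Un[OF A1(1) A2(1)] Bm]])
  also have "prob (A1 j \<union> A2 j \<union> B n) \<le> prob (A1 j \<union> A2 j) + prob (B n)"
   by (rule measure_Un_le[OF sets.Un[OF A1(1) A2(1)] Bm])
  also have "prob (A1 j \<union> A2 j) \<le> prob (A1 j) + prob (A2 j)"
   by (rule measure_Un_le[OF A1(1) A2(1)])
  finally have "prob ?err
   \<le> prob (A2 j) + (prob (A1 j) + prob (A2 j) + prob (B n) + \<eta>^2 * K / (\<epsilon> / 2)^2)" by simp
  then show ?case using j elim \<kappa> unfolding \<eta>2 by linarith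
 qed
next
 fix \<kappa> :: real assume "\<kappa> < 0"
 then show "\<forall>\<^sub>F n in sequentially. \<kappa> < prob {x\<in>space M. \<epsilon> \<le> euler_error (dt n) (tt n) (p n) X x}"
  by (intro always_eventually allI) (rule less_le_trans[OF _ measure_nonneg])
qed

end

section \<open>Existence of solutions\<close>

text \<open>The strict inequality t < T keeps the dyadic meshes of [0, T - t] positive; t = T is
  treated in \<open>solution_exists'\<close>.\<close>

locale sde_start = sde T M W \<sigma> for T :: real and M :: "'m measure" and W :: "real => 'm => real ^ ('d::finite)" and \<sigma> +
 fixes t :: real and w :: "'d path"
 assumes t: "0 \<le> t" "t < T" and w: "w \<in> path_space T"
begin

definition "S = T - t"
definition dt :: "nat => real" where "dt a = S / 2 ^ a"
abbreviation "nd a i \<equiv> real i * dt a"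
definition flo :: "nat => real => real" where "flo a s = nd a (nat \<lfloor>s / dt a\<rfloor>)"
definition b :: "real => 'd path => real ^ 'd ^ 'd" where "b s v = \<sigma> (t + s) (path_concat T t w v)"
text \<open>W starts at 0 and is continuous only almost surely. The version \<open>Wc\<close>, set
  to 0 on a null set, is continuous everywhere, so that integrals against it lie in the path space;
  it stays adapted because the filtration contains the null sets.\<close>

definition "N0 = (SOME N. N \<in> null_sets M \<and> (\<forall>x\<in>space M - N. W 0 x = 0 \<and> continuous_on {0..T} (\<lambda>s. W s x)))"
definition "Wc s x = (if x \<in> N0 then 0 else W s x)"
text \<open>The integral of the coefficient along X, frozen at the nodes of level a. It is an
  elementary integral by construction and serves as the Picard map.\<close>

definition J :: "nat => ('m => 'd path) => 'm => 'd path" where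
 "J a X x s = elementary_integral (*v) (2 ^ a) (\<lambda>k. nd a k) (\<lambda>k x. b (nd a k) (X x)) Wc (max 0 s) x"
definition proc :: "('m => 'd path) => bool" where
 "proc X \<longleftrightarrow> (\<forall>x\<in>space M. X x \<in> path_space S) \<and> (\<forall>s\<in>{0..S}. (\<lambda>x. X x s) \<in> borel_measurable (filt s))"

lemma S: "0 < S" "S \<le> T" using t by (auto simp: S_def)
lemma dt_pos: "0 < dt a" using S by (simp add: dt_def)
lemma dt_full: "nd a (2 ^ a) = S" by (simp add: dt_def)
lemma node_range: "i \<le> 2 ^ a ==> 0 \<le> nd a i \<and> nd a i \<le> S"
proof -
 assume "i \<le> 2 ^ a"
 then have "real i \<le> real (2 ^ a)" by (subst of_nat_le_iff)
 then have "nd a i \<le> nd a (2 ^ a)" using dt_pos[of a] by (intro mult_right_mono) auto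
 then have "nd a i \<le> S" unfolding dt_full .
 then show ?thesis using dt_pos[of a] by simp
qed

lemma dt_0: "dt \<longlonglongrightarrow> 0"
 using LIMSEQ_divide_realpow_zero[of 2 S] by (simp add: dt_def[abs_def])

lemma flo: "0 \<le> s ==> 0 \<le> flo a s \<and> flo a s \<le> s \<and> s < flo a s + dt a"
 using grid_interval[OF dt_pos, of s a] dt_pos[of a] by (auto simp: flo_def algebra_simps)

lemma N0: "N0 \<in> null_sets M" "x \<in> space M ==> x \<notin> N0 ==> W 0 x = 0 \<and> continuous_on {0..T} (\<lambda>s. W s x)"
proof -
 have "AE x in M. W 0 x = 0 \<and> continuous_on {0..T} (\<lambda>s. W s x)" using W_0 W_continuous by eventually_elim simp
 then obtain N where "{x \<in> space M. \<not> (W 0 x = 0 \<and> continuous_on {0..T} (\<lambda>s. W s x))} \<subseteq> N" "N \<in> null_sets M"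
  unfolding eventually_ae_filter by blast
 then have "\<exists>N. N \<in> null_sets M \<and> (\<forall>x\<in>space M - N. W 0 x = 0 \<and> continuous_on {0..T} (\<lambda>s. W s x))" by blast
 from someI_ex[OF this, folded N0_def]
 show "N0 \<in> null_sets M" "x \<in> space M ==> x \<notin> N0 ==> W 0 x = 0 \<and> continuous_on {0..T} (\<lambda>s. W s x)" by auto
qed

lemma Wc_continuous: "x \<in> space M ==> continuous_on {0..T} (\<lambda>s. Wc s x)"
 using N0(2)[of x] by (cases "x \<in> N0") (auto simp: Wc_def)

lemma Wc_filt: "0 \<le> s ==> s \<le> r ==> Wc s \<in> borel_measurable (filt r)"
 unfolding Wc_def[abs_def] using null_sets_filt[OF N0(1), of r] W_filt[of s r]
  sets.sets_into_space[OF null_setsD2[OF N0(1)]]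
 by (intro measurable_If_set) (auto simp: Int_absorb2)

lemma procD: "proc X ==> x \<in> space M ==> X x \<in> path_space S" "proc X ==> x \<in> space M ==> X x \<in> path_space T"
 using path_space_mono[of "X x" S T] S by (auto simp: proc_def)

lemma proc_coord:
 assumes "proc X" "0 \<le> s" shows "(\<lambda>x. X x s) \<in> borel_measurable (filt s)"
proof (cases "s \<le> S")
 case False
 have "(\<lambda>x. X x S) \<in> borel_measurable (filt s)"
  by (rule measurable_filt_mono[of _ S]) (use assms S False in \<open>auto simp: proc_def\<close>)
 also have "?this \<longleftrightarrow> ?thesis" using False S
  by (intro measurable_cong path_space_ge[OF procD(1)[OF assms(1)], symmetric]) auto
 finally show ?thesis .
qed (use assms in \<open>auto simp: proc_def\<close>)

lemma proc_coordM: assumes "proc X" shows "(\<lambda>x. X x s) \<in> borel_measurable M"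
proof -
 have "(\<lambda>x. X x (max 0 (min s T))) \<in> borel_measurable M"
  by (rule measurable_filt_M[OF proc_coord[OF assms, of "max 0 (min s T)"]]) (use T_pos in auto)
 also have "?this \<longleftrightarrow> ?thesis"
  by (intro measurable_cong path_space_clamp[OF procD(2)[OF assms], symmetric]) auto
 finally show ?thesis .
qed

lemma pc_path: "v \<in> path_space T ==> path_concat T t w v \<in> path_space T"
 using t w by (intro path_concat_path_space) auto

lemma b_lip:
 assumes "0 \<le> s" "s \<le> S" "v \<in> path_space T" "v' \<in> path_space T" "\<And>r. 0 \<le> r ==> r \<le> s ==> norm (v r - v' r) \<le> e"
 shows "norm (b s v - b s v') \<le> lip * e"
 unfolding b_def
proof (rule sigma_lip)
 fix r assume r: "0 \<le> r" "r \<le> t + s"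
 have n: "v u = v' u" if "u \<le> 0" for u using path_space_neg[OF assms(3)] path_space_neg[OF assms(4)] T_pos that by simp
 have e: "norm (v (max 0 u) - v' (max 0 u)) \<le> e" if "u \<le> s" for u using assms(1) that by (intro assms(5)) auto
 have "path_concat T t w v r - path_concat T t w v' r = v (min r T - t) - v' (min r T - t)"
  using t w assms by (simp add: path_concat_eq)
 moreover have "norm (v (min r T - t) - v' (min r T - t)) \<le> e"
 proof (cases "min r T - t \<le> 0")
  case True
  then show ?thesis using n[OF True] n[of 0] e[of 0] assms(1) by simp
 next
  case False
  then have "max 0 (min r T - t) = min r T - t" "min r T - t \<le> s" using r(2) by linarith+
  then show ?thesis using e[of "min r T - t"] by simp
 qed
 ultimately show "norm (path_concat T t w v r - path_concat T t w v' r) \<le> e" by simp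
qed (use assms t pc_path in \<open>auto simp: S_def\<close>)

lemma b_continuous:
 assumes "v \<in> path_space T" shows "continuous_on {0..S} (\<lambda>s. b s v)"
 unfolding b_def
 by (rule continuous_on_compose2[OF sigma_time[OF pc_path[OF assms]]])
   (use t in \<open>auto simp: S_def intro!: continuous_intros\<close>)

text \<open>By the Lipschitz bound with distance 0 the coefficient at s does not see X after s.
  Hence X may be stopped at s, and the stopped path is measurable at time s.\<close>

lemma b_measurable:
 assumes "proc X" "0 \<le> s" "s \<le> S" shows "(\<lambda>x. b s (X x)) \<in> borel_measurable (filt s)"
proof -
 have "(\<lambda>x. stopped s (X x)) \<in> measurable (filt s) (canonical_filtration T T)"
 proof (rule measurable_cfI)
  show "stopped s (X x) \<in> path_space T" if "x \<in> space (filt s)" for x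
   using that assms T_pos procD(2)[OF assms(1)] by (intro stopped_path_space) auto
  show "(\<lambda>x. stopped s (X x) r) \<in> borel_measurable (filt s)" if "0 \<le> r" for r
   unfolding stopped_def using that assms by (intro measurable_filt_mono[OF proc_coord[OF assms(1)]]) auto
 qed
 then have "(\<lambda>x. b s (stopped s (X x))) \<in> borel_measurable (filt s)"
  unfolding b_def using assms t w by (intro sigma_measurable path_concat_const_measurable) (auto simp: S_def)
 also have "?this \<longleftrightarrow> ?thesis"
 proof (rule measurable_cong)
  fix x assume "x \<in> space (filt s)"
  then have x: "X x \<in> path_space T" using procD(2)[OF assms(1)] by simp
  note x = x stopped_path_space[OF x less_imp_le[OF T_pos] assms(2)]
  have "norm (b s (stopped s (X x)) - b s (X x)) \<le> lip * 0"
   by (rule b_lip[OF assms(2,3) x(2,1)]) (auto simp: stopped_def min_def)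
  then show "b s (stopped s (X x)) = b s (X x)" by simp
 qed
 finally show ?thesis .
qed

lemma elementary_b:
 assumes "proc X"
 shows "elementary filt S (2 ^ a) (\<lambda>k. nd a k) (\<lambda>k x. b (nd a k) (X x))"
 unfolding elementary_def
proof (intro conjI allI impI)
 show "mono_on {..2 ^ a} (\<lambda>k. nd a k)" using dt_pos[of a] by (auto intro!: mono_onI mult_right_mono)
 show "nd a k \<in> {0..S}" if "k \<le> 2 ^ a" for k using node_range[OF that] by simp
 show "(\<lambda>x. b (nd a k) (X x)) \<in> borel_measurable (filt (nd a k))" if "k < 2 ^ a" for k
  using node_range[of k a] that assms by (intro b_measurable) auto
qed

lemma J_proc: assumes "proc X" shows "proc (J a X)"
 unfolding proc_def
proof (intro conjI ballI)
 fix x assume x: "x \<in> space M"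
 show "J a X x \<in> path_space S"
 proof (rule path_spaceI)
  show "continuous_on {0..S} (J a X x)" unfolding J_def elementary_integral_def
  proof (intro continuous_intros)
   fix i assume "i \<in> {..<(2::nat) ^ a}"
   then have "0 \<le> nd a i" "nd a i \<le> T" "0 \<le> nd a (Suc i)" "nd a (Suc i) \<le> T"
    using node_range[of i a] node_range[of "Suc i" a] S by auto
   then have "continuous_on {0..S} (\<lambda>s. Wc (min (nd a (Suc i)) (max 0 s)) x)"
    "continuous_on {0..S} (\<lambda>s. Wc (min (nd a i) (max 0 s)) x)"
    by (intro continuous_on_compose2[OF Wc_continuous[OF x]] continuous_intros; auto simp: min_le_iff_disj)+
   then show "continuous_on {0..S} (\<lambda>s. b (nd a i) (X x) *v (Wc (min (nd a (Suc i)) (max 0 s)) x - Wc (min (nd a i) (max 0 s)) x))"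
    by (intro bounded_linear.continuous_on[OF matrix_vector_mul_bounded_linear] continuous_on_diff)
  qed
  show "J a X x s = 0" if "s \<le> 0" for s
   unfolding J_def elementary_integral_def using that dt_pos[of a]
   by (intro sum.neutral ballI) (simp add: max_absorb1 min_absorb2)
  show "J a X x s = J a X x S" if "S \<le> s" for s
   unfolding J_def elementary_integral_def
  proof (intro sum.cong refl)
   fix i assume "i \<in> {..<(2::nat) ^ a}"
   then have "nd a i \<le> S" "nd a (Suc i) \<le> S" using node_range[of i a] node_range[of "Suc i" a] by auto
   then show "b (nd a i) (X x) *v (Wc (min (nd a (Suc i)) (max 0 s)) x - Wc (min (nd a i) (max 0 s)) x) =
    b (nd a i) (X x) *v (Wc (min (nd a (Suc i)) (max 0 S)) x - Wc (min (nd a i) (max 0 S)) x)"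
    using that S by (simp add: min_absorb1 max_absorb2)
  qed
 qed (use S in auto)
next
 fix s assume s: "s \<in> {0..S}"
 show "(\<lambda>x. J a X x s) \<in> borel_measurable (filt s)"
  unfolding J_def elementary_integral_def
 proof (intro borel_measurable_sum)
  fix i assume i: "i \<in> {..<(2::nat) ^ a}"
  show "(\<lambda>x. b (nd a i) (X x) *v (Wc (min (nd a (Suc i)) (max 0 s)) x - Wc (min (nd a i) (max 0 s)) x)) \<in> borel_measurable (filt s)"
  proof (cases "nd a i \<le> s")
   case True
   then show ?thesis using s i node_range[of i a] node_range[of "Suc i" a] assms
    by (intro borel_measurable_mv borel_measurable_diff Wc_filt measurable_filt_mono[OF b_measurable]) auto
  next
   case False
   have "nd a i \<le> nd a (Suc i)" using dt_pos[of a] by (intro mult_right_mono) auto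
   then have "min (nd a (Suc i)) (max 0 s) = s" "min (nd a i) (max 0 s) = s" using False s by auto
   then show ?thesis by simp
  qed
 qed
qed

lemma J_eq: "x \<notin> N0 ==> 0 \<le> s ==> J a X x s = elementary_integral (*v) (2 ^ a) (\<lambda>k. nd a k) (\<lambda>k x. b (nd a k) (X x)) W s x"
 by (simp add: J_def elementary_integral_def Wc_def)

lemma flo_node:
 assumes "a \<le> c"
 shows "flo a (nd c i) = real (i div 2 ^ (c - a)) * dt a" "nd c (Suc i) \<le> real (Suc (i div 2 ^ (c - a))) * dt a"
proof -
 define m :: nat where "m = 2 ^ (c - a)"
 have m: "0 < m" by (simp add: m_def)
 have "(2::real) ^ c = 2 ^ (c - a) * 2 ^ a" using assms by (simp flip: power_add)
 then have d: "dt a = nd c m" by (simp add: dt_def m_def)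
 have "nd c i / dt a = real i / real m" using dt_pos[of c] m unfolding d by simp
 then have "nat \<lfloor>nd c i / dt a\<rfloor> = i div m" by (simp add: floor_divide_of_nat_eq)
 then show "flo a (nd c i) = real (i div 2 ^ (c - a)) * dt a" by (simp add: flo_def m_def)
 have "i < i div m * m + m" using mod_less_divisor[OF m, of i] div_mult_mod_eq[of i m] by linarith
 then have "Suc i \<le> Suc (i div m) * m" unfolding mult_Suc by linarith
 then have "real (Suc i) \<le> real (Suc (i div m)) * real m" by (metis of_nat_le_iff of_nat_mult)
 then have "nd c (Suc i) \<le> real (Suc (i div m)) * real m * dt c" using dt_pos[of c] by (intro mult_right_mono) auto
 then show "nd c (Suc i) \<le> real (Suc (i div 2 ^ (c - a))) * dt a" by (simp add: d m_def mult.assoc)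
qed

lemma refinement_level:
 assumes "a \<le> c" shows "refinement (2 ^ c) (\<lambda>i. nd c i) (2 ^ a) (\<lambda>i. nd a i)"
proof
 show "nd c i < nd c (Suc i)" for i using dt_pos[of c] by (intro mult_strict_right_mono) auto
 show "nd a k \<le> nd a (Suc k)" for k using dt_pos[of a] by (intro mult_right_mono) auto
 show "nd a k \<in> (\<lambda>i. nd c i) ` {..2 ^ c}" if "k \<le> 2 ^ a" for k
 proof (rule image_eqI)
  have e: "(2::nat) ^ c = 2 ^ (c - a) * 2 ^ a" using assms by (simp flip: power_add)
  have e': "(2::real) ^ c = 2 ^ (c - a) * 2 ^ a" using assms by (simp flip: power_add)
  show "nd a k = real (k * 2 ^ (c - a)) * dt c" by (simp add: dt_def e')
  show "k * 2 ^ (c - a) \<in> {..2 ^ c}" using that by (simp add: e)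
 qed
qed

lemma level_grid: "grid (2 ^ c) (\<lambda>i. nd c i)"
 unfolding grid_def using node_range[of _ c] S dt_pos[of c] by (auto intro!: mult_right_mono intro: order_trans simp del: of_nat_Suc)

lemma process_const:
 assumes "a \<le> c" "i < 2 ^ c"
 shows "elementary_process (2 ^ a) (\<lambda>k. nd a k) (\<lambda>k x. b (nd a k) (X x)) (nd c (Suc i)) x = b (flo a (nd c i)) (X x)"
proof -
 let ?k = "i div 2 ^ (c - a)"
 have e: "(2::nat) ^ c = 2 ^ (c - a) * 2 ^ a" using assms by (simp flip: power_add)
 have "?k < 2 ^ a" using assms(2) unfolding e by (simp add: div_less_iff_less_mult mult.commute)
 moreover have "real ?k * dt a < nd c (Suc i)"
  using flo_node(1)[OF assms(1), of i] flo[of "nd c i" a] dt_pos[of c] by (simp add: algebra_simps)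
 ultimately show ?thesis
  using flo_node[OF assms(1), of i] by (simp add: elementary_process_uniform dt_pos)
qed

definition diffc :: "nat => ('m => 'd path) => nat => ('m => 'd path) => nat => nat => 'm => real ^ 'd ^ 'd" where
 "diffc a X a' Y c i x = b (flo a (nd c i)) (X x) - b (flo a' (nd c i)) (Y x)"

lemma diffc_measurable:
 assumes "proc X" "proc Y" "i < 2 ^ c"
 shows "diffc a X a' Y c i \<in> borel_measurable (filt (nd c i))"
 unfolding diffc_def[abs_def] using node_range[of i c] assms flo[of "nd c i" a] flo[of "nd c i" a']
 by (intro borel_measurable_diff measurable_filt_mono[OF b_measurable]) auto

lemma J_node_single:
 assumes "a \<le> c" "x \<notin> N0" "k \<le> 2 ^ c"
 shows "J a X x (nd c k) = step_integral (\<lambda>i. nd c i) (\<lambda>i x. b (flo a (nd c i)) (X x)) k x"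
proof -
 have 0: "0 \<le> nd c k" using dt_pos[of c] by simp
 show ?thesis
  unfolding J_eq[OF assms(2) 0] elementary_integral_refine[OF refinement_level[OF assms(1)] assms(3)]
  unfolding step_integral_def using assms(3) by (intro sum.cong refl) (simp add: process_const[OF assms(1)] del: of_nat_Suc)
qed

lemma J_node:
 assumes "a \<le> c" "a' \<le> c" "x \<notin> N0" "k \<le> 2 ^ c"
 shows "J a X x (nd c k) - J a' Y x (nd c k) = step_integral (\<lambda>i. nd c i) (diffc a X a' Y c) k x"
 unfolding J_node_single[OF assms(1,3,4)] J_node_single[OF assms(2-4)] diffc_def[abs_def]
 by (rule step_integral_diff[symmetric])

text \<open>Only dyadic nodes enter, which keeps the maximum measurable and lets it be expressed by
  step integrals. All times are reached by raising the level c.\<close>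

definition gap :: "nat => ('m => 'd path) => ('m => 'd path) => nat => 'm => real" where
 "gap c X Y i x = runmax (\<lambda>j. norm (X x (nd c j) - Y x (nd c j))) i"

lemma gap_nonneg: "0 \<le> gap c X Y i x" unfolding gap_def by (intro runmax_nonneg) simp

lemma gap_measurable: "proc X ==> proc Y ==> gap c X Y i \<in> borel_measurable M"
 unfolding gap_def[abs_def] by (intro runmax_measurable measurable_compose[OF borel_measurable_diff borel_measurable_norm] proc_coordM)

lemma gap_J:
 assumes "a \<le> c" "a' \<le> c" "x \<notin> N0" "i \<le> 2 ^ c"
 shows "gap c (J a X) (J a' Y) i x = runmax (\<lambda>k. norm (step_integral (\<lambda>i. nd c i) (diffc a X a' Y c) k x)) i"
 unfolding gap_def using assms by (intro runmax_cong) (simp add: J_node)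

lemma flo_tendsto: "0 \<le> s ==> (\<lambda>c. flo c s) \<longlonglongrightarrow> s"
proof (rule tendsto_sandwich[where f = "\<lambda>c. s - dt c" and h = "\<lambda>_. s"])
 show "(\<lambda>c. s - dt c) \<longlonglongrightarrow> s" using tendsto_diff[OF tendsto_const dt_0, of s] by simp
qed (use flo in \<open>auto intro!: always_eventually less_imp_le simp: diff_less_eq\<close>)

text \<open>Nodes obtained by rounding s down converge to s and do not exceed it, so bounds at nodes
  up to s pass to s by continuity.\<close>

lemma dense_bound:
 assumes "continuous_on {0..S} f" "0 \<le> s" "s \<le> S" "\<And>c i. c0 \<le> c ==> nd c i \<le> s ==> norm (f (nd c i)) \<le> e"
 shows "norm (f s) \<le> e"
proof (rule tendsto_upperbound)
 have "(\<lambda>c. f (flo c s)) \<longlonglongrightarrow> f s"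
  by (rule continuous_on_tendsto_compose[OF assms(1) flo_tendsto[OF assms(2)]])
   (use assms(2,3) flo[OF assms(2)] in \<open>auto intro!: always_eventually intro: order_trans[of _ s S]\<close>)
 then show "(\<lambda>c. norm (f (flo c s))) \<longlonglongrightarrow> norm (f s)" by (rule tendsto_norm)
 show "\<forall>\<^sub>F c in sequentially. norm (f (flo c s)) \<le> e"
  using eventually_ge_at_top[of c0]
 proof eventually_elim
  case (elim c)
  show ?case using flo[OF assms(2), of c] unfolding flo_def by (intro assms(4) elim) blast
 qed
qed simp

lemma gap_mono_level:
 assumes "c \<le> c'" shows "gap c X Y i x \<le> gap c' X Y (i * 2 ^ (c' - c)) x"
 unfolding gap_def runmax_le_iff
proof (intro allI impI)
 fix j assume j: "j \<le> i"
 have e: "(2::real) ^ c' = 2 ^ (c' - c) * 2 ^ c" using assms by (simp flip: power_add)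
 have eq: "nd c j = real (j * 2 ^ (c' - c)) * dt c'" by (simp add: dt_def e)
 show "norm (X x (nd c j) - Y x (nd c j)) \<le>
   runmax (\<lambda>j. norm (X x (nd c' j) - Y x (nd c' j))) (i * 2 ^ (c' - c))"
  unfolding eq by (rule runmax_ge[where f = "\<lambda>j. norm (X x (nd c' j) - Y x (nd c' j))"]) (use j in simp)
qed

lemma gap_bound_all:
 assumes "proc X" "proc Y" "x \<in> space M" "\<And>c. c0 \<le> c ==> gap c X Y (2 ^ c) x \<le> e"
 shows "norm (X x s - Y x s) \<le> e"
proof -
 have s: "X x s = X x (max 0 (min s S))" "Y x s = Y x (max 0 (min s S))"
  using path_space_clamp procD(1) assms by metis+
 have "norm (X x (max 0 (min s S)) - Y x (max 0 (min s S))) \<le> e"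
 proof (rule dense_bound)
  show "continuous_on {0..S} (\<lambda>s. X x s - Y x s)"
   by (intro continuous_on_diff path_space_continuous[OF procD(1)[OF assms(1,3)]]
     path_space_continuous[OF procD(1)[OF assms(2,3)]] less_imp_le[OF S(1)])
  fix c i assume c: "c0 \<le> c" "nd c i \<le> max 0 (min s S)"
  then have "nd c i \<le> nd c (2 ^ c)" unfolding dt_full using S by auto
  then have "real i \<le> real (2 ^ c)" using dt_pos[of c] by (simp only: mult_le_cancel_right_pos)
  then have "i \<le> 2 ^ c" by (simp only: of_nat_le_iff)
  then show "norm (X x (nd c i) - Y x (nd c i)) \<le> e"
   using assms(4)[OF c(1)] unfolding gap_def runmax_le_iff by auto
 qed (use S in auto)
 then show ?thesis using s by simp
qed

text \<open>Continuity from below: the level-dependent error v c vanishes in the limit and p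
  remains.\<close>

lemma prob_Union_levels:
 assumes "\<And>c. B c \<in> events" "\<And>c. c0 \<le> c ==> B c \<subseteq> B (Suc c)" "\<And>c. c0 \<le> c ==> prob (B c) \<le> p + v c" "v \<longlonglongrightarrow> 0"
 shows "prob (\<Union>c\<in>{c0..}. B c) \<le> p"
proof -
 have "(\<lambda>n. prob (B (n + c0))) \<longlonglongrightarrow> prob (\<Union>n. B (n + c0))"
 proof (rule finite_Lim_measure_incseq)
  show "incseq (\<lambda>n. B (n + c0))" by (rule incseq_SucI) (use assms(2)[of "_ + c0"] in simp)
 qed (use assms(1) in auto)
 moreover have "(\<lambda>n. p + v (n + c0)) \<longlonglongrightarrow> p + 0" by (intro tendsto_intros LIMSEQ_ignore_initial_segment assms(4))
 ultimately have "prob (\<Union>n. B (n + c0)) \<le> p + 0" by (rule LIMSEQ_le) (use assms(3) in auto)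
 moreover have "(\<Union>n. B (n + c0)) = (\<Union>c\<in>{c0..}. B c)"
 proof safe
  fix x c assume "x \<in> B c" "c0 \<le> c"
  then show "x \<in> (\<Union>n. B (n + c0))" by (intro UN_I[of "c - c0"]) auto
 next
  fix x n assume "x \<in> B (n + c0)"
  then show "x \<in> (\<Union>c\<in>{c0..}. B c)" by (intro UN_I[of "n + c0"]) auto
 qed
 ultimately show ?thesis by simp
qed

text \<open>\<open>step_gronwall\<close> on the grid of level c gives a bound independent of c, up
  to v c. The events that the gap exceeds e increase with c, so their union obeys the bound without
  v, and off it the two paths are close at all times.\<close>

lemma J_compare:
 assumes "proc X" "proc Y" "0 \<le> L" "0 < \<eta>" "0 < e" "\<And>c. U c \<in> events" "\<And>c. prob (U c) \<le> p + v c" "v \<longlonglongrightarrow> 0"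
  "\<And>c i x. x \<in> space M ==> x \<notin> U c ==> a \<le> c ==> a' \<le> c ==> i < 2 ^ c ==> norm (diffc a X a' Y c i x) \<le> L * gap c (J a X) (J a' Y) i x + \<eta>"
 obtains V where "V \<in> events" "prob V \<le> p + \<eta>^2 * exp (8 * (L^2 + 1) * T) / e^2"
  "\<And>x s. x \<in> space M ==> x \<notin> V ==> norm (J a X x s - J a' Y x s) \<le> e"
proof -
 let ?q = "\<eta>^2 * exp (8 * (L^2 + 1) * T) / e^2"
 define B where "B c = {x\<in>space M. e < gap c (J a X) (J a' Y) (2 ^ c) x}" for c
 note JX = J_proc[OF assms(1)] J_proc[OF assms(2)]
 have [measurable]: "gap c (J a X) (J a' Y) i \<in> borel_measurable M" for c i by (rule gap_measurable[OF JX])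
 have Bm: "B c \<in> events" for c unfolding B_def by measurable
 have "prob (\<Union>c\<in>{max a a'..}. B c) \<le> p + ?q"
 proof (rule prob_Union_levels[OF Bm _ _ assms(8)])
  fix c assume c: "max a a' \<le> c"
  then have ac: "a \<le> c" "a' \<le> c" by auto
  have "gap c (J a X) (J a' Y) (2 ^ c) x \<le> gap (Suc c) (J a X) (J a' Y) (2 ^ Suc c) x" for x
   using gap_mono_level[of c "Suc c" "J a X" "J a' Y" "2 ^ c" x] by (simp add: mult.commute)
  then show "B c \<subseteq> B (Suc c)" unfolding B_def by (auto intro: less_le_trans)
  define Z where "Z i x = runmax (\<lambda>k. norm (step_integral (\<lambda>i. nd c i) (diffc a X a' Y c) k x)) i" for i x
  let ?r = "\<lambda>i. nd c i"
  let ?bad = "{x\<in>space M. \<exists>i<2 ^ c. ?r i < ?r (Suc i) \<and> L * Z i x + \<eta> < norm (diffc a X a' Y c i x)}"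
  have GZ: "gap c (J a X) (J a' Y) i x = Z i x" if "x \<notin> N0" "i \<le> 2 ^ c" for i x
   unfolding Z_def by (rule gap_J[OF ac that])
  have Zm: "{x\<in>space M. e \<le> Z (2 ^ c) x} \<in> events"
  proof -
   have [measurable]: "Z (2 ^ c) \<in> borel_measurable M" unfolding Z_def[abs_def]
    by (intro runmax_measurable measurable_compose[OF step_integral_measurable[OF level_grid diffc_measurable[OF assms(1,2)]] borel_measurable_norm])
   show ?thesis by measurable
  qed
  have UN: "U c \<union> N0 \<in> events" "prob (U c \<union> N0) \<le> p + v c"
   using assms(6,7)[of c] N0(1) measure_Un_null_set[OF assms(6) N0(1)] by auto
  have "prob (B c) \<le> prob (N0 \<union> {x\<in>space M. e \<le> Z (2 ^ c) x})"
   using Zm N0(1) GZ by (intro finite_measure_mono sets.Un) (auto simp: B_def intro: less_imp_le)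
  also have "... = prob {x\<in>space M. e \<le> Z (2 ^ c) x}"
   using measure_Un_null_set[OF Zm N0(1)] by (simp add: Un_commute)
  also have "... \<le> prob ?bad + ?q"
   unfolding Z_def by (rule step_gronwall[OF level_grid diffc_measurable[OF assms(1,2)] assms(3-5)])
  also have "prob ?bad \<le> prob (U c \<union> N0)"
  proof (rule finite_measure_mono[OF _ UN(1)], rule subsetI)
   fix x assume "x \<in> ?bad"
   then obtain i where i: "x \<in> space M" "i < 2 ^ c" "L * Z i x + \<eta> < norm (diffc a X a' Y c i x)" by auto
   show "x \<in> U c \<union> N0"
   proof (rule ccontr)
    assume "x \<notin> U c \<union> N0"
    then show False using assms(9)[OF i(1) _ ac i(2)] GZ[of x i] i by auto
   qed
  qed
  finally show "prob (B c) \<le> p + ?q + v c" using UN(2) by simp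
 qed
 moreover have "(\<Union>c\<in>{max a a'..}. B c) \<in> events" using Bm by auto
 moreover have "norm (J a X x s - J a' Y x s) \<le> e" if "x \<in> space M" "x \<notin> (\<Union>c\<in>{max a a'..}. B c)" for x s
  using that by (intro gap_bound_all[OF JX, of x "max a a'"]) (auto simp: B_def not_less)
 ultimately show ?thesis using that by blast
qed

end

section \<open>Picard iteration with frozen coefficients\<close>

context sde_start
begin

primrec pic :: "nat => nat => 'm => 'd path" where
 "pic a 0 = (\<lambda>_ _. 0)"
| "pic a (Suc k) = J a (pic a k)"

lemma pic_proc: "proc (pic a k)"
 by (induction k) (auto simp: J_proc, auto simp: proc_def path_space_zero)

lemma node_shift: "real (i * 2 ^ m) * dt (c + m) = nd c i"
 by (simp add: dt_def power_add)

lemma node_index_le: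
 assumes "nd c i \<le> nd c k" shows "i \<le> k"
proof -
 have "real i \<le> real k" using assms dt_pos[of c] by (simp only: mult_le_cancel_right_pos)
 then show ?thesis by simp
qed

lemma proc_diff_bound:
 assumes "proc X" "proc Y" "x \<in> space M" "0 \<le> s" "s \<le> nd c i" "i \<le> 2 ^ c"
  "\<And>m. gap (c + m) X Y (i * 2 ^ m) x \<le> e"
 shows "norm (X x s - Y x s) \<le> e"
proof (rule dense_bound[of "\<lambda>s. X x s - Y x s" s c])
 show "continuous_on {0..S} (\<lambda>s. X x s - Y x s)"
  by (intro continuous_on_diff path_space_continuous[OF procD(1)[OF assms(1,3)]]
    path_space_continuous[OF procD(1)[OF assms(2,3)]] less_imp_le[OF S(1)])
 show "s \<le> S" using node_range[OF assms(6)] assms(5) by linarith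
 fix c' j assume c': "c \<le> c'" "nd c' j \<le> s"
 obtain m where m: "c' = c + m" using c'(1) le_Suc_ex by blast
 have "nd c' j \<le> nd c' (i * 2 ^ m)" unfolding m node_shift using c'(2) assms(5) m by simp
 then have "j \<le> i * 2 ^ m" by (rule node_index_le)
 then show "norm (X x (nd c' j) - Y x (nd c' j)) \<le> e"
  using assms(7)[of m] unfolding gap_def runmax_le_iff m by auto
qed (use assms in auto)

text \<open>The Lipschitz bound asks for the distance of X and Y on a whole interval, whereas
  \<open>gap\<close> sees finitely many nodes. The supremum over finer levels with the same end time
  closes this gap and is accessible to monotone convergence.\<close>

lemma ennreal_diffc_SUP:
 assumes "proc X" "proc Y" "x \<in> space M" "i < 2 ^ c"
 shows "ennreal ((norm (diffc a X a Y c i x))^2)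
   \<le> ennreal ((lip + 1)^2) * (SUP m. ennreal ((gap (c + m) X Y (i * 2 ^ m) x)^2))"
proof (cases "(SUP m. ennreal ((gap (c + m) X Y (i * 2 ^ m) x)^2)) = \<infinity>")
 case True
 \<comment> \<open>lip + 1 replaces lip because the factor has to be positive for its product with
   infinity to be infinite.\<close>
 have "0 < (lip + 1)^2" using lip(1) by simp
 then show ?thesis unfolding True by (simp add: ennreal_mult_top ennreal_eq_0_iff not_le)
next
 case False
 then obtain u where u: "0 \<le> u" "(SUP m. ennreal ((gap (c + m) X Y (i * 2 ^ m) x)^2)) = ennreal u"
  by (cases "SUP m. ennreal ((gap (c + m) X Y (i * 2 ^ m) x)^2)" rule: ennreal_cases) auto
 have g: "gap (c + m) X Y (i * 2 ^ m) x \<le> sqrt u" for m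
 proof -
  have "ennreal ((gap (c + m) X Y (i * 2 ^ m) x)^2) \<le> ennreal u" unfolding u(2)[symmetric] by (rule SUP_upper) simp
  then show ?thesis using u(1) by (simp add: real_le_rsqrt)
 qed
 have fl: "0 \<le> flo a (nd c i)" "flo a (nd c i) \<le> nd c i" "nd c i \<le> S"
  using flo[of "nd c i" a] node_range[of i c] assms(4) by auto
 have "norm (diffc a X a Y c i x) \<le> lip * sqrt u" unfolding diffc_def
  using fl g assms by (intro b_lip procD(2) proc_diff_bound[of X Y x _ i c]) auto
 also have "... \<le> (lip + 1) * sqrt u" using u(1) by (intro mult_right_mono) auto
 finally have "(norm (diffc a X a Y c i x))^2 \<le> ((lip + 1) * sqrt u)^2" by (intro power_mono) auto
 also have "... = (lip + 1)^2 * u" using u(1) by (simp add: power_mult_distrib)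
 finally show ?thesis unfolding u(2) using u(1) by (simp add: ennreal_mult[symmetric] ennreal_leI)
qed

text \<open>A left Riemann sum of an increasing exponential, bounded step by step with 1 + x \<le>
  exp x.\<close>

lemma exp_sum_le:
 assumes "0 \<le> l" shows "l * (\<Sum>j<i. dt c * exp (l * (nd c j))) \<le> exp (l * (nd c i))"
proof (induction i)
 case (Suc i)
 have "l * (\<Sum>j<Suc i. dt c * exp (l * (nd c j))) \<le> exp (l * (nd c i)) * (1 + l * dt c)"
  using Suc by (simp add: algebra_simps)
 also have "... \<le> exp (l * (nd c i)) * exp (l * dt c)" by (intro mult_left_mono) auto
 also have "... = exp (l * (nd c (Suc i)))" by (simp add: exp_add[symmetric] algebra_simps)
 finally show ?case .
qed simp

lemma gap_nn_integral:
 assumes "\<And>i. i < 2 ^ c ==> D i \<in> borel_measurable (filt (nd c i))"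
  "\<And>x. x \<in> space M ==> x \<notin> N0 ==> gap c X Y i x = runmax (\<lambda>k. norm (step_integral (\<lambda>i. nd c i) D k x)) i"
  "\<And>j. j < i ==> (\<integral>\<^sup>+x. ennreal ((norm (D j x))^2) \<partial>M) \<le> ennreal (B j)" "\<And>j. 0 \<le> B j" "i \<le> 2 ^ c"
 shows "(\<integral>\<^sup>+x. ennreal ((gap c X Y i x)^2) \<partial>M) \<le> ennreal (4 * (\<Sum>j<i. dt c * B j))"
proof -
 have "(\<integral>\<^sup>+x. ennreal ((gap c X Y i x)^2) \<partial>M) = (\<integral>\<^sup>+x. ennreal ((runmax (\<lambda>k. norm (step_integral (\<lambda>i. nd c i) D k x)) i)^2) \<partial>M)"
  using AE_not_in[OF N0(1)] assms(2) by (intro nn_integral_cong_AE) auto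
 also have "... \<le> 4 * (\<Sum>j<i. ennreal (nd c (Suc j) - nd c j) * (\<integral>\<^sup>+x. ennreal ((norm (D j x))^2) \<partial>M))"
  using assms(1,5) by (intro step_maximal grid_less[OF level_grid]) auto
 also have "... \<le> 4 * (\<Sum>j<i. ennreal (dt c) * ennreal (B j))"
  using assms(3) by (intro mult_left_mono sum_mono mult_mono ennreal_leI) (auto simp: algebra_simps)
 also have "... = ennreal (4 * (\<Sum>j<i. dt c * B j))"
 proof -
  have "(\<Sum>j<i. ennreal (dt c) * ennreal (B j)) = ennreal (\<Sum>j<i. dt c * B j)"
   using dt_pos[of c] assms(4) by (subst sum_ennreal[symmetric]) (auto simp: ennreal_mult less_imp_le)
  then show ?thesis by (subst ennreal_mult') auto
 qed
 finally show ?thesis .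
qed

text \<open>Contraction with respect to the weight exp (l s). The bound is uniform in the freezing
  level a, so that the number of iterations can be fixed before the level.\<close>

lemma pic_contraction:
 obtains A l where "0 \<le> A" "0 \<le> l" "\<And>a k c i. a \<le> c ==> i \<le> 2 ^ c ==>
   (\<integral>\<^sup>+x. ennreal ((gap c (pic a (Suc k)) (pic a k) i x)^2) \<partial>M) \<le> ennreal (A * (1/16) ^ k * exp (l * (nd c i)))"
proof -
 have "bounded ((\<lambda>s. b s (\<lambda>_. 0)) ` {0..S})"
  by (intro compact_imp_bounded compact_continuous_image b_continuous path_space_zero) auto
 then obtain K0 where "\<forall>y\<in>(\<lambda>s. b s (\<lambda>_. 0)) ` {0..S}. norm y \<le> K0" unfolding bounded_iff by (rule exE)
 then have K0: "norm (b s (\<lambda>_. 0)) \<le> K0" if "0 \<le> s" "s \<le> S" for s using that by auto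
 define A where "A = 4 * S * K0^2"
 \<comment> \<open>64 = 4 * 16: the factor 4 of the maximal inequality and the gain 1/16 aimed at in
   each iteration; the squared factor comes from \<open>ennreal_diffc_SUP\<close>.\<close>
 define l where "l = 64 * (lip + 1)^2"
 have A: "0 \<le> A" using S by (simp add: A_def)
 have l: "0 < l" using lip(1) by (simp add: l_def)
 have "\<forall>c i. a \<le> c \<longrightarrow> i \<le> 2 ^ c \<longrightarrow>
   (\<integral>\<^sup>+x. ennreal ((gap c (pic a (Suc k)) (pic a k) i x)^2) \<partial>M) \<le> ennreal (A * (1/16) ^ k * exp (l * (nd c i)))" for a k
 proof (induction k)
  case 0
  show ?case
  proof (intro allI impI)
   fix c i :: nat assume c: "a \<le> c" "i \<le> 2 ^ c"
   let ?D = "\<lambda>i (x :: 'm). b (flo a (nd c i)) (\<lambda>_. 0)"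
   have "(\<integral>\<^sup>+x. ennreal ((gap c (pic a (Suc 0)) (pic a 0) i x)^2) \<partial>M) \<le> ennreal (4 * (\<Sum>j<i. dt c * K0^2))"
   proof (rule gap_nn_integral[where D = ?D])
    fix x assume "x \<notin> N0"
    then show "gap c (pic a (Suc 0)) (pic a 0) i x = runmax (\<lambda>k. norm (step_integral (\<lambda>i. nd c i) ?D k x)) i"
     unfolding gap_def using c by (intro runmax_cong) (simp add: J_node_single)
   next
    fix j assume j: "j < i"
    have "norm (b (flo a (nd c j)) (\<lambda>_. 0)) \<le> K0"
     using flo[of "nd c j" a] node_range[of j c] j c by (intro K0) auto
    then have "ennreal ((norm (b (flo a (nd c j)) (\<lambda>_. 0)))^2) \<le> ennreal (K0^2)" by (intro ennreal_leI power_mono) auto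
    then show "(\<integral>\<^sup>+x. ennreal ((norm (?D j x))^2) \<partial>M) \<le> ennreal (K0^2)" by (simp add: emeasure_space_1)
   qed (use c in auto)
   also have "4 * (\<Sum>j<i. dt c * K0^2) \<le> A * (1/16) ^ 0 * exp (l * (nd c i))"
   proof -
    have nr: "0 \<le> nd c i" "nd c i \<le> S" using node_range[OF c(2)] by auto
    have "4 * (\<Sum>j<i. dt c * K0^2) = 4 * (nd c i) * K0^2" by simp
    also have "... \<le> A * 1" unfolding A_def using nr by (simp add: mult_right_mono)
    also have "... \<le> A * exp (l * (nd c i))" using A nr l by (intro mult_left_mono) auto
    finally show ?thesis by simp
   qed
   finally show "(\<integral>\<^sup>+x. ennreal ((gap c (pic a (Suc 0)) (pic a 0) i x)^2) \<partial>M) \<le> ennreal (A * (1/16) ^ 0 * exp (l * (nd c i)))"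
    by (simp add: ennreal_leI)
  qed
 next
  case (Suc k)
  show ?case
  proof (intro allI impI)
   fix c i :: nat assume c: "a \<le> c" "i \<le> 2 ^ c"
   let ?X = "pic a (Suc k)" and ?Y = "pic a k"
   define B where "B j = (lip + 1)^2 * (A * (1/16) ^ k * exp (l * (nd c j)))" for j
   have "(\<integral>\<^sup>+x. ennreal ((gap c (pic a (Suc (Suc k))) (pic a (Suc k)) i x)^2) \<partial>M) \<le> ennreal (4 * (\<Sum>j<i. dt c * B j))"
   proof (rule gap_nn_integral[where D = "diffc a ?X a ?Y c"])
    show "diffc a ?X a ?Y c i \<in> borel_measurable (filt (nd c i))" if "i < 2 ^ c" for i
     by (rule diffc_measurable[OF pic_proc pic_proc that])
    show "gap c (pic a (Suc (Suc k))) (pic a (Suc k)) i x = runmax (\<lambda>k'. norm (step_integral (\<lambda>i. nd c i) (diffc a ?X a ?Y c) k' x)) i" if "x \<notin> N0" for x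
     using gap_J[OF c(1) c(1) that c(2), of ?X ?Y] by simp
    fix j assume j: "j < i"
    let ?g = "\<lambda>m x. ennreal ((gap (c + m) ?X ?Y (j * 2 ^ m) x)^2)"
    have gm: "?g m \<in> borel_measurable M" for m
     using gap_measurable[OF pic_proc pic_proc, of "c + m" a "Suc k" a k "j * 2 ^ m"] by measurable
    have "(\<integral>\<^sup>+x. ennreal ((norm (diffc a ?X a ?Y c j x))^2) \<partial>M) \<le> (\<integral>\<^sup>+x. ennreal ((lip + 1)^2) * (SUP m. ?g m x) \<partial>M)"
     using j c by (intro nn_integral_mono ennreal_diffc_SUP pic_proc) auto
    also have "... = ennreal ((lip + 1)^2) * (\<integral>\<^sup>+x. (SUP m. ?g m x) \<partial>M)"
     using gm by (intro nn_integral_cmult) auto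
    also have "(\<integral>\<^sup>+x. (SUP m. ?g m x) \<partial>M) = (SUP m. \<integral>\<^sup>+x. ?g m x \<partial>M)"
    proof (rule nn_integral_monotone_convergence_SUP)
     show "incseq ?g"
     proof (rule incseq_SucI, rule le_funI)
      fix m x
      have "gap (c + m) ?X ?Y (j * 2 ^ m) x \<le> gap (c + Suc m) ?X ?Y (j * 2 ^ Suc m) x"
      proof -
       have e: "j * 2 ^ m * 2 ^ (c + Suc m - (c + m)) = j * 2 ^ Suc m" by simp
       show ?thesis by (rule gap_mono_level[of "c + m" "c + Suc m" ?X ?Y "j * 2 ^ m" x, unfolded e]) simp
      qed
      then show "?g m x \<le> ?g (Suc m) x" by (intro ennreal_leI power_mono gap_nonneg)
     qed
    qed (rule gm)
    also have "(SUP m. \<integral>\<^sup>+x. ?g m x \<partial>M) \<le> ennreal (A * (1/16) ^ k * exp (l * (nd c j)))"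
    proof (rule SUP_least)
     fix m
     have "j * 2 ^ m \<le> 2 ^ (c + m)" using j c by (simp add: power_add)
     with Suc.IH[rule_format, of "c + m" "j * 2 ^ m"] c(1)
     show "(\<integral>\<^sup>+x. ?g m x \<partial>M) \<le> ennreal (A * (1/16) ^ k * exp (l * (nd c j)))" unfolding node_shift by simp
    qed
    finally show "(\<integral>\<^sup>+x. ennreal ((norm (diffc a ?X a ?Y c j x))^2) \<partial>M) \<le> ennreal (B j)"
     unfolding B_def using A by (simp add: ennreal_mult mult_left_mono)
   qed (use c A in \<open>auto simp: B_def\<close>)
   also have "4 * (\<Sum>j<i. dt c * B j) = A * (1/16) ^ Suc k * (l * (\<Sum>j<i. dt c * exp (l * (nd c j))))"
    unfolding B_def l_def by (simp add: sum_distrib_left algebra_simps)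
   also have "ennreal ... \<le> ennreal (A * (1/16) ^ Suc k * exp (l * (nd c i)))"
    using A l by (intro ennreal_leI mult_left_mono exp_sum_le) auto
   finally show "(\<integral>\<^sup>+x. ennreal ((gap c (pic a (Suc (Suc k))) (pic a (Suc k)) i x)^2) \<partial>M) \<le> ennreal (A * (1/16) ^ Suc k * exp (l * (nd c i)))" .
  qed
 qed
 then show ?thesis using that[of A l] A l by auto
qed

lemma markov_sq:
 assumes "f \<in> borel_measurable M" "\<And>x. 0 \<le> f x" "0 < e" "(\<integral>\<^sup>+x. ennreal ((f x)^2) \<partial>M) \<le> ennreal B" "0 \<le> B"
 shows "prob {x\<in>space M. e < f x} \<le> B / e^2"
proof -
 have m: "{x\<in>space M. e < f x} \<in> events" using assms(1) by measurable
 have "ennreal (e^2) * emeasure M {x\<in>space M. e < f x} = (\<integral>\<^sup>+x. ennreal (e^2) * indicator {x\<in>space M. e < f x} x \<partial>M)"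
  using m by (simp add: nn_integral_cmult_indicator)
 also have "... \<le> (\<integral>\<^sup>+x. ennreal ((f x)^2) \<partial>M)"
  using assms(3) by (intro nn_integral_mono) (auto simp: indicator_def intro!: ennreal_leI power_mono)
 finally have "ennreal (e^2 * prob {x\<in>space M. e < f x}) \<le> ennreal B"
  using assms(4) by (simp add: emeasure_eq_measure ennreal_mult)
 then have "e^2 * prob {x\<in>space M. e < f x} \<le> B" using assms(5) by simp
 then show ?thesis using assms(3) by (simp add: field_simps)
qed

text \<open>Markov's inequality applied to the geometric bound; k depends on e but not on the level
  a.\<close>

lemma pic_close:
 assumes "0 < e"
 obtains k where "\<And>a. \<exists>V\<in>events. prob V < e \<and> (\<forall>x\<in>space M - V. \<forall>s. norm (pic a (Suc k) x s - pic a k x s) \<le> e)"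
proof -
 obtain A l where A: "0 \<le> A" "0 \<le> l" "\<And>a k c i. a \<le> c ==> i \<le> 2 ^ c ==>
   (\<integral>\<^sup>+x. ennreal ((gap c (pic a (Suc k)) (pic a k) i x)^2) \<partial>M) \<le> ennreal (A * (1/16) ^ k * exp (l * (nd c i)))"
  using pic_contraction by blast
 have "(\<lambda>k. A * (1/16) ^ k * exp (l * S) / e^2) \<longlonglongrightarrow> A * 0 * exp (l * S) / e^2"
  by (intro tendsto_intros LIMSEQ_power_zero) (use assms in auto)
 then have "\<forall>\<^sub>F k in sequentially. A * (1/16) ^ k * exp (l * S) / e^2 < e"
  using order_tendstoD(2)[of _ 0 sequentially e] assms by simp
 then obtain k where k: "A * (1/16) ^ k * exp (l * S) / e^2 < e" by (auto dest: eventually_happens)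
 have "\<exists>V\<in>events. prob V < e \<and> (\<forall>x\<in>space M - V. \<forall>s. norm (pic a (Suc k) x s - pic a k x s) \<le> e)" for a
 proof -
  let ?X = "pic a (Suc k)" and ?Y = "pic a k"
  note gm = gap_measurable[OF pic_proc[of a "Suc k"] pic_proc[of a k]]
  define B where "B c = {x\<in>space M. e < gap c ?X ?Y (2 ^ c) x}" for c
  have Bm: "B c \<in> events" for c unfolding B_def using gm[of c "2 ^ c"] by measurable
  have "prob (\<Union>c\<in>{a..}. B c) \<le> A * (1/16) ^ k * exp (l * S) / e^2"
  proof (rule prob_Union_levels[where v = "\<lambda>_. 0", OF Bm])
   fix c assume c: "a \<le> c"
   have "gap c ?X ?Y (2 ^ c) x \<le> gap (Suc c) ?X ?Y (2 ^ Suc c) x" for x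
    using gap_mono_level[of c "Suc c" ?X ?Y "2 ^ c" x] by (simp add: mult.commute)
   then show "B c \<subseteq> B (Suc c)" unfolding B_def by (auto intro: less_le_trans)
   show "prob (B c) \<le> A * (1/16) ^ k * exp (l * S) / e^2 + 0"
    unfolding B_def using markov_sq[OF gm gap_nonneg assms A(3)[OF c order_refl]] A(1) by (simp only: dt_full) simp
  qed simp
  moreover have "(\<Union>c\<in>{a..}. B c) \<in> events" using Bm by auto
  moreover have "norm (?X x s - ?Y x s) \<le> e" if "x \<in> space M" "x \<notin> (\<Union>c\<in>{a..}. B c)" for x s
   using that by (intro gap_bound_all[OF pic_proc pic_proc, of x a]) (auto simp: B_def not_less)
  ultimately show ?thesis using k by (intro bexI[of _ "\<Union>c\<in>{a..}. B c"]) auto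
 qed
 then show ?thesis using that by blast
qed

text \<open>Along each path of the fixed process Q the coefficient is uniformly continuous in time,
  so every sample leaves the event of a large freezing error as the mesh decreases. Quantifying over
  dyadic nodes keeps that event measurable.\<close>

lemma freeze_coefficient:
 assumes "proc Q" "0 < e"
 obtains a0 where "\<And>a. a0 \<le> a ==> \<exists>U\<in>events. prob U < e \<and>
  (\<forall>x\<in>space M - U. \<forall>c. \<forall>i\<le>2 ^ c. norm (b (flo a (nd c i)) (Q x) - b (nd c i) (Q x)) \<le> e)"
proof -
let ?d = "\<lambda>a c i x. b (flo a (nd c i)) (Q x) - b (nd c i) (Q x)"
 define U where "U a = {x\<in>space M. \<exists>c i. i \<le> 2 ^ c \<and> e < norm (?d a c i x)}" for a
 have Um: "U a \<in> events" for a
 proof -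
  have m: "(\<lambda>x. b s (Q x)) \<in> borel_measurable M" if "0 \<le> s" "s \<le> S" for s
   using measurable_filt_M[OF b_measurable[OF assms(1) that]] that S by simp
  have "{x\<in>space M. i \<le> 2 ^ c \<and> e < norm (?d a c i x)} \<in> events" for c i
  proof (cases "i \<le> 2 ^ c")
   case True
   have [measurable]: "(\<lambda>x. b (flo a (nd c i)) (Q x)) \<in> borel_measurable M" "(\<lambda>x. b (nd c i) (Q x)) \<in> borel_measurable M"
    using flo[of "nd c i" a] node_range[OF True] by (auto intro!: m)
   show ?thesis by measurable
  qed simp
  then show ?thesis unfolding U_def by (intro sets.sets_Collect_countable_Ex)
 qed
 have "(\<lambda>a. prob (U a)) \<longlonglongrightarrow> 0"
 proof (rule prob_tendsto_0[OF Um])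
  fix x assume x: "x \<in> space M"
  have "uniformly_continuous_on {0..S} (\<lambda>s. b s (Q x))"
   by (intro compact_uniformly_continuous b_continuous procD(2)[OF assms(1) x]) auto
  then obtain d where d: "d > 0" "\<And>s s'. s \<in> {0..S} ==> s' \<in> {0..S} ==> dist s' s < d ==> dist (b s' (Q x)) (b s (Q x)) < e"
   using uniformly_continuous_onE[of "{0..S}" "\<lambda>s. b s (Q x)" e] assms(2) by metis
  have "\<forall>\<^sub>F a in sequentially. dt a < d" using order_tendstoD(2)[OF dt_0 d(1)] .
  then show "\<forall>\<^sub>F a in sequentially. x \<notin> U a"
  proof eventually_elim
   case (elim a)
   have "norm (?d a c i x) < e" if "i \<le> 2 ^ c" for c i
    unfolding dist_norm[symmetric] using flo[of "nd c i" a] node_range[OF that] elim by (intro d(2)) (auto simp: dist_real_def)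
   then show ?case by (auto simp: U_def not_less intro: less_imp_le)
  qed
 qed
 then have "\<forall>\<^sub>F a in sequentially. prob (U a) < e" using order_tendstoD(2)[of _ 0 sequentially e] assms(2) by simp
 then obtain a0 where a0: "\<And>a. a0 \<le> a ==> prob (U a) < e" by (auto simp: eventually_sequentially)
 have "norm (?d a c i x) \<le> e" if "x \<in> space M - U a" "i \<le> 2 ^ c" for x a c i
  using that unfolding U_def by (auto simp: not_less)
 then show ?thesis using a0 Um by (intro that[of a0] bexI[of _ "U _"]) auto
qed

text \<open>For fixed k the iterates are Cauchy in probability as the level grows. Instead of a
  limit the statement names a process Q close to all late iterates; in the induction step it is the
  iterate of one high level, so no limit process has to be constructed.\<close>

lemma pic_cauchy:
 assumes "0 < e"
 shows "\<exists>Q a0. proc Q \<and> (\<forall>a\<ge>a0. \<exists>V\<in>events. prob V < e \<and> (\<forall>x\<in>space M - V. \<forall>s. norm (pic a k x s - Q x s) \<le> e))"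
 using assms
proof (induction k arbitrary: e)
 case 0
 then show ?case using pic_proc[of 0 0] by (intro exI[of _ "pic 0 0"] exI[of _ 0]) (auto intro!: bexI[of _ "{}"])
next
 case (Suc k)
 \<comment> \<open>The coefficient differences are bounded here by \<eta> alone, so
   \<open>J_compare\<close> is used with L = 0.\<close>
 define K where "K = exp (8 * (0^2 + 1) * T)"
 define \<eta> where "\<eta> = e * sqrt (e / (4 * K))"
 have K: "0 < K" by (simp add: K_def)
 have \<eta>: "0 < \<eta>" using Suc.prems K by (simp add: \<eta>_def)
 have \<eta>2: "\<eta>^2 * K / e^2 = e / 4" using Suc.prems K by (simp add: \<eta>_def power_mult_distrib field_simps)
 have lp: "0 < lip + 1" using lip(1) by simp
 define e1 where "e1 = min (e / 8) (min (\<eta> / 4) (\<eta> / (4 * (lip + 1))))"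
 have e1: "0 < e1" "e1 \<le> e / 8" "e1 \<le> \<eta> / 4" "e1 \<le> \<eta> / (4 * (lip + 1))"
  using Suc.prems \<eta> lp unfolding e1_def
  by (simp, intro min.cobounded1, intro order_trans[OF min.cobounded2 min.cobounded1], intro order_trans[OF min.cobounded2 min.cobounded2])
 have le1: "lip * e1 \<le> \<eta> / 4"
 proof -
  have "lip * e1 \<le> (lip + 1) * (\<eta> / (4 * (lip + 1)))" using e1 lip(1) by (intro mult_mono) auto
  also have "... = \<eta> / 4" using lp by (simp add: field_simps)
  finally show ?thesis .
 qed
 obtain Q a0 where Q: "proc Q" "\<And>a. a0 \<le> a ==> \<exists>V\<in>events. prob V < e1 \<and> (\<forall>x\<in>space M - V. \<forall>s. norm (pic a k x s - Q x s) \<le> e1)"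
  using Suc.IH[OF e1(1)] by blast
 obtain a1 where a1: "\<And>a. a1 \<le> a ==> \<exists>U\<in>events. prob U < e1 \<and>
  (\<forall>x\<in>space M - U. \<forall>c. \<forall>i\<le>2 ^ c. norm (b (flo a (nd c i)) (Q x) - b (nd c i) (Q x)) \<le> e1)"
  using freeze_coefficient[OF Q(1) e1(1)] by blast
 have near: "\<exists>U\<in>events. prob U < 2 * e1 \<and> (\<forall>x\<in>space M - U. \<forall>c. \<forall>i\<le>2 ^ c.
   norm (b (flo a (nd c i)) (pic a k x) - b (nd c i) (Q x)) \<le> \<eta> / 2)" if a: "max a0 a1 \<le> a" for a
 proof -
  obtain V where V: "V \<in> events" "prob V < e1" "\<And>x s. x \<in> space M ==> x \<notin> V ==> norm (pic a k x s - Q x s) \<le> e1"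
   using Q(2)[of a] a by auto
  obtain U where U: "U \<in> events" "prob U < e1" "\<And>x c i. x \<in> space M ==> x \<notin> U ==> i \<le> 2 ^ c ==>
    norm (b (flo a (nd c i)) (Q x) - b (nd c i) (Q x)) \<le> e1"
   using a1[of a] a by auto
  have "norm (b (flo a (nd c i)) (pic a k x) - b (nd c i) (Q x)) \<le> \<eta> / 2"
   if "x \<in> space M" "x \<notin> V \<union> U" "i \<le> 2 ^ c" for x c i
  proof -
   have "norm (b (flo a (nd c i)) (pic a k x) - b (flo a (nd c i)) (Q x)) \<le> lip * e1"
    using that V(3) flo[of "nd c i" a] node_range[OF that(3)] by (intro b_lip procD(2) pic_proc Q(1)) auto
   moreover have "norm (b (flo a (nd c i)) (Q x) - b (nd c i) (Q x)) \<le> \<eta> / 4"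
    using U(3)[of x i c] that e1(3) by auto
   ultimately show ?thesis using le1
     norm_triangle_ineq[of "b (flo a (nd c i)) (pic a k x) - b (flo a (nd c i)) (Q x)" "b (flo a (nd c i)) (Q x) - b (nd c i) (Q x)"]
    by simp
  qed
  moreover have "prob (V \<union> U) < 2 * e1" using measure_Un_le[OF V(1) U(1)] V(2) U(2) by linarith
  ultimately show ?thesis using V(1) U(1) by (intro bexI[of _ "V \<union> U"]) auto
 qed
 \<comment> \<open>The iterate of this level becomes the new Q, with which all later levels are
   compared.\<close>
 define a2 where "a2 = max a0 a1"
 obtain U2 where U2: "U2 \<in> events" "prob U2 < 2 * e1" "\<And>x c i. x \<in> space M ==> x \<notin> U2 ==> i \<le> 2 ^ c ==>
    norm (b (flo a2 (nd c i)) (pic a2 k x) - b (nd c i) (Q x)) \<le> \<eta> / 2"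
  using near[of a2] by (auto simp: a2_def)
 have "\<exists>V\<in>events. prob V < e \<and> (\<forall>x\<in>space M - V. \<forall>s. norm (pic a (Suc k) x s - pic a2 (Suc k) x s) \<le> e)" if a: "a2 \<le> a" for a
 proof -
  obtain U where U: "U \<in> events" "prob U < 2 * e1" "\<And>x c i. x \<in> space M ==> x \<notin> U ==> i \<le> 2 ^ c ==>
    norm (b (flo a (nd c i)) (pic a k x) - b (nd c i) (Q x)) \<le> \<eta> / 2"
   using near[of a] a by (auto simp: a2_def)
  obtain V where V: "V \<in> events" "prob V \<le> prob (U \<union> U2) + \<eta>^2 * exp (8 * (0^2 + 1) * T) / e^2"
   "\<And>x s. x \<in> space M ==> x \<notin> V ==> norm (J a (pic a k) x s - J a2 (pic a2 k) x s) \<le> e"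
  proof (rule J_compare[OF pic_proc pic_proc order_refl \<eta> Suc.prems, where U = "\<lambda>_. U \<union> U2" and v = "\<lambda>_. 0"])
   fix c i x assume x: "x \<in> space M" "x \<notin> U \<union> U2" "i < (2::nat) ^ c"
   have "norm (diffc a (pic a k) a2 (pic a2 k) c i x) \<le> \<eta> / 2 + \<eta> / 2"
    using norm_triangle_ineq4[of "b (flo a (nd c i)) (pic a k x) - b (nd c i) (Q x)" "b (flo a2 (nd c i)) (pic a2 k x) - b (nd c i) (Q x)"]
     U(3)[of x i c] U2(3)[of x i c] x by (simp add: diffc_def)
   then show "norm (diffc a (pic a k) a2 (pic a2 k) c i x) \<le> 0 * gap c (J a (pic a k)) (J a2 (pic a2 k)) i x + \<eta>" by simp
  qed (use U(1) U2(1) in auto)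
  have "prob V < e"
   using V(2) measure_Un_le[OF U(1) U2(1)] U(2) U2(2) e1(2) \<eta>2 Suc.prems unfolding K_def by linarith
  then show ?thesis using V by (intro bexI[of _ V]) auto
 qed
 then show ?case using pic_proc by blast
qed

lemma approximate_solution:
 assumes "0 < e"
 shows "\<exists>a X U. proc X \<and> U \<in> events \<and> prob U < e \<and>
  (\<forall>x\<in>space M - U. \<forall>c. \<forall>i\<le>2 ^ c. norm (b (flo a (nd c i)) (X x) - b (nd c i) (J a X x)) \<le> e)"
proof -
 have lp: "0 < lip + 1" using lip(1) by simp
 define e1 where "e1 = min (e / 4) (e / (4 * (lip + 1)))"
 have e1: "0 < e1" "e1 \<le> e / 4" "e1 \<le> e / (4 * (lip + 1))" using assms lp unfolding e1_def
  by (simp, intro min.cobounded1, intro min.cobounded2)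
 have le1: "lip * e1 \<le> e / 4"
 proof -
  have "lip * e1 \<le> (lip + 1) * (e / (4 * (lip + 1)))" using e1 lip(1) by (intro mult_mono) auto
  also have "... = e / 4" using lp by (simp add: field_simps)
  finally show ?thesis .
 qed
 obtain k where k: "\<And>a. \<exists>V\<in>events. prob V < e1 \<and> (\<forall>x\<in>space M - V. \<forall>s. norm (pic a (Suc k) x s - pic a k x s) \<le> e1)"
  using pic_close[OF e1(1)] by blast
 obtain Q a0 where Q: "proc Q" "\<And>a. a0 \<le> a ==> \<exists>V\<in>events. prob V < e1 \<and> (\<forall>x\<in>space M - V. \<forall>s. norm (pic a k x s - Q x s) \<le> e1)"
  using pic_cauchy[OF e1(1), of k] by blast
 obtain a1 where a1: "\<And>a. a1 \<le> a ==> \<exists>U\<in>events. prob U < e1 \<and>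
  (\<forall>x\<in>space M - U. \<forall>c. \<forall>i\<le>2 ^ c. norm (b (flo a (nd c i)) (Q x) - b (nd c i) (Q x)) \<le> e1)"
  using freeze_coefficient[OF Q(1) e1(1)] by blast
 define a where "a = max a0 a1"
 obtain V1 where V1: "V1 \<in> events" "prob V1 < e1" "\<And>x s. x \<in> space M ==> x \<notin> V1 ==> norm (pic a (Suc k) x s - pic a k x s) \<le> e1"
  using k[of a] by auto
 obtain V2 where V2: "V2 \<in> events" "prob V2 < e1" "\<And>x s. x \<in> space M ==> x \<notin> V2 ==> norm (pic a k x s - Q x s) \<le> e1"
  using Q(2)[of a] by (auto simp: a_def)
 obtain V3 where V3: "V3 \<in> events" "prob V3 < e1" "\<And>x c i. x \<in> space M ==> x \<notin> V3 ==> i \<le> 2 ^ c ==>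
    norm (b (flo a (nd c i)) (Q x) - b (nd c i) (Q x)) \<le> e1"
  using a1[of a] by (auto simp: a_def)
 have main: "norm (b (flo a (nd c i)) (pic a k x) - b (nd c i) (J a (pic a k) x)) \<le> e"
  if x: "x \<in> space M" "x \<notin> V1 \<union> V2 \<union> V3" and i: "i \<le> 2 ^ c" for x c i
 proof -
  let ?s = "nd c i"
  have s: "0 \<le> ?s" "?s \<le> S" "0 \<le> flo a ?s" "flo a ?s \<le> S" using flo[of ?s a] node_range[OF i] by auto
  have 1: "norm (b (flo a ?s) (pic a k x) - b (flo a ?s) (Q x)) \<le> lip * e1"
   using x V2(3) s by (intro b_lip procD(2) pic_proc Q(1)) auto
  have 2: "norm (b (flo a ?s) (Q x) - b ?s (Q x)) \<le> e1" using V3(3) x i by auto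
  have 3: "norm (b ?s (Q x) - b ?s (pic a k x)) \<le> lip * e1"
   using x V2(3) s by (intro b_lip procD(2) pic_proc Q(1)) (auto simp: norm_minus_commute)
  have 4: "norm (b ?s (pic a k x) - b ?s (pic a (Suc k) x)) \<le> lip * e1"
   using x V1(3) s by (intro b_lip procD(2) pic_proc) (auto simp: norm_minus_commute simp del: pic.simps)
  have eq: "b (flo a ?s) (pic a k x) - b ?s (J a (pic a k) x) = (b (flo a ?s) (pic a k x) - b (flo a ?s) (Q x)) +
    (b (flo a ?s) (Q x) - b ?s (Q x)) + (b ?s (Q x) - b ?s (pic a k x)) + (b ?s (pic a k x) - b ?s (pic a (Suc k) x))" by simp
  have "norm (b (flo a ?s) (pic a k x) - b ?s (J a (pic a k) x)) \<le> lip * e1 + e1 + lip * e1 + lip * e1"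
   by (subst eq, intro norm_triangle_mono 1 2 3 4)
  moreover have "lip * e1 + e1 + lip * e1 + lip * e1 \<le> e" using le1 e1(2) by linarith
  ultimately show ?thesis by (rule order_trans)
 qed
 have small: "prob (V1 \<union> V2 \<union> V3) < e"
  using measure_Un_le[OF sets.Un[OF V1(1) V2(1)] V3(1)] measure_Un_le[OF V1(1) V2(1)] V1(2) V2(2) V3(2) e1(2) assms by linarith
 show ?thesis
 proof (intro exI conjI)
  show "V1 \<union> V2 \<union> V3 \<in> events" using V1(1) V2(1) V3(1) by (intro sets.Un)
  show "\<forall>x\<in>space M - (V1 \<union> V2 \<union> V3). \<forall>c. \<forall>i\<le>2 ^ c. norm (b (flo a (nd c i)) (pic a k x) - b (nd c i) (J a (pic a k) x)) \<le> e"
   using main by blast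
 qed (rule pic_proc, rule small)
qed

end

lemma path_space_pconv_closed:
 assumes "\<And>n. p n \<in> path_space S" "pconv p q" "0 \<le> S"
 shows "(q :: ('d::finite) path) \<in> path_space S"
proof -
 have pt: "(\<lambda>n. p n s) \<longlonglongrightarrow> q s" for s
  using assms(2) unfolding pconv_def by (rule tendsto_uniform_limitI) simp
 show ?thesis
 proof (rule path_spaceI)
  show "continuous_on {0..S} q"
  proof (rule uniform_limit_theorem)
   show "\<forall>\<^sub>F n in sequentially. continuous_on {0..S} (p n)"
    using path_space_continuous[OF assms(1,3)] by simp
   show "uniform_limit {0..S} p q sequentially"
    using assms(2) unfolding pconv_def by (rule uniform_limit_on_subset) simp
  qed simp
  show "q s = 0" if "s \<le> 0" for s
   using pt[of s] path_space_neg[OF assms(1,3) that] by (simp add: LIMSEQ_const_iff)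
  show "q s = q S" if "S \<le> s" for s
  proof -
   have "(\<lambda>n. p n s) \<longlonglongrightarrow> q S" using pt[of S] path_space_ge[OF assms(1,3) that] by simp
   then show ?thesis using pt[of s] LIMSEQ_unique by blast
  qed
 qed (rule assms(3))
qed

section \<open>Existence as a limit of approximate solutions\<close>

context sde_start
begin

definition approx :: "real => nat => ('m => 'd path) => 'm set => bool" where
 "approx e a X U \<longleftrightarrow> proc X \<and> U \<in> events \<and> prob U < e \<and>
  (\<forall>x\<in>space M - U. \<forall>c. \<forall>i\<le>2 ^ c. norm (b (flo a (nd c i)) (X x) - b (nd c i) (J a X x)) \<le> e)"

lemma approxD: "approx e a X U ==> x \<in> space M ==> x \<notin> U ==> i \<le> 2 ^ c ==>
  norm (b (flo a (nd c i)) (X x) - b (nd c i) (J a X x)) \<le> e"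
 by (auto simp: approx_def)

lemma oscillation_event:
 assumes "proc X" "proc Y" "0 < e"
 obtains O' where "\<And>c. O' c \<in> events" "(\<lambda>c. prob (O' c)) \<longlonglongrightarrow> 0"
  "\<And>c i x s. x \<in> space M ==> x \<notin> O' c ==> i \<le> 2 ^ c ==> 0 \<le> s ==> s \<le> nd c i ==> norm (X x s - Y x s) \<le> gap c X Y i x + e"
proof -
 define O' where "O' c = {x\<in>space M. \<exists>c' k. e < norm ((X x (nd c' k) - Y x (nd c' k)) - (X x (flo c (nd c' k)) - Y x (flo c (nd c' k))))}" for c
 have Om: "O' c \<in> events" for c
  unfolding O'_def
 proof (intro sets.sets_Collect_countable_Ex)
  fix c' k
  have [measurable]: "(\<lambda>x. X x s) \<in> borel_measurable M" "(\<lambda>x. Y x s) \<in> borel_measurable M" for s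
   using proc_coordM[OF assms(1)] proc_coordM[OF assms(2)] by auto
  show "{x\<in>space M. e < norm ((X x (nd c' k) - Y x (nd c' k)) - (X x (flo c (nd c' k)) - Y x (flo c (nd c' k))))} \<in> events"
   by measurable
 qed
 have lim: "(\<lambda>c. prob (O' c)) \<longlonglongrightarrow> 0"
 proof (rule prob_tendsto_0[OF Om])
  fix x assume x: "x \<in> space M"
  obtain d1 where d1: "d1 > 0" "\<And>s s'. \<bar>s - s'\<bar> < d1 ==> norm (X x s - X x s') < e/2"
   using path_space_modulus[OF procD(2)[OF assms(1) x], of "e/2"] assms(3) T_pos by auto
  obtain d2 where d2: "d2 > 0" "\<And>s s'. \<bar>s - s'\<bar> < d2 ==> norm (Y x s - Y x s') < e/2"
   using path_space_modulus[OF procD(2)[OF assms(2) x], of "e/2"] assms(3) T_pos by auto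
  have "\<forall>\<^sub>F c in sequentially. dt c < min d1 d2" using order_tendstoD(2)[OF dt_0, of "min d1 d2"] d1(1) d2(1) by linarith
  then show "\<forall>\<^sub>F c in sequentially. x \<notin> O' c"
  proof eventually_elim
   case (elim c)
   have "norm ((X x s - Y x s) - (X x (flo c s) - Y x (flo c s))) < e" if "0 \<le> s" for s
   proof -
    have "\<bar>s - flo c s\<bar> < min d1 d2" using flo[OF that, of c] elim by auto
    then have "norm (X x s - X x (flo c s)) < e/2" "norm (Y x s - Y x (flo c s)) < e/2" using d1(2) d2(2) by auto
    from norm_diff_halves[OF this] show ?thesis by (simp add: algebra_simps)
   qed
   from less_not_sym[OF this] have "\<not> e < norm ((X x (nd c' k) - Y x (nd c' k)) - (X x (flo c (nd c' k)) - Y x (flo c (nd c' k))))" for c' k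
    using dt_pos[of c'] by (metis mult_nonneg_nonneg of_nat_0_le_iff less_imp_le)
   then show ?case unfolding O'_def by blast
  qed
 qed
 have "norm (X x s - Y x s) \<le> gap c X Y i x + e" if x: "x \<in> space M" "x \<notin> O' c" and i: "i \<le> 2 ^ c" and s: "0 \<le> s" "s \<le> nd c i" for c i x s
 proof (rule dense_bound[of "\<lambda>s. X x s - Y x s" s 0])
  show "continuous_on {0..S} (\<lambda>s. X x s - Y x s)"
   by (intro continuous_on_diff path_space_continuous[OF procD(1)[OF assms(1) x(1)]]
     path_space_continuous[OF procD(1)[OF assms(2) x(1)]] less_imp_le[OF S(1)])
  show "s \<le> S" using node_range[OF i] s by linarith
  fix c' k assume k: "nd c' k \<le> s"
  let ?r = "nd c' k" and ?f = "flo c (nd c' k)"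
  have r0: "0 \<le> ?r" using dt_pos[of c'] by simp
  have "nd c (nat \<lfloor>?r / dt c\<rfloor>) \<le> nd c i" using flo[OF r0, of c] k s unfolding flo_def by linarith
  then have "nat \<lfloor>?r / dt c\<rfloor> \<le> i" by (rule node_index_le)
  then have "norm (X x ?f - Y x ?f) \<le> gap c X Y i x" unfolding gap_def flo_def
   by (rule runmax_ge[where f = "\<lambda>j. norm (X x (nd c j) - Y x (nd c j))"])
  moreover have "norm ((X x ?r - Y x ?r) - (X x ?f - Y x ?f)) \<le> e" using x unfolding O'_def by (auto simp: not_less)
  ultimately show "norm (X x ?r - Y x ?r) \<le> gap c X Y i x + e"
   using norm_triangle_sub[of "X x ?r - Y x ?r" "X x ?f - Y x ?f"] by linarith
 qed (rule s)
 then show ?thesis using that Om lim by blast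
qed

text \<open>Two approximate solutions are close whatever their levels. The defects e1 and e2 and the
  oscillation error lip * e1 form the inhomogeneity of the Gronwall estimate, and the difference of
  the integrals feeds its Lipschitz part.\<close>

lemma approx_compare:
 assumes "approx e1 a X U" "approx e2 a' Y U'" "0 < e1" "0 < e2" "0 < e"
 obtains V where "V \<in> events" "prob V \<le> e1 + e2 + (e1 + e2 + lip * e1)^2 * exp (8 * (lip^2 + 1) * T) / e^2"
  "\<And>x s. x \<in> space M ==> x \<notin> V ==> norm (J a X x s - J a' Y x s) \<le> e"
proof -
 have XY: "proc X" "proc Y" "U \<in> events" "U' \<in> events" "prob U < e1" "prob U' < e2" using assms by (auto simp: approx_def)
 note JX = J_proc[OF XY(1), of a] J_proc[OF XY(2), of a']
 obtain O' where O': "\<And>c. O' c \<in> events" "(\<lambda>c. prob (O' c)) \<longlonglongrightarrow> 0"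
  "\<And>c i x s. x \<in> space M ==> x \<notin> O' c ==> i \<le> 2 ^ c ==> 0 \<le> s ==> s \<le> nd c i ==> norm (J a X x s - J a' Y x s) \<le> gap c (J a X) (J a' Y) i x + e1"
  using oscillation_event[OF JX assms(3)] by blast
 have pos: "0 < e1 + e2 + lip * e1" using assms(3,4) lip(1) by (intro add_pos_nonneg) auto
 show ?thesis
 proof (rule J_compare[OF XY(1,2) lip(1) pos assms(5), where U = "\<lambda>c. U \<union> U' \<union> O' c" and v = "\<lambda>c. prob (O' c)" and p = "e1 + e2" and a = a and a' = a'])
  show "U \<union> U' \<union> O' c \<in> events" for c using XY O'(1) by auto
  show "prob (U \<union> U' \<union> O' c) \<le> e1 + e2 + prob (O' c)" for c
   using measure_Un_le[OF sets.Un[OF XY(3,4)] O'(1)[of c]] measure_Un_le[OF XY(3,4)] XY(5,6) by linarith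
  fix c i x assume x: "x \<in> space M" "x \<notin> U \<union> U' \<union> O' c" and i: "i < (2::nat) ^ c"
  let ?s = "nd c i" and ?g = "gap c (J a X) (J a' Y) i x"
  have s: "0 \<le> ?s" "?s \<le> S" "i \<le> 2 ^ c" using node_range[of i c] i by auto
  have 1: "norm (b (flo a ?s) (X x) - b ?s (J a X x)) \<le> e1" using approxD[OF assms(1)] x s by auto
  have 2: "norm (b ?s (J a' Y x) - b (flo a' ?s) (Y x)) \<le> e2" using approxD[OF assms(2), of x i c] x s by (auto simp: norm_minus_commute)
  have 3: "norm (b ?s (J a X x) - b ?s (J a' Y x)) \<le> lip * (?g + e1)"
   using x s O'(3)[of x c i] by (intro b_lip procD(2) JX) auto
  have eq: "diffc a X a' Y c i x = (b (flo a ?s) (X x) - b ?s (J a X x)) + (b ?s (J a X x) - b ?s (J a' Y x)) + (b ?s (J a' Y x) - b (flo a' ?s) (Y x))"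
   by (simp add: diffc_def)
  have "norm (diffc a X a' Y c i x) \<le> e1 + lip * (?g + e1) + e2" by (subst eq, intro norm_triangle_mono 1 2 3)
  then show "norm (diffc a X a' Y c i x) \<le> lip * ?g + (e1 + e2 + lip * e1)" by (simp add: algebra_simps)
 qed (use O'(2) that in auto)
qed

text \<open>Approximate solutions with geometrically decreasing defects are almost surely uniformly
  Cauchy by Borel-Cantelli. Their frozen integrands and integrals are the elementary approximations
  that \<open>has_stoch_integral\<close> demands for the limit.\<close>

theorem solution_exists: "\<exists>X. solves t w X"
proof -
 \<comment> \<open>4^-j against the tolerance 2^-j: the squared quotient in
   \<open>approx_compare\<close> is again 4^-j and thus summable.\<close>
 define \<epsilon> :: "nat => real" where "\<epsilon> j = (1/4) ^ j" for j
 have \<epsilon>: "0 < \<epsilon> j" for j by (simp add: \<epsilon>_def)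
 have "\<forall>j. \<exists>p. approx (\<epsilon> j) (fst p) (fst (snd p)) (snd (snd p))"
  using approximate_solution[OF \<epsilon>] by (auto simp: approx_def)
 from choice[OF this] obtain f where f: "\<forall>j. approx (\<epsilon> j) (fst (f j)) (fst (snd (f j))) (snd (snd (f j)))" by (rule exE)
 define a X U where "a j = fst (f j)" and "X j = fst (snd (f j))" and "U j = snd (snd (f j))" for j
 have ap: "approx (\<epsilon> j) (a j) (X j) (U j)" for j using f by (simp add: a_def X_def U_def)
 have apD: "proc (X j)" "U j \<in> events" "prob (U j) < \<epsilon> j" for j using ap[of j] by (auto simp: approx_def)
 define Z where "Z j = J (a j) (X j)" for j
 have Zp: "proc (Z j)" for j unfolding Z_def by (rule J_proc[OF apD(1)])
 define C where "C = 2 + (2 + lip)^2 * exp (8 * (lip^2 + 1) * T)"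
 have "\<exists>V. V \<in> events \<and> prob V \<le> C * (1/4) ^ j \<and> (\<forall>x\<in>space M - V. \<forall>s. norm (Z j x s - Z (Suc j) x s) \<le> (1/2) ^ j)" for j
 proof -
  have h: "0 < (1/2::real) ^ j" by simp
  let ?e = "\<epsilon> j + \<epsilon> (Suc j) + lip * \<epsilon> j"
  let ?K = "exp (8 * (lip^2 + 1) * T)"
  obtain V where V: "V \<in> events" "prob V \<le> \<epsilon> j + \<epsilon> (Suc j) + ?e^2 * ?K / ((1/2) ^ j)^2"
   "\<And>x s. x \<in> space M ==> x \<notin> V ==> norm (Z j x s - Z (Suc j) x s) \<le> (1/2) ^ j"
   using approx_compare[OF ap[of j] ap[of "Suc j"] \<epsilon> \<epsilon> h] unfolding Z_def by blast
  have "\<epsilon> (Suc j) \<le> \<epsilon> j" by (simp add: \<epsilon>_def)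
  then have "?e \<le> (2 + lip) * \<epsilon> j" "0 \<le> ?e"
   using \<epsilon>[of j] \<epsilon>[of "Suc j"] lip(1) by (auto simp: algebra_simps)
  then have "?e^2 \<le> ((2 + lip) * \<epsilon> j)^2" by (rule power_mono)
  then have "?e^2 * ?K / ((1/2) ^ j)^2 \<le> ((2 + lip) * \<epsilon> j)^2 * ?K / ((1/2) ^ j)^2"
   by (intro divide_right_mono mult_right_mono) auto
  also have "... = (2 + lip)^2 * ?K * ((\<epsilon> j)^2 / ((1/2) ^ j)^2)" by (simp add: power_mult_distrib)
  also have "(\<epsilon> j)^2 / ((1/2) ^ j)^2 = \<epsilon> j"
  proof -
   have "((1/2::real) ^ j)^2 = (1/4) ^ j" by (simp add: power_mult[symmetric] mult.commute[of j 2]) (simp add: power_mult power_divide power2_eq_square)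
   then show ?thesis by (simp add: \<epsilon>_def power2_eq_square)
  qed
  finally have "prob V \<le> 2 * \<epsilon> j + (2 + lip)^2 * ?K * \<epsilon> j" using V(2) \<open>\<epsilon> (Suc j) \<le> \<epsilon> j\<close> by linarith
  then have "prob V \<le> C * (1/4) ^ j" unfolding C_def \<epsilon>_def distrib_right .
  then show ?thesis using V by blast
 qed
 then have "\<forall>j. \<exists>V. V \<in> events \<and> prob V \<le> C * (1/4) ^ j \<and> (\<forall>x\<in>space M - V. \<forall>s. norm (Z j x s - Z (Suc j) x s) \<le> (1/2) ^ j)" by blast
 from choice[OF this] obtain V where V': "\<forall>j. V j \<in> events \<and> prob (V j) \<le> C * (1/4) ^ j \<and> (\<forall>x\<in>space M - V j. \<forall>s. norm (Z j x s - Z (Suc j) x s) \<le> (1/2) ^ j)" by (rule exE)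
 have V: "V j \<in> events" "prob (V j) \<le> C * (1/4) ^ j" for j using V' by auto
 have VZ: "norm (Z j x s - Z (Suc j) x s) \<le> (1/2) ^ j" if "x \<in> space M" "x \<notin> V j" for j x s using V' that by blast
 have "AE x in M. \<forall>\<^sub>F j in sequentially. x \<in> space M - V j"
 proof (rule borel_cantelli_AE1)
  show "summable (\<lambda>j. prob (V j))"
   by (rule summable_comparison_test'[OF summable_mult[OF summable_geometric[of "1/4"]], of 0 _ C]) (use V in auto)
 qed (use V in \<open>auto simp: emeasure_eq_measure\<close>)
 then obtain N1 where N1: "N1 \<in> null_sets M" "{x\<in>space M. \<not> (\<forall>\<^sub>F j in sequentially. x \<in> space M - V j)} \<subseteq> N1"
  unfolding eventually_ae_filter by blast
 \<comment> \<open>On the null set without convergence the zero path is a default value in the path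
   space; adaptedness survives since the filtration contains the null sets.\<close>
 define Y where "Y x = (if x \<in> N1 then (\<lambda>_. 0) else (\<lambda>s. lim (\<lambda>j. Z j x s)))" for x
 have conv: "pconv (\<lambda>j. Z j x) (Y x)" if x: "x \<in> space M" "x \<notin> N1" for x
 proof -
  have ev: "\<forall>\<^sub>F j in sequentially. \<forall>s\<in>UNIV. norm (Z (Suc j) x s - Z j x s) \<le> (1/2) ^ j"
  proof -
   have "\<forall>\<^sub>F j in sequentially. x \<in> space M - V j" using N1(2) x by blast
   then show ?thesis by eventually_elim (use VZ in \<open>auto simp: norm_minus_commute\<close>)
  qed
  have "uniform_limit UNIV (\<lambda>n s. \<Sum>i<n. Z (Suc i) x s - Z i x s) (\<lambda>s. suminf (\<lambda>i. Z (Suc i) x s - Z i x s)) sequentially"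
   by (rule Weierstrass_m_test_ev[OF ev]) (simp add: summable_geometric)
  moreover have "(\<lambda>n s. \<Sum>i<n. Z (Suc i) x s - Z i x s) = (\<lambda>n s. Z n x s - Z 0 x s)"
   by (intro ext) (rule sum_lessThan_telescope)
  ultimately have ul: "uniform_limit UNIV (\<lambda>n s. Z n x s - Z 0 x s) (\<lambda>s. suminf (\<lambda>i. Z (Suc i) x s - Z i x s)) sequentially"
   by simp
  from uniform_limit_add[OF ul uniform_limit_const[of "Z 0 x" UNIV sequentially]]
  obtain L where L: "pconv (\<lambda>j. Z j x) L" unfolding pconv_def by auto
  have "(\<lambda>j. Z j x s) \<longlonglongrightarrow> L s" for s
   using L unfolding pconv_def by (rule tendsto_uniform_limitI) simp
  then have "Y x = L" using x by (auto simp: Y_def fun_eq_iff intro: limI)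
  then show ?thesis using L by simp
 qed
 have Yp: "proc Y"
  unfolding proc_def
 proof (intro conjI ballI)
  fix x assume x: "x \<in> space M"
  show "Y x \<in> path_space S"
  proof (cases "x \<in> N1")
   case True then show ?thesis by (simp add: Y_def path_space_zero)
  next
   case False
   show ?thesis by (rule path_space_pconv_closed[OF procD(1)[OF Zp x] conv[OF x False]]) (use S in simp)
  qed
 next
  fix s assume s: "s \<in> {0..S}"
  show "(\<lambda>x. Y x s) \<in> borel_measurable (filt s)"
  proof (rule borel_measurable_LIMSEQ_metric)
   show "(\<lambda>x. if x \<in> N1 then 0 else Z j x s) \<in> borel_measurable (filt s)" for j
    using null_sets_filt[OF N1(1), of s] sets.sets_into_space[OF null_setsD2[OF N1(1)]] proc_coord[OF Zp, of s j] s
    by (intro measurable_If_set) (auto simp: Int_absorb2)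
   fix x assume "x \<in> space (filt s)"
   then have x: "x \<in> space M" by simp
   show "(\<lambda>j. if x \<in> N1 then 0 else Z j x s) \<longlonglongrightarrow> Y x s"
   proof (cases "x \<in> N1")
    case False
    then show ?thesis using tendsto_uniform_limitI[OF conv[OF x False, unfolded pconv_def] UNIV_I, of s] by simp
   qed (simp add: Y_def)
  qed
 qed
 \<comment> \<open>The supremum over all times is replaced by the dyadic gaps, which makes the event
   measurable.\<close>
 define B where "B e j = {x\<in>space M. x \<in> N1 \<or> (\<exists>c. e < gap c (Z j) Y (2 ^ c) x)}" for e j
 have Bm: "B e j \<in> events" for e j
 proof -
  have "{x\<in>space M. \<exists>c. e < gap c (Z j) Y (2 ^ c) x} \<in> events"
  proof (intro sets.sets_Collect_countable_Ex)
   show "{x\<in>space M. e < gap c (Z j) Y (2 ^ c) x} \<in> events" for c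
    using gap_measurable[OF Zp Yp, of c j "2 ^ c"] by measurable
  qed
  moreover have "B e j = N1 \<union> {x\<in>space M. \<exists>c. e < gap c (Z j) Y (2 ^ c) x}"
   using sets.sets_into_space[OF null_setsD2[OF N1(1)]] by (auto simp: B_def)
  ultimately show ?thesis using N1(1) by auto
 qed
 have B0: "(\<lambda>j. prob (B e j)) \<longlonglongrightarrow> 0" if e: "0 < e" for e
 proof -
  have "(\<lambda>j. prob (B e j - N1)) \<longlonglongrightarrow> 0"
  proof (rule prob_tendsto_0)
   show "B e j - N1 \<in> events" for j using Bm N1(1) by auto
   fix x assume x: "x \<in> space M"
   show "\<forall>\<^sub>F j in sequentially. x \<notin> B e j - N1"
   proof (cases "x \<in> N1")
    case False
    from pconvD[OF conv[OF x False] e] show ?thesis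
    proof eventually_elim
     case (elim j)
     then have "gap c (Z j) Y (2 ^ c) x \<le> e" for c unfolding gap_def runmax_le_iff by (auto intro: less_imp_le)
     then show ?case by (auto simp: B_def not_less)
    qed
   qed simp
  qed
  then show ?thesis using measure_Diff_null_set[OF Bm N1(1)] by simp
 qed
 have BZ: "norm (Z j x s - Y x s) \<le> e" if "x \<in> space M" "x \<notin> B e j" for e j x s
  using that by (intro gap_bound_all[OF Zp Yp, of x 0]) (auto simp: B_def not_less)
 have e0: "\<epsilon> \<longlonglongrightarrow> 0" unfolding \<epsilon>_def by (rule LIMSEQ_power_zero) simp
 have U0: "(\<lambda>j. prob (U j)) \<longlonglongrightarrow> 0"
  by (rule tendsto_sandwich[OF _ _ tendsto_const e0]) (use apD(3) in \<open>auto intro!: always_eventually less_imp_le\<close>)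
 define H where "H j = elementary_process (2 ^ a j) (\<lambda>k. real k * dt (a j)) (\<lambda>k x. b (real k * dt (a j)) (X j x))" for j
 let ?r = "\<lambda>j k. real k * dt (a j)"
 let ?\<xi> = "\<lambda>j k x. b (real k * dt (a j)) (X j x)"
 let ?E = "\<lambda>j. elementary_integral (*v) (2 ^ a j) (?r j) (?\<xi> j) W"
 have Hb: "norm (H j s x - b s (Z j x)) \<le> \<epsilon> j" if x: "x \<in> space M" "x \<notin> U j" and s: "0 < s" "s \<le> S" for j x s
 proof -
  \<comment> \<open>Dyadic times strictly below s and tending to s. Strictness matters: if s is a
    coarse node, rounding s itself down would leave the left-open interval on which H is
    constant.\<close>
  let ?r = "\<lambda>c. flo c (s - dt c)"
  have ev: "\<forall>\<^sub>F c in sequentially. norm (H j s x - b (?r c) (Z j x)) \<le> \<epsilon> j \<and> 0 \<le> ?r c \<and> ?r c \<le> s"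
  proof -
   define k where "k = nat \<lceil>s / dt (a j)\<rceil> - 1"
   have "0 < s / dt (a j)" using s dt_pos by simp
   then have "real k < s / dt (a j)" "s / dt (a j) \<le> real (Suc k)" unfolding k_def by linarith+
   then have k: "real k * dt (a j) < s" "s \<le> real (Suc k) * dt (a j)"
    using dt_pos[of "a j"] by (simp_all add: pos_less_divide_eq pos_divide_le_eq)
   have "real k * dt (a j) < real (2 ^ a j) * dt (a j)" using k(1) s(2) unfolding dt_full by linarith
   then have k2: "k < 2 ^ a j" using dt_pos[of "a j"] by (simp only: mult_less_cancel_right_pos of_nat_less_iff)
   have Hk: "H j s x = b (real k * dt (a j)) (X j x)" unfolding H_def
    by (rule elementary_process_uniform[OF dt_pos k2 k])
   have "\<forall>\<^sub>F c in sequentially. dt c < (s - real k * dt (a j)) / 2"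
    using order_tendstoD(2)[OF dt_0, of "(s - real k * dt (a j)) / 2"] k(1) by simp
   then show ?thesis
   proof eventually_elim
    case (elim c)
    have k0: "0 \<le> real k * dt (a j)" using dt_pos[of "a j"] by simp
    have sd: "0 \<le> s - dt c" using elim k0 s(1) by (simp add: field_simps)
    have r: "0 \<le> ?r c" "?r c \<le> s - dt c" "real k * dt (a j) \<le> ?r c" "?r c < s"
     using flo[OF sd, of c] elim dt_pos[of c] by (auto simp: field_simps)
    have "flo (a j) (?r c) = real k * dt (a j)"
    proof -
     have "real k \<le> ?r c / dt (a j)" "?r c / dt (a j) < real k + 1"
      using r k dt_pos[of "a j"] by (simp_all add: pos_le_divide_eq pos_divide_less_eq algebra_simps)
     then have "\<lfloor>?r c / dt (a j)\<rfloor> = int k" by linarith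
     then show ?thesis by (simp add: flo_def[of "a j"])
    qed
    moreover have "?r c = real (nat \<lfloor>(s - dt c) / dt c\<rfloor>) * dt c" by (simp add: flo_def)
    moreover have "nat \<lfloor>(s - dt c) / dt c\<rfloor> \<le> 2 ^ c"
     by (rule node_index_le[of _ c]) (use r s(2) in \<open>simp only: flo_def[symmetric] dt_full\<close>)
    ultimately show ?case unfolding Hk Z_def
     using approxD[OF ap[of j] x, of "nat \<lfloor>(s - dt c) / dt c\<rfloor>" c] r by simp
   qed
  qed
  have rl: "?r \<longlonglongrightarrow> s"
  proof (rule tendsto_sandwich[where f = "\<lambda>c. s - 2 * dt c" and h = "\<lambda>_. s"])
   show "(\<lambda>c. s - 2 * dt c) \<longlonglongrightarrow> s" using tendsto_diff[OF tendsto_const tendsto_mult_right_zero[OF dt_0, of 2], of s] by simp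
   have "\<forall>\<^sub>F c in sequentially. dt c < s" using order_tendstoD(2)[OF dt_0 s(1)] .
   then show "\<forall>\<^sub>F c in sequentially. s - 2 * dt c \<le> ?r c"
   proof eventually_elim
    case (elim c) then show ?case using flo[of "s - dt c" c] by simp
   qed
   show "\<forall>\<^sub>F c in sequentially. ?r c \<le> s" using ev by eventually_elim simp
  qed simp
  show ?thesis
  proof (rule tendsto_upperbound)
   have "(\<lambda>c. b (?r c) (Z j x)) \<longlonglongrightarrow> b s (Z j x)"
   proof (rule continuous_on_tendsto_compose[OF b_continuous[OF procD(2)[OF Zp x(1)]] rl])
    show "\<forall>\<^sub>F c in sequentially. ?r c \<in> {0..S}" using ev by eventually_elim (use s in auto)
   qed (use s in auto)
   then show "(\<lambda>c. norm (H j s x - b (?r c) (Z j x))) \<longlonglongrightarrow> norm (H j s x - b s (Z j x))"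
    by (intro tendsto_norm tendsto_diff tendsto_const)
   show "\<forall>\<^sub>F c in sequentially. norm (H j s x - b (?r c) (Z j x)) \<le> \<epsilon> j" using ev by eventually_elim simp
  qed simp
 qed
 have "has_stoch_integral M filt S (*v) (\<lambda>s x. b s (Y x)) W (\<lambda>s x. Y x s)"
  unfolding has_stoch_integral_def
 proof (intro exI conjI allI)
  show "elementary filt S (2 ^ a j) (?r j) (?\<xi> j)" for j
   by (rule elementary_b[OF apD(1)])
  show "ucp_tendsto M {0<..S} (\<lambda>j. elementary_process (2 ^ a j) (?r j) (?\<xi> j)) (\<lambda>s x. b s (Y x))"
   unfolding ucp_tendsto_def H_def[symmetric]
  proof (intro allI impI)
   fix e :: real assume e: "0 < e"
   have lp: "0 < lip + 1" using lip(1) by simp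
   define e' where "e' = e / (2 * (lip + 1))"
   have e': "0 < e'" "lip * e' \<le> e / 2" using e lp lip(1) by (auto simp: e'_def field_simps)
   \<comment> \<open>At the finitely many indices with a large defect the whole space is the
     exceptional set.\<close>
   define A where "A j = (if \<epsilon> j \<le> e / 2 then B e' j \<union> U j else space M)" for j
   have "A j \<in> events \<and> {x \<in> space M. \<exists>s\<in>{0<..S}. e < dist (H j s x) (b s (Y x))} \<subseteq> A j" for j
   proof
    show "A j \<in> events" using Bm apD(2) by (auto simp: A_def)
    show "{x \<in> space M. \<exists>s\<in>{0<..S}. e < dist (H j s x) (b s (Y x))} \<subseteq> A j"
    proof (intro subsetI, rule ccontr)
     fix x assume x: "x \<in> {x \<in> space M. \<exists>s\<in>{0<..S}. e < dist (H j s x) (b s (Y x))}" "x \<notin> A j"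
     then obtain s where s: "x \<in> space M" "0 < s" "s \<le> S" "e < dist (H j s x) (b s (Y x))" by auto
     have n: "\<epsilon> j \<le> e / 2" "x \<notin> B e' j" "x \<notin> U j" using x(2) s(1) by (auto simp: A_def split: if_splits)
     have 1: "norm (H j s x - b s (Z j x)) \<le> \<epsilon> j" by (rule Hb[OF s(1) n(3) s(2,3)])
     have 2: "norm (b s (Z j x) - b s (Y x)) \<le> lip * e'"
      using s BZ[OF s(1) n(2)] by (intro b_lip procD(2) Zp Yp) auto
     have "dist (H j s x) (b s (Y x)) \<le> \<epsilon> j + lip * e'"
      using norm_triangle_mono[OF 1 2] by (simp add: dist_norm)
     then show False using s(4) n(1) e'(2) by linarith
    qed
   qed
   moreover have "(\<lambda>j. prob (A j)) \<longlonglongrightarrow> 0"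
   proof (rule tendsto_sandwich[OF _ _ tendsto_const])
    have "\<forall>\<^sub>F j in sequentially. \<epsilon> j < e / 2" using order_tendstoD(2)[OF e0, of "e/2"] e by simp
    then show "\<forall>\<^sub>F j in sequentially. prob (A j) \<le> prob (B e' j) + prob (U j)"
     by eventually_elim (use measure_Un_le[OF Bm apD(2)] in \<open>auto simp: A_def\<close>)
    show "(\<lambda>j. prob (B e' j) + prob (U j)) \<longlonglongrightarrow> 0" using tendsto_add[OF B0[OF e'(1)] U0] by simp
   qed auto
   ultimately show "\<exists>A. (\<forall>j. A j \<in> events \<and> {x \<in> space M. \<exists>s\<in>{0<..S}. e < dist (H j s x) (b s (Y x))} \<subseteq> A j) \<and> (\<lambda>j. prob (A j)) \<longlonglongrightarrow> 0"
    by (intro exI[of _ A]) simp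
  qed
  show "ucp_tendsto M {0..S} (\<lambda>j. ?E j) (\<lambda>s x. Y x s)"
   unfolding ucp_tendsto_def
  proof (intro allI impI exI conjI)
   fix e :: real assume e: "0 < e"
   show "B e j \<union> N0 \<in> events" for j using Bm N0(1) by auto
   show "{x \<in> space M. \<exists>s\<in>{0..S}. e < dist (?E j s x) (Y x s)} \<subseteq> B e j \<union> N0" for j
   proof (intro subsetI, rule ccontr)
    fix x assume x: "x \<in> {x \<in> space M. \<exists>s\<in>{0..S}. e < dist (?E j s x) (Y x s)}" "x \<notin> B e j \<union> N0"
    then obtain s where s: "x \<in> space M" "0 \<le> s" "e < dist (?E j s x) (Y x s)" by auto
    have "?E j s x = Z j x s"
     unfolding Z_def using J_eq[of x s "a j" "X j"] x(2) s(2) by simp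
    then show False using s(3) BZ[OF s(1), of e j s] x(2) by (simp add: dist_norm)
   qed
   show "(\<lambda>j. prob (B e j \<union> N0)) \<longlonglongrightarrow> 0" using B0[OF e] measure_Un_null_set[OF Bm N0(1)] by simp
  qed
 qed
 then show ?thesis unfolding strong_solution_def
  using Yp unfolding proc_def S_def b_def shift_def by blast
qed

end

context sde
begin

lemma solution_exists:
 assumes "0 \<le> t" "t < T" "w \<in> path_space T"
 shows "\<exists>X. solves t w X"
proof -
 interpret sde_start T M W \<sigma> t w by unfold_locales (use assms in auto)
 show ?thesis by (rule solution_exists)
qed

end

section \<open>Laws on path space\<close>

text \<open>Test functions for the laws: continuity serves the limits of Euler schemes, the range
  [0,1] serves dominated convergence and the passage to \<open>nn_integral\<close>.\<close>

definition unit_fun :: "real => (('d::finite) path => real) => bool" where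
 "unit_fun T f \<longleftrightarrow> path_continuous T f \<and> (\<forall>w\<in>path_space T. 0 \<le> f w \<and> f w \<le> 1)"

lemma unit_funD: "unit_fun T f ==> path_continuous T f" "unit_fun T f ==> w \<in> path_space T ==> 0 \<le> f w"
 "unit_fun T f ==> w \<in> path_space T ==> f w \<le> 1"
 by (auto simp: unit_fun_def)

lemma unit_fun_measurable: "unit_fun T f ==> 0 < T ==> f \<in> borel_measurable (canonical_filtration T T)"
 by (simp add: unit_funD path_continuous_measurable)

text \<open>An intersection-stable generator of the path \<sigma>-algebra whose indicators are
  pointwise limits of unit functions. It carries identities from continuous functionals over to
  measurable ones.\<close>

definition zero_sets :: "real => ('d::finite) path set set" where
 "zero_sets T = {{w\<in>path_space T. f w = 0} | f :: 'd path => real. unit_fun T f}"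

lemma zero_sets_UNIV: "path_space T \<in> zero_sets T"
 unfolding zero_sets_def by (intro CollectI exI[of _ "\<lambda>_. 0"]) (auto simp: unit_fun_def path_continuous_def)

lemma Int_stable_zero_sets: "Int_stable (zero_sets T :: ('d::finite) path set set)"
proof (rule Int_stableI)
 fix a b :: "'d path set" assume "a \<in> zero_sets T" "b \<in> zero_sets T"
 then obtain f g where *: "a = {w\<in>path_space T. f w = 0}" "b = {w\<in>path_space T. g w = 0}" "unit_fun T f" "unit_fun T g"
  by (auto simp: zero_sets_def)
 have "unit_fun T (\<lambda>w. max (f w) (g w))"
  using *(3,4) unfolding unit_fun_def path_continuous_def by (auto intro!: tendsto_max simp: le_max_iff_disj)
 moreover have "a \<inter> b = {w\<in>path_space T. max (f w) (g w) = 0}"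
 proof -
  have "max (f w) (g w) = 0 \<longleftrightarrow> f w = 0 \<and> g w = 0" if "w \<in> path_space T" for w
   using unit_funD(2)[OF *(3) that] unit_funD(2)[OF *(4) that] by linarith
  then show ?thesis using *(1,2) by auto
 qed
 ultimately show "a \<inter> b \<in> zero_sets T" unfolding zero_sets_def
  by (intro CollectI exI[of _ "\<lambda>w. max (f w) (g w)"]) simp
qed

lemma zero_sets_Pow: "zero_sets T \<subseteq> Pow (path_space T)"
 by (auto simp: zero_sets_def)

text \<open>A closed condition on one coordinate is the zero set of a truncated distance, so the
  zero sets make all coordinates measurable.\<close>

lemma sets_cf_zero_sets:
 assumes "0 < T"
 shows "sets (canonical_filtration T T :: ('d::finite) path measure) = sigma_sets (path_space T) (zero_sets T)"
proof
 let ?M = "canonical_filtration T T :: 'd path measure"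
 have "zero_sets T \<subseteq> sets ?M"
 proof
  fix A :: "'d path set" assume "A \<in> zero_sets T"
  then obtain f where f: "A = {w\<in>space ?M. f w = 0}" "unit_fun T f" by (auto simp: zero_sets_def)
  show "A \<in> sets ?M" unfolding f(1) using unit_fun_measurable[OF f(2) assms] by measurable
 qed
 from sets.sigma_sets_subset[OF this] show "sigma_sets (path_space T) (zero_sets T) \<subseteq> sets ?M" by simp
 let ?S = "sigma (path_space T) (zero_sets T :: 'd path set set)"
 have S: "space ?S = path_space T" "sets ?S = sigma_sets (path_space T) (zero_sets T)"
  using zero_sets_Pow by (auto intro!: space_measure_of sets_measure_of)
 have "(\<lambda>w. w) \<in> measurable ?S ?M"
 proof (rule measurable_cfI)
  fix s
  show "(\<lambda>w. w s) \<in> borel_measurable ?S"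
   unfolding borel_eq_closed
  proof (rule measurable_measure_of)
   fix C :: "(real ^ 'd) set" assume "C \<in> Collect closed"
   then have C: "closed C" by simp
   show "(\<lambda>w. w s) -` C \<inter> space ?S \<in> sets ?S"
   proof (cases "C = {}")
    case False
    let ?f = "\<lambda>w :: 'd path. min 1 (infdist (w s) C)"
    have "unit_fun T ?f" unfolding unit_fun_def path_continuous_def
    proof (intro conjI allI impI ballI)
     fix p :: "nat => 'd path" and q assume "pconv p q"
     then have "(\<lambda>n. p n s) \<longlonglongrightarrow> q s" unfolding pconv_def by (rule tendsto_uniform_limitI) simp
     then show "(\<lambda>n. ?f (p n)) \<longlonglongrightarrow> ?f q" by (intro tendsto_min tendsto_infdist tendsto_const)
    qed (auto simp: infdist_nonneg)
    moreover have "(\<lambda>w. w s) -` C \<inter> space ?S = {w\<in>path_space T. ?f w = 0}"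
     unfolding S using in_closed_iff_infdist_zero[OF C False] by (auto simp: min_def)
    ultimately show ?thesis unfolding S(2) by (intro sigma_sets.Basic) (auto simp: zero_sets_def)
   qed simp
  qed auto
 qed (simp add: S)
 note id = this
 show "sets ?M \<subseteq> sigma_sets (path_space T) (zero_sets T)"
 proof
  fix A assume A: "A \<in> sets ?M"
  have "(\<lambda>w. w) -` A \<inter> space ?S = A" using sets.sets_into_space[OF A] unfolding S by auto
  then show "A \<in> sigma_sets (path_space T) (zero_sets T)" using measurable_sets[OF id A] unfolding S by simp
 qed
qed

text \<open>max 0 (1 - n f) equals 1 on the zero set of f and vanishes for large n
  elsewhere.\<close>

lemma zero_set_approx:
 fixes A :: "('d::finite) path set"
 assumes "A \<in> zero_sets T"
 obtains h :: "nat => 'd path => real" where "\<And>n. unit_fun T (h n)" "\<And>w. w \<in> path_space T ==> (\<lambda>n. h n w) \<longlonglongrightarrow> indicator A w"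
proof -
 obtain f where f: "A = {w\<in>path_space T. f w = 0}" "unit_fun T f" using assms by (auto simp: zero_sets_def)
 define h where "h n w = max 0 (1 - real n * f w)" for n w
 have "unit_fun T (h n)" for n
  using f(2) unfolding unit_fun_def path_continuous_def h_def
  by (auto intro!: tendsto_max tendsto_diff tendsto_mult)
 moreover have "(\<lambda>n. h n w) \<longlonglongrightarrow> indicator A w" if wT: "w \<in> path_space T" for w
 proof (cases "f w = 0")
  case False
  then have f0: "0 < f w" using unit_funD(2)[OF f(2) wT] by simp
  obtain m :: nat where m: "1 / f w < real m" using reals_Archimedean2 by blast
  have "h n w = 0" if "m \<le> n" for n
  proof -
   have "1 / f w \<le> real n" using m that by linarith
   then have "1 \<le> real n * f w" using f0 by (simp add: pos_divide_le_eq)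
   then show ?thesis by (simp add: h_def)
  qed
  then have "(\<lambda>n. h n w) \<longlonglongrightarrow> 0" by (intro tendsto_eventually) (auto simp: eventually_sequentially)
  then show ?thesis using False by (simp add: f(1))
 qed (use wT in \<open>simp add: h_def f(1)\<close>)
 ultimately show ?thesis by (rule that)
qed

lemma (in prob_space) abs_integral_le_1:
 fixes h :: "'a => real"
 assumes "\<And>x. x \<in> space M ==> \<bar>h x\<bar> \<le> 1"
 shows "\<bar>\<integral>x. h x \<partial>M\<bar> \<le> 1"
proof (cases "integrable M h")
 case True
 have "\<bar>\<integral>x. h x \<partial>M\<bar> \<le> (\<integral>x. \<bar>h x\<bar> \<partial>M)" by (rule integral_abs_bound)
 also have "... \<le> 1" using True assms by (intro integral_le_const integrable_abs AE_I2) auto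
 finally show ?thesis .
qed (simp add: not_integrable_integral_eq)

text \<open>The hypothesis for products of unit functions passes to rectangles of zero sets, which
  generate the product \<sigma>-algebra; this identifies the joint law of a and b with the one built
  from a and \<kappa>. Measurability of the kernel uses the same generator.\<close>

lemma kernel_fubini:
 fixes a b :: "'x => ('d::finite) path" and \<kappa> :: "'x => 'd path measure"
 assumes T: "0 < T" and N: "prob_space N"
  and ab: "a \<in> measurable N (canonical_filtration T T)" "b \<in> measurable N (canonical_filtration T T)"
  and \<kappa>: "\<And>x. x \<in> space N ==> prob_space (\<kappa> x)" "\<And>x. x \<in> space N ==> sets (\<kappa> x) = sets (canonical_filtration T T)"
  and meas: "\<And>g. unit_fun T g ==> (\<lambda>x. \<integral>y. g y \<partial>\<kappa> x) \<in> borel_measurable N"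
  and eq: "\<And>f g. unit_fun T f ==> unit_fun T g ==> (\<integral>x. f (a x) * g (b x) \<partial>N) = (\<integral>x. f (a x) * (\<integral>y. g y \<partial>\<kappa> x) \<partial>N)"
 shows "\<kappa> \<in> measurable N (subprob_algebra (canonical_filtration T T))"
  "\<And>F. F \<in> borel_measurable (canonical_filtration T T \<Otimes>\<^sub>M canonical_filtration T T) ==>
   (\<integral>\<^sup>+x. F (a x, b x) \<partial>N) = (\<integral>\<^sup>+x. \<integral>\<^sup>+y. F (a x, y) \<partial>\<kappa> x \<partial>N)"
proof -
 interpret N: prob_space N by (rule N)
 let ?C = "canonical_filtration T T :: 'd path measure"
 let ?P2 = "path_space T \<times> path_space T"
 let ?CC = "?C \<Otimes>\<^sub>M ?C"
 let ?J = "distr N ?CC (\<lambda>x. (a x, b x))"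
 have spk: "space (\<kappa> x) = path_space T" if "x \<in> space N" for x
  using sets_eq_imp_space_eq[OF \<kappa>(2)[OF that]] by simp
 have bnd: "\<bar>h y\<bar> \<le> 1" if "unit_fun T h" "y \<in> path_space T" for h y
  using unit_funD[OF that(1)] that(2) by simp
 have zs: "A \<in> sets ?C" if "A \<in> zero_sets T" for A using that unfolding sets_cf_zero_sets[OF T] by (rule sigma_sets.Basic)
 have lim\<kappa>: "(\<lambda>n. \<integral>y. h n y \<partial>\<kappa> x) \<longlonglongrightarrow> measure (\<kappa> x) B"
  if x: "x \<in> space N" and B: "B \<in> zero_sets T" and h: "\<And>n. unit_fun T (h n)" "\<And>w. w \<in> path_space T ==> (\<lambda>n. h n w) \<longlonglongrightarrow> indicator B w"
  for x B and h :: "nat => 'd path => real"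
 proof -
  interpret K: prob_space "\<kappa> x" by (rule \<kappa>(1)[OF x])
  have mB: "B \<in> sets (\<kappa> x)" using zs[OF B] \<kappa>(2)[OF x] by simp
  have "(\<lambda>n. \<integral>y. h n y \<partial>\<kappa> x) \<longlonglongrightarrow> (\<integral>y. indicator B y \<partial>\<kappa> x)"
  proof (rule integral_dominated_convergence[where w = "\<lambda>_. 1"])
   show "h n \<in> borel_measurable (\<kappa> x)" for n
    using unit_fun_measurable[OF h(1) T, of n] measurable_cong_sets[OF \<kappa>(2)[OF x] refl] by blast
  qed (use mB h spk[OF x] in \<open>auto intro!: AE_I2 bnd\<close>)
  then show ?thesis using mB by simp
 qed
 have mm: "(\<lambda>x. measure (\<kappa> x) B) \<in> borel_measurable N" if B: "B \<in> zero_sets T" for B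
 proof -
  obtain h :: "nat => 'd path => real" where h: "\<And>n. unit_fun T (h n)" "\<And>w. w \<in> path_space T ==> (\<lambda>n. h n w) \<longlonglongrightarrow> indicator B w"
   using zero_set_approx[OF B] by blast
  show ?thesis by (rule borel_measurable_LIMSEQ_metric[OF meas[OF h(1)] lim\<kappa>[OF _ B h]])
 qed
 have em: "emeasure (\<kappa> x) B = ennreal (measure (\<kappa> x) B)" if "x \<in> space N" for x B
  by (rule finite_measure.emeasure_eq_measure[OF prob_space.finite_measure[OF \<kappa>(1)[OF that]]])
 show k: "\<kappa> \<in> measurable N (subprob_algebra ?C)"
 proof (rule measurable_subprob_algebra_generated[OF sets_cf_zero_sets[OF T] Int_stable_zero_sets zero_sets_Pow])
  have *: "(\<lambda>x. emeasure (\<kappa> x) B) \<in> borel_measurable N" if "B \<in> zero_sets T" for B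
   using mm[OF that] em by (subst measurable_cong[OF em]) auto
  then show "(\<lambda>x. emeasure (\<kappa> x) B) \<in> borel_measurable N" if "B \<in> zero_sets T" for B using that .
  show "(\<lambda>x. emeasure (\<kappa> x) (path_space T)) \<in> borel_measurable N" by (rule *[OF zero_sets_UNIV])
 qed (use \<kappa> in \<open>auto intro: prob_space_imp_subprob_space\<close>)
 \<comment> \<open>The law of (a x, y) with y drawn from \<open>\<kappa> x\<close>; binding it to N
   gives the candidate for the joint law.\<close>
 let ?D = "\<lambda>x. distr (\<kappa> x) ?CC (Pair (a x))"
 have D: "?D \<in> measurable N (subprob_algebra ?CC)"
  by (rule measurable_distr2[OF _ k]) (use ab(1) in measurable)
 have rect: "emeasure (?J) (A \<times> B) = emeasure (N \<bind> ?D) (A \<times> B)"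
  if A: "A \<in> zero_sets T" and B: "B \<in> zero_sets T" for A B
 proof -
  obtain f :: "nat => 'd path => real" where f: "\<And>n. unit_fun T (f n)" "\<And>w. w \<in> path_space T ==> (\<lambda>n. f n w) \<longlonglongrightarrow> indicator A w"
   using zero_set_approx[OF A] by blast
  obtain h :: "nat => 'd path => real" where h: "\<And>n. unit_fun T (h n)" "\<And>w. w \<in> path_space T ==> (\<lambda>n. h n w) \<longlonglongrightarrow> indicator B w"
   using zero_set_approx[OF B] by blast
  have spa: "a x \<in> path_space T" "b x \<in> path_space T" if "x \<in> space N" for x
   using measurable_space[OF ab(1) that] measurable_space[OF ab(2) that] by auto
  note fm = measurable_compose[OF ab(1) unit_fun_measurable[OF f(1) T]]
  note hm = measurable_compose[OF ab(2) unit_fun_measurable[OF h(1) T]]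
  have mA: "(\<lambda>x. indicator A (a x) :: real) \<in> borel_measurable N" by (rule measurable_compose[OF ab(1)]) (use zs[OF A] in simp)
  have mB: "(\<lambda>x. indicator B (b x) :: real) \<in> borel_measurable N" by (rule measurable_compose[OF ab(2)]) (use zs[OF B] in simp)
  have "(\<lambda>n. \<integral>x. f n (a x) * h n (b x) \<partial>N) \<longlonglongrightarrow> (\<integral>x. indicator A (a x) * indicator B (b x) \<partial>N)"
  proof (rule integral_dominated_convergence[where w = "\<lambda>_. 1"])
   show "AE x in N. norm (f n (a x) * h n (b x)) \<le> 1" for n
    unfolding real_norm_def abs_mult using spa bnd[OF f(1)] bnd[OF h(1)] by (intro AE_I2 mult_le_one) auto
  qed (use mA mB fm hm f(2) h(2) spa in \<open>auto intro!: AE_I2 tendsto_mult borel_measurable_times\<close>)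
  moreover have "(\<lambda>n. \<integral>x. f n (a x) * (\<integral>y. h n y \<partial>\<kappa> x) \<partial>N) \<longlonglongrightarrow> (\<integral>x. indicator A (a x) * measure (\<kappa> x) B \<partial>N)"
  proof (rule integral_dominated_convergence[where w = "\<lambda>_. 1"])
   have "\<bar>\<integral>y. h n y \<partial>\<kappa> x\<bar> \<le> 1" if x: "x \<in> space N" for x n
   proof -
    interpret K: prob_space "\<kappa> x" by (rule \<kappa>(1)[OF x])
    show ?thesis
     by (rule K.abs_integral_le_1) (use bnd[OF h(1)] spk[OF x] in simp)
   qed
   then show "AE x in N. norm (f n (a x) * (\<integral>y. h n y \<partial>\<kappa> x)) \<le> 1" for n
    unfolding real_norm_def abs_mult using spa bnd[OF f(1)] by (intro AE_I2 mult_le_one) auto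
  qed (use mA mm[OF B] fm meas[OF h(1)] f(2) lim\<kappa>[OF _ B h] spa in \<open>auto intro!: AE_I2 tendsto_mult borel_measurable_times\<close>)
  ultimately have e: "(\<integral>x. indicator A (a x) * indicator B (b x) \<partial>N) = (\<integral>x. indicator A (a x) * measure (\<kappa> x) B \<partial>N)"
   unfolding eq[OF f(1) h(1)] by (rule LIMSEQ_unique)
  have "emeasure (?J) (A \<times> B) = (\<integral>\<^sup>+x. ennreal (indicator A (a x) * indicator B (b x)) \<partial>N)"
  proof -
   let ?S = "(\<lambda>x. (a x, b x)) -` (A \<times> B) \<inter> space N"
   have P: "(\<lambda>x. (a x, b x)) \<in> measurable N ?CC" using ab by measurable
   have AB: "A \<times> B \<in> sets ?CC" using zs A B by auto
   have "emeasure (?J) (A \<times> B) = (\<integral>\<^sup>+x. indicator ?S x \<partial>N)"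
    unfolding emeasure_distr[OF P AB] by (rule nn_integral_indicator[OF measurable_sets[OF P AB], symmetric])
   also have "... = (\<integral>\<^sup>+x. ennreal (indicator A (a x) * indicator B (b x)) \<partial>N)"
    by (intro nn_integral_cong) (simp add: indicator_def)
   finally show ?thesis .
  qed
  also have "... = ennreal (\<integral>x. indicator A (a x) * indicator B (b x) \<partial>N)"
   using mA mB by (intro nn_integral_eq_integral N.integrable_const_bound[where B = 1]) (auto simp: indicator_def)
  also have "... = (\<integral>\<^sup>+x. ennreal (indicator A (a x) * measure (\<kappa> x) B) \<partial>N)"
   unfolding e using mA mm[OF B] prob_space.prob_le_1[OF \<kappa>(1)]
   by (intro nn_integral_eq_integral[symmetric] N.integrable_const_bound[where B = 1]) (auto simp: indicator_def)
  also have "... = (\<integral>\<^sup>+x. emeasure (?D x) (A \<times> B) \<partial>N)"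
  proof (rule nn_integral_cong)
   fix x assume x: "x \<in> space N"
   have mP: "Pair (a x) \<in> measurable (\<kappa> x) ?CC"
    using spa(1)[OF x] by (subst measurable_cong_sets[OF \<kappa>(2)[OF x] refl]) auto
   have "emeasure (?D x) (A \<times> B) = emeasure (\<kappa> x) (Pair (a x) -` (A \<times> B) \<inter> space (\<kappa> x))"
    using zs A B by (intro emeasure_distr mP) auto
   also have "Pair (a x) -` (A \<times> B) \<inter> space (\<kappa> x) = (if a x \<in> A then B else {})"
    using spk[OF x] B zero_sets_Pow by auto
   finally show "ennreal (indicator A (a x) * measure (\<kappa> x) B) = emeasure (?D x) (A \<times> B)"
    using em[OF x, of B] by (simp add: indicator_def)
  qed
  also have "... = emeasure (N \<bind> ?D) (A \<times> B)"
   using zs A B N.not_empty by (intro emeasure_bind[OF _ D, symmetric]) auto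
  finally show ?thesis .
 qed
 define E where "E = {A \<times> B |A B. A \<in> (zero_sets T :: 'd path set set) \<and> B \<in> (zero_sets T :: 'd path set set)}"
 have gen: "sets ?CC = sigma_sets ?P2 E"
 proof -
  have "sets ?CC = sets (sigma (space ?C \<times> space ?C) E)"
   unfolding E_def by (rule sets_pair_eq[where Ca = "{path_space T}" and Cb = "{path_space T}"])
    (use zero_sets_Pow zero_sets_UNIV sets_cf_zero_sets[OF T] in auto)
  also have "... = sigma_sets ?P2 E"
   using zero_sets_Pow by (subst sets_measure_of) (auto simp: E_def)
  finally show ?thesis .
 qed
 have sb: "sets (N \<bind> ?D) = sets ?CC" by (rule sets_bind) (use N.not_empty in auto)
 have meq: "?J = N \<bind> ?D"
 proof (rule measure_eqI_generator_eq)
  show "Int_stable E"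
  proof (rule Int_stableI)
   fix u v assume "u \<in> E"
    "v \<in> E"
   then obtain A B A' B' :: "'d path set" where *: "u = A \<times> B" "v = A' \<times> B'"
    "A \<in> zero_sets T" "B \<in> zero_sets T" "A' \<in> zero_sets T" "B' \<in> zero_sets T" unfolding E_def by blast
   have "A \<inter> A' \<in> zero_sets T" "B \<inter> B' \<in> zero_sets T" using Int_stable_zero_sets *(3-6) by (auto simp: Int_stable_def)
   then show "u \<inter> v \<in> E" unfolding * Times_Int_Times E_def by blast
  qed
  show "E \<subseteq> Pow ?P2"
   using zero_sets_Pow by (auto simp: E_def)
  show "emeasure (?J) X = emeasure (N \<bind> ?D) X"
   if "X \<in> E" for X using that rect by (auto simp: E_def)
  show "range (\<lambda>_::nat. path_space T \<times> path_space T) \<subseteq> E"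
   using zero_sets_UNIV by (auto simp: E_def)
  interpret J: prob_space "?J" by (rule N.prob_space_distr) (use ab in auto)
  show "emeasure (?J) ?P2 \<noteq> \<infinity>" by simp
 qed (use gen sb in auto)
 fix F :: "'d path \<times> 'd path => ennreal" assume F: "F \<in> borel_measurable ?CC"
 have "(\<integral>\<^sup>+x. F (a x, b x) \<partial>N) = (\<integral>\<^sup>+z. F z \<partial>?J)"
  using ab F by (intro nn_integral_distr[symmetric]) auto
 also have "... = (\<integral>\<^sup>+x. \<integral>\<^sup>+z. F z \<partial>?D x \<partial>N)" unfolding meq by (rule nn_integral_bind[OF F D])
 also have "... = (\<integral>\<^sup>+x. \<integral>\<^sup>+y. F (a x, y) \<partial>\<kappa> x \<partial>N)"
 proof (rule nn_integral_cong)
  fix x assume x: "x \<in> space N"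
  have "Pair (a x) \<in> measurable (\<kappa> x) ?CC"
   using measurable_space[OF ab(1) x] by (subst measurable_cong_sets[OF \<kappa>(2)[OF x] refl]) auto
  then show "(\<integral>\<^sup>+z. F z \<partial>?D x) = (\<integral>\<^sup>+y. F (a x, y) \<partial>\<kappa> x)" using F by (intro nn_integral_distr) auto
 qed
 finally show "(\<integral>\<^sup>+x. F (a x, b x) \<partial>N) = (\<integral>\<^sup>+x. \<integral>\<^sup>+y. F (a x, y) \<partial>\<kappa> x \<partial>N)" .
qed

lemma tendsto_subseq_subseq:
 fixes X :: "nat => real"
 assumes "\<And>r :: nat => nat. strict_mono r ==> \<exists>r'. strict_mono (r' :: nat => nat) \<and> (\<lambda>n. X (r (r' n))) \<longlonglongrightarrow> L"
 shows "X \<longlonglongrightarrow> L"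
proof (rule ccontr)
 assume "\<not> X \<longlonglongrightarrow> L"
 then obtain e where e: "e > 0" "\<forall>N. \<exists>n\<ge>N. e \<le> dist (X n) L"
  unfolding LIMSEQ_def by (auto simp: not_less)
 have "infinite {n. e \<le> dist (X n) L}" unfolding infinite_nat_iff_unbounded_le using e(2) by simp
 from infinite_enumerate[OF this] obtain r :: "nat => nat" where r: "strict_mono r" "\<forall>n. r n \<in> {n. e \<le> dist (X n) L}" by blast
 from assms[OF r(1)] obtain r' :: "nat => nat" where "(\<lambda>n. X (r (r' n))) \<longlonglongrightarrow> L" by blast
 from metric_LIMSEQ_D[OF this e(1)] obtain n where "dist (X (r (r' n))) L < e" by blast
 then show False using r(2)[rule_format, of "r' n"] by simp
qed

section \<open>The law of the chosen solution as a limit of Euler schemes\<close>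

context sde
begin

abbreviation "\<P> \<equiv> solution_law M W T \<sigma>"
abbreviation "\<C> \<equiv> (canonical_filtration T T :: 'd path measure)"

text \<open>At t = T the time interval is a single point, and the zero path solves the equation with
  empty elementary sums.\<close>

lemma solution_exists':
 assumes "0 \<le> t" "t \<le> T" "w \<in> path_space T"
 shows "\<exists>X. solves t w X"
proof (cases "t = T")
 case True
 have "solves T w (\<lambda>_ _. 0)" unfolding strong_solution_def
 proof (intro conjI)
  show "has_stoch_integral M filt (T - T) (*v) (\<lambda>t' x. shift T T w \<sigma> t' (\<lambda>_. 0)) W (\<lambda>t x. 0)"
   unfolding has_stoch_integral_def
   by (rule exI[of _ "\<lambda>_. 0"], rule exI[of _ "\<lambda>_ _. 0"], rule exI[of _ "\<lambda>_ _ _. 0"])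
    (auto simp: elementary_def ucp_tendsto_def elementary_integral_def intro!: exI[of _ "\<lambda>_. {}"] mono_onI)
 qed (auto simp: path_space_zero)
 then show ?thesis using True by blast
qed (use solution_exists assms in auto)

text \<open>The same choice as in \<open>solution_law\<close>, so that \<open>law_eq\<close> holds
  by unfolding.\<close>

definition sol :: "real => 'd path => 'm => 'd path" where
 "sol t w = (SOME X. solves t w X)"

lemma sol: "0 \<le> t ==> t \<le> T ==> w \<in> path_space T ==> solves t w (sol t w)"
 unfolding sol_def using solution_exists' by (intro someI_ex[where P = "solves t w"])

lemma law_eq: "\<P> t w = distr M \<C> (sol t w)"
 by (simp add: solution_law_def sol_def)

lemma sets_law [simp]: "sets (\<P> t w) = sets \<C>"
 by (simp add: law_eq)

lemma space_law [simp]: "space (\<P> t w) = path_space T"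
 by (simp add: law_eq)

lemma measurable_law [simp]: "measurable (\<P> t w) N = measurable \<C> N"
 by (rule measurable_cong_sets) auto

lemma sol_measurable: "0 \<le> t ==> t \<le> T ==> w \<in> path_space T ==> sol t w \<in> measurable M \<C>"
 using solves_measurable sol by blast

lemma prob_space_law: "0 \<le> t ==> t \<le> T ==> w \<in> path_space T ==> prob_space (\<P> t w)"
 unfolding law_eq by (intro prob_space_distr sol_measurable)

lemma law_integral:
 fixes g :: "'d path => real"
 assumes "0 \<le> t" "t \<le> T" "w \<in> path_space T" "g \<in> borel_measurable \<C>"
 shows "(\<integral>v. g v \<partial>\<P> t w) = (\<integral>x. g (sol t w x) \<partial>M)"
 unfolding law_eq by (intro integral_distr sol_measurable assms)

lemma law_stopped: "\<P> t (stopped t w) = \<P> t w"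
 by (simp add: solution_law_def shift_def path_concat_stopped)

abbreviation "scheme dt t w x \<equiv> euler dt t w (noise dt x) (steps dt t)"

definition euler_mean :: "real => real => 'd path => ('d path => real) => real" where
 "euler_mean dt t w g = (\<integral>x. g (scheme dt t w x) \<partial>M)"

lemma scheme_path:
 assumes "0 < dt" "0 \<le> t" "t \<le> T"
 shows "scheme dt t w x \<in> path_space T"
 using steps_le[OF assms(1,3)] assms by (intro euler_path_space) auto

lemma scheme_measurable:
 assumes "0 < dt" "0 \<le> t" "t \<le> T" "w \<in> path_space T"
 shows "scheme dt t w \<in> measurable M \<C>"
proof (rule euler_measurable)
 show "(\<lambda>x. noise dt x i) \<in> borel_measurable M" if "i < steps dt t" for i
  using measurable_filt_M[OF noise_filt[OF assms(1) order_refl that]] steps_le[OF assms(1,3)] assms by auto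
qed (use steps_le[OF assms(1,3)] assms in auto)

lemma scheme_interpolate:
 assumes "0 < dt" "0 \<le> t" "t \<le> T" "X x \<in> path_space T"
 shows "norm (scheme dt t w x s - interpolate dt (steps dt t) (X x) s) \<le> euler_error dt t w X x"
proof -
 let ?N = "steps dt t" and ?y = "\<lambda>i. euler_coef dt t w (noise dt x) i *v noise dt x i"
 let ?d = "\<lambda>k. ?y k - (X x (real (Suc k) * dt) - X x (real k * dt))"
 have *: "norm (\<Sum>k<j. ?d k) \<le> euler_error dt t w X x" if j: "j \<le> ?N" for j
 proof -
  have "X x 0 = 0" using path_space_0[OF assms(4)] .
  then have "(\<Sum>k<j. ?d k) = scheme dt t w x (real j * dt) - X x (real j * dt)"
   unfolding euler_polygon polygon_grid[OF assms(1) j] sum_subtractf[of ?y "\<lambda>k. X x (real (Suc k) * dt) - X x (real k * dt)"] sum_increments by simp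
  then show ?thesis unfolding euler_error_def
   using runmax_ge[OF j, of "\<lambda>k. norm (X x (real k * dt) - scheme dt t w x (real k * dt))"] by (simp add: norm_minus_commute)
 qed
 have eq: "scheme dt t w x s - interpolate dt ?N (X x) s = polygon dt ?N ?d s"
  unfolding interpolate_def euler_polygon polygon_diff ..
 show ?thesis unfolding eq
 proof (cases "s \<le> real ?N * dt")
  case True
  show "norm (polygon dt ?N ?d s) \<le> euler_error dt t w X x"
   by (rule norm_polygon_le_max[OF assms(1) * order_refl True])
 next
  case False
  then show "norm (polygon dt ?N ?d s) \<le> euler_error dt t w X x"
   using polygon_end[OF assms(1), of ?N s ?d] *[of ?N] by simp
 qed
qed

text \<open>Convergence of the error in probability gives convergence of the truncated error in
  mean, hence almost surely along a subsequence. Between the nodes scheme and X are compared through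
  the interpolation of X, which converges on every path.\<close>

lemma scheme_AE_subseq:
 assumes t: "0 \<le> t" "t \<le> T" and tt: "\<And>n. t \<le> tt n \<and> tt n \<le> T" "tt \<longlonglongrightarrow> t"
  and p: "w \<in> path_space T" "\<And>n. p n \<in> path_space T" "pconv (\<lambda>n. stopped (tt n) (p n)) (stopped t w)"
  and dt: "\<And>n. 0 < dt n" "dt \<longlonglongrightarrow> 0" and X: "solves t w X"
 obtains r :: "nat => nat" where "strict_mono r" "AE x in M. pconv (\<lambda>n. scheme (dt (r n)) (tt (r n)) (p (r n)) x) (X x)"
proof -
 define e where "e n x = euler_error (dt n) (tt n) (p n) X x" for n x
 let ?L = "\<lambda>n. \<integral>x. norm (min 1 (e n x)) \<partial>M"
 have tt0: "0 \<le> tt n" "tt n \<le> T" for n using tt(1)[of n] t by auto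
 have em: "e n \<in> borel_measurable M" for n
  unfolding e_def using solves_measurable[OF X t] dt(1) tt0 p(2) by (intro euler_error_measurable) auto
 have e0: "0 \<le> e n x" for n x
  unfolding e_def euler_error_def by (rule order_trans[OF norm_ge_zero runmax_ge[of 0]]) simp
 have int: "integrable M (\<lambda>x. min 1 (e n x))" for n
  using em[of n] e0[of n] by (intro integrable_const_bound[where B = 1]) auto
 have "(\<lambda>n. \<integral>x. norm (min 1 (e n x)) \<partial>M) \<longlonglongrightarrow> 0"
 proof (rule metric_LIMSEQ_I)
  fix c :: real assume c: "0 < c"
  have "(\<lambda>n. prob {x\<in>space M. c/2 \<le> e n x}) \<longlonglongrightarrow> 0"
   unfolding e_def using euler_converges[OF t tt p dt X, of "c/2"] c by simp
  then have "\<forall>\<^sub>F n in sequentially. prob {x\<in>space M. c/2 \<le> e n x} < c/2" using c by (intro order_tendstoD(2)) auto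
  then have "\<forall>\<^sub>F n in sequentially. dist (?L n) 0 < c"
  proof eventually_elim
   case (elim n)
   let ?A = "{x\<in>space M. c/2 \<le> e n x}"
   have A: "?A \<in> events" using em[of n] by measurable
   have "(?L n) \<le> (\<integral>x. c/2 + indicator ?A x \<partial>M)"
   proof (rule integral_mono)
    show "norm (min 1 (e n x)) \<le> c/2 + indicator ?A x" if "x \<in> space M" for x
     using that e0[of n x] c by (auto simp: indicator_def)
   qed (use int A in \<open>auto intro!: integrable_real_indicator simp: emeasure_eq_measure\<close>)
   also have "... = c/2 + prob ?A" using A by (simp add: prob_space emeasure_eq_measure)
   also have "... < c" using elim by simp
   finally have "(?L n) < c" .
   moreover have "0 \<le> (?L n)" by simp
   ultimately show ?case by simp
  qed
  then show "\<exists>no. \<forall>n\<ge>no. dist (?L n) 0 < c" by (simp add: eventually_sequentially)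
 qed
 from tendsto_L1_AE_subseq[OF int this] obtain r :: "nat => nat" where r: "strict_mono r" "AE x in M. (\<lambda>n. min 1 (e (r n) x)) \<longlonglongrightarrow> 0" by blast
 note rl = LIMSEQ_subseq_LIMSEQ[OF _ r(1), unfolded o_def]
 have "AE x in M. pconv (\<lambda>n. scheme (dt (r n)) (tt (r n)) (p (r n)) x) (X x)"
  using r(2) AE_space
 proof eventually_elim
  case (elim x)
  have XS: "X x \<in> path_space (T - t)" by (rule solves_path[OF X elim(2)])
  have XT: "X x \<in> path_space T" by (rule path_space_mono[OF XS]) (use t in auto)
  have N: "real (steps (dt n) (tt n)) * dt n \<le> T - tt n" "T - tt n - dt n \<le> real (steps (dt n) (tt n)) * dt n" for n
   using steps_le[OF dt(1) tt0(2), of n n] steps_gt[OF dt(1) tt0(2), of n n] by (auto simp: algebra_simps)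
  have "pconv (\<lambda>n. interpolate (dt (r n)) (steps (dt (r n)) (tt (r n))) (X x)) (X x)"
  proof (rule pconv_interpolate[OF XT T_pos, where S = "T - t"])
   show "real (steps (dt (r n)) (tt (r n))) * dt (r n) \<le> T - t" for n using N(1)[of "r n"] tt(1)[of "r n"] by linarith
   show "(\<lambda>n. real (steps (dt (r n)) (tt (r n))) * dt (r n)) \<longlonglongrightarrow> T - t"
   proof (rule tendsto_sandwich[OF always_eventually always_eventually])
    show "(\<lambda>n. T - tt (r n) - dt (r n)) \<longlonglongrightarrow> T - t"
     using tendsto_diff[OF tendsto_diff[OF tendsto_const rl[OF tt(2)]] rl[OF dt(2)], of T] by simp
    show "(\<lambda>n. T - tt (r n)) \<longlonglongrightarrow> T - t" by (intro tendsto_diff tendsto_const rl[OF tt(2)])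
   qed (use N in auto)
  qed (use XS t dt(1) rl[OF dt(2)] in auto)
  show ?case
  proof (rule pconvI)
   fix c :: real assume c: "0 < c"
   have "\<forall>\<^sub>F n in sequentially. min 1 (e (r n) x) < min 1 (c/2)" using c by (intro order_tendstoD(2)[OF elim(1)]) auto
   moreover have "\<forall>\<^sub>F n in sequentially. \<forall>s. norm (interpolate (dt (r n)) (steps (dt (r n)) (tt (r n))) (X x) s - X x s) < c/2"
    using c \<open>pconv (\<lambda>n. interpolate (dt (r n)) (steps (dt (r n)) (tt (r n))) (X x)) (X x)\<close> by (intro pconvD) auto
   ultimately show "\<forall>\<^sub>F n in sequentially. \<forall>s. norm (scheme (dt (r n)) (tt (r n)) (p (r n)) x s - X x s) < c"
   proof eventually_elim
    case (elim n)
    have e: "e (r n) x < c/2" using elim(1) by (simp add: min_def split: if_splits)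
    show ?case
    proof
     fix s
     have 1: "norm (scheme (dt (r n)) (tt (r n)) (p (r n)) x s - interpolate (dt (r n)) (steps (dt (r n)) (tt (r n))) (X x) s) \<le> e (r n) x"
      unfolding e_def
      by (intro scheme_interpolate dt(1) tt0) (rule XT)
     show "norm (scheme (dt (r n)) (tt (r n)) (p (r n)) x s - X x s) < c"
      using norm_triangle_mono[OF 1 order_refl, of "interpolate (dt (r n)) (steps (dt (r n)) (tt (r n))) (X x) s - X x s"]
       e elim(2)[rule_format, of s] by simp
    qed
   qed
  qed
 qed
 then show ?thesis using that r(1) by blast
qed

lemma unit_fun_abs: "unit_fun T g ==> w \<in> path_space T ==> \<bar>g w\<bar> \<le> 1"
 by (simp add: unit_funD)

text \<open>Every subsequence has a further one along which the schemes converge uniformly almost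
  surely, and dominated convergence identifies the same limit each time.\<close>

lemma euler_mean_tendsto:
 assumes t: "0 \<le> t" "t \<le> T" and tt: "\<And>n. t \<le> tt n \<and> tt n \<le> T" "tt \<longlonglongrightarrow> t"
  and p: "w \<in> path_space T" "\<And>n. p n \<in> path_space T" "pconv (\<lambda>n. stopped (tt n) (p n)) (stopped t w)"
  and dt: "\<And>n. 0 < dt n" "dt \<longlonglongrightarrow> 0" and g: "unit_fun T g"
 shows "(\<lambda>n. euler_mean (dt n) (tt n) (p n) g) \<longlonglongrightarrow> (\<integral>v. g v \<partial>\<P> t w)"
proof (rule tendsto_subseq_subseq)
 fix r0 :: "nat => nat" assume r0: "strict_mono r0"
 note rl = LIMSEQ_subseq_LIMSEQ[OF _ r0, unfolded o_def]
 have tt0: "0 \<le> tt n" "tt n \<le> T" for n using tt(1)[of n] t by auto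
 obtain r :: "nat => nat" where r: "strict_mono r" "AE x in M. pconv (\<lambda>n. scheme (dt (r0 (r n))) (tt (r0 (r n))) (p (r0 (r n))) x) (sol t w x)"
  using scheme_AE_subseq[OF t, of "\<lambda>n. tt (r0 n)" w "\<lambda>n. p (r0 n)" "\<lambda>n. dt (r0 n)" "sol t w"]
   tt(1) rl[OF tt(2)] p(1,2) pconv_subseq[OF p(3) r0] dt(1) rl[OF dt(2)] sol[OF t p(1)] by blast
 have gm: "g \<in> borel_measurable \<C>" by (rule unit_fun_measurable[OF g T_pos])
 have "(\<lambda>n. euler_mean (dt (r0 (r n))) (tt (r0 (r n))) (p (r0 (r n))) g) \<longlonglongrightarrow> (\<integral>x. g (sol t w x) \<partial>M)"
  unfolding euler_mean_def
 proof (rule integral_dominated_convergence[where w = "\<lambda>_. 1"])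
  show "(\<lambda>x. g (sol t w x)) \<in> borel_measurable M" by (rule measurable_compose[OF sol_measurable[OF t p(1)] gm])
  show "(\<lambda>x. g (scheme (dt (r0 (r n))) (tt (r0 (r n))) (p (r0 (r n))) x)) \<in> borel_measurable M" for n
   by (rule measurable_compose[OF scheme_measurable[OF dt(1) tt0 p(2)] gm])
  show "AE x in M. norm (g (scheme (dt (r0 (r n))) (tt (r0 (r n))) (p (r0 (r n))) x)) \<le> 1" for n
   unfolding real_norm_def by (intro AE_I2 unit_fun_abs[OF g] scheme_path dt(1) tt0)
  show "AE x in M. (\<lambda>n. g (scheme (dt (r0 (r n))) (tt (r0 (r n))) (p (r0 (r n))) x)) \<longlonglongrightarrow> g (sol t w x)"
   using r(2) AE_space
  proof eventually_elim
   case (elim x)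
   show ?case
    by (rule path_continuousD[OF unit_funD(1)[OF g] _ _ elim(1)])
     (use scheme_path[OF dt(1) tt0] measurable_space[OF sol_measurable[OF t p(1)] elim(2)] in auto)
  qed
 qed auto
 then show "\<exists>r'. strict_mono r' \<and> (\<lambda>n. euler_mean (dt (r0 (r' n))) (tt (r0 (r' n))) (p (r0 (r' n))) g) \<longlonglongrightarrow> (\<integral>v. g v \<partial>\<P> t w)"
  unfolding law_integral[OF t p(1) gm] using r(1) by blast
qed

text \<open>A diagonal argument. Each law is replaced by an Euler mean whose mesh is fine enough for
  an error below 1/(n + 1); the Euler means along the diagonal converge because
  \<open>euler_mean_tendsto\<close> admits moving starting points.\<close>

lemma law_right_continuous:
 assumes t: "0 \<le> t" "t \<le> T" and tt: "\<And>n. t \<le> tt n \<and> tt n \<le> T" "tt \<longlonglongrightarrow> t"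
  and p: "w \<in> path_space T" "\<And>n. p n \<in> path_space T" "pconv (\<lambda>n. stopped (tt n) (p n)) (stopped t w)"
  and g: "unit_fun T g"
 shows "(\<lambda>n. \<integral>v. g v \<partial>\<P> (tt n) (p n)) \<longlonglongrightarrow> (\<integral>v. g v \<partial>\<P> t w)"
proof -
 let ?d = "\<lambda>n::nat. inverse (real (Suc n))"
 let ?I = "\<lambda>n. \<integral>v. g v \<partial>\<P> (tt n) (p n)"
 let ?m = "\<lambda>k n. euler_mean (?d k) (tt n) (p n) g"
 have d: "0 < ?d n" for n by simp
 have tt0: "0 \<le> tt n" "tt n \<le> T" for n using tt(1)[of n] t by auto
 have "\<exists>m\<ge>n. dist (?m m n) (?I n) < ?d n" for n
 proof -
  have "(\<lambda>m. euler_mean (?d m) (tt n) (p n) g) \<longlonglongrightarrow> (?I n)"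
   by (rule euler_mean_tendsto[OF tt0 _ _ p(2) p(2) _ d LIMSEQ_inverse_real_of_nat g])
    (use tt0 in \<open>auto simp: pconv_const\<close>)
  from metric_LIMSEQ_D[OF this d[of n]] obtain m0 where "\<forall>m\<ge>m0. dist (?m m n) (?I n) < ?d n" by blast
  then show ?thesis by (intro exI[of _ "max n m0"]) simp
 qed
 then have "\<forall>n. \<exists>m. n \<le> m \<and> dist (?m m n) (?I n) < ?d n" by blast
 from choice[OF this] obtain m where m: "\<forall>n. n \<le> m n \<and> dist (?m (m n) n) (?I n) < ?d n" by (rule exE)
 have "filterlim m at_top sequentially"
  using m by (intro filterlim_at_top_mono[OF filterlim_ident]) (auto intro: always_eventually)
 then have d0: "(\<lambda>n. ?d (m n)) \<longlonglongrightarrow> 0" by (rule filterlim_compose[OF LIMSEQ_inverse_real_of_nat])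
 have lim: "(\<lambda>n. ?m (m n) n) \<longlonglongrightarrow> (\<integral>v. g v \<partial>\<P> t w)"
  by (rule euler_mean_tendsto[OF t tt p d d0 g])
 have d1: "(\<lambda>n. dist (?I n) (?m (m n) n)) \<longlonglongrightarrow> 0"
  by (rule tendsto_sandwich[OF _ _ tendsto_const LIMSEQ_inverse_real_of_nat])
   (use m in \<open>auto intro!: always_eventually less_imp_le simp: dist_commute\<close>)
 have "(\<lambda>n. (?I n) - ?m (m n) n) \<longlonglongrightarrow> 0"
  by (rule tendsto_norm_zero_cancel) (use d1 in \<open>simp only: dist_norm\<close>)
 then show ?thesis by (rule Lim_transform[OF lim])
qed

section \<open>Stationarity and independence of the noise\<close>

lemma noise_distr:
 assumes "0 < dt" "real (Suc k) * dt \<le> T"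
 shows "distr M borel (\<lambda>x. noise dt x k) = distr M borel (\<lambda>x. noise dt x 0)"
proof -
 let ?\<mu> = "PiM (UNIV :: 'd set) (\<lambda>i. density lborel (normal_density 0 (sqrt dt)))"
 have "distr M borel (\<lambda>x. noise dt x j) = distr ?\<mu> borel vec_lambda" if j: "real (Suc j) * dt \<le> T" for j
 proof -
  have st: "0 \<le> real j * dt" "real j * dt < real (Suc j) * dt" "real (Suc j) * dt - real j * dt = dt"
   using assms(1) by (auto simp: algebra_simps)
  note ic = increment_components[OF st(1,2) j, folded noise_def, unfolded st(3)]
  have n: "noise dt x j = vec_lambda (\<lambda>i\<in>UNIV. noise dt x j $ i)" for x by (simp add: vec_eq_iff)
  have rv: "random_variable borel (\<lambda>x. noise dt x j $ i)" for i using ic(1) by (auto simp: indep_vars_def)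
  have vm: "vec_lambda \<in> measurable (PiM (UNIV :: 'd set) (\<lambda>_. borel)) (borel :: (real ^ 'd) measure)"
   by (rule borel_measurable_vec) simp
  have dl: "distr M borel (\<lambda>x. noise dt x j $ i) = density lborel (normal_density 0 (sqrt dt))" for i
   using distributed_distr_eq_density[OF ic(2)[of i]] by (simp add: distr_cong[of M M lborel borel])
  have "distr M (PiM UNIV (\<lambda>_. borel)) (\<lambda>x. \<lambda>i\<in>UNIV. noise dt x j $ i) = ?\<mu>"
   using ic(1) unfolding indep_vars_iff_distr_eq_PiM[OF UNIV_not_empty rv] dl .
  note mu = this
  have rvP: "(\<lambda>x. \<lambda>i\<in>UNIV. noise dt x j $ i) \<in> measurable M (PiM UNIV (\<lambda>_. borel))"
   by (intro measurable_restrict rv)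
  have "distr ?\<mu> borel vec_lambda = distr M borel (\<lambda>x. vec_lambda (\<lambda>i\<in>UNIV. noise dt x j $ i))"
   unfolding mu[symmetric] distr_distr[OF vm rvP] by (simp add: o_def)
  then show ?thesis using n by simp
 qed
 moreover have "real (Suc 0) * dt \<le> real (Suc k) * dt" using assms(1) by (intro mult_right_mono) auto
 then have "real (Suc 0) * dt \<le> T" using assms(2) by linarith
 ultimately show ?thesis using assms(2) by metis
qed


lemma noise_measurable:
 assumes "0 < dt" "real (Suc i) * dt \<le> T"
 shows "(\<lambda>x. noise dt x i) \<in> borel_measurable M"
 using measurable_filt_M[OF noise_filt[OF assms(1) order_refl, of i "Suc i"] assms(2)] by simp

text \<open>Both blocks are independent families with the same marginals, hence have the same
  product law.\<close>

lemma noise_block_distr: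
 assumes "0 < dt" "real (k + m) * dt \<le> T"
 shows "distr M (PiM {..<m} (\<lambda>_. borel)) (\<lambda>x. \<lambda>i\<in>{..<m}. noise dt x (k + i)) =
  distr M (PiM {..<m} (\<lambda>_. borel)) (\<lambda>x. \<lambda>i\<in>{..<m}. noise dt x i)"
proof (cases "m = 0")
 case False
 have le: "real j * dt \<le> T" if "j \<le> k + m" for j
 proof -
  have "real j * dt \<le> real (k + m) * dt" using that assms(1) by (intro mult_right_mono) auto
  then show ?thesis using assms(2) by linarith
 qed
 have *: "distr M (PiM {..<m} (\<lambda>_. borel)) (\<lambda>x. \<lambda>i\<in>{..<m}. noise dt x (l + i)) =
   PiM {..<m} (\<lambda>_. distr M borel (\<lambda>x. noise dt x 0))" if l: "l \<le> k" for l
 proof -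
  have "indep_vars (\<lambda>_. borel) (\<lambda>i x. W (real (l + Suc i) * dt) x - W (real (l + i) * dt) x) {..<m}"
  proof (rule increments_indep[where r = "\<lambda>i. real (l + i) * dt"])
   show "real (l + i) * dt \<in> {0..T}" if "i \<le> m" for i using le[of "l + i"] that l assms(1) by simp
   show "mono_on {..m} (\<lambda>i. real (l + i) * dt)" using assms(1) by (intro mono_onI mult_right_mono) auto
  qed
  then have ind: "indep_vars (\<lambda>_. borel) (\<lambda>i x. noise dt x (l + i)) {..<m}" by (simp add: noise_def)
  have rv: "random_variable borel (\<lambda>x. noise dt x (l + i))" if "i \<in> {..<m}" for i
   using that l by (intro noise_measurable assms(1) le) auto
  have "distr M (PiM {..<m} (\<lambda>_. borel)) (\<lambda>x. \<lambda>i\<in>{..<m}. noise dt x (l + i)) = PiM {..<m} (\<lambda>i. distr M borel (\<lambda>x. noise dt x (l + i)))"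
   using ind False by (subst (asm) indep_vars_iff_distr_eq_PiM'[OF _ rv]) auto
  also have "... = PiM {..<m} (\<lambda>_. distr M borel (\<lambda>x. noise dt x 0))"
   using l by (intro PiM_cong noise_distr assms(1) le) auto
  finally show ?thesis .
 qed
 show ?thesis using *[of k] *[of 0] by simp
qed (simp add: restrict_def)

text \<open>The later block is independent of the earlier one and distributed like the block at time
  0. It may be replaced by the initial increments at a second, independent sample point y, that is,
  by the noise of a scheme started afresh.\<close>

lemma noise_split:
 fixes H :: "(nat => real ^ 'd) \<times> (nat => real ^ 'd) => real"
 assumes "0 < dt" "real (k + m) * dt \<le> T"
  and H: "H \<in> borel_measurable (PiM {..<k} (\<lambda>_. borel) \<Otimes>\<^sub>M PiM {..<m} (\<lambda>_. borel))" "\<And>z. \<bar>H z\<bar> \<le> 1"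
 defines "R \<equiv> (\<lambda>l x. \<lambda>i\<in>{..<l}. noise dt x i)"
 shows "(\<integral>x. H (R k x, \<lambda>i\<in>{..<m}. noise dt x (k + i)) \<partial>M) = (\<integral>x. \<integral>y. H (R k x, R m y) \<partial>M \<partial>M)"
  "(\<lambda>x. \<integral>y. H (R k x, R m y) \<partial>M) \<in> borel_measurable M"
proof -
 let ?A = "PiM {..<k} (\<lambda>_. borel :: (real ^ 'd) measure)" and ?B = "PiM {..<m} (\<lambda>_. borel :: (real ^ 'd) measure)"
 let ?S = "\<lambda>x. \<lambda>i\<in>{..<m}. noise dt x (k + i)"
 have le: "real j * dt \<le> T" if "j \<le> k + m" for j
 proof -
  have "real j * dt \<le> real (k + m) * dt" using that assms(1) by (intro mult_right_mono) auto
  then show ?thesis using assms(2) by linarith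
 qed
 have nm: "(\<lambda>x. noise dt x i) \<in> borel_measurable M" if "i < k + m" for i
  using that by (intro noise_measurable assms(1) le) auto
 have Rm: "R k \<in> measurable M ?A" "R m \<in> measurable M ?B" "?S \<in> measurable M ?B"
  unfolding R_def by (intro measurable_restrict nm; auto)+
 have ind: "indep_vars (\<lambda>_. borel) (\<lambda>i x. noise dt x i) {..<k + m}" unfolding noise_def
 proof (rule increments_indep[where r = "\<lambda>i. real i * dt"])
  show "real i * dt \<in> {0..T}" if "i \<le> k + m" for i using le[OF that] assms(1) by simp
  show "mono_on {..k + m} (\<lambda>i. real i * dt)" using assms(1) by (intro mono_onI mult_right_mono) auto
 qed
 have "indep_var (PiM {..<k} (\<lambda>_. borel)) (\<lambda>x. restrict (\<lambda>i. noise dt x i) {..<k})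
   (PiM {k..<k + m} (\<lambda>_. borel)) (\<lambda>x. restrict (\<lambda>i. noise dt x i) {k..<k + m})"
  by (rule indep_var_restrict[OF ind]) auto
 from indep_var_compose[OF this, of id ?A "\<lambda>z. \<lambda>i\<in>{..<m}. z (k + i)" ?B]
 have "indep_var ?A (R k) ?B (\<lambda>x. \<lambda>i\<in>{..<m}. restrict (\<lambda>i. noise dt x i) {k..<k + m} (k + i))"
  by (auto simp: o_def R_def intro!: measurable_restrict)
 moreover have "(\<lambda>i\<in>{..<m}. restrict (\<lambda>i. noise dt x i) {k..<k + m} (k + i)) = ?S x" for x by (auto simp: fun_eq_iff)
 ultimately have iv: "indep_var ?A (R k) ?B ?S" by simp
 interpret A: prob_space "distr M ?A (R k)" by (rule prob_space_distr[OF Rm(1)])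
 interpret B: prob_space "distr M ?B (R m)" by (rule prob_space_distr[OF Rm(2)])
 interpret AB: pair_prob_space "distr M ?A (R k)" "distr M ?B (R m)" ..
 have J: "distr M (?A \<Otimes>\<^sub>M ?B) (\<lambda>x. (R k x, ?S x)) = distr M ?A (R k) \<Otimes>\<^sub>M distr M ?B (R m)"
  using iv noise_block_distr[OF assms(1,2)] unfolding indep_var_distribution_eq R_def by metis
 have Hm: "H \<in> borel_measurable (distr M ?A (R k) \<Otimes>\<^sub>M distr M ?B (R m))" using H(1) by simp
 have iH: "integrable (distr M ?A (R k) \<Otimes>\<^sub>M distr M ?B (R m)) H"
  by (rule AB.P.integrable_const_bound[where B = 1, OF _ Hm]) (use H(2) in auto)
 have inner: "(\<integral>z. H (a, z) \<partial>distr M ?B (R m)) = (\<integral>y. H (a, R m y) \<partial>M)" if "a \<in> space ?A" for a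
  by (rule integral_distr[OF Rm(2) measurable_compose[OF measurable_Pair1'[OF that] H(1)]])
 have Fm: "(\<lambda>a. \<integral>z. H (a, z) \<partial>distr M ?B (R m)) \<in> borel_measurable ?A"
  using B.borel_measurable_lebesgue_integral[of "\<lambda>a z. H (a, z)" ?A] H(1) by (simp add: split_def)
 have "(\<integral>x. H (R k x, ?S x) \<partial>M) = (\<integral>z. H z \<partial>distr M (?A \<Otimes>\<^sub>M ?B) (\<lambda>x. (R k x, ?S x)))"
  using Rm H(1) by (intro integral_distr[symmetric]) auto
 also have "... = (\<integral>a. \<integral>z. H (a, z) \<partial>distr M ?B (R m) \<partial>distr M ?A (R k))"
  unfolding J using AB.integral_fst[of "\<lambda>a z. H (a, z)"] iH by (simp add: split_def)
 also have "... = (\<integral>x. \<integral>z. H (R k x, z) \<partial>distr M ?B (R m) \<partial>M)"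
  by (rule integral_distr[OF Rm(1) Fm])
 also have "... = (\<integral>x. \<integral>y. H (R k x, R m y) \<partial>M \<partial>M)"
  by (intro Bochner_Integration.integral_cong inner refl measurable_space[OF Rm(1)])
 finally show "(\<integral>x. H (R k x, ?S x) \<partial>M) = (\<integral>x. \<integral>y. H (R k x, R m y) \<partial>M \<partial>M)" .
 show "(\<lambda>x. \<integral>y. H (R k x, R m y) \<partial>M) \<in> borel_measurable M"
  using measurable_compose[OF Rm(1) Fm] measurable_space[OF Rm(1)] inner by (subst measurable_cong[where g = "\<lambda>x. \<integral>z. H (R k x, z) \<partial>distr M ?B (R m)"]) auto
qed

end

text \<open>Passes from nonnegative to signed functions by positive and negative parts. The inner
  integral exists only almost everywhere and has the default value 0 elsewhere, so its measurability
  is shown through a case distinction on the two parts.\<close>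

lemma kernel_integral:
 fixes G :: "'a \<times> 'b => real"
 assumes \<kappa>: "\<kappa> \<in> measurable N (subprob_algebra C)" and G: "G \<in> borel_measurable (A \<Otimes>\<^sub>M C)"
  and a: "a \<in> measurable N A"
  and eq: "\<And>F. F \<in> borel_measurable (A \<Otimes>\<^sub>M C) ==> (\<integral>\<^sup>+x. F (a x, b x) \<partial>N) = (\<integral>\<^sup>+x. \<integral>\<^sup>+y. F (a x, y) \<partial>\<kappa> x \<partial>N)"
  and int: "integrable N (\<lambda>x. G (a x, b x))"
 shows "integrable N (\<lambda>x. \<integral>y. G (a x, y) \<partial>\<kappa> x)"
  "(\<integral>x. G (a x, b x) \<partial>N) = (\<integral>x. \<integral>y. G (a x, y) \<partial>\<kappa> x \<partial>N)"
  "AE x in N. integrable (\<kappa> x) (\<lambda>y. G (a x, y))"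
proof -
 define p where "p x = (\<integral>\<^sup>+y. ennreal (G (a x, y)) \<partial>\<kappa> x)" for x
 define m where "m x = (\<integral>\<^sup>+y. ennreal (- G (a x, y)) \<partial>\<kappa> x)" for x
 have sp: "(\<lambda>(x, y). (a x, y)) \<in> measurable (N \<Otimes>\<^sub>M C) (A \<Otimes>\<^sub>M C)" using a by measurable
 have pm: "p \<in> borel_measurable N"
  unfolding p_def by (rule nn_integral_measurable_subprob_algebra2[OF _ \<kappa>]) (use measurable_compose[OF sp measurable_compose[OF G measurable_ennreal]] in \<open>simp add: split_def\<close>)
 have mm: "m \<in> borel_measurable N"
  unfolding m_def by (rule nn_integral_measurable_subprob_algebra2[OF _ \<kappa>])
   (use measurable_compose[OF sp measurable_compose[OF borel_measurable_uminus[OF G] measurable_ennreal]] in \<open>simp add: split_def\<close>)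
 have pe: "(\<integral>\<^sup>+x. ennreal (G (a x, b x)) \<partial>N) = (\<integral>\<^sup>+x. p x \<partial>N)"
  unfolding p_def by (rule eq) (use G in measurable)
 have me: "(\<integral>\<^sup>+x. ennreal (- G (a x, b x)) \<partial>N) = (\<integral>\<^sup>+x. m x \<partial>N)"
  unfolding m_def by (rule eq[of "\<lambda>z. ennreal (- G z)"]) (use G in measurable)
 have fin: "(\<integral>\<^sup>+x. p x \<partial>N) \<noteq> \<infinity>" "(\<integral>\<^sup>+x. m x \<partial>N) \<noteq> \<infinity>"
  unfolding pe[symmetric] me[symmetric] using real_integrable_def[of N "\<lambda>x. G (a x, b x)"] int by auto
 have Gk: "(\<lambda>y. G (a x, y)) \<in> borel_measurable (\<kappa> x)" if "x \<in> space N" for x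
  using measurable_compose[OF measurable_Pair1'[OF measurable_space[OF a that]] G]
   measurable_cong_sets[OF subprob_measurableD(2)[OF \<kappa> that] refl] by blast
 have ae: "AE x in N. p x \<noteq> \<infinity> \<and> m x \<noteq> \<infinity>"
  using nn_integral_PInf_AE[OF pm fin(1)] nn_integral_PInf_AE[OF mm fin(2)] by auto
 show "AE x in N. integrable (\<kappa> x) (\<lambda>y. G (a x, y))"
  using ae AE_space by eventually_elim (use Gk in \<open>auto simp: real_integrable_def p_def m_def\<close>)
 then have eq': "AE x in N. (\<integral>y. G (a x, y) \<partial>\<kappa> x) = enn2real (p x) - enn2real (m x)"
  by eventually_elim (simp add: real_lebesgue_integral_def p_def m_def)
 have en: "integrable N (\<lambda>x. enn2real (h x)) \<and> (\<integral>x. enn2real (h x) \<partial>N) = enn2real (\<integral>\<^sup>+x. h x \<partial>N)"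
  if hm: "h \<in> borel_measurable N" and hf: "(\<integral>\<^sup>+x. h x \<partial>N) \<noteq> \<infinity>" for h
 proof -
  have e: "(\<integral>\<^sup>+x. ennreal (enn2real (h x)) \<partial>N) = (\<integral>\<^sup>+x. h x \<partial>N)"
   using nn_integral_PInf_AE[OF hm hf] by (intro nn_integral_cong_AE) (auto simp: less_top elim: eventually_mono)
  have "integrable N (\<lambda>x. enn2real (h x))"
   using hm hf by (intro integrableI_nonneg) (auto simp: e less_top)
  moreover have "(\<integral>x. enn2real (h x) \<partial>N) = enn2real (\<integral>\<^sup>+x. h x \<partial>N)"
   unfolding e[symmetric] using hm by (intro integral_eq_nn_integral) auto
  ultimately show ?thesis by simp
 qed
 have km: "(\<lambda>x. \<integral>y. G (a x, y) \<partial>\<kappa> x) \<in> borel_measurable N"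
 proof (subst measurable_cong)
  show "(\<integral>y. G (a x, y) \<partial>\<kappa> x) = (if p x \<noteq> \<infinity> \<and> m x \<noteq> \<infinity> then enn2real (p x) - enn2real (m x) else 0)" if x: "x \<in> space N" for x
  proof (cases "integrable (\<kappa> x) (\<lambda>y. G (a x, y))")
   case True
   then show ?thesis by (simp add: real_lebesgue_integral_def real_integrable_def p_def m_def)
  next
   case False
   then show ?thesis using Gk[OF x] by (auto simp: not_integrable_integral_eq real_integrable_def p_def m_def)
  qed
  show "(\<lambda>x. if p x \<noteq> \<infinity> \<and> m x \<noteq> \<infinity> then enn2real (p x) - enn2real (m x) else 0) \<in> borel_measurable N" using pm mm by measurable
 qed
 have iD: "integrable N (\<lambda>x. enn2real (p x) - enn2real (m x))" using en[OF pm fin(1)] en[OF mm fin(2)] by auto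
 have em: "(\<lambda>x. enn2real (p x) - enn2real (m x)) \<in> borel_measurable N" using pm mm by measurable
 show "integrable N (\<lambda>x. \<integral>y. G (a x, y) \<partial>\<kappa> x)" using iD integrable_cong_AE[OF km em eq'] by simp
 have "(\<integral>x. \<integral>y. G (a x, y) \<partial>\<kappa> x \<partial>N) = (\<integral>x. enn2real (p x) - enn2real (m x) \<partial>N)" by (rule integral_cong_AE[OF km em eq'])
 also have "... = enn2real (\<integral>\<^sup>+x. p x \<partial>N) - enn2real (\<integral>\<^sup>+x. m x \<partial>N)"
  using en[OF pm fin(1)] en[OF mm fin(2)] by simp
 also have "... = (\<integral>x. G (a x, b x) \<partial>N)" unfolding real_lebesgue_integral_def[OF int] pe me ..
 finally show "(\<integral>x. G (a x, b x) \<partial>N) = (\<integral>x. \<integral>y. G (a x, y) \<partial>\<kappa> x \<partial>N)" ..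
qed

section \<open>Flow property of the schemes and of the laws\<close>

context sde
begin

lemma euler_cong:
 "(\<And>j. j < k ==> z j = z' j) ==> euler dt t w z k = euler dt t w z' k"
proof (induction k)
 case (Suc k)
 have "euler dt t w z k = euler dt t w z' k" by (rule Suc.IH) (use Suc.prems in simp)
 then show ?case using Suc.prems[of k] by simp
qed simp

text \<open>After k steps the rest of the scheme is the scheme for the concatenated starting path
  with shifted noise: by \<open>path_concat_path_tail\<close> both evaluate the coefficient along
  the same path.\<close>

lemma euler_restart:
 fixes z :: "nat => real ^ 'd"
 assumes dt: "0 < dt" and t: "0 \<le> t" and w: "w \<in> path_space T" and le: "t + real (k + i) * dt \<le> T"
 defines "s \<equiv> real k * dt"
 defines "q \<equiv> path_concat T t w (euler dt t w z k)"
 shows "stopped s (euler dt t w z (k + i)) = euler dt t w z k"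
  "path_tail s (euler dt t w z (k + i)) = euler dt (t + s) q (\<lambda>j. z (k + j)) i"
proof -
 let ?e = "euler dt t w z" and ?e' = "euler dt (t + s) q (\<lambda>j. z (k + j))"
 have s: "0 \<le> s" using dt by (simp add: s_def)
 have leT: "real j * dt \<le> T - t" if "j \<le> k + i" for j
 proof -
  have "real j * dt \<le> real (k + i) * dt" using that dt by (intro mult_right_mono) auto
  then show ?thesis using le by linarith
 qed
 have sT: "t + s \<le> T" "t \<le> T" using leT[of k] s t by (auto simp: s_def)
 have sp: "?e j \<in> path_space T" if "j \<le> k + i" for j
  using leT[OF that] t by (intro euler_path_space dt) auto
 have sp': "?e' j \<in> path_space T" if "j \<le> i" for j
  using leT[of j] that t by (intro euler_path_space dt) auto
 have neg: "?e' j r = 0" if "j \<le> i" "r \<le> 0" for j r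
  using path_space_neg[OF sp'[OF that(1)]] T_pos that(2) by simp
 have fin: "?e k r = ?e k s" if "s \<le> r" for r
  using that unfolding euler_polygon s_def by (simp add: polygon_end[OF dt])
 have cons: "stopped s v = ?e k \<and> path_tail s v = ?e' j"
  if j: "j \<le> i" and v: "v = (\<lambda>r. ?e k r + ?e' j (r - s))" for j v
 proof
  show "stopped s v = ?e k"
  proof
   fix r show "stopped s v r = ?e k r"
    unfolding stopped_def v using neg[OF j, of "min s r - s"] fin[of r] by (auto simp: min_def)
  qed
  show "path_tail s v = ?e' j"
  proof
   fix r show "path_tail s v r = ?e' j r"
    unfolding path_tail_def v using neg[OF j, of 0] neg[OF j, of r] fin[of "s + max 0 r"] by (auto simp: max_def)
  qed
 qed
 have main: "?e (k + j) = (\<lambda>r. ?e k r + ?e' j (r - s))" if "j \<le> i" for j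
  using that
 proof (induction j)
  case (Suc j)
  then have IH: "?e (k + j) = (\<lambda>r. ?e k r + ?e' j (r - s))" and j: "j \<le> i" "j < i" by auto
  note c = cons[OF j(1) IH]
  have kj: "?e (k + j) \<in> path_space T" "?e k \<in> path_space T" using sp j by auto
  have st: "stopped (t + s) q = stopped (t + s) (path_concat T t w (?e (k + j)))"
   unfolding q_def using path_concat_stopped_right[OF w kj(1) t s sT(1)] c by simp
  have "path_concat T (t + s) q (?e' j) = path_concat T (t + s) (stopped (t + s) q) (path_tail s (?e (k + j)))"
   using c by (simp add: path_concat_stopped)
  also have "... = path_concat T t w (?e (k + j))"
   unfolding st path_concat_stopped by (rule path_concat_path_tail[OF w kj(1) t s sT(1)])
  finally have pc: "path_concat T (t + s) q (?e' j) = path_concat T t w (?e (k + j))" .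
  have rp: "ramp dt (k + j) r = ramp dt j (r - s)" for r
   using dt by (simp add: ramp_def s_def diff_divide_distrib)
  have tm: "t + real (k + j) * dt = t + s + real j * dt" by (simp add: s_def algebra_simps)
  have "?e (Suc (k + j)) r = ?e k r + ?e' (Suc j) (r - s)" for r
   unfolding euler.simps(2) pc rp tm by (subst IH) (simp add: add.assoc)
  then show ?case by (simp add: fun_eq_iff)
 qed simp
 from cons[OF order_refl main[OF order_refl]]
 show "stopped s (?e (k + i)) = ?e k" "path_tail s (?e (k + i)) = ?e' i" by auto
qed

lemma steps_shift:
 assumes "0 < dt" "t + real k * dt \<le> T"
 shows "steps dt t = k + steps dt (t + real k * dt)"
proof -
 have "(T - (t + real k * dt)) / dt = (T - t) / dt - real k" using assms(1) by (simp add: field_simps)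
 moreover have "0 \<le> (T - (t + real k * dt)) / dt" using assms by simp
 ultimately have "\<lfloor>(T - t) / dt\<rfloor> = int k + \<lfloor>(T - (t + real k * dt)) / dt\<rfloor>" "0 \<le> \<lfloor>(T - (t + real k * dt)) / dt\<rfloor>" by linarith+
 then show ?thesis unfolding steps_def by (simp add: nat_add_distrib)
qed

lemma unit_fun_stopped:
 fixes f :: "'d path => real"
 assumes "unit_fun T f" "0 \<le> s"
 shows "unit_fun T (\<lambda>v. f (stopped s v))"
 unfolding unit_fun_def path_continuous_def
proof (intro conjI allI impI ballI)
 fix p :: "nat => 'd path" and q assume p: "\<forall>n. p n \<in> path_space T" "q \<in> path_space T" "pconv p q"
 show "(\<lambda>n. f (stopped s (p n))) \<longlonglongrightarrow> f (stopped s q)"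
  using p T_pos assms(2) by (intro path_continuousD[OF unit_funD(1)[OF assms(1)]] stopped_path_space pconv_stopped_time'[OF p(2)]) auto
qed (use stopped_path_space[of _ T s] assms(2) T_pos unit_funD(2,3)[OF assms(1)] in auto)

lemma unit_fun_tail:
 fixes f :: "'d path => real"
 assumes "unit_fun T f" "0 \<le> s" "s \<le> T"
 shows "unit_fun T (\<lambda>v. f (path_tail s v))"
 unfolding unit_fun_def path_continuous_def
proof (intro conjI allI impI ballI)
 fix p :: "nat => 'd path" and q assume p: "\<forall>n. p n \<in> path_space T" "q \<in> path_space T" "pconv p q"
 show "(\<lambda>n. f (path_tail s (p n))) \<longlonglongrightarrow> f (path_tail s q)"
  using p T_pos assms(2,3) by (intro path_continuousD[OF unit_funD(1)[OF assms(1)]] path_tail_path_space' pconv_path_tail) auto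
qed (use path_tail_path_space'[of _ T s] assms(2,3) T_pos unit_funD(2,3)[OF assms(1)] in auto)

text \<open>Since s is a grid point, the flow property of the scheme is an exact identity:
  \<open>noise_split\<close> replaces the noise after step k by an independent copy, and
  \<open>euler_restart\<close> recognises the rest as a scheme started from the stopped
  path.\<close>

lemma euler_flow:
 assumes dt: "0 < dt" and t: "0 \<le> t" and w: "w \<in> path_space T" and le: "t + real k * dt \<le> T"
  and fg: "unit_fun T f" "unit_fun T g"
 defines "s \<equiv> real k * dt"
 defines "m \<equiv> (\<lambda>x. euler_mean dt (t + s) (path_concat T t w (stopped s (scheme dt t w x))) g)"
 shows "(\<integral>x. f (stopped s (scheme dt t w x)) * g (path_tail s (scheme dt t w x)) \<partial>M) =
   (\<integral>x. f (stopped s (scheme dt t w x)) * m x \<partial>M)"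
  "(\<lambda>x. f (stopped s (scheme dt t w x)) * m x) \<in> borel_measurable M"
proof -
 define i where "i = steps dt (t + s)"
 let ?s = "\<lambda>x. scheme dt t w x"
 have s: "0 \<le> s" "s \<le> T" using dt le t by (auto simp: s_def)
 have N: "steps dt t = k + i" unfolding i_def s_def by (rule steps_shift[OF dt le])
 have tT: "t \<le> T" "t + s \<le> T" using le s by (auto simp: s_def)
 have leT: "t + real (k + i) * dt \<le> T" using steps_le[OF dt tT(1)] unfolding N by simp
 \<comment> \<open>Glues an earlier and a later block into one noise sequence, so that the whole
   scheme becomes a function of the pair treated by \<open>noise_split\<close>.\<close>
 define zz where "zz z j = (if j < k then fst z j else snd z (j - k))" for z :: "(nat => real ^ 'd) \<times> (nat => real ^ 'd)" and j
 define H where "H z = f (stopped s (euler dt t w (zz z) (k + i))) * g (path_tail s (euler dt t w (zz z) (k + i)))" for z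
 let ?A = "PiM {..<k} (\<lambda>_. borel :: (real ^ 'd) measure)" and ?B = "PiM {..<i} (\<lambda>_. borel :: (real ^ 'd) measure)"
 note f' = unit_fun_stopped[OF fg(1) s(1)] and g' = unit_fun_tail[OF fg(2) s]
 have "(\<lambda>z. zz z j) \<in> borel_measurable (?A \<Otimes>\<^sub>M ?B)" if "j < k + i" for j
  using that by (cases "j < k") (auto simp: zz_def intro!: measurable_compose[OF measurable_fst] measurable_compose[OF measurable_snd] measurable_component_singleton)
 then have em: "(\<lambda>z. euler dt t w (zz z) (k + i)) \<in> measurable (?A \<Otimes>\<^sub>M ?B) \<C>"
  using leT by (intro euler_measurable dt t w) auto
 have Hm: "H \<in> borel_measurable (?A \<Otimes>\<^sub>M ?B)"
  unfolding H_def by (intro borel_measurable_times measurable_compose[OF em unit_fun_measurable[OF f' T_pos]]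
   measurable_compose[OF em unit_fun_measurable[OF g' T_pos]])
 have esp: "euler dt t w z (k + i) \<in> path_space T" for z using leT t by (intro euler_path_space dt) auto
 have Hb: "\<bar>H z\<bar> \<le> 1" for z
  unfolding H_def abs_mult using unit_fun_abs[OF f' esp] unit_fun_abs[OF g' esp] by (intro mult_le_one) auto
 have kiT: "real (k + i) * dt \<le> T" using leT t by linarith
 note ns = noise_split[OF dt kiT Hm Hb]
 have 1: "H (\<lambda>i\<in>{..<k}. noise dt x i, \<lambda>i\<in>{..<i}. noise dt x (k + i)) = f (stopped s (?s x)) * g (path_tail s (?s x))" for x
 proof -
  have "euler dt t w (zz (\<lambda>i\<in>{..<k}. noise dt x i, \<lambda>i\<in>{..<i}. noise dt x (k + i))) (k + i) = scheme dt t w x"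
   unfolding N by (rule euler_cong) (auto simp: zz_def)
  then show ?thesis by (simp add: H_def)
 qed
 have 2: "(\<integral>y. H (\<lambda>i\<in>{..<k}. noise dt x i, \<lambda>i\<in>{..<i}. noise dt y i) \<partial>M) = f (stopped s (?s x)) * m x" for x
 proof -
  have h: "H (\<lambda>i\<in>{..<k}. noise dt x i, \<lambda>i\<in>{..<i}. noise dt y i) =
    f (stopped s (?s x)) * g (scheme dt (t + s) (path_concat T t w (stopped s (?s x))) y)" for y
  proof -
   let ?z = "zz (\<lambda>i\<in>{..<k}. noise dt x i, \<lambda>i\<in>{..<i}. noise dt y i)"
   have ek: "euler dt t w ?z k = euler dt t w (noise dt x) k" by (rule euler_cong) (simp add: zz_def)
   have ss: "stopped s (?s x) = euler dt t w (noise dt x) k"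
    unfolding N s_def by (rule euler_restart(1)[OF dt t w leT])
   have "euler dt (t + s) q (\<lambda>j. ?z (k + j)) i = scheme dt (t + s) q y" for q
    unfolding i_def[symmetric] by (rule euler_cong) (simp add: zz_def)
   then show ?thesis unfolding H_def s_def euler_restart[OF dt t w leT]
    using ss unfolding s_def ek by simp
  qed
  show ?thesis unfolding h m_def euler_mean_def by simp
 qed
 show "(\<integral>x. f (stopped s (?s x)) * g (path_tail s (?s x)) \<partial>M) =
   (\<integral>x. f (stopped s (?s x)) * m x \<partial>M)" using ns(1) unfolding 1 2 .
 show "(\<lambda>x. f (stopped s (?s x)) * m x) \<in> borel_measurable M" using ns(2) unfolding 2 .
qed

lemma law_path_continuous:
 assumes t: "0 \<le> t" and w: "w \<in> path_space T" and s: "0 \<le> s" "t + s \<le> T" and g: "unit_fun T g"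
 shows "path_continuous T (\<lambda>v. \<integral>y. g y \<partial>\<P> (t + s) (path_concat T t w v))"
 unfolding path_continuous_def
proof (intro allI impI)
 fix p :: "nat => 'd path" and q assume p: "\<forall>n. p n \<in> path_space T" "q \<in> path_space T" "pconv p q"
 have c: "pconv (\<lambda>n. path_concat T t w (p n)) (path_concat T t w q)"
  using p t s T_pos by (intro pconv_path_concat[OF _ _ w]) (auto simp: w pconv_const)
 show "(\<lambda>n. \<integral>y. g y \<partial>\<P> (t + s) (path_concat T t w (p n))) \<longlonglongrightarrow> (\<integral>y. g y \<partial>\<P> (t + s) (path_concat T t w q))"
 proof (rule law_right_continuous[OF _ _ _ tendsto_const _ _ _ g])
  have pcs: "path_concat T t w v \<in> path_space T" if "v \<in> path_space T" for v
   using that t s by (intro path_concat_path_space w) auto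
  show "path_concat T t w q \<in> path_space T" "\<And>n. path_concat T t w (p n) \<in> path_space T" using p by (auto intro: pcs)
  show "pconv (\<lambda>n. stopped (t + s) (path_concat T t w (p n))) (stopped (t + s) (path_concat T t w q))"
   by (rule pconv_stopped_time'[OF pcs[OF p(2)] less_imp_le[OF T_pos] tendsto_const c])
 qed (use t s in auto)
qed

text \<open>The meshes s / 2^n make s a grid point of every scheme, so \<open>euler_flow\<close>
  holds for all n and passes to the limit. The inner Euler means start from random paths that
  converge along the subsequence, hence the need for moving starting points.\<close>

lemma flow_fixed_time:
 assumes t: "0 \<le> t" and w: "w \<in> path_space T" and s: "0 < s" "t + s \<le> T" and fg: "unit_fun T f" "unit_fun T g"
 shows "(\<integral>v. f (stopped s v) * g (path_tail s v) \<partial>\<P> t w) =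
  (\<integral>v. f (stopped s v) * (\<integral>y. g y \<partial>\<P> (t + s) (path_concat T t w v)) \<partial>\<P> t w)"
proof -
 have tT: "t \<le> T" and sT: "0 \<le> s" "s \<le> T" using s t by auto
 define dt where "dt n = s / 2 ^ n" for n :: nat
 have dt: "0 < dt n" "real (2 ^ n) * dt n = s" for n using s by (auto simp: dt_def)
 have dt0: "dt \<longlonglongrightarrow> 0" unfolding dt_def using tendsto_mult_right_zero[OF LIMSEQ_inverse_realpow_zero[of 2], of s] by (simp add: divide_inverse)
 let ?X = "sol t w"
 obtain r :: "nat => nat" where r: "strict_mono r" "AE x in M. pconv (\<lambda>n. scheme (dt (r n)) t w x) (?X x)"
  using scheme_AE_subseq[OF t tT, of "\<lambda>_. t" w "\<lambda>_. w" dt ?X] tT w dt(1) dt0 sol[OF t tT w] pconv_const by auto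
 define E where "E n x = scheme (dt (r n)) t w x" for n x
 define m where "m n x = euler_mean (dt (r n)) (t + s) (path_concat T t w (stopped s (E n x))) g" for n x
 define G where "G v = (\<integral>y. g y \<partial>\<P> (t + s) (path_concat T t w v))" for v
 have Esp: "E n x \<in> path_space T" for n x unfolding E_def by (rule scheme_path[OF dt(1) t tT])
 have Em: "E n \<in> measurable M \<C>" for n unfolding E_def by (rule scheme_measurable[OF dt(1) t tT w])
 note Xm = sol_measurable[OF t tT w]
 note f' = unit_fun_stopped[OF fg(1) sT(1)] and g' = unit_fun_tail[OF fg(2) sT]
 note fm = unit_fun_measurable[OF f' T_pos] and gm = unit_fun_measurable[OF g' T_pos]
 have Gm: "G \<in> borel_measurable \<C>"
  unfolding G_def by (rule path_continuous_measurable[OF law_path_continuous[OF t w sT(1) s(2) fg(2)] T_pos])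
 have leT: "t + real (2 ^ r n) * dt (r n) \<le> T" for n unfolding dt(2) by (rule s(2))
 note ef = euler_flow[OF dt(1) t w leT fg, unfolded dt(2), folded E_def, folded m_def]
 have m1: "\<bar>m n x\<bar> \<le> 1" for n x
 proof -
  show ?thesis unfolding m_def euler_mean_def
   using t sT s(2) by (intro abs_integral_le_1 unit_fun_abs[OF fg(2)] scheme_path dt(1)) auto
 qed
 have lhs: "(\<lambda>n. \<integral>x. f (stopped s (E n x)) * g (path_tail s (E n x)) \<partial>M) \<longlonglongrightarrow> (\<integral>x. f (stopped s (?X x)) * g (path_tail s (?X x)) \<partial>M)"
 proof (rule integral_dominated_convergence[where w = "\<lambda>_. 1"])
  show "AE x in M. norm (f (stopped s (E n x)) * g (path_tail s (E n x))) \<le> 1" for n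
   unfolding real_norm_def abs_mult using unit_fun_abs[OF f' Esp] unit_fun_abs[OF g' Esp] by (intro AE_I2 mult_le_one) auto
  show "AE x in M. (\<lambda>n. f (stopped s (E n x)) * g (path_tail s (E n x))) \<longlonglongrightarrow> f (stopped s (?X x)) * g (path_tail s (?X x))"
   using r(2)[folded E_def] AE_space
  proof eventually_elim
   case (elim x)
   have X: "?X x \<in> path_space T" using measurable_space[OF Xm elim(2)] by simp
   show ?case by (intro tendsto_mult path_continuousD[OF unit_funD(1)[OF f'] Esp X elim(1)] path_continuousD[OF unit_funD(1)[OF g'] Esp X elim(1)])
  qed
 qed (auto intro!: borel_measurable_times measurable_compose[OF Xm fm] measurable_compose[OF Xm gm] measurable_compose[OF Em fm] measurable_compose[OF Em gm])
 have rhs: "(\<lambda>n. \<integral>x. f (stopped s (E n x)) * m n x \<partial>M) \<longlonglongrightarrow> (\<integral>x. f (stopped s (?X x)) * G (?X x) \<partial>M)"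
 proof (rule integral_dominated_convergence[where w = "\<lambda>_. 1"])
  show "AE x in M. norm (f (stopped s (E n x)) * m n x) \<le> 1" for n
   unfolding real_norm_def abs_mult using unit_fun_abs[OF f' Esp] m1 by (intro AE_I2 mult_le_one) auto
  show "AE x in M. (\<lambda>n. f (stopped s (E n x)) * m n x) \<longlonglongrightarrow> f (stopped s (?X x)) * G (?X x)"
   using r(2)[folded E_def] AE_space
  proof eventually_elim
   case (elim x)
   have X: "?X x \<in> path_space T" using measurable_space[OF Xm elim(2)] by simp
   have c: "pconv (\<lambda>n. path_concat T t w (E n x)) (path_concat T t w (?X x))"
    using X Esp t tT T_pos elim(1) by (intro pconv_path_concat[OF _ _ w]) (auto simp: w pconv_const)
   have pcs: "path_concat T t w v \<in> path_space T" if "v \<in> path_space T" for v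
    using that t tT by (intro path_concat_path_space w) auto
   have c2: "pconv (\<lambda>n. stopped (t + s) (path_concat T t w (stopped s (E n x)))) (stopped (t + s) (path_concat T t w (?X x)))"
    unfolding path_concat_stopped_right[OF w Esp t sT(1) s(2)]
    by (rule pconv_stopped_time'[OF pcs[OF X] _ tendsto_const c]) (use T_pos in simp)
   have "(\<lambda>n. m n x) \<longlonglongrightarrow> G (?X x)" unfolding m_def G_def
    using t s tT T_pos sT Esp X
    by (intro euler_mean_tendsto[OF _ _ _ _ _ _ c2 _ _ fg(2)] dt(1) LIMSEQ_subseq_LIMSEQ[OF dt0 r(1), unfolded o_def])
     (auto intro!: pcs stopped_path_space)
   then show ?case by (intro tendsto_mult path_continuousD[OF unit_funD(1)[OF f'] Esp X elim(1)])
  qed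
 qed (use ef(2) in \<open>auto intro!: borel_measurable_times measurable_compose[OF Xm fm] measurable_compose[OF Xm Gm]\<close>)
 have "(\<integral>x. f (stopped s (?X x)) * g (path_tail s (?X x)) \<partial>M) = (\<integral>x. f (stopped s (?X x)) * G (?X x) \<partial>M)"
  using lhs unfolding ef(1) by (rule LIMSEQ_unique[OF _ rhs])
 then show ?thesis unfolding G_def[symmetric]
  using fm gm Gm by (simp add: law_integral[OF t tT w] borel_measurable_times)
qed


lemma start_path_space: "0 \<le> t ==> t \<le> T ==> w \<in> path_space T ==> v \<in> path_space T ==> path_concat T t w v \<in> path_space T"
 by (intro path_concat_path_space)

lemma law_abs_le_1:
 assumes "0 \<le> t" "t \<le> T" "w \<in> path_space T" "unit_fun T g"
 shows "\<bar>\<integral>y. g y \<partial>\<P> t w\<bar> \<le> 1" "0 \<le> (\<integral>y. g y \<partial>\<P> t w)"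
proof -
 show "\<bar>\<integral>y. g y \<partial>\<P> t w\<bar> \<le> 1" by (rule prob_space.abs_integral_le_1[OF prob_space_law[OF assms(1-3)]]) (simp add: unit_fun_abs[OF assms(4)])
 show "0 \<le> (\<integral>y. g y \<partial>\<P> t w)" by (rule Bochner_Integration.integral_nonneg) (simp add: unit_funD[OF assms(4)])
qed

text \<open>Measurable F are needed since the level sets of a rounded stopping time, whose
  indicators enter next, are not described by continuous functionals.\<close>

lemma flow_fixed_kernel:
 fixes F :: "'d path \<times> 'd path => ennreal"
 assumes t: "0 \<le> t" and w: "w \<in> path_space T" and s: "0 < s" "t + s \<le> T" and F: "F \<in> borel_measurable (\<C> \<Otimes>\<^sub>M \<C>)"
 shows "(\<integral>\<^sup>+v. F (stopped s v, path_tail s v) \<partial>\<P> t w) = (\<integral>\<^sup>+v. \<integral>\<^sup>+y. F (stopped s v, y) \<partial>\<P> (t + s) (path_concat T t w v) \<partial>\<P> t w)"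
proof (rule kernel_fubini(2)[OF T_pos _ _ _ _ _ _ _ F])
 have tT: "t \<le> T" and sT: "0 \<le> s" "s \<le> T" "0 \<le> t + s" using s t by auto
 show "prob_space (\<P> t w)" by (rule prob_space_law[OF t tT w])
 show "stopped s \<in> measurable (\<P> t w) \<C>" "path_tail s \<in> measurable (\<P> t w) \<C>"
  using sT T_pos stopped_measurable[of "\<lambda>x. x" \<C> T "\<lambda>_. s"] path_tail_measurable[of "\<lambda>x. x" \<C> T "\<lambda>_. s"] by auto
 show "prob_space (\<P> (t + s) (path_concat T t w v))" if "v \<in> space (\<P> t w)" for v
  using that by (intro prob_space_law sT s start_path_space t tT w) simp
 show "(\<lambda>v. \<integral>y. g y \<partial>\<P> (t + s) (path_concat T t w v)) \<in> borel_measurable (\<P> t w)" if "unit_fun T g" for g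
  using path_continuous_measurable[OF law_path_continuous[OF t w sT(1) s(2) that] T_pos] by simp
 show "(\<integral>v. f (stopped s v) * g (path_tail s v) \<partial>\<P> t w) =
  (\<integral>v. f (stopped s v) * (\<integral>y. g y \<partial>\<P> (t + s) (path_concat T t w v)) \<partial>\<P> t w)" if "unit_fun T f" "unit_fun T g" for f g
  by (rule flow_fixed_time[OF t w s that])
qed simp

lemma law_eval_continuous:
 assumes t: "0 \<le> t" "t \<le> T" and w: "w \<in> path_space T" and v: "v \<in> path_space T" and g: "unit_fun T g"
  and tt: "0 \<le> r" "\<And>n. r \<le> tt n \<and> tt n \<le> T - t" "tt \<longlonglongrightarrow> r"
 shows "(\<lambda>n. \<integral>y. g y \<partial>\<P> (t + tt n) (path_concat T t w v)) \<longlonglongrightarrow> (\<integral>y. g y \<partial>\<P> (t + r) (path_concat T t w v))"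
proof -
 have lim: "(\<lambda>n. t + tt n) \<longlonglongrightarrow> t + r" by (intro tendsto_add tendsto_const tt)
 note c = start_path_space[OF t w v]
 show ?thesis
  by (rule law_right_continuous[OF _ _ _ lim c c pconv_stopped_time[OF c less_imp_le[OF T_pos] lim] g])
   (use t tt(1) tt(2) order_trans[of r "tt 0" "T - t"] in \<open>auto simp: algebra_simps\<close>)
qed

lemma law_eval_measurable:
 assumes t: "0 \<le> t" "t \<le> T" and w: "w \<in> path_space T" and g: "unit_fun T g"
  and q: "q \<in> borel_measurable \<C>" "\<And>v. v \<in> path_space T ==> 0 \<le> q v \<and> q v \<le> T - t"
 shows "(\<lambda>v. \<integral>y. g y \<partial>\<P> (t + q v) (path_concat T t w v)) \<in> borel_measurable \<C>"
proof (rule right_continuous_measurable[where T = "T - t" and \<Phi> = "\<lambda>s v. \<integral>y. g y \<partial>\<P> (t + s) (path_concat T t w v)", OF _ q(1)])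
 show "(\<lambda>v. \<integral>y. g y \<partial>\<P> (t + s) (path_concat T t w v)) \<in> borel_measurable \<C>" if "s \<in> {0..T - t}" for s
  using path_continuous_measurable[OF law_path_continuous[OF t(1) w _ _ g] T_pos, of s] that by simp
 show "(\<lambda>n. \<integral>y. g y \<partial>\<P> (t + tt n) (path_concat T t w v)) \<longlonglongrightarrow> (\<integral>y. g y \<partial>\<P> (t + q v) (path_concat T t w v))"
  if "v \<in> space \<C>" "\<And>n::nat. tt n \<in> {q v..T - t}" "tt \<longlonglongrightarrow> q v" for v tt
  using that q(2)[of v] by (intro law_eval_continuous[OF t w _ g]) auto
qed (use q(2) in auto)


text \<open>The stopping time is rounded up to dyadic values, the fixed-time flow is applied on each
  level set, and the limit is taken. Rounding up matters twice: each level set is decided by the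
  path up to its value, and the laws are continuous from the right in the starting time.\<close>

lemma flow_stopping_time:
 assumes t: "0 \<le> t" "t < T" and w: "w \<in> path_space T" and \<tau>: "\<tau> \<in> stopping_times_le T (\<lambda>_. T - t)"
 shows "(\<lambda>v. \<P> (t + \<tau> v) (path_concat T t w v)) \<in> measurable (\<P> t w) (subprob_algebra \<C>)" (is ?K)
  "\<And>F :: 'd path \<times> 'd path => ennreal. F \<in> borel_measurable (\<C> \<Otimes>\<^sub>M \<C>) ==>
   (\<integral>\<^sup>+v. F (stopped (\<tau> v) v, path_tail (\<tau> v) v) \<partial>\<P> t w) =
   (\<integral>\<^sup>+v. \<integral>\<^sup>+y. F (stopped (\<tau> v) v, y) \<partial>\<P> (t + \<tau> v) (path_concat T t w v) \<partial>\<P> t w)"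
proof -
 define S where "S = T - t"
 have S: "0 < S" "S \<le> T" using t by (auto simp: S_def)
 have tT: "t \<le> T" "0 \<le> T" using t by auto
 have \<tau>s: "\<tau> \<in> stopping_times T" and \<tau>r: "\<And>v. v \<in> path_space T ==> 0 \<le> \<tau> v \<and> \<tau> v \<le> S"
  using \<tau> by (auto simp: stopping_times_le_def S_def)
 have \<tau>m: "\<tau> \<in> borel_measurable \<C>" by (rule stopping_times_measurable[OF \<tau>s tT(2)])
 interpret Q: prob_space "\<P> t w" by (rule prob_space_law[OF t(1) tT(1) w])
 define G where "G g s v = (\<integral>y. g y \<partial>\<P> (t + s) (path_concat T t w v))" for g :: "'d path => real" and s v
 have G01: "0 \<le> G g s v" "\<bar>G g s v\<bar> \<le> 1" if "unit_fun T g" "0 \<le> s" "s \<le> S" "v \<in> path_space T" for g s v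
  unfolding G_def using that t tT by (auto intro!: law_abs_le_1 start_path_space w simp: S_def)
 have Gm: "(\<lambda>v. G g (q v) v) \<in> borel_measurable \<C>"
  if "unit_fun T g" "q \<in> borel_measurable \<C>" "\<And>v. v \<in> path_space T ==> 0 \<le> q v \<and> q v \<le> S" for g q
  unfolding G_def using law_eval_measurable[OF t(1) tT(1) w that(1,2)] that(3) by (simp add: S_def)
 have fsm: "(\<lambda>v. f (stopped (q v) v)) \<in> borel_measurable \<C>" "(\<lambda>v. f (path_tail (q v) v)) \<in> borel_measurable \<C>"
  if f: "unit_fun T f" and q: "q \<in> borel_measurable \<C>" "\<And>v. v \<in> path_space T ==> 0 \<le> q v \<and> q v \<le> S" for f q
  using q S tT stopped_measurable[of "\<lambda>x. x" \<C> T q] path_tail_measurable[of "\<lambda>x. x" \<C> T q]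
  by (auto intro!: measurable_compose[OF _ unit_fun_measurable[OF f T_pos]] intro: order_trans)
 have spq: "stopped s v \<in> path_space T" "path_tail s v \<in> path_space T" if "v \<in> path_space T" "0 \<le> s" "s \<le> S" for s v
  using that S tT by (auto intro!: stopped_path_space path_tail_path_space')
 have main: "(\<integral>v. f (stopped (\<tau> v) v) * g (path_tail (\<tau> v) v) \<partial>\<P> t w) = (\<integral>v. f (stopped (\<tau> v) v) * G g (\<tau> v) v \<partial>\<P> t w)"
  if f: "unit_fun T f" and g: "unit_fun T g" for f g
 proof -
  \<comment> \<open>The + 1 makes the rounded time positive, as the fixed-time statement requires,
    and keeps it above \<tau>; the minimum with 2^n keeps it within the horizon.\<close>
  define j where "j n v = min (2 ^ n) (nat \<lfloor>\<tau> v * 2 ^ n / S\<rfloor> + 1)" for n :: nat and v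
  define q where "q n i = S * real i / 2 ^ n" for n i :: nat
  have qr: "0 \<le> q n i" "q n i \<le> S" "0 < i ==> 0 < q n i" if "i \<le> 2 ^ n" for n i
  proof -
   have "real i \<le> 2 ^ n" using that by (metis of_nat_le_iff of_nat_numeral of_nat_power)
   then show "q n i \<le> S" using S by (simp add: q_def pos_divide_le_eq)
   show "0 \<le> q n i" "0 < i ==> 0 < q n i" using S by (auto simp: q_def)
  qed
  have jr: "0 < j n v" "j n v \<le> 2 ^ n" for n v by (auto simp: j_def)
  have jm: "j n \<in> measurable \<C> (count_space UNIV)" for n
   unfolding j_def using \<tau>m by measurable
  have jq: "\<tau> v \<le> q n (j n v)" "q n (j n v) \<le> \<tau> v + S / 2 ^ n" if v: "v \<in> path_space T" for n v
  proof -
   define c where "c = nat \<lfloor>\<tau> v * 2 ^ n / S\<rfloor>"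
   have "0 \<le> \<tau> v * 2 ^ n / S" using \<tau>r[OF v] S by simp
   then have "real c \<le> \<tau> v * 2 ^ n / S" "\<tau> v * 2 ^ n / S < real (c + 1)" unfolding c_def by linarith+
   then have c: "S * real c / 2 ^ n \<le> \<tau> v" "\<tau> v \<le> S * real (c + 1) / 2 ^ n" using S by (auto simp: field_simps)
   have "S * real (2 ^ n) / 2 ^ n = S" by simp
   then have d: "q n (j n v) = min S (S * real (c + 1) / 2 ^ n)"
   proof (cases "(2::nat) ^ n \<le> c + 1")
    case True
    then have "(2::real) ^ n \<le> real (c + 1)" by (metis of_nat_le_iff of_nat_numeral of_nat_power)
    then have "S \<le> S * real (c + 1) / 2 ^ n" using S by (simp add: pos_le_divide_eq)
    then show ?thesis using True by (simp add: q_def j_def c_def min_absorb1)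
   next
    case False
    then have "real (c + 1) \<le> 2 ^ n" by (metis nat_le_linear of_nat_le_iff of_nat_numeral of_nat_power)
    then have "S * real (c + 1) / 2 ^ n \<le> S" using S by (simp add: pos_divide_le_eq)
    then show ?thesis using False by (simp add: q_def j_def c_def min_absorb2)
   qed
   show "\<tau> v \<le> q n (j n v)" using d c(2) \<tau>r[OF v] by simp
   have "S * real (c + 1) / 2 ^ n = S * real c / 2 ^ n + S / 2 ^ n" by (simp add: field_simps)
   then show "q n (j n v) \<le> \<tau> v + S / 2 ^ n" using d c(1) by linarith
  qed
  \<comment> \<open>Whether the rounded time equals q n i is decided by the path up to q n i, so the
    indicator of the level set may be read as a function of the past.\<close>
  have jst: "j n (stopped (q n i) v) = i \<longleftrightarrow> j n v = i" if v: "v \<in> path_space T" and i: "i \<le> 2 ^ n" for n i v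
  proof -
   note sp = spq(1)[OF v qr(1,2)[OF i]]
   have "j n (stopped (q n i) v) = j n v" if "\<tau> v \<le> q n i"
    using stopping_times_stopped[OF \<tau>s tT(2) v that] by (simp add: j_def)
   moreover have "\<tau> v \<le> q n i" if "j n (stopped (q n i) v) = i"
    using jq(1)[OF sp, of n] that stopping_times_le_iff[OF \<tau>s tT(2) qr(1)[OF i] v] by simp
   ultimately show ?thesis using jq(1)[OF v, of n] by auto
  qed
  have qjm: "(\<lambda>v. q n (j n v)) \<in> borel_measurable \<C>" for n
   by (rule measurable_compose[OF jm]) simp
  have qjr: "0 \<le> q n (j n v) \<and> q n (j n v) \<le> S" for n v using qr[OF jr(2)] by simp
  let ?fg = "\<lambda>r v. f (stopped r v) * g (path_tail r v)"
  let ?fG = "\<lambda>r v. f (stopped r v) * G g r v"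
  let ?A = "\<lambda>n i. {a. j n a = i}"
  have step: "(\<integral>v. ?fg (q n (j n v)) v \<partial>\<P> t w) = (\<integral>v. ?fG (q n (j n v)) v \<partial>\<P> t w)" for n
  proof -
   define F where "F i z = ennreal (f (fst z) * g (snd z)) * indicator (?A n i) (fst z)" for i and z :: "'d path \<times> 'd path"
   have indm: "(\<lambda>v. indicator (?A n i) v :: ennreal) \<in> borel_measurable \<C>" for i
    using measurable_compose[OF jm[of n], of "\<lambda>k. indicator {i} k :: ennreal"] by (simp add: indicator_def)
   have Fm: "F i \<in> borel_measurable (\<C> \<Otimes>\<^sub>M \<C>)" for i
   proof -
    note fm = measurable_compose[OF measurable_fst unit_fun_measurable[OF f T_pos]]
     and gm = measurable_compose[OF measurable_snd unit_fun_measurable[OF g T_pos]]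
    show ?thesis unfolding F_def
     by (intro borel_measurable_times_ennreal measurable_compose[OF borel_measurable_times[OF fm gm] measurable_ennreal]
      measurable_compose[OF measurable_fst indm])
   qed
   have split: "(\<integral>\<^sup>+v. h (j n v) v \<partial>\<P> t w) = (\<Sum>i\<in>{1..2^n}. \<integral>\<^sup>+v. h i v * indicator (?A n i) v \<partial>\<P> t w)"
    if hm: "\<And>i. i \<in> {1..2^n} ==> h i \<in> borel_measurable \<C>" for h
   proof -
    have hs: "h (j n v) v = (\<Sum>i\<in>{1..2^n}. h i v * indicator (?A n i) v)" for v
    proof -
     have "(\<Sum>i\<in>{1..2^n}. h i v * indicator (?A n i) v) = (\<Sum>i\<in>{1..2^n}. if i = j n v then h i v else 0)"
      by (intro sum.cong) (auto simp: indicator_def)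
     then show ?thesis using jr[of n v] by (simp add: Suc_le_eq)
    qed
    have hm': "(\<lambda>v. h i v * indicator (?A n i) v) \<in> borel_measurable (\<P> t w)" if "i \<in> {1..2^n}" for i
     unfolding measurable_law by (intro borel_measurable_times_ennreal indm hm that)
    show ?thesis unfolding hs by (rule nn_integral_sum[OF hm'])
   qed
   have part: "(\<integral>\<^sup>+v. ennreal (?fg (q n i) v) * indicator (?A n i) v \<partial>\<P> t w)
     = (\<integral>\<^sup>+v. ennreal (?fG (q n i) v) * indicator (?A n i) v \<partial>\<P> t w)" if i: "i \<in> {1..2^n}" for i
   proof -
    have i': "0 < i" "i \<le> 2 ^ n" using i by auto
    have "(\<integral>\<^sup>+v. ennreal (?fg (q n i) v) * indicator (?A n i) v \<partial>\<P> t w) = (\<integral>\<^sup>+v. F i (stopped (q n i) v, path_tail (q n i) v) \<partial>\<P> t w)"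
     using i' jst by (intro nn_integral_cong) (simp add: F_def indicator_def)
    also have "... = (\<integral>\<^sup>+v. \<integral>\<^sup>+y. F i (stopped (q n i) v, y) \<partial>\<P> (t + q n i) (path_concat T t w v) \<partial>\<P> t w)"
     using qr[OF i'(2)] i'(1) by (intro flow_fixed_kernel[OF t(1) w _ _ Fm]) (auto simp: S_def)
    also have "... = (\<integral>\<^sup>+v. ennreal (?fG (q n i) v) * indicator (?A n i) v \<partial>\<P> t w)"
    proof (rule nn_integral_cong)
     fix v assume "v \<in> space (\<P> t w)"
     then have v: "v \<in> path_space T" by simp
     have tq: "0 \<le> t + q n i" "t + q n i \<le> T" using qr[OF i'(2)] t by (auto simp: S_def)
     note pc = start_path_space[OF t(1) tT(1) w v]
     interpret K: prob_space "\<P> (t + q n i) (path_concat T t w v)" by (rule prob_space_law[OF tq pc])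
     have "(\<integral>\<^sup>+y. ennreal (g y) \<partial>\<P> (t + q n i) (path_concat T t w v)) = ennreal (G g (q n i) v)"
      unfolding G_def using unit_fun_measurable[OF g T_pos] unit_fun_abs[OF g] unit_funD[OF g]
      by (intro nn_integral_eq_integral K.integrable_const_bound[where B = 1]) (auto intro!: AE_I2)
     moreover have "(\<integral>\<^sup>+y. F i (stopped (q n i) v, y) \<partial>\<P> (t + q n i) (path_concat T t w v)) =
       (\<integral>\<^sup>+y. ennreal (f (stopped (q n i) v)) * indicator (?A n i) v * ennreal (g y) \<partial>\<P> (t + q n i) (path_concat T t w v))"
      using spq(1)[OF v qr(1,2)[OF i'(2)]] jst[OF v i'(2)] unit_funD[OF f] unit_funD[OF g]
      by (intro nn_integral_cong) (auto simp: F_def indicator_def ennreal_mult)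
     ultimately show "(\<integral>\<^sup>+y. F i (stopped (q n i) v, y) \<partial>\<P> (t + q n i) (path_concat T t w v)) = ennreal (?fG (q n i) v) * indicator (?A n i) v"
      using measurable_compose[OF unit_fun_measurable[OF g T_pos] measurable_ennreal] unit_funD(2)[OF f spq(1)[OF v qr(1,2)[OF i'(2)]]] G01(1)[OF g qr(1,2)[OF i'(2)] v]
      by (simp add: nn_integral_multc ennreal_mult ac_simps)
    qed
    finally show ?thesis .
   qed
   have "(\<integral>\<^sup>+v. ennreal (?fg (q n (j n v)) v) \<partial>\<P> t w) =
     (\<integral>\<^sup>+v. ennreal (?fG (q n (j n v)) v) \<partial>\<P> t w)"
   proof -
    have m1: "(\<lambda>v. ennreal (?fg (q n i) v)) \<in> borel_measurable \<C>" if "i \<in> {1..2^n}" for i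
     using that qr[of i n] by (intro measurable_compose[OF _ measurable_ennreal] borel_measurable_times fsm[OF f, of "\<lambda>_. q n i"] fsm[OF g, of "\<lambda>_. q n i"]) auto
    have m2: "(\<lambda>v. ennreal (?fG (q n i) v)) \<in> borel_measurable \<C>" if "i \<in> {1..2^n}" for i
     using that qr[of i n] by (intro measurable_compose[OF _ measurable_ennreal] borel_measurable_times fsm[OF f, of "\<lambda>_. q n i"] Gm[OF g, of "\<lambda>_. q n i"]) auto
    note s1 = split[of "\<lambda>i v. ennreal (?fg (q n i) v)", OF m1]
     and s2 = split[of "\<lambda>i v. ennreal (?fG (q n i) v)", OF m2]
    show ?thesis by (rule trans[OF s1 trans[OF sum.cong[OF refl part] s2[symmetric]]])
   qed
   note nn = this
   note mf = fsm(1)[OF f qjm[of n] qjr] and mg = fsm(2)[OF g qjm[of n] qjr] and mG = Gm[OF g qjm[of n] qjr]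
   have "(\<integral>v. ?fg (q n (j n v)) v \<partial>\<P> t w) =
     enn2real (\<integral>\<^sup>+v. ennreal (?fg (q n (j n v)) v) \<partial>\<P> t w)"
    using unit_funD(2)[OF f spq(1)] unit_funD(2)[OF g spq(2)] qjr[of n] borel_measurable_times[OF mf mg]
    by (intro integral_eq_nn_integral AE_I2) auto
   moreover have "(\<integral>v. ?fG (q n (j n v)) v \<partial>\<P> t w) =
     enn2real (\<integral>\<^sup>+v. ennreal (?fG (q n (j n v)) v) \<partial>\<P> t w)"
    using unit_funD(2)[OF f spq(1)] G01(1)[OF g] qjr[of n] borel_measurable_times[OF mf mG]
    by (intro integral_eq_nn_integral AE_I2) auto
   ultimately show ?thesis using nn by simp
  qed
  have lim: "(\<lambda>n. q n (j n v)) \<longlonglongrightarrow> \<tau> v" if "v \<in> path_space T" for v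
  proof (rule tendsto_sandwich[OF always_eventually always_eventually tendsto_const])
   show "(\<lambda>n. \<tau> v + S / 2 ^ n) \<longlonglongrightarrow> \<tau> v"
    using tendsto_add[OF tendsto_const tendsto_mult_right_zero[OF LIMSEQ_inverse_realpow_zero[of 2], of S], of "\<tau> v"] by (simp add: divide_inverse)
  qed (use jq[OF that] in auto)
  have bnd: "\<bar>f (stopped s v) * g (path_tail s v)\<bar> \<le> 1" "\<bar>f (stopped s v) * G g s v\<bar> \<le> 1" if "v \<in> path_space T" "0 \<le> s" "s \<le> S" for s v
   unfolding abs_mult using unit_fun_abs[OF f spq(1)[OF that]] unit_fun_abs[OF g spq(2)[OF that]] G01(2)[OF g that(2,3,1)]
   by (auto intro!: mult_le_one)
  have flim: "(\<lambda>n. f (stopped (q n (j n v)) v)) \<longlonglongrightarrow> f (stopped (\<tau> v) v)" if "v \<in> path_space T" for v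
   using that qjr \<tau>r[OF that] by (intro path_continuousD[OF unit_funD(1)[OF f]] spq pconv_stopped_time[OF that tT(2)] lim) auto
  have glim: "(\<lambda>n. g (path_tail (q n (j n v)) v)) \<longlonglongrightarrow> g (path_tail (\<tau> v) v)" if "v \<in> path_space T" for v
   using that qjr \<tau>r[OF that] by (intro path_continuousD[OF unit_funD(1)[OF g]] spq pconv_path_tail_time[OF that tT(2)] lim) auto
  have Glim: "(\<lambda>n. G g (q n (j n v)) v) \<longlonglongrightarrow> G g (\<tau> v) v" if "v \<in> path_space T" for v
   unfolding G_def using jq[OF that] qjr \<tau>r[OF that] by (intro law_eval_continuous[OF t(1) tT(1) w that g] lim that) (auto simp: S_def)
  have L: "(\<lambda>n. \<integral>v. ?fg (q n (j n v)) v \<partial>\<P> t w) \<longlonglongrightarrow> (\<integral>v. f (stopped (\<tau> v) v) * g (path_tail (\<tau> v) v) \<partial>\<P> t w)"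
   by (rule integral_dominated_convergence[where w = "\<lambda>_. 1"])
    (use fsm[OF f qjm qjr] fsm[OF g qjm qjr] fsm[OF f \<tau>m \<tau>r] fsm[OF g \<tau>m \<tau>r] bnd qjr flim glim in \<open>auto intro!: AE_I2 tendsto_mult borel_measurable_times\<close>)
  have R: "(\<lambda>n. \<integral>v. ?fG (q n (j n v)) v \<partial>\<P> t w) \<longlonglongrightarrow> (\<integral>v. f (stopped (\<tau> v) v) * G g (\<tau> v) v \<partial>\<P> t w)"
   by (rule integral_dominated_convergence[where w = "\<lambda>_. 1"])
    (use fsm[OF f qjm qjr] Gm[OF g qjm qjr] fsm[OF f \<tau>m \<tau>r] Gm[OF g \<tau>m \<tau>r] bnd qjr flim Glim in \<open>auto intro!: AE_I2 tendsto_mult borel_measurable_times\<close>)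
  show ?thesis using L unfolding step by (rule LIMSEQ_unique[OF _ R])
 qed
 have st: "(\<lambda>v. stopped (\<tau> v) v) \<in> measurable (\<P> t w) \<C>" "(\<lambda>v. path_tail (\<tau> v) v) \<in> measurable (\<P> t w) \<C>"
  using \<tau>m \<tau>r S tT stopped_measurable[of "\<lambda>x. x" \<C> T \<tau>] path_tail_measurable[of "\<lambda>x. x" \<C> T \<tau>] by (auto intro: order_trans)
 have pr: "prob_space (\<P> (t + \<tau> v) (path_concat T t w v))" if "v \<in> space (\<P> t w)" for v
  using that \<tau>r[of v] t by (intro prob_space_law start_path_space w t tT) (auto simp: S_def)
 have gm: "(\<lambda>v. \<integral>y. g y \<partial>\<P> (t + \<tau> v) (path_concat T t w v)) \<in> borel_measurable (\<P> t w)" if "unit_fun T g" for g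
  using Gm[OF that \<tau>m \<tau>r] by (simp add: G_def)
 note kf = kernel_fubini[OF T_pos Q.prob_space_axioms st pr _ gm main[unfolded G_def]]
 show ?K by (rule kf(1)) auto
 show "(\<integral>\<^sup>+v. F (stopped (\<tau> v) v, path_tail (\<tau> v) v) \<partial>\<P> t w) =
   (\<integral>\<^sup>+v. \<integral>\<^sup>+y. F (stopped (\<tau> v) v, y) \<partial>\<P> (t + \<tau> v) (path_concat T t w v) \<partial>\<P> t w)"
  if "F \<in> borel_measurable (\<C> \<Otimes>\<^sub>M \<C>)" for F :: "'d path \<times> 'd path => ennreal" by (rule kf(2)[OF _ _ _ _ _ that]) auto
qed

end

section \<open>A countable dense family of stopping times\<close>

text \<open>Codes for the sets obtained by finitely many Boolean operations from a sequence of sets;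
  \<open>Nand\<close> alone generates them, and codes make countability evident.\<close>

datatype bexp = Atom nat | Nand bexp bexp

instance bexp :: countable
 by countable_datatype

primrec bset :: "'a set => (nat => 'a set) => bexp => 'a set" where
 "bset \<Omega> A (Atom k) = A k"
| "bset \<Omega> A (Nand b c) = \<Omega> - (bset \<Omega> A b \<inter> bset \<Omega> A c)"

lemma bset_sets: "range A \<subseteq> sets N ==> bset (space N) A b \<in> sets N"
 by (induction b) auto

text \<open>The sets approximable in measure by coded ones form a \<sigma>-algebra: complements and
  finite unions have codes, and a countable union is close to a finite one by continuity from
  below.\<close>

lemma bset_approx:
 assumes N: "finite_measure N" "sets N = sigma_sets (space N) (range A)" and E: "E \<in> sets N" "e > 0"
 shows "\<exists>b. measure N ((E - bset (space N) A b) \<union> (bset (space N) A b - E)) < e"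
proof -
 interpret finite_measure N by (rule N)
 let ?B = "bset (space N) A"
 define d where "d E F = measure N ((E - F) \<union> (F - E))" for E F
 have "range A \<subseteq> sets N" unfolding N(2) by auto
 then have B: "?B b \<in> sets N" for b by (rule bset_sets)
 have un: "\<forall>e>0. \<exists>b. d (E \<union> F) (?B b) < e"
  if E: "E \<in> sets N" "\<forall>e>0. \<exists>b. d E (?B b) < e" and F: "F \<in> sets N" "\<forall>e>0. \<exists>b. d F (?B b) < e" for E F
 proof (intro allI impI)
  fix e :: real assume "e > 0"
  then obtain b c where bc: "d E (?B b) < e/2" "d F (?B c) < e/2" using E(2) F(2) by (meson half_gt_zero)
  have eq: "?B (Nand (Nand b b) (Nand c c)) = ?B b \<union> ?B c" using B sets.sets_into_space by auto
  have "d (E \<union> F) (?B b \<union> ?B c) \<le> measure N (((E - ?B b) \<union> (?B b - E)) \<union> ((F - ?B c) \<union> (?B c - F)))"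
   unfolding d_def using E(1) F(1) B by (intro finite_measure_mono) auto
  also have "... \<le> d E (?B b) + d F (?B c)" unfolding d_def using E(1) F(1) B by (intro measure_Un_le) auto
  finally show "\<exists>b. d (E \<union> F) (?B b) < e" using bc eq by (intro exI[of _ "Nand (Nand b b) (Nand c c)"]) simp
 qed
 have compl: "\<forall>e>0. \<exists>b. d (space N - E) (?B b) < e" if E: "E \<in> sets N" "\<forall>e>0. \<exists>b. d E (?B b) < e" for E
 proof (intro allI impI)
  fix e :: real assume "e > 0"
  then obtain b where b: "d E (?B b) < e" using E(2) by blast
  have "((space N - E) - (space N - ?B b)) \<union> ((space N - ?B b) - (space N - E)) = (E - ?B b) \<union> (?B b - E)"
   using sets.sets_into_space[OF E(1)] sets.sets_into_space[OF B[of b]] by auto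
  then have "d (space N - E) (?B (Nand b b)) = d E (?B b)" unfolding d_def by simp
  then show "\<exists>b. d (space N - E) (?B b) < e" using b by (intro exI[of _ "Nand b b"]) simp
 qed
 have atom: "\<forall>e>0. \<exists>b. d (A k) (?B b) < e" for k
  by (intro allI impI exI[of _ "Atom k"]) (simp add: d_def)
 have empty: "\<forall>e>0. \<exists>b. d {} (?B b) < e"
 proof -
  have A0: "A 0 \<in> sets N" using B[of "Atom 0"] by simp
  have eq: "A 0 \<union> (space N - A 0) = space N" using sets.sets_into_space[OF A0] by auto
  have "\<forall>e>0. \<exists>b. d (space N) (?B b) < e"
   using un[OF A0 atom sets.compl_sets[OF A0] compl[OF A0 atom]] unfolding eq .
  from compl[OF sets.top this] show ?thesis by simp
 qed
 have "\<forall>e>0. \<exists>b. d E (?B b) < e" using E(1) unfolding N(2)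
 proof induction
  case (Basic a) then show ?case using atom by auto
 next
  case Empty then show ?case by (rule empty)
 next
  case (Compl a) then show ?case using compl N(2) by simp
 next
  case (Union a)
  have am: "a i \<in> sets N" for i using Union.hyps N(2) by simp
  let ?U = "\<lambda>m::nat. \<Union>i<m. a i"
  have U: "\<forall>e>0. \<exists>b. d (?U m) (?B b) < e" for m
  proof (induction m)
   case (Suc m)
   have "?U (Suc m) = ?U m \<union> a m" by (auto simp: less_Suc_eq)
   then show ?case using un[of "?U m" "a m"] Suc.IH Union.IH[of m] am by auto
  qed (use empty in simp)
  show ?case
  proof (intro allI impI)
   fix e :: real assume e: "e > 0"
   have "(\<lambda>m. measure N (?U m)) \<longlonglongrightarrow> measure N (\<Union>m. ?U m)"
    using am by (intro finite_Lim_measure_incseq) (auto simp: incseq_def intro: less_le_trans)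
   moreover have "(\<Union>m. ?U m) = (\<Union>i. a i)" by auto
   ultimately obtain m where "dist (measure N (?U m)) (measure N (\<Union>i. a i)) < e/2"
    using metric_LIMSEQ_D[of _ _ "e/2"] e by (metis half_gt_zero order_refl)
   moreover have "measure N ((\<Union>i. a i) - ?U m) = measure N (\<Union>i. a i) - measure N (?U m)"
    using am by (intro finite_measure_Diff) auto
   ultimately have m: "measure N ((\<Union>i. a i) - ?U m) < e/2" unfolding dist_real_def by linarith
   obtain b where b: "d (?U m) (?B b) < e/2" using U e by (meson half_gt_zero)
   have "d (\<Union>i. a i) (?B b) \<le> measure N (((\<Union>i. a i) - ?U m) \<union> ((?U m - ?B b) \<union> (?B b - ?U m)))"
    unfolding d_def using am B by (intro finite_measure_mono) auto
   also have "... \<le> measure N ((\<Union>i. a i) - ?U m) + d (?U m) (?B b)"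
    unfolding d_def using am B by (intro measure_Un_le) auto
   finally show "\<exists>b. d (\<Union>i. a i) (?B b) < e" using m b by (intro exI[of _ b]) simp
  qed
 qed
 then show ?thesis using E(2) by (simp add: d_def)
qed

context sde
begin

text \<open>Rational times and bounds, enumerated by \<open>from_nat\<close>. By continuity of the
  paths these countably many sets still generate the \<sigma>-algebra.\<close>

definition cylinder :: "nat => 'd path set" where
 "cylinder k = (case from_nat k of (q, i, r) => {v\<in>path_space T. v (real_of_rat q) $ (i :: 'd) \<le> real_of_rat r})"

lemma cylinder_sets: "range cylinder \<subseteq> sets \<C>"
proof -
 have "{v\<in>space \<C>. v q $ i \<le> r} \<in> sets \<C>" for q r :: real and i :: 'd
  using measurable_compose[OF coord_measurable[OF less_imp_le[OF T_pos], of q] borel_measurable_vec_nth[of i]] by measurable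
 then show ?thesis by (auto simp: cylinder_def split: prod.split)
qed

lemma sets_cf_cylinder: "sets \<C> = sigma_sets (path_space T) (range cylinder)"
proof
 let ?S = "sigma (path_space T) (range cylinder)"
 have sub: "range cylinder \<subseteq> Pow (path_space T)" using cylinder_sets sets.sets_into_space[of _ \<C>] by auto
 have S: "space ?S = path_space T" "sets ?S = sigma_sets (path_space T) (range cylinder)"
  using sub by (auto intro!: space_measure_of sets_measure_of)
 have id: "(\<lambda>v. v) \<in> measurable ?S \<C>"
 proof (rule measurable_cfI)
  fix s :: real
  have "s \<in> closure \<rat>" by (simp add: Rats_closure_real)
  then obtain q where q: "\<And>n. q n \<in> \<rat>" "q \<longlonglongrightarrow> s" unfolding closure_sequential by blast
  show "(\<lambda>v. v s) \<in> borel_measurable ?S"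
  proof (rule borel_measurable_LIMSEQ_metric)
   fix n
   obtain q' where q': "q n = real_of_rat q'" using q(1)[of n] by (auto simp: Rats_def)
   show "(\<lambda>v. v (q n)) \<in> borel_measurable ?S"
   proof (intro borel_measurable_vec borel_measurableI_less)
    fix i y
    have "{v\<in>space ?S. v (q n) $ i < y} = (\<Union>r\<in>{r. real_of_rat r < y}. {v\<in>path_space T. v (q n) $ i \<le> real_of_rat r})"
    proof (intro equalityI subsetI)
     fix v assume v: "v \<in> {v\<in>space ?S. v (q n) $ i < y}"
     then obtain r where "v (q n) $ i < real_of_rat r" "real_of_rat r < y" using of_rat_dense[of "v (q n) $ i" y] by auto
     then show "v \<in> (\<Union>r\<in>{r. real_of_rat r < y}. {v\<in>path_space T. v (q n) $ i \<le> real_of_rat r})"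
      using v by (auto simp: S(1) intro!: exI[of _ r])
    qed (auto simp: S(1))
    moreover have "{v\<in>path_space T. v (q n) $ i \<le> real_of_rat r} = cylinder (to_nat (q', i, r))" for r
     by (simp add: cylinder_def q')
    ultimately show "{v\<in>space ?S. v (q n) $ i < y} \<in> sets ?S"
     unfolding S(2) by (auto intro!: sigma_sets_UNION countableI_type)
   qed
  next
   fix v assume "v \<in> space ?S"
   then have "v \<in> path_space T" unfolding S(1) .
   from path_space_continuous[OF this less_imp_le[OF T_pos], of UNIV]
   show "(\<lambda>n. v (q n)) \<longlonglongrightarrow> v s" by (rule continuous_on_tendsto_compose[OF _ q(2)]) auto
  qed
 qed (simp add: S)
 show "sets \<C> \<subseteq> sigma_sets (path_space T) (range cylinder)"
 proof
  fix A assume A: "A \<in> sets \<C>"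
  have "(\<lambda>v. v) -` A \<inter> space ?S = A" using sets.sets_into_space[OF A] unfolding S by auto
  then show "A \<in> sigma_sets (path_space T) (range cylinder)" using measurable_sets[OF id A] unfolding S by simp
 qed
 show "sigma_sets (path_space T) (range cylinder) \<subseteq> sets \<C>" using sets.sigma_sets_subset[OF cylinder_sets] by simp
qed

abbreviation "cyl \<equiv> bset (path_space T) cylinder"

lemma cyl_sets: "cyl b \<in> sets \<C>"
 using bset_sets[OF cylinder_sets] by simp

text \<open>The earliest dyadic time at which the stopped path lies in the set assigned to that
  time, and T at the latest. Testing the stopped path makes this a stopping time for every list of
  codes, and there are only countably many lists.\<close>

definition simple_time :: "nat => bexp list => 'd path => real" where
 "simple_time n bs v = real (LEAST j. 2 ^ n \<le> j \<or> stopped (real j * (T / 2 ^ n)) v \<in> cyl (bs ! j)) * (T / 2 ^ n)"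

lemma least_grid:
 fixes dt :: real
 assumes "0 < dt" "real N * dt = T" "\<And>j. j \<ge> N ==> Q j"
 shows "0 \<le> real (LEAST j. Q j) * dt" "real (LEAST j. Q j) * dt \<le> T"
  "real (LEAST j. Q j) * dt \<le> s \<longleftrightarrow> (\<exists>j. real j * dt \<le> s \<and> Q j)"
proof -
 have le: "real i * dt \<le> real j * dt" if "i \<le> j" for i j using that assms(1) by (intro mult_right_mono) auto
 show "0 \<le> real (LEAST j. Q j) * dt" using assms(1) by simp
 show "real (LEAST j. Q j) * dt \<le> T" using le[OF Least_le[of Q N]] assms(2,3) by simp
 show "real (LEAST j. Q j) * dt \<le> s \<longleftrightarrow> (\<exists>j. real j * dt \<le> s \<and> Q j)"
  using le[OF Least_le[of Q]] LeastI[of Q N] assms(3) order_trans[of "real (LEAST j. Q j) * dt"] by blast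
qed

lemma simple_time_stopping: "simple_time n bs \<in> stopping_times T"
proof (rule stopping_timesI[OF less_imp_le[OF T_pos]])
 let ?d = "T / 2 ^ n"
 have d: "0 < ?d" "real (2 ^ n) * ?d = T" using T_pos by auto
 define Q where "Q v j \<longleftrightarrow> 2 ^ n \<le> j \<or> stopped (real j * ?d) v \<in> cyl (bs ! j)" for v j
 have st: "simple_time n bs v = real (LEAST j. Q v j) * ?d" for v by (simp add: simple_time_def Q_def)
 have QN: "Q v j" if "2 ^ n \<le> j" for v j using that by (simp add: Q_def)
 note lg = least_grid[OF d QN]
 have "{v\<in>space \<C>. Q v j} \<in> sets \<C>" for j
 proof -
  have "stopped (real j * ?d) \<in> measurable \<C> \<C>"
   using stopped_measurable[of "\<lambda>x. x" \<C> T "\<lambda>_. real j * ?d"] T_pos by auto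
  from measurable_sets[OF this cyl_sets[of "bs ! j"]]
  have "{v\<in>space \<C>. stopped (real j * ?d) v \<in> cyl (bs ! j)} \<in> sets \<C>" by (simp add: vimage_def Int_def conj_commute)
  then show ?thesis using sets.top[of \<C>] unfolding Q_def by (cases "2 ^ n \<le> j") auto
 qed
 then have "(\<lambda>v. LEAST j. Q v j) \<in> measurable \<C> (count_space UNIV)" by (intro measurable_Least) (simp add: pred_def)
 then show "simple_time n bs \<in> borel_measurable \<C>" unfolding st[abs_def]
  by (rule measurable_compose) simp
 show "0 \<le> simple_time n bs v \<and> simple_time n bs v \<le> T" for v unfolding st by (intro conjI lg(1,2))
 fix v :: "'d path" and s :: real
 have Qs: "Q (stopped s v) j \<longleftrightarrow> Q v j" if "real j * ?d \<le> s" for j using that by (simp add: Q_def stopped_stopped min_absorb1)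
 show "simple_time n bs (stopped s v) \<le> s \<longleftrightarrow> simple_time n bs v \<le> s"
  unfolding st by (rule trans[OF lg(3) trans[OF _ lg(3)[symmetric]]]) (assumption | intro iff_exI conj_cong refl Qs)+
qed

text \<open>The events that \<theta> has occurred by a grid time are replaced by coded sets. Where
  all replacements of level n are correct, the simple time is \<theta> rounded up to the grid; by
  Borel-Cantelli this is eventually the case.\<close>

lemma simple_time_dense:
 assumes P: "prob_space P" "sets P = sets \<C>" and \<theta>: "\<theta> \<in> stopping_times T"
 obtains bs where "AE v in P. (\<lambda>n. simple_time n (bs n) v) \<longlonglongrightarrow> \<theta> v"
proof -
 interpret P: prob_space P by (rule P)
 have spP: "space P = path_space T" using sets_eq_imp_space_eq[OF P(2)] by simp
 have T0: "0 \<le> T" using T_pos by simp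
 define dt where "dt n = T / 2 ^ n" for n :: nat
 have dt: "0 < dt n" "real (2 ^ n) * dt n = T" for n using T_pos by (auto simp: dt_def)
 define S where "S n j b = {v\<in>path_space T. (\<theta> v \<le> real j * dt n) \<noteq> (stopped (real j * dt n) v \<in> cyl b)}" for n j b
 \<comment> \<open>Precision 4^-n at each of 2^n nodes leaves the summable total error 2^-n.\<close>
 have "\<exists>b. S n j b \<in> P.events \<and> P.prob (S n j b) < (1/4) ^ n" for n j
 proof -
  let ?s = "real j * dt n"
  have s: "0 \<le> ?s" using dt(1)[of n] by simp
  have sm: "stopped ?s \<in> measurable P \<C>"
   using stopped_measurable[of "\<lambda>x. x" \<C> T "\<lambda>_. ?s"] s T0 measurable_cong_sets[OF P(2) refl] by auto
  \<comment> \<open>Simple times test stopped paths, so the approximation is made under the law of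
    the stopped path.\<close>
  define N where "N = distr P \<C> (stopped ?s)"
  interpret N: prob_space N unfolding N_def by (rule P.prob_space_distr[OF sm])
  have N: "space N = path_space T" "sets N = sets \<C>" by (auto simp: N_def)
  define E where "E = {v\<in>path_space T. \<theta> v \<le> ?s}"
  let ?d = "\<lambda>b. (E - cyl b) \<union> (cyl b - E)"
  have "{v\<in>space \<C>. \<theta> v \<le> ?s} \<in> sets \<C>" using stopping_times_measurable[OF \<theta> T0] by measurable
  then have E: "E \<in> sets \<C>" by (simp add: E_def)
  obtain b where b: "measure N (?d b) < (1/4) ^ n"
   using bset_approx[of N cylinder E "(1/4) ^ n"] N.finite_measure_axioms E sets_cf_cylinder unfolding N by auto
  have "measure N (?d b) = P.prob (stopped ?s -` (?d b) \<inter> space P)"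
   unfolding N_def using E cyl_sets by (intro measure_distr sm) auto
  moreover have "stopped ?s -` (?d b) \<inter> space P = S n j b"
   unfolding spP S_def E_def using stopping_times_le_iff[OF \<theta> T0 s] stopped_path_space[OF _ T0 s] by auto
  moreover have "stopped ?s -` (?d b) \<inter> space P \<in> P.events"
   using E cyl_sets by (intro measurable_sets[OF sm]) auto
  ultimately show ?thesis using b by (intro exI[of _ b]) simp
 qed
 then have "\<forall>z. \<exists>b. S (fst z) (snd z) b \<in> P.events \<and> P.prob (S (fst z) (snd z) b) < (1/4) ^ fst z" by blast
 from choice[OF this] obtain f where f: "\<forall>z. S (fst z) (snd z) (f z) \<in> P.events \<and> P.prob (S (fst z) (snd z) (f z)) < (1/4) ^ fst z" by (rule exE)
 define bs where "bs n = map (\<lambda>j. f (n, j)) [0..<2 ^ n]" for n :: nat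
 define V where "V n = (\<Union>j\<in>{..<2 ^ n}. S n j (f (n, j)))" for n :: nat
 have fz: "S n j (f (n, j)) \<in> P.events" "P.prob (S n j (f (n, j))) < (1/4) ^ n" for n j using f[rule_format, of "(n, j)"] by auto
 have V: "V n \<in> P.events" "P.prob (V n) \<le> (1/2) ^ n" for n
 proof -
  show "V n \<in> P.events" unfolding V_def using fz by auto
  have "P.prob (V n) \<le> (\<Sum>j<2 ^ n. P.prob (S n j (f (n, j))))"
   unfolding V_def using fz by (intro P.finite_measure_subadditive_finite) auto
  also have "... \<le> (\<Sum>j<(2::nat) ^ n. (1/4) ^ n)" using fz by (intro sum_mono less_imp_le)
  also have "... = (1/2) ^ n" by (simp add: power_mult_distrib[symmetric])
  finally show "P.prob (V n) \<le> (1/2) ^ n" .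
 qed
 have "AE v in P. \<forall>\<^sub>F n in sequentially. v \<in> space P - V n"
 proof (rule borel_cantelli_AE1)
  show "summable (\<lambda>n. P.prob (V n))"
   by (rule summable_comparison_test'[OF summable_geometric[of "1/2"], of 0]) (use V in auto)
 qed (use V in \<open>auto simp: P.emeasure_eq_measure\<close>)
 then have "AE v in P. (\<lambda>n. simple_time n (bs n) v) \<longlonglongrightarrow> \<theta> v"
  using AE_space
 proof eventually_elim
  case (elim v)
  have v: "v \<in> path_space T" using elim(2) spP by simp
  have r: "0 \<le> \<theta> v" "\<theta> v \<le> T" using stopping_times_range[OF \<theta> v] by auto
  have ev: "\<forall>\<^sub>F n in sequentially. \<theta> v \<le> simple_time n (bs n) v \<and> simple_time n (bs n) v \<le> \<theta> v + dt n"
   using elim(1)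
  proof eventually_elim
   case (elim n)
   define Q where "Q j \<longleftrightarrow> 2 ^ n \<le> j \<or> stopped (real j * dt n) v \<in> cyl (bs n ! j)" for j
   have st: "simple_time n (bs n) v = real (LEAST j. Q j) * dt n" by (simp add: simple_time_def Q_def dt_def)
   have Q: "Q j \<longleftrightarrow> \<theta> v \<le> real j * dt n" for j
   proof (cases "2 ^ n \<le> j")
    case True
    have "real (2 ^ n) * dt n \<le> real j * dt n" using True dt(1)[of n] by (intro mult_right_mono) auto
    then show ?thesis using True r(2) dt(2)[of n] by (simp add: Q_def)
   next
    case False
    then have "v \<notin> S n j (f (n, j))" "bs n ! j = f (n, j)" using elim by (auto simp: V_def bs_def)
    then show ?thesis using v False by (auto simp: Q_def S_def)
   qed
   note lg = least_grid[OF dt, of n Q]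
   define c where "c = nat \<lceil>\<theta> v / dt n\<rceil>"
   have "0 \<le> \<theta> v / dt n" using r dt(1)[of n] by simp
   then have "\<theta> v / dt n \<le> real c" "real c \<le> \<theta> v / dt n + 1" unfolding c_def by linarith+
   then have c: "\<theta> v \<le> real c * dt n" "real c * dt n \<le> \<theta> v + dt n" using dt(1)[of n] by (auto simp: field_simps)
   have Q2: "Q j" if "2 ^ n \<le> j" for j using that by (simp add: Q_def)
   have "Q (LEAST j. Q j)" using Q2[OF order_refl] by (rule LeastI)
   then have 1: "\<theta> v \<le> real (LEAST j. Q j) * dt n" unfolding Q .
   have 2: "real (LEAST j. Q j) * dt n \<le> \<theta> v + dt n" using c Q by (subst lg(3)) (auto intro: Q2)
   show ?case unfolding st using 1 2 by simp
  qed
  show ?case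
  proof (rule tendsto_sandwich[where f = "\<lambda>_. \<theta> v"])
   show "(\<lambda>n. \<theta> v + dt n) \<longlonglongrightarrow> \<theta> v" unfolding dt_def
    using tendsto_add[OF tendsto_const tendsto_mult_right_zero[OF LIMSEQ_inverse_realpow_zero[of 2], of T], of "\<theta> v"] by (simp add: divide_inverse)
  qed (use ev in \<open>auto elim: eventually_mono\<close>)
 qed
 then show ?thesis by (rule that)
qed

end

section \<open>Exhaustion by stopping times\<close>

context sde
begin

text \<open>The class in which all expectations of stopped values exist and dominated convergence
  applies; by \<open>dominated_affine\<close> it admits adding \<epsilon> s and changing
  sign.\<close>

definition dominated :: "(real => 'd path => real) => bool" where
 "dominated X \<longleftrightarrow> X \<in> C0 T \<and> prog_measurable T T X \<and> (\<forall>t\<in>{0..T}. \<forall>w\<in>path_space T.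
   \<exists>Y. integrable (\<P> t w) Y \<and> (AE v in \<P> t w. \<forall>s\<in>{0..T - t}. \<bar>shift T t w X s v\<bar> \<le> Y v))"

lemma shift_measurable:
 fixes X :: "real => 'd path => real"
 assumes "prog_measurable T T X" "0 \<le> t" "t \<le> T" "w \<in> path_space T"
  and "f \<in> measurable N \<C>" "q \<in> borel_measurable N" "\<And>x. x \<in> space N ==> 0 \<le> q x \<and> q x \<le> T - t"
 shows "(\<lambda>x. shift T t w X (q x) (f x)) \<in> borel_measurable N"
 unfolding shift_def
proof (rule prog_measurable_joint[where u = X])
 show "(\<lambda>x. path_concat T t w (f x)) \<in> measurable N \<C>" by (intro path_concat_const_measurable assms)
 show "t + q x \<in> {0..T}" if "x \<in> space N" for x using assms(7)[OF that] assms(2) by auto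
qed (use assms T_pos in auto)

lemma shift_tendsto:
 fixes X :: "real => 'd path => real"
 assumes "X \<in> C0 T" and t: "0 \<le> t" "t \<le> T" and w: "w \<in> path_space T"
  and "v \<in> path_space T" "\<And>n. 0 \<le> q n \<and> q n \<le> T - t" "0 \<le> r" "r \<le> T - t" "q \<longlonglongrightarrow> r"
 shows "(\<lambda>n. shift T t w X (q n) v) \<longlonglongrightarrow> shift T t w X r v"
 unfolding shift_def
proof (rule C0_sequentially[where u = X])
 show "t + q n \<in> {0..T}" for n using assms(6)[of n] t by auto
 show l: "(\<lambda>n. t + q n) \<longlonglongrightarrow> t + r" by (intro tendsto_add tendsto_const assms)
 show "pconv (\<lambda>n. stopped (t + q n) (path_concat T t w v)) (stopped (t + r) (path_concat T t w v))"
  using T_pos by (intro pconv_stopped_time[OF start_path_space[OF t w assms(5)] _ l]) simp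
qed (use T_pos assms start_path_space[OF t w] in auto)

context
 fixes X :: "real => 'd path => real" and t :: real and w :: "'d path"
 assumes X: "dominated X" and t: "0 \<le> t" "t \<le> T" and w: "w \<in> path_space T"
begin

lemma dominated_bound: "\<exists>Y. integrable (\<P> t w) Y \<and> (AE v in \<P> t w. \<forall>s\<in>{0..T - t}. \<bar>shift T t w X s v\<bar> \<le> Y v)"
proof -
 have "\<forall>t\<in>{0..T}. \<forall>w\<in>path_space T. \<exists>Y. integrable (\<P> t w) Y \<and> (AE v in \<P> t w. \<forall>s\<in>{0..T - t}. \<bar>shift T t w X s v\<bar> \<le> Y v)"
  using X unfolding dominated_def by (elim conjE)
 from bspec[OF bspec[OF this, of t] w] show ?thesis using t by simp
qed

lemma dominated_C0: "X \<in> C0 T" "prog_measurable T T X"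
 using X by (auto simp: dominated_def)

lemmas dominated_measurable = shift_measurable[OF dominated_C0(2) t w]
lemmas dominated_continuous = shift_tendsto[OF dominated_C0(1) t w]

lemma dominated_integrable:
 assumes "q \<in> borel_measurable \<C>" "\<And>v. v \<in> path_space T ==> 0 \<le> q v \<and> q v \<le> T - t"
 shows "integrable (\<P> t w) (\<lambda>v. shift T t w X (q v) v)"
proof -
 obtain Y where Y: "integrable (\<P> t w) Y" "AE v in \<P> t w. \<forall>s\<in>{0..T - t}. \<bar>shift T t w X s v\<bar> \<le> Y v"
  using dominated_bound by (elim exE conjE)
 show ?thesis
 proof (rule Bochner_Integration.integrable_bound[OF Y(1)])
  show "(\<lambda>v. shift T t w X (q v) v) \<in> borel_measurable (\<P> t w)"
   using dominated_measurable[of "\<lambda>v. v" \<C> q] assms by simp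
  show "AE v in \<P> t w. norm (shift T t w X (q v) v) \<le> norm (Y v)"
   using Y(2) AE_space
  proof eventually_elim
   case (elim v)
   then have "\<bar>shift T t w X (q v) v\<bar> \<le> Y v" using assms(2)[of v] by simp
   then show ?case by simp
  qed
 qed
qed

lemma dominated_integral_tendsto:
 assumes q: "\<And>n. q n \<in> borel_measurable \<C>" "\<And>n v. v \<in> path_space T ==> 0 \<le> q n v \<and> q n v \<le> T - t"
  and r: "r \<in> borel_measurable \<C>" "\<And>v. v \<in> path_space T ==> 0 \<le> r v \<and> r v \<le> T - t"
  and lim: "AE v in \<P> t w. (\<lambda>n. q n v) \<longlonglongrightarrow> r v"
 shows "(\<lambda>n. \<integral>v. shift T t w X (q n v) v \<partial>\<P> t w) \<longlonglongrightarrow> (\<integral>v. shift T t w X (r v) v \<partial>\<P> t w)"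
proof -
 obtain Y where Y: "integrable (\<P> t w) Y" "AE v in \<P> t w. \<forall>s\<in>{0..T - t}. \<bar>shift T t w X s v\<bar> \<le> Y v"
  using dominated_bound by (elim exE conjE)
 show ?thesis
 proof (rule integral_dominated_convergence[OF _ _ Y(1)])
  show "(\<lambda>v. shift T t w X (r v) v) \<in> borel_measurable (\<P> t w)" "\<And>n. (\<lambda>v. shift T t w X (q n v) v) \<in> borel_measurable (\<P> t w)"
   using dominated_measurable[of "\<lambda>v. v" \<C> r] dominated_measurable[of "\<lambda>v. v" \<C> "q _"] q r by auto
  show "AE v in \<P> t w. (\<lambda>n. shift T t w X (q n v) v) \<longlonglongrightarrow> shift T t w X (r v) v"
   using lim AE_space by eventually_elim (use q r in \<open>auto intro!: dominated_continuous\<close>)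
  show "AE v in \<P> t w. norm (shift T t w X (q n v) v) \<le> Y v" for n
   using Y(2) AE_space by eventually_elim (use q in auto)
 qed
qed

lemma shift_0: "v \<in> path_space T ==> shift T t w X 0 v = X t w"
 using C0_stopped[of X T t w "path_concat T t w v"] X t T_pos w start_path_space[OF t w] stopped_path_concat[OF w _ t]
 by (auto simp: shift_def dominated_def)

text \<open>Improvement is an open condition: along simple times tending to \<theta> the
  expectations converge, so one of them already exceeds c. The same countable family thus serves all
  starting points. The minimum confines simple times, which range up to T, to the horizon T -
  t.\<close>

lemma simple_time_improves:
 assumes \<theta>: "\<theta> \<in> stopping_times_le T (\<lambda>_. T - t)" "c < (\<integral>v. shift T t w X (\<theta> v) v \<partial>\<P> t w)"
 shows "\<exists>n bs. c < (\<integral>v. shift T t w X (min (simple_time n bs v) (T - t)) v \<partial>\<P> t w)"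
proof -
 have T0: "0 \<le> T" using T_pos by simp
 have \<theta>s: "\<theta> \<in> stopping_times T" "\<And>v. v \<in> path_space T ==> 0 \<le> \<theta> v \<and> \<theta> v \<le> T - t"
  using \<theta>(1) by (auto simp: stopping_times_le_def)
 obtain bs where bs: "AE v in \<P> t w. (\<lambda>n. simple_time n (bs n) v) \<longlonglongrightarrow> \<theta> v"
  using simple_time_dense[OF prob_space_law[OF t w] sets_law \<theta>s(1)] by blast
 have "(\<lambda>n. \<integral>v. shift T t w X (min (simple_time n (bs n) v) (T - t)) v \<partial>\<P> t w) \<longlonglongrightarrow> (\<integral>v. shift T t w X (\<theta> v) v \<partial>\<P> t w)"
 proof (rule dominated_integral_tendsto)
  show "(\<lambda>v. min (simple_time n (bs n) v) (T - t)) \<in> borel_measurable \<C>" for n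
   using stopping_times_measurable[OF simple_time_stopping T0] by (intro borel_measurable_min) auto
  show "0 \<le> min (simple_time n (bs n) v) (T - t) \<and> min (simple_time n (bs n) v) (T - t) \<le> T - t" if "v \<in> path_space T" for n v
   using stopping_times_range[OF simple_time_stopping that] t by simp
  show "AE v in \<P> t w. (\<lambda>n. min (simple_time n (bs n) v) (T - t)) \<longlonglongrightarrow> \<theta> v"
   using bs AE_space
  proof eventually_elim
   case (elim v)
   from tendsto_min[OF elim(1) tendsto_const[of "T - t"]] show ?case using \<theta>s(2)[of v] elim(2) by (simp add: min_absorb1)
  qed
 qed (use \<theta>s stopping_times_measurable[OF \<theta>s(1) T0] in auto)
 from order_tendstoD(1)[OF this \<theta>(2)] obtain n where "c < (\<integral>v. shift T t w X (min (simple_time n (bs n) v) (T - t)) v \<partial>\<P> t w)"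
  unfolding eventually_sequentially by blast
 then show ?thesis by blast
qed

end

text \<open>Wherever \<tau> lies below the horizon some simple time improves on stopping. As there
  are countably many, a single one improves on a non-null set of pasts; it is appended to \<tau> on
  that set, and \<tau> is kept elsewhere. Thus no selection at individual points occurs.\<close>

lemma improve_stopping_time:
 assumes X: "dominated X" and t: "0 \<le> t" "t < T" and w: "w \<in> path_space T"
  and imp: "\<And>t w. 0 \<le> t ==> t < T ==> w \<in> path_space T ==>
   \<exists>\<theta>\<in>stopping_times_le T (\<lambda>_. T - t). X t w < (\<integral>v. shift T t w X (\<theta> v) v \<partial>\<P> t w)"
  and \<tau>: "\<tau> \<in> stopping_times_le T (\<lambda>_. T - t)" and pos: "\<not> (AE v in \<P> t w. \<tau> v = T - t)"
 shows "\<exists>\<tau>'\<in>stopping_times_le T (\<lambda>_. T - t). (\<forall>v\<in>path_space T. \<tau> v \<le> \<tau>' v) \<and>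
  (\<integral>v. shift T t w X (\<tau> v) v \<partial>\<P> t w) < (\<integral>v. shift T t w X (\<tau>' v) v \<partial>\<P> t w)"
proof -
 define S where "S = T - t"
 have S: "0 < S" "S \<le> T" "t + S = T" using t by (auto simp: S_def)
 have tT: "t \<le> T" and T0: "0 \<le> T" using t by auto
 interpret Q: prob_space "\<P> t w" by (rule prob_space_law[OF t(1) tT w])
 have \<tau>s: "\<tau> \<in> stopping_times T" and \<tau>r: "\<And>v. v \<in> path_space T ==> 0 \<le> \<tau> v \<and> \<tau> v \<le> S"
  using \<tau> by (auto simp: stopping_times_le_def S_def)
 have \<tau>m: "\<tau> \<in> borel_measurable \<C>" by (rule stopping_times_measurable[OF \<tau>s T0])
 note sp = start_path_space[OF t(1) tT w]
 define a where "a v = stopped (\<tau> v) v" for v :: "'d path"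
 define b where "b v = path_tail (\<tau> v) v" for v :: "'d path"
 define \<kappa> where "\<kappa> v = \<P> (t + \<tau> v) (path_concat T t w v)" for v
 \<comment> \<open>The value of X after continuing with \<theta>, as a function of the past
   \<open>fst z\<close> and the future \<open>snd z\<close>. As \<tau> is itself determined by the
   past, the flow property applies.\<close>
 define G where "G \<theta> z = X (t + \<tau> (fst z) + min (\<theta> (snd z)) (S - \<tau> (fst z)))
   (path_concat T (t + \<tau> (fst z)) (path_concat T t w (fst z)) (snd z))" for \<theta> :: "'d path => real" and z
 define \<psi> where "\<psi> \<theta> v = (\<integral>y. G \<theta> (a v, y) \<partial>\<kappa> v)" for \<theta> v
 define \<rho> where "\<rho> \<theta> v = \<tau> v + min (\<theta> (b v)) (S - \<tau> v)" for \<theta> :: "'d path => real" and v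
 define Z where "Z s v = shift T t w X s v" for s v
 let ?I\<tau> = "\<integral>v. Z (\<tau> v) v \<partial>\<P> t w"
 define A where "A \<theta> = {v\<in>path_space T. \<tau> v < S \<and> Z (\<tau> v) v < \<psi> \<theta> v}" for \<theta>
 let ?pv = "\<lambda>v. path_concat T t w v"
 let ?tv = "\<lambda>v. t + \<tau> v"
 have ab: "a v \<in> path_space T" "b v \<in> path_space T" "\<tau> (a v) = \<tau> v" "a (a v) = a v"
  "stopped (?tv v) (path_concat T t w (a v)) = stopped (?tv v) (?pv v)" if v: "v \<in> path_space T" for v
 proof -
  have r: "0 \<le> \<tau> v" "\<tau> v \<le> T" "?tv v \<le> T" using \<tau>r[OF v] S by auto
  show "a v \<in> path_space T" "b v \<in> path_space T" unfolding a_def b_def using v T0 r by (auto intro: stopped_path_space path_tail_path_space')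
  show e: "\<tau> (a v) = \<tau> v" unfolding a_def by (rule stopping_times_stopped[OF \<tau>s T0 v order_refl])
  show "a (a v) = a v" unfolding a_def[of "a v"] e by (simp add: a_def stopped_stopped)
  show "stopped (?tv v) (path_concat T t w (a v)) = stopped (?tv v) (?pv v)"
   unfolding a_def by (rule path_concat_stopped_right[OF w v t(1) r(1,3)])
 qed
 have am: "a \<in> measurable \<C> \<C>" "b \<in> measurable \<C> \<C>"
  unfolding a_def b_def using \<tau>m \<tau>r S stopped_measurable[of "\<lambda>x. x" \<C> T \<tau>] path_tail_measurable[of "\<lambda>x. x" \<C> T \<tau>] T0
  by (auto intro: order_trans)
 have restart: "path_concat T (?tv v) (path_concat T t w (a v)) y = path_concat T (?tv v) (?pv v) y"
  if "v \<in> path_space T" for v y by (metis path_concat_stopped ab(5)[OF that])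
 have Ga: "G \<theta> (a v, y) = shift T (?tv v) (?pv v) X (min (\<theta> y) (T - (?tv v))) y" if "v \<in> path_space T" for \<theta> v y
  by (simp add: G_def ab(3)[OF that] restart[OF that] shift_def S_def diff_diff_eq)
 have Gab: "G \<theta> (a v, b v) = Z (\<rho> \<theta> v) v" if v: "v \<in> path_space T" for \<theta> v
  using \<tau>r[OF v] S path_concat_path_tail[OF w v t(1), of "\<tau> v"]
  by (simp add: G_def ab(3)[OF v] restart[OF v] Z_def shift_def \<rho>_def b_def add.assoc)
 have XC: "X \<in> C0 T" "prog_measurable T T X" using X by (auto simp: dominated_def)
 have Za: "Z (\<tau> v) (a v) = Z (\<tau> v) v" if v: "v \<in> path_space T" for v
  unfolding Z_def shift_def using \<tau>r[OF v] S t by (intro C0_stopped[OF XC(1) T0 _ sp sp ab(5)] v ab(1)) auto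
 have \<kappa>a: "\<kappa> (a v) = \<kappa> v" if v: "v \<in> path_space T" for v
  unfolding \<kappa>_def ab(3)[OF v] by (metis law_stopped ab(5)[OF v])
 note flow = flow_stopping_time[OF t w \<tau>, folded a_def b_def \<kappa>_def]
 have Gm: "G \<theta> \<in> borel_measurable (\<C> \<Otimes>\<^sub>M \<C>)" if \<theta>: "\<theta> \<in> stopping_times T" for \<theta>
  unfolding G_def
 proof (rule prog_measurable_joint[OF XC(2) T0])
  have m: "(\<lambda>z. \<tau> (fst z)) \<in> borel_measurable (\<C> \<Otimes>\<^sub>M \<C>)" "(\<lambda>z. \<theta> (snd z)) \<in> borel_measurable (\<C> \<Otimes>\<^sub>M \<C>)"
   using measurable_compose[OF measurable_fst \<tau>m] measurable_compose[OF measurable_snd stopping_times_measurable[OF \<theta> T0]] by auto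
  show "(\<lambda>z. path_concat T (t + \<tau> (fst z)) (path_concat T t w (fst z)) (snd z)) \<in> measurable (\<C> \<Otimes>\<^sub>M \<C>) \<C>"
   using m(1) \<tau>r S t T0 by (intro path_concat_measurable path_concat_const_measurable w measurable_fst measurable_snd borel_measurable_add)
    (auto simp: space_pair_measure)
  show "(\<lambda>z. t + \<tau> (fst z) + min (\<theta> (snd z)) (S - \<tau> (fst z))) \<in> borel_measurable (\<C> \<Otimes>\<^sub>M \<C>)" using m by measurable
  show "t + \<tau> (fst z) + min (\<theta> (snd z)) (S - \<tau> (fst z)) \<in> {0..T}" if "z \<in> space (\<C> \<Otimes>\<^sub>M \<C>)" for z
   using that \<tau>r[of "fst z"] stopping_times_range[OF \<theta>, of "snd z"] S(3) t by (auto simp: space_pair_measure min_def)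
 qed
 have \<rho>r: "\<tau> v \<le> \<rho> \<theta> v" "\<rho> \<theta> v \<le> S" "0 \<le> \<rho> \<theta> v" if \<theta>: "\<theta> \<in> stopping_times T" and v: "v \<in> path_space T" for \<theta> v
  using \<tau>r[OF v] stopping_times_range[OF \<theta> ab(2)[OF v]] by (auto simp: \<rho>_def min_def)
 have \<rho>m: "\<rho> \<theta> \<in> borel_measurable \<C>" if \<theta>: "\<theta> \<in> stopping_times T" for \<theta>
  unfolding \<rho>_def using \<tau>m measurable_compose[OF am(2) stopping_times_measurable[OF \<theta> T0]] by measurable
 note Zint = dominated_integrable[OF X t(1) tT w, folded Z_def S_def]
 have Z\<tau>: "integrable (\<P> t w) (\<lambda>v. Z (\<tau> v) v)" by (rule Zint[OF \<tau>m \<tau>r])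
 have GI: "integrable (\<P> t w) (\<lambda>v. G \<theta> (a v, b v))" if \<theta>: "\<theta> \<in> stopping_times T" for \<theta>
  using Zint[OF \<rho>m[OF \<theta>]] \<rho>r[OF \<theta>] Gab by (subst Bochner_Integration.integrable_cong[OF refl]) auto
 have amP: "a \<in> measurable (\<P> t w) \<C>" using am(1) by simp
 have \<psi>m: "integrable (\<P> t w) (\<psi> \<theta>)" if \<theta>: "\<theta> \<in> stopping_times T" for \<theta>
  unfolding \<psi>_def by (rule kernel_integral(1)[OF flow(1) Gm[OF \<theta>] amP flow(2) GI[OF \<theta>]])
 have Am: "A \<theta> \<in> sets \<C>" if \<theta>: "\<theta> \<in> stopping_times T" for \<theta>
 proof -
  have [measurable]: "\<psi> \<theta> \<in> borel_measurable \<C>" "(\<lambda>v. Z (\<tau> v) v) \<in> borel_measurable \<C>" "\<tau> \<in> borel_measurable \<C>"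
   using borel_measurable_integrable[OF \<psi>m[OF \<theta>]] borel_measurable_integrable[OF Z\<tau>] \<tau>m by auto
  have "{v\<in>space \<C>. \<tau> v < S \<and> Z (\<tau> v) v < \<psi> \<theta> v} \<in> sets \<C>" by measurable
  then show ?thesis by (simp add: A_def)
 qed
 \<comment> \<open>Membership is decided by the path up to \<tau>, which makes the pasted time a
   stopping time.\<close>
 have Aa: "a v \<in> A \<theta> \<longleftrightarrow> v \<in> A \<theta>" if v: "v \<in> path_space T" for v \<theta>
  unfolding A_def using v ab[OF v] Za[OF v] \<kappa>a[OF v] by (simp add: \<psi>_def)
 have "\<exists>n bs. \<not> (AE v in \<P> t w. v \<notin> A (simple_time n bs))"
 proof (rule ccontr)
  assume "\<nexists>n bs. \<not> (AE v in \<P> t w. v \<notin> A (simple_time n bs))"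
  then have "AE v in \<P> t w. \<forall>n bs. v \<notin> A (simple_time n bs)" by (simp add: AE_all_countable)
  then have "AE v in \<P> t w. \<tau> v = T - t" using AE_space
  proof eventually_elim
   case (elim v)
   then have v: "v \<in> path_space T" by simp
   show ?case
   proof (rule ccontr)
    assume "\<tau> v \<noteq> T - t"
    then have r: "0 \<le> ?tv v" "?tv v < T" "\<tau> v < S" using \<tau>r[OF v] t(1) by (auto simp: S_def)
    obtain \<theta> where \<theta>: "\<theta> \<in> stopping_times_le T (\<lambda>_. T - (?tv v))"
     "X (?tv v) (?pv v) < (\<integral>y. shift T (?tv v) (?pv v) X (\<theta> y) y \<partial>\<kappa> v)"
     using imp[OF r(1,2) sp[OF v]] unfolding \<kappa>_def by blast
    obtain n bs where nb: "X (?tv v) (?pv v) <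
      (\<integral>y. shift T (?tv v) (?pv v) X (min (simple_time n bs y) (T - (?tv v))) y \<partial>\<kappa> v)"
     using simple_time_improves[OF X r(1) less_imp_le[OF r(2)] sp[OF v] \<theta>(1) \<theta>(2)[unfolded \<kappa>_def]] unfolding \<kappa>_def by blast
    have "\<psi> (simple_time n bs) v = (\<integral>y. shift T (?tv v) (?pv v) X (min (simple_time n bs y) (T - (?tv v))) y \<partial>\<kappa> v)"
     unfolding \<psi>_def Ga[OF v] ..
    then have "v \<in> A (simple_time n bs)" using nb v r(3) by (simp add: A_def Z_def shift_def)
    then show False using elim(1) by blast
   qed
  qed
  then show False using pos by blast
 qed
 then obtain n bs where nAE: "\<not> (AE v in \<P> t w. v \<notin> A (simple_time n bs))" by blast
 define \<theta> where "\<theta> = simple_time n bs"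
 have \<theta>: "\<theta> \<in> stopping_times T" unfolding \<theta>_def by (rule simple_time_stopping)
 define \<tau>' where "\<tau>' v = (if v \<in> A \<theta> then \<rho> \<theta> v else \<tau> v)" for v
 have ge: "\<tau> v \<le> \<tau>' v" "0 \<le> \<tau>' v \<and> \<tau>' v \<le> S" if v: "v \<in> path_space T" for v
  using \<tau>r[OF v] \<rho>r[OF \<theta> v] by (auto simp: \<tau>'_def)
 have \<tau>'m: "\<tau>' \<in> borel_measurable \<C>"
  unfolding \<tau>'_def using \<tau>m \<rho>m[OF \<theta>] Am[OF \<theta>] sets.Int_space_eq2[OF Am[OF \<theta>]] by (intro measurable_If_set) auto
 have "\<tau>' \<in> stopping_times T"
 proof (rule stopping_timesI[OF T0 \<tau>'m])
  show "0 \<le> \<tau>' v \<and> \<tau>' v \<le> T" if "v \<in> path_space T" for v using ge(2)[OF that] S by auto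
  fix v :: "'d path" and s :: real assume v: "v \<in> path_space T" and s: "0 \<le> s" "s < T"
  note sps = stopped_path_space[OF v T0 s(1)]
  show "\<tau>' (stopped s v) \<le> s \<longleftrightarrow> \<tau>' v \<le> s"
  proof (cases "\<tau> v \<le> s")
   case False
   then have "\<not> \<tau> (stopped s v) \<le> s" using stopping_times_le_iff[OF \<tau>s T0 s(1) v] by simp
   then show ?thesis using False ge(1)[OF v] ge(1)[OF sps] by linarith
  next
   case True
   have e: "\<tau> (stopped s v) = \<tau> v" by (rule stopping_times_stopped[OF \<tau>s T0 v True])
   have "a (stopped s v) = a v" unfolding a_def e stopped_stopped using True by (simp add: min_absorb1)
   then have A: "stopped s v \<in> A \<theta> \<longleftrightarrow> v \<in> A \<theta>" using Aa[OF v] Aa[OF sps] by metis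
   have "b (stopped s v) = stopped (s - \<tau> v) (b v)"
    unfolding b_def e using True \<tau>r[OF v] by (intro path_tail_stopped) auto
   then have "\<theta> (b (stopped s v)) \<le> s - \<tau> v \<longleftrightarrow> \<theta> (b v) \<le> s - \<tau> v"
    using stopping_times_le_iff[OF \<theta> T0 _ ab(2)[OF v], of "s - \<tau> v"] True by simp
   then show ?thesis unfolding \<tau>'_def A \<rho>_def e by (auto simp: min_def)
  qed
 qed
 then have mem: "\<tau>' \<in> stopping_times_le T (\<lambda>_. T - t)" using ge(2) by (auto simp: stopping_times_le_def S_def)
 define H where "H z = indicator (A \<theta>) (fst z) * G \<theta> z" for z
 let ?IZ = "\<integral>v. indicator (A \<theta>) v * Z (\<rho> \<theta> v) v \<partial>\<P> t w"
 let ?I\<psi> = "\<integral>v. indicator (A \<theta>) v * \<psi> \<theta> v \<partial>\<P> t w"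
 have Hab: "H (a v, b v) = indicator (A \<theta>) v * Z (\<rho> \<theta> v) v" "(\<integral>y. H (a v, y) \<partial>\<kappa> v) = indicator (A \<theta>) v * \<psi> \<theta> v" if "v \<in> path_space T" for v
  using Gab[OF that] Aa[OF that] by (auto simp: H_def \<psi>_def indicator_def)
 have Hm: "H \<in> borel_measurable (\<C> \<Otimes>\<^sub>M \<C>)"
  unfolding H_def using Am[OF \<theta>] by (intro borel_measurable_times Gm[OF \<theta>] measurable_compose[OF measurable_fst]) auto
 have AmP: "A \<theta> \<in> sets (\<P> t w)" using Am[OF \<theta>] by simp
 have iA: "integrable (\<P> t w) (\<lambda>v. indicator (A \<theta>) v * h v)" if "integrable (\<P> t w) h" for h :: "'d path => real"
  using integrable_mult_indicator[OF AmP that] by simp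
 have HI: "integrable (\<P> t w) (\<lambda>v. H (a v, b v))"
  using iA[OF Zint[OF \<rho>m[OF \<theta>]]] \<rho>r[OF \<theta>] Hab(1) by (subst Bochner_Integration.integrable_cong[OF refl]) auto
 have eq: "?IZ = ?I\<psi>"
 proof -
  have "?IZ = (\<integral>v. H (a v, b v) \<partial>\<P> t w)"
   using Hab(1) by (intro Bochner_Integration.integral_cong) auto
  also have "... = (\<integral>v. \<integral>y. H (a v, y) \<partial>\<kappa> v \<partial>\<P> t w)" by (rule kernel_integral(2)[OF flow(1) Hm amP flow(2) HI])
  also have "... = ?I\<psi>"
   using Hab(2) by (intro Bochner_Integration.integral_cong) auto
  finally show ?thesis .
 qed
 \<comment> \<open>The conditional gain of the pasted time: positive on \<open>A \<theta>\<close>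
   and 0 elsewhere.\<close>
 let ?D = "\<lambda>v. indicator (A \<theta>) v * (\<psi> \<theta> v - Z (\<tau> v) v)"
 have iD: "integrable (\<P> t w) ?D" by (intro iA Bochner_Integration.integrable_diff \<psi>m \<theta> Z\<tau>)
 have "(\<integral>v. Z (\<tau>' v) v \<partial>\<P> t w) = (\<integral>v. Z (\<tau> v) v + (indicator (A \<theta>) v * Z (\<rho> \<theta> v) v - indicator (A \<theta>) v * Z (\<tau> v) v) \<partial>\<P> t w)"
  by (intro Bochner_Integration.integral_cong) (auto simp: \<tau>'_def indicator_def)
 also have "... = ?I\<tau> + (?IZ - (\<integral>v. indicator (A \<theta>) v * Z (\<tau> v) v \<partial>\<P> t w))"
  using Z\<tau> iA[OF Z\<tau>] iA[OF Zint[OF \<rho>m[OF \<theta>]]] \<rho>r[OF \<theta>] by simp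
 also have "... = ?I\<tau> + (\<integral>v. ?D v \<partial>\<P> t w)"
  unfolding eq right_diff_distrib using iA[OF \<psi>m[OF \<theta>]] iA[OF Z\<tau>] by simp
 finally have fin: "(\<integral>v. Z (\<tau>' v) v \<partial>\<P> t w) = ?I\<tau> + (\<integral>v. ?D v \<partial>\<P> t w)" .
 have D0: "0 \<le> ?D v" for v by (auto simp: indicator_def A_def)
 have "(\<integral>v. ?D v \<partial>\<P> t w) \<noteq> 0"
 proof
  assume "(\<integral>v. ?D v \<partial>\<P> t w) = 0"
  then have "AE v in \<P> t w. ?D v = 0" using integral_nonneg_eq_0_iff_AE[OF iD] D0 by simp
  then have "AE v in \<P> t w. v \<notin> A \<theta>" by eventually_elim (auto simp: A_def indicator_def)
  then show False using nAE by (simp add: \<theta>_def)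
 qed
 moreover have "0 \<le> (\<integral>v. ?D v \<partial>\<P> t w)" by (intro Bochner_Integration.integral_nonneg D0)
 ultimately have "?I\<tau> < (\<integral>v. Z (\<tau>' v) v \<partial>\<P> t w)" unfolding fin by simp
 then show ?thesis using mem ge(1) unfolding Z_def by (intro bexI[of _ \<tau>'] conjI ballI)
qed


text \<open>If the limit were not the horizon, a strict improvement of it would have been an
  admissible choice in every step, so its mean could not exceed the mean of the limit. Being later,
  it would coincide with the limit almost surely, which contradicts strictness.\<close>

lemma exhaustion:
 assumes X: "dominated X" and t: "0 \<le> t" "t < T" and w: "w \<in> path_space T"
  and imp: "\<And>t w. 0 \<le> t ==> t < T ==> w \<in> path_space T ==>
   \<exists>\<theta>\<in>stopping_times_le T (\<lambda>_. T - t). X t w < (\<integral>v. shift T t w X (\<theta> v) v \<partial>\<P> t w)"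
 shows "X t w \<le> (\<integral>v. shift T t w X (T - t) v \<partial>\<P> t w)"
proof -
 define S where "S = T - t"
 have S: "0 \<le> S" "S \<le> T" using t by (auto simp: S_def)
 have tT: "t \<le> T" and T0: "0 \<le> T" using t by auto
 interpret Q: prob_space "\<P> t w" by (rule prob_space_law[OF t(1) tT w])
 define TS where "TS = (stopping_times_le T (\<lambda>_. S) :: ('d path => real) set)"
 define e where "e \<tau> = (\<integral>v. shift T t w X (\<tau> v) v \<partial>\<P> t w)" for \<tau>
 define m where "m \<tau> = (\<integral>v. \<tau> v \<partial>\<P> t w)" for \<tau> :: "'d path => real"
 \<comment> \<open>The order of the Brezis-Browder principle: later and with no smaller value. The
   mean \<open>m\<close> is its monotone functional.\<close>
 define R where "R \<tau> = {\<tau>'\<in>TS. (\<forall>v\<in>path_space T. \<tau> v \<le> \<tau>' v) \<and> e \<tau> \<le> e \<tau>'}" for \<tau>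
 have TS: "\<tau> \<in> stopping_times T" "\<tau> \<in> borel_measurable \<C>" "\<And>v. v \<in> path_space T ==> 0 \<le> \<tau> v \<and> \<tau> v \<le> S" if "\<tau> \<in> TS" for \<tau>
  using that stopping_times_measurable[OF _ T0, of \<tau>] by (auto simp: TS_def stopping_times_le_def)
 have int: "integrable (\<P> t w) \<tau>" if "\<tau> \<in> TS" for \<tau>
  using TS[OF that] by (intro Q.integrable_const_bound[where B = S]) (auto intro!: AE_I2)
 have mS: "m \<tau> \<le> S" if "\<tau> \<in> TS" for \<tau>
  unfolding m_def using TS(3)[OF that] by (intro Q.integral_le_const int that AE_I2) auto
 have 0: "(\<lambda>_. 0) \<in> TS" "e (\<lambda>_. 0) = X t w"
 proof -
  show "(\<lambda>_. 0) \<in> TS" using S T0 by (auto simp: TS_def stopping_times_le_def intro!: stopping_timesI)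
  have "e (\<lambda>_. 0) = (\<integral>v. X t w \<partial>\<P> t w)"
   unfolding e_def using shift_0[OF X t(1) tT w] by (intro Bochner_Integration.integral_cong) auto
  then show "e (\<lambda>_. 0) = X t w" using Q.prob_space by simp
 qed
 have "\<exists>f. \<forall>n. (f n \<in> TS \<and> X t w \<le> e (f n)) \<and> f (Suc n) \<in> R (f n) \<and> (\<forall>\<tau>\<in>R (f n). m \<tau> \<le> m (f (Suc n)) + (1/2) ^ n)"
 proof (rule dependent_nat_choice)
  show "\<exists>\<tau>. \<tau> \<in> TS \<and> X t w \<le> e \<tau>" using 0 by (intro exI[of _ "\<lambda>_. 0"]) simp
  fix \<tau> and n :: nat assume \<tau>: "\<tau> \<in> TS \<and> X t w \<le> e \<tau>"
  have ne: "m ` R \<tau> \<noteq> {}" "bdd_above (m ` R \<tau>)"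
   using \<tau> mS by (auto simp: R_def intro!: bdd_aboveI[of _ S])
  have "Sup (m ` R \<tau>) - (1/2) ^ n < Sup (m ` R \<tau>)" by simp
  from less_cSupD[OF ne(1) this] obtain \<tau>' where \<tau>': "\<tau>' \<in> R \<tau>" "Sup (m ` R \<tau>) - (1/2) ^ n < m \<tau>'" by blast
  have "m \<sigma>' \<le> m \<tau>' + (1/2) ^ n" if "\<sigma>' \<in> R \<tau>" for \<sigma>' using cSUP_upper[OF that ne(2)] \<tau>'(2) by linarith
  then show "\<exists>\<tau>'. (\<tau>' \<in> TS \<and> X t w \<le> e \<tau>') \<and> \<tau>' \<in> R \<tau> \<and> (\<forall>\<sigma>'\<in>R \<tau>. m \<sigma>' \<le> m \<tau>' + (1/2) ^ n)"
   using \<tau>'(1) \<tau> by (intro exI[of _ \<tau>']) (auto simp: R_def)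
 qed
 then obtain f where f: "\<forall>n. (f n \<in> TS \<and> X t w \<le> e (f n)) \<and> f (Suc n) \<in> R (f n) \<and> (\<forall>\<tau>\<in>R (f n). m \<tau> \<le> m (f (Suc n)) + (1/2) ^ n)"
  by (rule exE)
 have fT: "f n \<in> TS" and fe: "X t w \<le> e (f n)" and fR: "f (Suc n) \<in> R (f n)" and fm: "\<And>\<tau>. \<tau> \<in> R (f n) ==> m \<tau> \<le> m (f (Suc n)) + (1/2) ^ n" for n
  using f[rule_format, of n] by auto
 define \<tau> where "\<tau> v = (SUP n. f n v)" for v
 have inc: "incseq (\<lambda>n. f n v)" if "v \<in> path_space T" for v
  using fR that by (intro incseq_SucI) (auto simp: R_def)
 have bdd: "bdd_above (range (\<lambda>n. f n v))" if "v \<in> path_space T" for v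
  using TS(3)[OF fT that] by (intro bdd_aboveI[of _ S]) auto
 have lim: "(\<lambda>n. f n v) \<longlonglongrightarrow> \<tau> v" if "v \<in> path_space T" for v
  unfolding \<tau>_def by (rule LIMSEQ_incseq_SUP[OF bdd[OF that] inc[OF that]])
 have le: "\<tau> v \<le> c \<longleftrightarrow> (\<forall>n. f n v \<le> c)" if "v \<in> path_space T" for v c
  unfolding \<tau>_def by (subst cSUP_le_iff[OF _ bdd[OF that]]) auto
 have ge: "f n v \<le> \<tau> v" if "v \<in> path_space T" for n v unfolding \<tau>_def by (rule cSUP_upper[OF _ bdd[OF that]]) simp
 have \<tau>r: "0 \<le> \<tau> v" "\<tau> v \<le> S" if "v \<in> path_space T" for v
  using TS(3)[OF fT that] ge[OF that, of 0] le[OF that, of S] by (auto intro: order_trans)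
 have \<tau>m: "\<tau> \<in> borel_measurable \<C>" by (rule borel_measurable_LIMSEQ_real[of _ f]) (use lim TS(2)[OF fT] in auto)
 have \<tau>T: "\<tau> \<in> TS"
 proof -
  have "\<tau> \<in> stopping_times T"
  proof (rule stopping_timesI[OF T0 \<tau>m])
   show "0 \<le> \<tau> v \<and> \<tau> v \<le> T" if "v \<in> path_space T" for v using \<tau>r[OF that] S by auto
   show "\<tau> (stopped s v) \<le> s \<longleftrightarrow> \<tau> v \<le> s" if "v \<in> path_space T" "0 \<le> s" for v s
    using le[OF that(1), of s] le[OF stopped_path_space[OF that(1) T0 that(2)], of s]
     stopping_times_le_iff[OF TS(1)[OF fT] T0 that(2,1)] by simp
  qed
  then show ?thesis using \<tau>r by (auto simp: TS_def stopping_times_le_def)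
 qed
 have elim: "(\<lambda>n. e (f n)) \<longlonglongrightarrow> e \<tau>"
  unfolding e_def using TS(2,3)[OF fT] \<tau>m \<tau>r lim
  by (intro dominated_integral_tendsto[OF X t(1) tT w]) (auto simp: S_def intro!: AE_I2)
 have "incseq (\<lambda>n. e (f n))" using fR by (intro incseq_SucI) (auto simp: R_def)
 then have ele: "e (f n) \<le> e \<tau>" for n using incseq_le[OF _ elim] by simp
 have "AE v in \<P> t w. \<tau> v = T - t"
 proof (rule ccontr)
  assume "\<not> (AE v in \<P> t w. \<tau> v = T - t)"
  from improve_stopping_time[OF X t w imp \<tau>T[unfolded TS_def S_def] this]
  obtain \<tau>' where \<tau>': "\<tau>' \<in> TS" "\<And>v. v \<in> path_space T ==> \<tau> v \<le> \<tau>' v" "e \<tau> < e \<tau>'"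
   unfolding e_def TS_def S_def by blast
  have R: "\<tau>' \<in> R (f n)" for n
   unfolding R_def using \<tau>' ge ele[of n] by (auto intro: order_trans)
  have mono: "m (f n) \<le> m \<tau>" for n
   unfolding m_def using ge by (intro integral_mono int fT \<tau>T) auto
  have "m \<tau>' \<le> m \<tau>"
  proof (rule tendsto_lowerbound[of "\<lambda>n. m \<tau> + (1/2) ^ n"])
   show "(\<lambda>n. m \<tau> + (1/2) ^ n) \<longlonglongrightarrow> m \<tau>" using tendsto_add[OF tendsto_const LIMSEQ_power_zero[of "1/2"], of "m \<tau>"] by simp
   show "\<forall>\<^sub>F n in sequentially. m \<tau>' \<le> m \<tau> + (1/2) ^ n"
    using fm[OF R] mono by (intro always_eventually allI) (meson add_right_mono order_trans)
  qed simp
  moreover have "(\<integral>v. \<tau>' v - \<tau> v \<partial>\<P> t w) = m \<tau>' - m \<tau>" unfolding m_def using int[OF \<tau>'(1)] int[OF \<tau>T] by simp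
  moreover have "0 \<le> (\<integral>v. \<tau>' v - \<tau> v \<partial>\<P> t w)" using \<tau>'(2) by (intro Bochner_Integration.integral_nonneg) auto
  ultimately have "(\<integral>v. \<tau>' v - \<tau> v \<partial>\<P> t w) = 0" by linarith
  then have "AE v in \<P> t w. \<tau>' v - \<tau> v = 0"
   using \<tau>'(2) int[OF \<tau>'(1)] int[OF \<tau>T] by (subst (asm) integral_nonneg_eq_0_iff_AE) (auto intro!: AE_I2)
  then have "AE v in \<P> t w. shift T t w X (\<tau>' v) v = shift T t w X (\<tau> v) v" by eventually_elim simp
  moreover have "(\<lambda>v. shift T t w X (\<tau>'' v) v) \<in> borel_measurable (\<P> t w)" if "\<tau>'' \<in> TS" for \<tau>''
   using dominated_measurable[OF X t(1) tT w, of "\<lambda>v. v" \<C> \<tau>''] TS(2,3)[OF that] by (simp add: S_def)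
  ultimately have "e \<tau>' = e \<tau>" unfolding e_def using \<tau>'(1) \<tau>T by (intro integral_cong_AE) auto
  then show False using \<tau>'(3) by simp
 qed
 then have ae: "AE v in \<P> t w. shift T t w X (\<tau> v) v = shift T t w X (T - t) v" by eventually_elim simp
 have "e \<tau> = (\<integral>v. shift T t w X (T - t) v \<partial>\<P> t w)"
  unfolding e_def
  using dominated_measurable[OF X t(1) tT w, of "\<lambda>v. v" \<C> \<tau>] dominated_measurable[OF X t(1) tT w, of "\<lambda>v. v" \<C> "\<lambda>_. T - t"] \<tau>m \<tau>r tT
  by (intro integral_cong_AE[OF _ _ ae]) (auto simp: S_def)
 then show ?thesis using fe[of 0] ele[of 0] by simp
qed

end

section \<open>The comparison theorem\<close>

context sde
begin

text \<open>The supremum over clamped rational times is measurable, and continuity of u extends its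
  bound to all times. The inequality x \<le> 1 + x^2 turns square integrability into an integrable
  majorant.\<close>

lemma C0_2_dominated:
 assumes u: "u \<in> C0_2 T \<P>"
 shows "dominated u"
proof -
 have uC: "u \<in> C0 T" using u by (simp add: C0_2_def)
 have u2: "prog_measurable T (T - t) (shift T t w u)"
  "(\<integral>\<^sup>+ v. (SUP s\<in>{0..T - t}. ennreal (\<bar>shift T t w u s v\<bar>^2)) \<partial>\<P> t w) < \<infinity>"
  if "0 \<le> t" "t \<le> T" "w \<in> path_space T" for t w
  using u that by (auto simp: C0_2_def)
 have T0: "0 \<le> T" using T_pos by simp
 \<comment> \<open>Shifting by the zero path at time 0 changes nothing, so u itself is covered by
   the case t = 0.\<close>
 have pm: "prog_measurable T T u" unfolding prog_measurable_def
 proof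
  fix s assume s: "s \<in> {0..T}"
  have "(\<lambda>(r, v). shift T 0 (\<lambda>_. 0) u r v) \<in> borel_measurable (restrict_space borel {0..s} \<Otimes>\<^sub>M canonical_filtration T s)"
   using u2(1)[OF order_refl T0 path_space_zero] s by (simp add: prog_measurable_def)
  moreover have "shift T 0 (\<lambda>_. 0) u r v = u r v" if "v \<in> path_space T" for r and v :: "'d path"
   by (simp add: shift_def path_concat_0[OF path_space_zero that T0])
  ultimately show "(\<lambda>(r, v). u r v) \<in> borel_measurable (restrict_space borel {0..s} \<Otimes>\<^sub>M canonical_filtration T s)"
   by (subst (asm) measurable_cong[where g = "\<lambda>(r, v). u r v"]) (auto simp: space_pair_measure)
 qed
 have "\<exists>Y. integrable (\<P> t w) Y \<and> (AE v in \<P> t w. \<forall>s\<in>{0..T - t}. \<bar>shift T t w u s v\<bar> \<le> Y v)"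
  if t: "0 \<le> t" "t \<le> T" and w: "w \<in> path_space T" for t w
 proof -
  interpret Q: prob_space "\<P> t w" by (rule prob_space_law[OF t w])
  let ?u = "\<lambda>s v. shift T t w u s v"
  \<comment> \<open>Clamping sends every rational to an admissible time, so the supremum may run
    over all rationals.\<close>
  define c where "c r = max 0 (min r (T - t))" for r :: real
  have c: "0 \<le> c r \<and> c r \<le> T - t" for r using t by (auto simp: c_def)
  have cid: "c s = s" if "s \<in> {0..T - t}" for s using that by (auto simp: c_def)
  define y where "y v = (SUP n::nat. ennreal (\<bar>shift T t w u (c (real_of_rat (from_nat n))) v\<bar>^2))" for v
  have um: "(\<lambda>v. ?u (c r) v) \<in> borel_measurable \<C>" for r
   using shift_measurable[OF pm t w, of "\<lambda>v. v" \<C> "\<lambda>_. c r"] c by simp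
  have ym: "y \<in> borel_measurable (\<P> t w)"
  proof -
   have "(\<lambda>v. ennreal (\<bar>?u (c r) v\<bar>^2)) \<in> borel_measurable \<C>" for r using um[of r] by measurable
   then show ?thesis unfolding y_def by (intro borel_measurable_SUP) auto
  qed
  have "(\<integral>\<^sup>+v. y v \<partial>\<P> t w) \<le> (\<integral>\<^sup>+ v. (SUP s\<in>{0..T - t}. ennreal (\<bar>?u s v\<bar>^2)) \<partial>\<P> t w)"
   unfolding y_def using c by (intro nn_integral_mono SUP_least SUP_upper) auto
  then have yi: "(\<integral>\<^sup>+v. y v \<partial>\<P> t w) < \<infinity>" using u2(2)[OF t w] by (rule le_less_trans)
  have yfin: "AE v in \<P> t w. y v \<noteq> \<infinity>" using yi by (intro nn_integral_PInf_AE[OF ym]) auto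
  have "(\<integral>\<^sup>+v. ennreal (enn2real (y v)) \<partial>\<P> t w) = (\<integral>\<^sup>+v. y v \<partial>\<P> t w)"
   using yfin by (intro nn_integral_cong_AE) (auto simp: less_top elim: eventually_mono)
  then have "integrable (\<P> t w) (\<lambda>v. enn2real (y v))"
   using ym yi by (intro integrableI_nonneg) auto
  then have 1: "integrable (\<P> t w) (\<lambda>v. 1 + enn2real (y v))" by simp
  have "AE v in \<P> t w. \<forall>s\<in>{0..T - t}. \<bar>?u s v\<bar> \<le> 1 + enn2real (y v)"
   using yfin AE_space
  proof eventually_elim
   case (elim v)
   then have v: "v \<in> path_space T" by simp
   have r: "\<bar>shift T t w u (c (real_of_rat q)) v\<bar> \<le> 1 + enn2real (y v)" for q
   proof -
    let ?x = "\<bar>shift T t w u (c (real_of_rat q)) v\<bar>"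
    have "ennreal (?x^2) \<le> y v" unfolding y_def by (rule SUP_upper2[of "to_nat q"]) auto
    then have "?x^2 \<le> enn2real (y v)" using elim(1) by (metis enn2real_ennreal enn2real_mono less_top zero_le_power2 infinity_ennreal_def)
    moreover have "?x \<le> 1 + ?x^2"
    proof -
     have "0 \<le> (?x - 1/2)^2" by simp
     then show ?thesis by (simp add: power2_diff power_divide)
    qed
    ultimately show ?thesis by linarith
   qed
   show ?case
   proof
    fix s assume s: "s \<in> {0..T - t}"
    have "s \<in> closure \<rat>" by (simp add: Rats_closure_real)
    then obtain q where q: "\<And>n. q n \<in> \<rat>" "q \<longlonglongrightarrow> s" unfolding closure_sequential by blast
    have "(\<lambda>n. c (q n)) \<longlonglongrightarrow> s" unfolding c_def
     using tendsto_max[OF tendsto_const tendsto_min[OF q(2) tendsto_const[of "T - t"]], of 0] cid[OF s] unfolding c_def by simp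
    then have "(\<lambda>n. ?u (c (q n)) v) \<longlonglongrightarrow> ?u s v"
     using c s by (intro shift_tendsto[OF uC t w v]) auto
    then have "(\<lambda>n. \<bar>?u (c (q n)) v\<bar>) \<longlonglongrightarrow> \<bar>?u s v\<bar>" by (rule tendsto_rabs)
    moreover have "\<bar>?u (c (q n)) v\<bar> \<le> 1 + enn2real (y v)" for n
     using r q(1)[of n] by (auto simp: Rats_def)
    ultimately show "\<bar>?u s v\<bar> \<le> 1 + enn2real (y v)"
     by (intro LIMSEQ_le_const2) auto
   qed
  qed
  then show ?thesis using 1 by (intro exI[of _ "\<lambda>v. 1 + enn2real (y v)"] conjI)
 qed
 then show ?thesis unfolding dominated_def using uC pm by (intro conjI ballI) auto
qed

text \<open>Used with c = 1 and c = -1 in the comparison, and with c = 0 to place the linear test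
  function in \<open>C0\<close>.\<close>

lemma dominated_affine:
 assumes u: "dominated u"
 shows "dominated (\<lambda>s v. \<epsilon> * s + c * u s v)"
 unfolding dominated_def
proof (intro conjI ballI)
 let ?X = "\<lambda>s v. \<epsilon> * s + c * u s v"
 have uC: "u \<in> C0 T" "prog_measurable T T u" using u by (auto simp: dominated_def)
 show "?X \<in> C0 T" unfolding C0_def
 proof (intro CollectI ballI allI impI)
  fix t and w :: "'d path" and e :: real assume t: "t \<in> {0..T}" and w: "w \<in> path_space T" and e: "0 < e"
  define e1 where "e1 = e / (2 * (\<bar>c\<bar> + 1))"
  define e2 where "e2 = e / (2 * (\<bar>\<epsilon>\<bar> + 1))"
  have "0 < \<bar>c\<bar> + 1" "0 < \<bar>\<epsilon>\<bar> + 1" by auto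
  then have e12: "0 < e1" "\<bar>c\<bar> * e1 < e / 2" "0 < e2" "\<bar>\<epsilon>\<bar> * e2 < e / 2" using e by (auto simp: e1_def e2_def field_simps)
  have "\<forall>e>0. \<exists>dt>0. \<forall>t'\<in>{0..T}. \<forall>w'\<in>path_space T. path_dist T t w t' w' < dt \<longrightarrow> dist (u t w) (u t' w') < e"
   using uC(1) t w unfolding C0_def by blast
  then obtain d where d: "d > 0" "\<And>t' w'. t' \<in> {0..T} ==> w' \<in> path_space T ==> path_dist T t w t' w' < d ==> dist (u t w) (u t' w') < e1"
   using e12(1) by blast
  show "\<exists>dt>0. \<forall>t'\<in>{0..T}. \<forall>w'\<in>path_space T. path_dist T t w t' w' < dt \<longrightarrow> dist (?X t w) (?X t' w') < e"
  proof (intro exI[of _ "min d e2"] conjI ballI impI)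
   fix t' and w' :: "'d path" assume t': "t' \<in> {0..T}" and w': "w' \<in> path_space T" and pd: "path_dist T t w t' w' < min d e2"
   have "continuous_on {0..T} (\<lambda>s. w (min t s) - w' (min t' s))"
    using path_space_continuous[OF stopped_path_space[OF w, of t]] path_space_continuous[OF stopped_path_space[OF w', of t']] t t' T_pos
    by (intro continuous_on_diff) (auto simp: stopped_def[abs_def])
   then have "0 \<le> path_norm T (\<lambda>s. w (min t s) - w' (min t' s))" using T_pos by (intro path_norm_nonneg) auto
   then have "\<bar>t - t'\<bar> < e2" using pd by (simp add: path_dist_def)
   then have "\<bar>\<epsilon>\<bar> * \<bar>t - t'\<bar> \<le> \<bar>\<epsilon>\<bar> * e2" by (intro mult_left_mono) auto
   then have 1: "\<bar>\<epsilon> * (t - t')\<bar> < e / 2" using e12(4) by (simp add: abs_mult)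
   have "\<bar>c\<bar> * \<bar>u t w - u t' w'\<bar> \<le> \<bar>c\<bar> * e1"
    using d(2)[OF t' w'] pd by (intro mult_left_mono) (auto simp: dist_real_def)
   then have 2: "\<bar>c * (u t w - u t' w')\<bar> < e / 2" using e12(2) by (simp add: abs_mult)
   have "?X t w - ?X t' w' = \<epsilon> * (t - t') + c * (u t w - u t' w')" by (simp add: algebra_simps)
   then show "dist (?X t w) (?X t' w') < e" unfolding dist_real_def using 1 2 by linarith
  qed (use d e12 in auto)
 qed
 show "prog_measurable T T ?X" unfolding prog_measurable_def
 proof
  fix s assume "s \<in> {0..T}"
  then have m: "(\<lambda>z. u (fst z) (snd z)) \<in> borel_measurable (restrict_space borel {0..s} \<Otimes>\<^sub>M canonical_filtration T s)"
   using uC(2) by (simp add: prog_measurable_def split_def)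
  have f: "(\<lambda>z. fst z) \<in> borel_measurable (restrict_space borel {0..s} \<Otimes>\<^sub>M (canonical_filtration T s :: 'd path measure))"
   using measurable_compose[OF measurable_fst measurable_restrict_space1[OF measurable_ident]] by (simp add: id_def)
  show "(\<lambda>(r, v). ?X r v) \<in> borel_measurable (restrict_space borel {0..s} \<Otimes>\<^sub>M canonical_filtration T s)"
   unfolding split_def using m f by (intro borel_measurable_add borel_measurable_times borel_measurable_const)
 qed
 fix t and w :: "'d path" assume t: "t \<in> {0..T}" and w: "w \<in> path_space T"
 then have t': "0 \<le> t" "t \<le> T" by auto
 interpret Q: prob_space "\<P> t w" by (rule prob_space_law[OF t' w])
 obtain Y where Y: "integrable (\<P> t w) Y" "AE v in \<P> t w. \<forall>s\<in>{0..T - t}. \<bar>shift T t w u s v\<bar> \<le> Y v"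
  using dominated_bound[OF u t' w] by (elim exE conjE)
 have "AE v in \<P> t w. \<forall>s\<in>{0..T - t}. \<bar>shift T t w ?X s v\<bar> \<le> \<bar>\<epsilon>\<bar> * T + \<bar>c\<bar> * Y v"
  using Y(2)
 proof eventually_elim
  case (elim v)
  show ?case
  proof
   fix s assume s: "s \<in> {0..T - t}"
   have "\<bar>\<epsilon> * (t + s)\<bar> \<le> \<bar>\<epsilon>\<bar> * T" unfolding abs_mult using s t by (intro mult_left_mono) auto
   moreover have "\<bar>c * shift T t w u s v\<bar> \<le> \<bar>c\<bar> * Y v" unfolding abs_mult using elim s by (intro mult_left_mono) auto
   ultimately show "\<bar>shift T t w ?X s v\<bar> \<le> \<bar>\<epsilon>\<bar> * T + \<bar>c\<bar> * Y v" unfolding shift_def by linarith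
  qed
 qed
 then show "\<exists>Y. integrable (\<P> t w) Y \<and> (AE v in \<P> t w. \<forall>s\<in>{0..T - t}. \<bar>shift T t w ?X s v\<bar> \<le> Y v)"
  using Y(1) by (intro exI[of _ "\<lambda>v. \<bar>\<epsilon>\<bar> * T + \<bar>c\<bar> * Y v"]) simp
qed

text \<open>With Z = 0 the stochastic integral is approximated by empty elementary processes and
  vanishes.\<close>

lemma time_derivs: "has_path_derivs T \<P> (\<lambda>s _. \<epsilon> * s) (\<lambda>_ _. \<epsilon>) (\<lambda>_ _. 0)"
 unfolding has_path_derivs_def
proof (intro conjI ballI)
 have "dominated (\<lambda>_ _. 0)" unfolding dominated_def C0_def prog_measurable_def shift_def
  by (auto intro!: exI[of _ "\<lambda>_. 0"] exI[of _ "1::real"])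
 from dominated_affine[OF this, of \<epsilon> 0] show "(\<lambda>s _. \<epsilon> * s) \<in> (C0 T :: (real => 'd path => real) set)" by (simp add: dominated_def)
 show "(\<lambda>_ _. \<epsilon>) \<in> (C0 T :: (real => 'd path => real) set)" "(\<lambda>_ _. 0) \<in> (C0 T :: (real => 'd path => real ^ 'd) set)"
  by (auto simp: C0_def intro!: exI[of _ "1::real"])
 fix t and w :: "'d path" assume t: "t \<in> {0..T}" and w: "w \<in> path_space T"
 show "\<exists>I. has_stoch_integral (\<P> t w) (canonical_filtration T) (T - t) (\<bullet>) (shift T t w (\<lambda>_ _. 0)) (\<lambda>s w'. w' s) I \<and>
   (AE w' in \<P> t w. \<forall>s\<in>{0..T - t}. shift T t w (\<lambda>s _. \<epsilon> * s) s w' - \<epsilon> * t = (LINT r:{0..s}|lborel. shift T t w (\<lambda>_ _. \<epsilon>) r w') + I s w')"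
 proof (intro exI[of _ "\<lambda>_ _. 0"] conjI)
  show "has_stoch_integral (\<P> t w) (canonical_filtration T) (T - t) (\<bullet>) (shift T t w (\<lambda>_ _. 0)) (\<lambda>s w'. w' s) (\<lambda>_ _. 0)"
   unfolding has_stoch_integral_def
   by (rule exI[of _ "\<lambda>_. 0"], rule exI[of _ "\<lambda>_ _. 0"], rule exI[of _ "\<lambda>_ _ _. 0"])
    (use t in \<open>auto simp: elementary_def ucp_tendsto_def elementary_integral_def elementary_process_def shift_def intro!: exI[of _ "\<lambda>_. {}"] mono_onI\<close>)
  show "AE w' in \<P> t w. \<forall>s\<in>{0..T - t}. shift T t w (\<lambda>s _. \<epsilon> * s) s w' - \<epsilon> * t = (LINT r:{0..s}|lborel. shift T t w (\<lambda>_ _. \<epsilon>) r w') + 0"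
   by (intro AE_I2) (auto simp: shift_def set_lebesgue_integral_def algebra_simps)
 qed
qed

lemma time_C1_2: "(\<lambda>s _. \<epsilon> * s) \<in> C1_2 T \<P>"
 unfolding C1_2_def by (rule CollectI, rule exI, rule exI, rule time_derivs)

lemma const_pos_stopping:
 assumes "0 \<le> t" "t < T" shows "(\<lambda>_. T - t) \<in> (pos_stopping_times_le T (\<lambda>_. T - t) :: ('d path => real) set)"
 using assms T_pos by (auto simp: pos_stopping_times_le_def intro!: stopping_timesI)

lemma zero_stopping: "t \<le> T ==> (\<lambda>_. 0) \<in> (stopping_times_le T (\<lambda>_. T - t) :: ('d path => real) set)"
 using T_pos by (auto simp: stopping_times_le_def intro!: stopping_timesI)

lemma test_value:
 assumes "dominated X" "0 \<le> t" "t < T" "w \<in> path_space T"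
 shows "stopped_integrable T \<P> t w (\<lambda>_. T - t) X" "X t w \<in> stopped_values T \<P> t w (\<lambda>_. T - t) X"
proof -
 have tT: "t \<le> T" using assms by simp
 interpret Q: prob_space "\<P> t w" by (rule prob_space_law[OF assms(2) tT assms(4)])
 show "stopped_integrable T \<P> t w (\<lambda>_. T - t) X" unfolding stopped_integrable_def
 proof
  fix \<tau> :: "'d path => real" assume "\<tau> \<in> stopping_times_le T (\<lambda>_. T - t)"
  then show "integrable (\<P> t w) (\<lambda>v. shift T t w X (\<tau> v) v)"
   using stopping_times_measurable[of \<tau> T] T_pos
   by (intro dominated_integrable[OF assms(1,2) tT assms(4)]) (auto simp: stopping_times_le_def)
 qed
 have "(\<integral>v. shift T t w X 0 v \<partial>\<P> t w) = (\<integral>v. X t w \<partial>\<P> t w)"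
  using shift_0[OF assms(1,2) tT assms(4)] by (intro Bochner_Integration.integral_cong) auto
 then have "X t w = (\<integral>v. shift T t w X 0 v \<partial>\<P> t w)" using Q.prob_space by simp
 then show "X t w \<in> stopped_values T \<P> t w (\<lambda>_. T - t) X"
  unfolding stopped_values_def using zero_stopping[OF tT] by (intro CollectI exI[of _ "\<lambda>_. 0"]) simp
qed

lemma end_value_integrable:
 assumes "dominated u" "0 \<le> t" "t \<le> T" "w \<in> path_space T"
 shows "integrable (\<P> t w) (\<lambda>v. u T (path_concat T t w v))"
 using dominated_integrable[OF assms, of "\<lambda>_. T - t"] assms by (simp add: shift_def)

text \<open>The deterministic part is taken out of the terminal expectation; the improvement
  hypothesis is what the viscosity property supplies.\<close>

lemma exhaustion_affine:
 assumes u: "dominated u" and t: "0 \<le> t" "t < T" and w: "w \<in> path_space T"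
  and imp: "\<And>t w. 0 \<le> t ==> t < T ==> w \<in> path_space T ==> \<exists>\<theta>\<in>stopping_times_le T (\<lambda>_. T - t).
   \<epsilon> * t + c * u t w < (\<integral>v. shift T t w (\<lambda>s v. \<epsilon> * s + c * u s v) (\<theta> v) v \<partial>\<P> t w)"
 shows "\<epsilon> * t + c * u t w \<le> \<epsilon> * T + c * (\<integral>v. u T (path_concat T t w v) \<partial>\<P> t w)"
proof -
 have tT: "t \<le> T" using t by simp
 interpret Q: prob_space "\<P> t w" by (rule prob_space_law[OF t(1) tT w])
 note int = end_value_integrable[OF u t(1) tT w]
 have "\<epsilon> * t + c * u t w \<le> (\<integral>v. \<epsilon> * T + c * u T (path_concat T t w v) \<partial>\<P> t w)"
  using exhaustion[OF dominated_affine[OF u] t w imp] by (simp add: shift_def)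
 also have "... = \<epsilon> * T + c * (\<integral>v. u T (path_concat T t w v) \<partial>\<P> t w)" using int Q.prob_space by simp
 finally show "\<epsilon> * t + c * u t w \<le> \<epsilon> * T + c * (\<integral>v. u T (path_concat T t w v) \<partial>\<P> t w)" .
qed

lemma comparison:
 assumes u: "u \<in> C0_2 T \<P>" and v: "v \<in> C0_2 T \<P>"
  and sub: "heat_viscosity_subsolution T \<P> u" and super: "heat_viscosity_supersolution T \<P> v"
  and le: "\<And>w. w \<in> path_space T ==> u T w \<le> v T w"
  and t: "0 \<le> t" "t \<le> T" and w: "w \<in> path_space T"
 shows "u t w \<le> v t w"
proof (cases "t = T")
 case False
 then have tT: "t < T" using t by simp
 note du = C0_2_dominated[OF u] and dv = C0_2_dominated[OF v]
 interpret Q: prob_space "\<P> t w" by (rule prob_space_law[OF t w])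
 \<comment> \<open>Each of the two estimates against the terminal expectation loses \<epsilon> (T -
   t), which is at most \<epsilon> T.\<close>
 have "u t w \<le> v t w + \<epsilon> * (2 * T)" if \<epsilon>: "0 < \<epsilon>" for \<epsilon>
 proof -
  have 1: "\<exists>\<theta>\<in>stopping_times_le T (\<lambda>_. T - t). \<epsilon> * t + 1 * u t w < (\<integral>\<eta>. shift T t w (\<lambda>s \<eta>. \<epsilon> * s + 1 * u s \<eta>) (\<theta> \<eta>) \<eta> \<partial>\<P> t w)"
   if t: "0 \<le> t" "t < T" and w: "w \<in> path_space T" for t w
  proof (rule ccontr)
   assume "\<not> ?thesis"
   then have n: "(\<integral>\<eta>. shift T t w (\<lambda>s \<eta>. \<epsilon> * s + u s \<eta>) (\<theta> \<eta>) \<eta> \<partial>\<P> t w) \<le> \<epsilon> * t + u t w" if "\<theta> \<in> stopping_times_le T (\<lambda>_. T - t)" for \<theta>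
    using that by (auto simp: not_less)
   \<comment> \<open>If no stopping time improves \<epsilon> s + u, then -\<epsilon> s - u is
     minimal at once, with horizon T - t. So -\<epsilon> s is a lower test function, and its drift
     -\<epsilon> contradicts the subsolution property.\<close>
   let ?X = "\<lambda>s \<eta>. (- \<epsilon>) * s - u s \<eta>"
   have dX: "dominated ?X" using dominated_affine[OF du, of "- \<epsilon>" "-1"] by simp
   have m: "?X t w \<le> y" if y: "y \<in> stopped_values T \<P> t w (\<lambda>_. T - t) ?X" for y
   proof -
    obtain \<theta> where \<theta>: "\<theta> \<in> stopping_times_le T (\<lambda>_. T - t)" "y = (\<integral>\<eta>. shift T t w ?X (\<theta> \<eta>) \<eta> \<partial>\<P> t w)"
     using y unfolding stopped_values_def by blast
    have "y = (\<integral>\<eta>. - shift T t w (\<lambda>s \<eta>. \<epsilon> * s + u s \<eta>) (\<theta> \<eta>) \<eta> \<partial>\<P> t w)"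
     unfolding \<theta>(2) by (simp add: shift_def)
    then show ?thesis using n[OF \<theta>(1)] by simp
   qed
   have "(\<lambda>s _. (- \<epsilon>) * s) \<in> lower_tests T \<P> u t w"
    unfolding lower_tests_def Let_def
    by (intro CollectI conjI bexI[OF _ const_pos_stopping[OF t]] time_C1_2 test_value[OF dX t w] ballI m)
   then have "- (- \<epsilon>) \<le> 0" using sub t w time_derivs[of "- \<epsilon>"] unfolding heat_viscosity_subsolution_def by fastforce
   then show False using \<epsilon> by simp
  qed
  have 2: "\<exists>\<theta>\<in>stopping_times_le T (\<lambda>_. T - t). \<epsilon> * t + (-1) * v t w < (\<integral>\<eta>. shift T t w (\<lambda>s \<eta>. \<epsilon> * s + (-1) * v s \<eta>) (\<theta> \<eta>) \<eta> \<partial>\<P> t w)"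
   if t: "0 \<le> t" "t < T" and w: "w \<in> path_space T" for t w
  proof (rule ccontr)
   assume "\<not> ?thesis"
   then have n: "(\<integral>\<eta>. shift T t w (\<lambda>s \<eta>. \<epsilon> * s - v s \<eta>) (\<theta> \<eta>) \<eta> \<partial>\<P> t w) \<le> \<epsilon> * t - v t w" if "\<theta> \<in> stopping_times_le T (\<lambda>_. T - t)" for \<theta>
    using that by (auto simp: not_less)
   \<comment> \<open>Now \<epsilon> s - v is maximal at once, and the drift \<epsilon> contradicts
     the supersolution property.\<close>
   let ?X = "\<lambda>s \<eta>. \<epsilon> * s - v s \<eta>"
   have dX: "dominated ?X" using dominated_affine[OF dv, of \<epsilon> "-1"] by simp
   have m: "y \<le> ?X t w" if "y \<in> stopped_values T \<P> t w (\<lambda>_. T - t) ?X" for y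
    using that n by (auto simp: stopped_values_def)
   have "(\<lambda>s _. \<epsilon> * s) \<in> upper_tests T \<P> v t w"
    unfolding upper_tests_def Let_def
    by (intro CollectI conjI bexI[OF _ const_pos_stopping[OF t]] time_C1_2 test_value[OF dX t w] ballI m)
   then have "- \<epsilon> \<ge> 0" using super t w time_derivs[of \<epsilon>] unfolding heat_viscosity_supersolution_def by fastforce
   then show False using \<epsilon> by simp
  qed
  have eu: "\<epsilon> * t + 1 * u t w \<le> \<epsilon> * T + 1 * (\<integral>\<eta>. u T (path_concat T t w \<eta>) \<partial>\<P> t w)"
   by (rule exhaustion_affine[OF du t(1) tT w]) (rule 1)
  have ev: "\<epsilon> * t + (-1) * v t w \<le> \<epsilon> * T + (-1) * (\<integral>\<eta>. v T (path_concat T t w \<eta>) \<partial>\<P> t w)"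
   by (rule exhaustion_affine[OF dv t(1) tT w]) (rule 2)
  have "(\<integral>\<eta>. u T (path_concat T t w \<eta>) \<partial>\<P> t w) \<le> (\<integral>\<eta>. v T (path_concat T t w \<eta>) \<partial>\<P> t w)"
   by (rule integral_mono[OF end_value_integrable[OF du t w] end_value_integrable[OF dv t w]]) (intro le start_path_space t w, simp)
  moreover have "0 \<le> \<epsilon> * t" using \<epsilon> t by simp
  ultimately show ?thesis using eu ev by simp
 qed
 note eps = this
 show ?thesis
 proof (rule field_le_epsilon)
  fix e :: real assume "0 < e"
  then show "u t w \<le> v t w + e" using eps[of "e / (2 * T)"] T_pos by simp
 qed
qed (use le w in simp)

end

theorem theorem4p11:
  fixes T :: real
    and \<sigma> :: "real \<Rightarrow> ('d::finite) path \<Rightarrow> real ^ 'd ^ 'd"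
    and M :: "'m measure"
    and W :: "real \<Rightarrow> 'm \<Rightarrow> real ^ 'd"
    and u v :: "real \<Rightarrow> 'd path \<Rightarrow> real"
  assumes "T > 0"
    and "admissible_coefficient T \<sigma>"
    and "brownian_motion T M W"
    and "u \<in> C0_2 T (solution_law M W T \<sigma>)"
    and "v \<in> C0_2 T (solution_law M W T \<sigma>)"
    and "heat_viscosity_subsolution T (solution_law M W T \<sigma>) u"
    and "heat_viscosity_supersolution T (solution_law M W T \<sigma>) v"
    and "\<forall>\<omega>\<in>path_space T. u T \<omega> \<le> v T \<omega>"
  shows "\<forall>t\<in>{0..T}. \<forall>\<omega>\<in>path_space T. u t \<omega> \<le> v t \<omega>"
proof -
  interpret sde T M W \<sigma>
    by unfold_locales (use assms(1-3) in auto)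
  show ?thesis using comparison[OF assms(4-7)] assms(8) by auto
qed

end
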